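(* Let $\mathbb{F}$ be a field of characteristic $0$, let $M\ne 0$ be an additive subgroup of $\mathbb{F}$, and let $\alpha\in\mathbb{F}$ with $2\alpha\in M$. Then every module of the intermediate series over the generalized super-Virasoro algebra $\mathrm{SVir}[M,\alpha]$ is isomorphic, up to interchanging the even and odd parts, to one of the following: $SA_{a,b}(M,\alpha)$, $SA_a(M,\alpha)$, $SB_a(M,\alpha)$ for $a,b\in\mathbb{F}$, and their nonzero subquotients.
   Context: $\mathrm{SVir}[M,\alpha]$ is the Lie superalgebra over $\mathbb{F}$ with basis $\{L_\mu, G_\nu, c\mid \mu\in M,\ \nu\in\alpha+M\}$, even part $\mathrm{SVir}_{\bar0}[M,\alpha]=\mathrm{span}\{L_\mu,c\mid\mu\in M\}$, odd part $\mathrm{SVir}_{\bar1}[M,\alpha]=\mathrm{span}\{G_\nu\mid\nu\in\alpha+M\}$, and brackets $[L_\mu,L_\nu]=(\nu-\mu)L_{\mu+\nu}+\frac1{12}(\mu^3-\mu)\delta_{\mu+\nu,0}\,c$ and $[c,L_\mu]=[c,c]=0$ for $\mu,\nu\in M$; $[L_\mu,G_\nu]=(\nu-\frac12\mu)G_{\mu+\nu}$, $[c,G_\nu]=0$, and $[G_\nu,G_\lambda]=2L_{\nu+\lambda}-\frac13(\nu^2-\frac14)\delta_{\nu+\lambda,0}\,c$ for $\mu\in M$, $\nu,\lambda\in\alpha+M$. A module of the intermediate series over $\mathrm{SVir}[M,\alpha]$ is an indecomposable $\mathrm{SVir}[M,\alpha]$-module given by a $\mathbb{Z}/2\mathbb{Z}$-graded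 vector space $V=V_{\bar0}\oplus V_{\bar1}$ with $\mathrm{SVir}_\sigma[M,\alpha]V_\tau\subset V_{\sigma+\tau}$ for all $\sigma,\tau\in\mathbb{Z}/2\mathbb{Z}$, such that $\dim_{\mathbb{F}}(V_\sigma)_\lambda\le1$ for all $\lambda\in\mathbb{F}$, $\sigma\in\mathbb{Z}/2\mathbb{Z}$, where $(V_\sigma)_\lambda=\{v\in V_\sigma\mid L_0v=\lambda v\}$. As for Harish-Chandra modules over the generalized Virasoro algebra, $V$ is understood to be the direct sum of these weight spaces. For $a,b\in\mathbb{F}$, the modules $SA_{a,b}(M,\alpha)$ and $SA_a(M,\alpha)$ have basis $\{v_\mu\mid\mu\in M\}\cup\{w_\nu\mid\nu\in\alpha+M\}$, and $SB_a(M,\alpha)$ has basis $\{v_\nu\mid\nu\in\alpha+M\}\cup\{w_\mu\mid\mu\in M\}$. In each, the $v$'s span one homogeneous component (the even part) and the $w$'s the other (the odd part), $c$ acts as $0$, and for all $\lambda,\mu\in M$ and $\nu,\eta\in\alpha+M$: - $SA_{a,b}(M,\alpha)$: $L_\lambda v_\mu=(a+\mu+\lambda b)v_{\lambda+\mu}$, $L_\lambda w_\nu=(a+\nu+\lambda(b-\frac12))w_{\lambda+\nu}$, $G_\eta v_\mu=w_{\eta+\mu}$, $G_\eta w_\nu=(a+\nu+2\eta(b-\frac12))v_{\eta+\nu}$; - $SA_a(M,\alpha)$: $L_\lambda v_\mu=(\mu+\lambda)v_{\lambda+\mu}$ if $\mu\neq0$, $L_\lambda v_0=\lambda(\lambda+a)v_\lambda$,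 $L_\lambda w_\nu=(\nu+\frac\lambda2)w_{\lambda+\nu}$, $G_\eta v_\mu=w_{\eta+\mu}$ if $\mu\ne0$, $G_\eta v_0=(2\eta+a)w_\eta$, $G_\eta w_\nu=(\nu+\eta)v_{\eta+\nu}$; - $SB_a(M,\alpha)$: $L_\lambda v_\nu=(\nu+\frac\lambda2)v_{\lambda+\nu}$, $L_\lambda w_\mu=\mu w_{\lambda+\mu}$ if $\mu\neq-\lambda$, $L_\lambda w_{-\lambda}=-\lambda(\lambda+a)w_0$, $G_\eta v_\nu=w_{\eta+\nu}$ if $\nu\ne-\eta$, $G_\eta v_{-\eta}=(2\eta+a)w_0$, $G_\eta w_\mu=\mu v_{\eta+\mu}$. "Isomorphic up to interchanging the even and odd parts" means: there is a linear bijection commuting with the action of $\mathrm{SVir}[M,\alpha]$ which either preserves or reverses the $\mathbb{Z}/2\mathbb{Z}$-grading. *)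

theory Defs
  imports
    Complex_Main
    "HOL-Library.Poly_Mapping"
    "HOL-Library.Set_Algebras"
    "HOL-Library.Z2"
begin

text \<open>
  A free vector space on a set \<open>B\<close> of basis symbols is the set of finitely supported functions
  \<open>x\<close> with \<open>Poly_Mapping.keys x \<subseteq> B\<close>; parities are elements of the field \<^typ>\<open>bit\<close>, i.e. of
  \<open>\<int>/2\<int>\<close>.
\<close>

definition pm_scale :: "'f::field \<Rightarrow> ('i \<Rightarrow>\<^sub>0 'f) \<Rightarrow> ('i \<Rightarrow>\<^sub>0 'f)" where
  "pm_scale k x = Poly_Mapping.map ((*) k) x"

definition bilinear_ext ::
  "('i \<Rightarrow> 'j \<Rightarrow> ('k \<Rightarrow>\<^sub>0 'f::field)) \<Rightarrow> ('i \<Rightarrow>\<^sub>0 'f) \<Rightarrow> ('j \<Rightarrow>\<^sub>0 'f) \<Rightarrow> ('k \<Rightarrow>\<^sub>0 'f)" where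
  "bilinear_ext f x y =
     (\<Sum>i\<in>Poly_Mapping.keys x. \<Sum>j\<in>Poly_Mapping.keys y.
        pm_scale (Poly_Mapping.lookup x i * Poly_Mapping.lookup y j) (f i j))"


section \<open>The generalized super-Virasoro algebra\<close>

datatype 'f svir_gen = LG 'f | GG 'f | CG

type_synonym 'f svir = "'f svir_gen \<Rightarrow>\<^sub>0 'f"

text \<open>
  The brackets of basis elements. The formulas do not involve \<open>M\<close> and \<open>\<alpha>\<close>, which only
  determine the set of admissible indices. \<open>[G\<^sub>\<nu>, L\<^sub>\<mu>]\<close> is given by super skew-symmetry.
\<close>

fun svir_gen_bracket :: "'f::field_char_0 svir_gen \<Rightarrow> 'f svir_gen \<Rightarrow> 'f svir" where
  "svir_gen_bracket (LG \<mu>) (LG \<nu>) =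
     Poly_Mapping.single (LG (\<mu> + \<nu>)) (\<nu> - \<mu>)
     + Poly_Mapping.single CG (if \<mu> + \<nu> = 0 then 1/12 * (\<mu>^3 - \<mu>) else 0)"
| "svir_gen_bracket (LG \<mu>) (GG \<nu>) = Poly_Mapping.single (GG (\<mu> + \<nu>)) (\<nu> - 1/2 * \<mu>)"
| "svir_gen_bracket (GG \<nu>) (LG \<mu>) = - Poly_Mapping.single (GG (\<mu> + \<nu>)) (\<nu> - 1/2 * \<mu>)"
| "svir_gen_bracket (GG \<nu>) (GG \<kappa>) =
     Poly_Mapping.single (LG (\<nu> + \<kappa>)) 2
     - Poly_Mapping.single CG (if \<nu> + \<kappa> = 0 then 1/3 * (\<nu>^2 - 1/4) else 0)"
| "svir_gen_bracket CG _ = 0"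
| "svir_gen_bracket _ CG = 0"

definition svir_bracket :: "'f::field_char_0 svir \<Rightarrow> 'f svir \<Rightarrow> 'f svir" where
  "svir_bracket = bilinear_ext svir_gen_bracket"

definition svir_part :: "'f::field_char_0 set \<Rightarrow> 'f \<Rightarrow> bit \<Rightarrow> 'f svir set" where
  "svir_part M \<alpha> \<sigma> =
     {x. Poly_Mapping.keys x \<subseteq> (if \<sigma> = 0 then insert CG (LG ` M) else GG ` (\<alpha> +o M))}"

definition svir_carrier :: "'f::field_char_0 set \<Rightarrow> 'f \<Rightarrow> 'f svir set" where
  "svir_carrier M \<alpha> = {x. Poly_Mapping.keys x \<subseteq> insert CG (LG ` M \<union> GG ` (\<alpha> +o M))}"


section \<open>Graded modules\<close>

text \<open>
  Addition of vectors is the one of the type \<open>'v\<close>. Only the restriction of \<open>act V\<close> to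
  \<open>svir_carrier M \<alpha>\<close> and to the sum of the two homogeneous parts is relevant. For a type
  of sets, addition is elementwise.
\<close>

record (overloaded) ('f, 'v) gr_module =
  part :: "bit \<Rightarrow> 'v set"
  scal :: "'f \<Rightarrow> 'v \<Rightarrow> 'v"
  act :: "'f svir \<Rightarrow> 'v \<Rightarrow> 'v"

definition vecs :: "('f::zero, 'v::plus) gr_module \<Rightarrow> 'v set" where
  "vecs V = part V 0 + part V 1"

definition svir_module ::
  "'f::field_char_0 set \<Rightarrow> 'f \<Rightarrow> ('f, 'v::ab_group_add) gr_module \<Rightarrow> bool" where
  "svir_module M \<alpha> V \<longleftrightarrow>
     vector_space (scal V)
     \<and> (\<forall>\<sigma>. module.subspace (scal V) (part V \<sigma>))
     \<and> part V 0 \<inter> part V 1 = {0}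
     \<and> (\<forall>\<sigma> \<tau>. \<forall>x\<in>svir_part M \<alpha> \<sigma>. \<forall>v\<in>part V \<tau>. act V x v \<in> part V (\<sigma> + \<tau>))
     \<and> (\<forall>x\<in>svir_carrier M \<alpha>. \<forall>u\<in>vecs V. \<forall>v\<in>vecs V. act V x (u + v) = act V x u + act V x v)
     \<and> (\<forall>x\<in>svir_carrier M \<alpha>. \<forall>k. \<forall>v\<in>vecs V. act V x (scal V k v) = scal V k (act V x v))
     \<and> (\<forall>x\<in>svir_carrier M \<alpha>. \<forall>y\<in>svir_carrier M \<alpha>. \<forall>v\<in>vecs V.
          act V (x + y) v = act V x v + act V y v)
     \<and> (\<forall>k. \<forall>x\<in>svir_carrier M \<alpha>. \<forall>v\<in>vecs V. act V (pm_scale k x) v = scal V k (act V x v))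
     \<and> (\<forall>\<sigma> \<tau>. \<forall>x\<in>svir_part M \<alpha> \<sigma>. \<forall>y\<in>svir_part M \<alpha> \<tau>. \<forall>v\<in>vecs V.
          act V (svir_bracket x y) v =
            (if \<sigma> = 1 \<and> \<tau> = 1 then act V x (act V y v) + act V y (act V x v)
             else act V x (act V y v) - act V y (act V x v)))"

definition svir_submodule ::
  "'f::field_char_0 set \<Rightarrow> 'f \<Rightarrow> ('f, 'v::ab_group_add) gr_module \<Rightarrow> 'v set \<Rightarrow> bool" where
  "svir_submodule M \<alpha> V N \<longleftrightarrow>
     module.subspace (scal V) N
     \<and> N = (N \<inter> part V 0) + (N \<inter> part V 1)
     \<and> (\<forall>x\<in>svir_carrier M \<alpha>. \<forall>v\<in>N. act V x v \<in> N)"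

definition svir_indecomposable ::
  "'f::field_char_0 set \<Rightarrow> 'f \<Rightarrow> ('f, 'v::ab_group_add) gr_module \<Rightarrow> bool" where
  "svir_indecomposable M \<alpha> V \<longleftrightarrow>
     vecs V \<noteq> {0}
     \<and> (\<forall>A B. svir_submodule M \<alpha> V A \<and> svir_submodule M \<alpha> V B \<and> A + B = vecs V \<and> A \<inter> B = {0}
          \<longrightarrow> A = {0} \<or> B = {0})"

definition weight_space ::
  "('f::field_char_0, 'v) gr_module \<Rightarrow> bit \<Rightarrow> 'f \<Rightarrow> 'v set" where
  "weight_space V \<sigma> \<kappa> =
     {v \<in> part V \<sigma>. act V (Poly_Mapping.single (LG 0) 1) v = scal V \<kappa> v}"

text \<open>
  The library's \<open>dim\<close> is \<open>0\<close> for infinite-dimensional spaces, hence the separate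
  finiteness condition. The sum of the weight spaces, which are eigenspaces of one linear
  operator for different eigenvalues, is automatically direct.
\<close>

definition intermediate_series ::
  "'f::field_char_0 set \<Rightarrow> 'f \<Rightarrow> ('f, 'v::ab_group_add) gr_module \<Rightarrow> bool" where
  "intermediate_series M \<alpha> V \<longleftrightarrow>
     svir_module M \<alpha> V
     \<and> svir_indecomposable M \<alpha> V
     \<and> (\<forall>\<sigma> \<kappa>. (\<exists>B. finite B \<and> weight_space V \<sigma> \<kappa> \<subseteq> module.span (scal V) B)
              \<and> vector_space.dim (scal V) (weight_space V \<sigma> \<kappa>) \<le> 1)
     \<and> (\<forall>\<sigma>. part V \<sigma> = module.span (scal V) (\<Union>\<kappa>. weight_space V \<sigma> \<kappa>))"

text \<open>
  The quotient \<open>A / B\<close> of two submodules \<open>B \<subseteq> A\<close> of \<open>V\<close>: its vectors are the cosets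
  \<open>v + B\<close> with \<open>v \<in> A\<close>, and their addition is the elementwise addition of sets. Adding
  \<open>B\<close> in the last two operations turns the image of a coset into a full coset again.
\<close>

definition subquotient ::
  "('f::zero, 'v::ab_group_add) gr_module \<Rightarrow> 'v set \<Rightarrow> 'v set \<Rightarrow> ('f, 'v set) gr_module" where
  "subquotient V A B =
     \<lparr> part = (\<lambda>\<sigma>. (\<lambda>v. v +o B) ` (A \<inter> part V \<sigma>)),
       scal = (\<lambda>k C. scal V k ` C + B),
       act = (\<lambda>x C. act V x ` C + B) \<rparr>"

definition isomorphic_upto_parity ::
  "'f::field_char_0 set \<Rightarrow> 'f \<Rightarrow> ('f, 'v::plus) gr_module \<Rightarrow> ('f, 'w::plus) gr_module \<Rightarrow> bool" where
  "isomorphic_upto_parity M \<alpha> V W \<longleftrightarrow>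
     (\<exists>\<phi>. bij_betw \<phi> (vecs V) (vecs W)
        \<and> (\<forall>u\<in>vecs V. \<forall>v\<in>vecs V. \<phi> (u + v) = \<phi> u + \<phi> v)
        \<and> (\<forall>k. \<forall>v\<in>vecs V. \<phi> (scal V k v) = scal W k (\<phi> v))
        \<and> (\<forall>x\<in>svir_carrier M \<alpha>. \<forall>v\<in>vecs V. \<phi> (act V x v) = act W x (\<phi> v))
        \<and> (\<exists>\<epsilon>. \<forall>\<sigma>. \<phi> ` part V \<sigma> = part W (\<sigma> + \<epsilon>)))"


section \<open>The modules \<open>SA\<^sub>a\<^sub>,\<^sub>b\<close>, \<open>SA\<^sub>a\<close> and \<open>SB\<^sub>a\<close>\<close>

datatype 'f vw = VB 'f | WB 'f

fun SAab_gen_act :: "'f::field_char_0 \<Rightarrow> 'f \<Rightarrow> 'f svir_gen \<Rightarrow> 'f vw \<Rightarrow> ('f vw \<Rightarrow>\<^sub>0 'f)" where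
  "SAab_gen_act a b (LG \<kappa>) (VB \<mu>) = Poly_Mapping.single (VB (\<kappa> + \<mu>)) (a + \<mu> + \<kappa> * b)"
| "SAab_gen_act a b (LG \<kappa>) (WB \<nu>) = Poly_Mapping.single (WB (\<kappa> + \<nu>)) (a + \<nu> + \<kappa> * (b - 1/2))"
| "SAab_gen_act a b (GG \<eta>) (VB \<mu>) = Poly_Mapping.single (WB (\<eta> + \<mu>)) 1"
| "SAab_gen_act a b (GG \<eta>) (WB \<nu>) =
     Poly_Mapping.single (VB (\<eta> + \<nu>)) (a + \<nu> + 2 * \<eta> * (b - 1/2))"
| "SAab_gen_act a b CG _ = 0"

fun SAa_gen_act :: "'f::field_char_0 \<Rightarrow> 'f svir_gen \<Rightarrow> 'f vw \<Rightarrow> ('f vw \<Rightarrow>\<^sub>0 'f)" where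
  "SAa_gen_act a (LG \<kappa>) (VB \<mu>) =
     (if \<mu> \<noteq> 0 then Poly_Mapping.single (VB (\<kappa> + \<mu>)) (\<mu> + \<kappa>)
      else Poly_Mapping.single (VB \<kappa>) (\<kappa> * (\<kappa> + a)))"
| "SAa_gen_act a (LG \<kappa>) (WB \<nu>) = Poly_Mapping.single (WB (\<kappa> + \<nu>)) (\<nu> + \<kappa> / 2)"
| "SAa_gen_act a (GG \<eta>) (VB \<mu>) =
     (if \<mu> \<noteq> 0 then Poly_Mapping.single (WB (\<eta> + \<mu>)) 1
      else Poly_Mapping.single (WB \<eta>) (2 * \<eta> + a))"
| "SAa_gen_act a (GG \<eta>) (WB \<nu>) = Poly_Mapping.single (VB (\<eta> + \<nu>)) (\<nu> + \<eta>)"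
| "SAa_gen_act a CG _ = 0"

fun SBa_gen_act :: "'f::field_char_0 \<Rightarrow> 'f svir_gen \<Rightarrow> 'f vw \<Rightarrow> ('f vw \<Rightarrow>\<^sub>0 'f)" where
  "SBa_gen_act a (LG \<kappa>) (VB \<nu>) = Poly_Mapping.single (VB (\<kappa> + \<nu>)) (\<nu> + \<kappa> / 2)"
| "SBa_gen_act a (LG \<kappa>) (WB \<mu>) =
     (if \<mu> \<noteq> - \<kappa> then Poly_Mapping.single (WB (\<kappa> + \<mu>)) \<mu>
      else Poly_Mapping.single (WB 0) (- \<kappa> * (\<kappa> + a)))"
| "SBa_gen_act a (GG \<eta>) (VB \<nu>) =
     (if \<nu> \<noteq> - \<eta> then Poly_Mapping.single (WB (\<eta> + \<nu>)) 1
      else Poly_Mapping.single (WB 0) (2 * \<eta> + a))"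
| "SBa_gen_act a (GG \<eta>) (WB \<mu>) = Poly_Mapping.single (VB (\<eta> + \<mu>)) \<mu>"
| "SBa_gen_act a CG _ = 0"

definition vw_module ::
  "'f::field_char_0 set \<Rightarrow> 'f set \<Rightarrow> ('f svir_gen \<Rightarrow> 'f vw \<Rightarrow> ('f vw \<Rightarrow>\<^sub>0 'f))
     \<Rightarrow> ('f, 'f vw \<Rightarrow>\<^sub>0 'f) gr_module" where
  "vw_module I J f =
     \<lparr> part = (\<lambda>\<sigma>. {v. Poly_Mapping.keys v \<subseteq> (if \<sigma> = 0 then VB ` I else WB ` J)}),
       scal = pm_scale,
       act = bilinear_ext f \<rparr>"

definition SAab :: "'f::field_char_0 set \<Rightarrow> 'f \<Rightarrow> 'f \<Rightarrow> 'f \<Rightarrow> ('f, 'f vw \<Rightarrow>\<^sub>0 'f) gr_module" where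
  "SAab M \<alpha> a b = vw_module M (\<alpha> +o M) (SAab_gen_act a b)"

definition SAa :: "'f::field_char_0 set \<Rightarrow> 'f \<Rightarrow> 'f \<Rightarrow> ('f, 'f vw \<Rightarrow>\<^sub>0 'f) gr_module" where
  "SAa M \<alpha> a = vw_module M (\<alpha> +o M) (SAa_gen_act a)"

definition SBa :: "'f::field_char_0 set \<Rightarrow> 'f \<Rightarrow> 'f \<Rightarrow> ('f, 'f vw \<Rightarrow>\<^sub>0 'f) gr_module" where
  "SBa M \<alpha> a = vw_module (\<alpha> +o M) M (SBa_gen_act a)"

end

theory Submission
  imports Defs "HOL-Computational_Algebra.Polynomial"
begin

text \<open>
  Write \<open>g\<close> and \<open>l\<close> for the coefficients of the operators \<open>G\<^sub>\<nu>\<close> and \<open>L\<^sub>\<mu>\<close> with respect to a basis of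
  weight vectors. The product \<open>e s p q\<close> of the two coefficients of \<open>G\<close> between the weights \<open>p\<close> and
  \<open>q\<close> does not depend on the choice of the basis vectors. On a chain of weights with an odd step the
  bracket relations force \<open>c = 0\<close>, the presence of all nonzero weights, and \<open>e\<close> to be affine.
  A double bracket identity, together with the elimination of a three term recurrence, glues the
  chains: \<open>e s p q = (1 - \<beta>) * p + \<beta> * q\<close> for one \<open>\<beta>\<close>. The two factors of \<open>e\<close> cannot mix: for
  \<open>\<beta> \<noteq> 0, 1\<close> one of them has rank one, so a rescaling of the basis turns it into \<open>1\<close> and gives
  \<open>SA\<^sub>a\<^sub>,\<^sub>b\<close> with \<open>b = 1 - \<beta>/2\<close>. In the degenerate cases \<open>\<beta> = 0\<close> and \<open>\<beta> = 1\<close> (exchanged by the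
  parity change) only the coefficients at the weight \<open>0\<close> remain free; they are affine in the weight
  and vanish in one direction, which leaves \<open>SA\<^sub>a\<close>, \<open>SB\<^sub>a\<close>, \<open>SA\<^sub>a\<^sub>,\<^sub>b\<close> with \<open>b = 1\<close> or \<open>b = 1/2\<close>, or a
  subquotient of one of them.
\<close>

section \<open>Recurrences along a chain of weights\<close>

text \<open>The relations see the four-cycles of \<open>G\<close> as well as \<open>e\<close>, and a
  four-cycle is not a function of \<open>e\<close>. Its sum and its product with the reversed cycle
  are known from \<open>e\<close> and \<open>K\<close>, however, and so is its change when the step
  changes sign; eliminating both cycles leaves \<open>e_cubic\<close>, the source of the affine form
  of \<open>e\<close> and of the formula for \<open>K\<close>. The obstacle is that M may be any
  nonzero subgroup of the field: the weights need not lie on one progression, and each chain starts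
  with a slope of its own. The field carries no order, so weights cannot be compared by size.
  Instead a relation is read along a progression, where it is a polynomial identity with infinitely
  many solutions and so holds coefficient by coefficient. This requires infinitely many present
  weights on one chain. On a finite string the alternating sum of the reflection relations gives an
  integrality condition, for every odd multiple of the step at once, and divisibility then leaves no
  room unless \<open>p + c / 24 = 0\<close>.\<close>

lemma poly4_vanishing:
  fixes a :: "'a::field_char_0"
  assumes inf: "infinite A"
    and z: "\<And>x. x \<in> A \<Longrightarrow> a + b * x + c * x^2 + d * x^3 + e * x^4 = 0"
  shows "a = 0" "b = 0" "c = 0" "d = 0" "e = 0"
proof -
  have "A \<subseteq> {x. poly [:a, b, c, d, e:] x = 0}"
    using z by (auto simp: algebra_simps power2_eq_square power3_eq_cube power4_eq_xxxx)
  then have "[:a, b, c, d, e:] = 0"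
    using inf poly_roots_finite finite_subset by blast
  then show "a = 0" "b = 0" "c = 0" "d = 0" "e = 0" by simp_all
qed

lemma infinite_progression:
  fixes a d :: "'a::field_char_0"
  assumes "d \<noteq> 0"
  shows "infinite ((\<lambda>i::nat. a + of_nat i * d) ` UNIV)"
proof -
  have "inj (\<lambda>i::nat. a + of_nat i * d)"
    using assms by (auto intro!: injI)
  then show ?thesis
    by (simp add: finite_image_iff)
qed

text \<open>The excluded value \<open>w\<close> is room for the one point of the progression at
  which \<open>E x (x + k)\<close> vanishes, so that \<open>E_cubic\<close> says nothing
  there.\<close>

lemma quadratic_vanishing_on_progression:
  fixes a0 :: "'a::field_char_0"
  assumes d: "d \<noteq> 0"
    and z: "\<And>i::nat. x + of_nat i * d \<noteq> w \<Longrightarrow>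
      a0 + a1 * (x + of_nat i * d) + a2 * (x + of_nat i * d)^2 = 0"
  shows "a0 = 0" "a1 = 0" "a2 = 0"
proof -
  let ?A = "(\<lambda>i::nat. x + of_nat i * d) ` UNIV - {w}"
  have inf: "infinite ?A"
    using infinite_progression [OF d] by simp
  have "a0 + a1 * y + a2 * y^2 + 0 * y^3 + 0 * y^4 = 0" if "y \<in> ?A" for y
    using that z by auto
  from poly4_vanishing [OF inf this] show "a0 = 0" "a1 = 0" "a2 = 0" by blast+
qed

text \<open>
  \<open>E k l\<close> and \<open>K k l\<close> stand for the products of opposite coefficients of \<open>G\<close> and of \<open>2 L\<close> between the
  weights \<open>p + k \<theta>\<close> and \<open>p + l \<theta>\<close>, where \<open>z = p + c/24\<close> and \<open>\<gamma> = \<theta>\<^sup>2 c/3\<close>. Only the weights with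
  \<open>k \<ge> 0\<close> are known to be present.
\<close>

locale coefficient_chain =
  fixes E K :: "int \<Rightarrow> int \<Rightarrow> 'a::field_char_0" and z \<theta> \<gamma> :: 'a
  assumes \<theta>: "\<theta> \<noteq> 0"
    and E_sym: "odd (k - l) \<Longrightarrow> E k l = E l k"
    and E_refl: "k \<ge> 0 \<Longrightarrow> odd j \<Longrightarrow>
      E k (k + j) + E k (k - j) = 2 * (z + of_int k * \<theta>) - \<gamma> * of_int j^2"
    and K_rec: "k \<ge> 0 \<Longrightarrow> even m \<Longrightarrow> m \<noteq> 0 \<Longrightarrow>
      K k (k + m) - K (k - m) k = 8 * of_int m * \<theta> * (z + of_int k * \<theta>) - of_int m^3 * \<theta> * \<gamma>"
    and K_diff: "even (a - b) \<Longrightarrow> a \<noteq> b \<Longrightarrow> odd (a - c) \<Longrightarrow> c \<noteq> d \<Longrightarrow> a + b = c + d \<Longrightarrow>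
      K a b - K c d = (E a c - E b d) * (E b c - E a d)"
    and E_cubic: "odd k \<Longrightarrow> odd n \<Longrightarrow> k \<noteq> n \<Longrightarrow> k \<noteq> -n \<Longrightarrow> x \<ge> 0 \<Longrightarrow> x + k \<ge> 0 \<Longrightarrow> E x (x + k) \<noteq> 0 \<Longrightarrow>
      D = (3 * of_int n - of_int k) * \<theta> - E x (x + n) + E (x + k - n) (x + k) \<Longrightarrow>
      E x (x + n) * E (x + k + n) (x + n) * E (x + k + n) (x + k)
        - E x (x - n) * E (x + k - n) (x - n) * E (x + k - n) (x + k)
      = D * (K x (x + k + n) - E x (x + n) * E (x + k + n) (x + n)
             - E x (x + k) * E (x + k + n) (x + k) - E x (x + k) * D)"
begin

text \<open>The reflections at \<open>k + j\<close> and at \<open>k + 2 * j\<close> share the edge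
  between these two weights; their difference is free of this edge and of the central term.\<close>

lemma E_shift:
  assumes "k \<ge> 0" "odd j" "j > 0"
  shows "E (k + 2 * j) (k + 2 * j + j) = E k (k + j) + 2 * of_int j * \<theta>"
proof -
  have "E (k + j) (k + 2 * j) + E (k + j) k = 2 * (z + of_int (k + j) * \<theta>) - \<gamma> * of_int j^2"
    using E_refl [of "k + j" j] assms by (simp add: algebra_simps)
  moreover have "E (k + 2 * j) (k + 2 * j + j) + E (k + 2 * j) (k + j)
      = 2 * (z + of_int (k + 2 * j) * \<theta>) - \<gamma> * of_int j^2"
    using E_refl [of "k + 2 * j" j] assms by (simp add: algebra_simps)
  moreover have "E (k + j) k = E k (k + j)" "E (k + 2 * j) (k + j) = E (k + j) (k + 2 * j)"
    using E_sym assms by simp_all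
  ultimately show ?thesis
    by (simp only: of_int_add of_int_mult of_int_numeral) algebra
qed

lemma E_shift_iter:
  assumes "k \<ge> 0" "odd j" "j > 0"
  shows "E (k + 2 * j * int i) (k + 2 * j * int i + j) = E k (k + j) + 2 * of_int j * of_nat i * \<theta>"
proof (induction i)
  case (Suc i)
  have "k + 2 * j * int i \<ge> 0" using assms by simp
  from E_shift [OF this assms(2,3)] Suc show ?case
    by (simp add: algebra_simps)
qed simp

text \<open>The recurrence telescopes: its linear part adds up to a difference of squares of
  midpoints, while the central part contributes m^3 for each step of length m.\<close>

lemma K_shift_iter:
  assumes "k \<ge> 0" "even m" "m > 0"
  shows "K (k + m * int i) (k + m * int i + m) = K k (k + m)
    + 4 * (z + of_int k * \<theta> + of_int m * of_nat i * \<theta> + of_int m * \<theta> / 2)^2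
    - 4 * (z + of_int k * \<theta> + of_int m * \<theta> / 2)^2 - of_nat i * of_int m^3 * \<theta> * \<gamma>"
proof (induction i)
  case (Suc i)
  have nn: "k + m * int (Suc i) \<ge> 0" using assms by simp
  have "K (k + m * int (Suc i)) (k + m * int (Suc i) + m)
     = K (k + m * int i) (k + m * int i + m)
       + 8 * of_int m * \<theta> * (z + of_int (k + m * int (Suc i)) * \<theta>) - of_int m^3 * \<theta> * \<gamma>"
    using K_rec [OF nn assms(2)] assms(3) by (simp add: algebra_simps)
  then show ?case unfolding Suc
    by (simp add: field_simps power2_eq_square)
qed simp

text \<open>The pairs 2, 4 and 1, 5 have the same midpoint, and both are moved by 12, once in six
  steps of 2 and once in three steps of 4. By \<open>K_diff\<close> the difference of their
  \<open>K\<close> is a product of differences of \<open>E\<close>, which this translation does not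
  change. The quadratic parts agree as well, but the central terms are 6 * 8 = 48 and 3 * 64 =
  192.\<close>

lemma gamma_zero: "\<gamma> = 0"
proof -
  have a1: "E 14 17 = E 2 5 + 12 * \<theta>" using E_shift_iter [of 2 3 2] by simp
  have a2: "E 13 16 = E 1 4 + 12 * \<theta>" using E_shift_iter [of 1 3 2] by simp
  have a3: "E 16 17 = E 4 5 + 12 * \<theta>" using E_shift_iter [of 4 1 6] by simp
  have a4: "E 13 14 = E 1 2 + 12 * \<theta>" using E_shift_iter [of 1 1 6] by simp
  have k1: "K 14 16 = K 2 4 + 4 * (z + 15 * \<theta>)^2 - 4 * (z + 3 * \<theta>)^2 - 48 * \<theta> * \<gamma>"
    using K_shift_iter [of 2 2 6] by (simp add: algebra_simps)
  have q1: "K 2 4 - K 1 5 = (E 2 5 - E 4 1) * (E 4 5 - E 2 1)"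
    using K_diff [of 2 4 1 5] E_sym [of 4 1] E_sym [of 2 1] by (simp add: algebra_simps)
  have q2: "K 14 16 - K 13 17 = (E 14 17 - E 16 13) * (E 16 17 - E 14 13)"
    using K_diff [of 14 16 13 17] by (simp add: algebra_simps)
  have k2: "K 13 17 = K 1 5 + 4 * (z + 15 * \<theta>)^2 - 4 * (z + 3 * \<theta>)^2 - 192 * \<theta> * \<gamma>"
    using K_shift_iter [of 1 4 3] by (simp add: algebra_simps)
  have "K 14 16 - K 13 17 = K 2 4 - K 1 5"
    unfolding q1 q2 using a1 a2 a3 a4 E_sym [of 4 1] E_sym [of 2 1] E_sym [of 16 13] E_sym [of 14 13]
    by simp
  with k1 k2 have "144 * (\<theta> * \<gamma>) = 0" by algebra
  then show ?thesis using \<theta> by simp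
qed

text \<open>The deviation of \<open>E\<close> from the value at the midpoint of the edge. For an
  affine \<open>E\<close> with slope \<beta> it is (\<beta> - 1/2) j \<theta> at even k and the
  negative of this at odd k.\<close>

definition r :: "int \<Rightarrow> int \<Rightarrow> 'a" where
  "r j k = E k (k + j) - (z + of_int k * \<theta> + of_int j * \<theta> / 2)"

lemma E_r: "E k (k + j) = z + of_int k * \<theta> + of_int j * \<theta> / 2 + r j k"
  by (simp add: r_def)

lemma r_flip:
  assumes "k \<ge> 0" "odd j" "j > 0"
  shows "r j (k + j) = - r j k"
proof -
  have "E (k + j) (k + j + j) + E k (k + j) = 2 * (z + of_int (k + j) * \<theta>)"
    using E_refl [of "k + j" j] E_sym [of "k + j" k] assms by (simp add: gamma_zero)
  moreover define h where "h = of_int j * \<theta> / 2"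
  moreover have "2 * h = of_int j * \<theta>" unfolding h_def by simp
  ultimately show ?thesis
    unfolding r_def h_def [symmetric] by (simp only: of_int_add eq_neg_iff_add_eq_0) algebra
qed

lemma r_periodic: "k \<ge> 0 \<Longrightarrow> odd j \<Longrightarrow> j > 0 \<Longrightarrow> r j (k + 2 * j * int i) = r j k"
  using E_shift_iter [of k j i] by (simp add: r_def algebra_simps)

lemma r_one_even: "k \<ge> 0 \<Longrightarrow> even i \<Longrightarrow> i \<ge> 0 \<Longrightarrow> r 1 (k + i) = r 1 k"
  using r_periodic [of k 1 "nat (i div 2)"] by simp

lemma r_one_odd: "k \<ge> 0 \<Longrightarrow> odd i \<Longrightarrow> i \<ge> 0 \<Longrightarrow> r 1 (k + i) = - r 1 k"
  using r_one_even [of "k + 1" "i - 1"] r_flip [of k 1] by (cases "i = 0") auto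

text \<open>\<open>E_cubic\<close> for the steps 1 and j at the translates of k by multiples of 2 j
  (j + 1). This number is a period of \<open>r j\<close> and of \<open>r 1\<close> and a multiple of
  the step j + 1 of \<open>K\<close>, so the relation is a quadratic polynomial, with constant
  coefficients, in the midpoint X of the translated edge. The two claims are its leading and its
  linear coefficient.\<close>

lemma r_step:
  assumes j: "odd j" "j \<ge> 3" and k: "k \<ge> 1"
  shows "r j (k + 1) = r j (k - 1)" "of_int j * r 1 k + 2 * r j (k + 1) + r j k = 0"
proof -
  define \<tau> \<sigma> a b where "\<tau> = r 1 k" and "\<sigma> = r j k" and "a = r j (k + 1)" and "b = r j (k - 1)"
  note rdefs = \<tau>_def [symmetric] \<sigma>_def [symmetric] a_def [symmetric] b_def [symmetric]
  define J where "J = (of_int j * \<theta> :: 'a)"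
  define q where "q = z + of_int k * \<theta> + J / 2"
  define C where "C = K k (k + (j + 1)) - 4 * (q + \<theta> / 2)^2"
  define d where "d = of_int (2 * j * (j + 1)) * \<theta>"
  have d: "d \<noteq> 0"
  proof -
    have "2 * j * (j + 1) \<noteq> 0" using j by auto
    then show ?thesis using \<theta> unfolding d_def by (metis mult_eq_0_iff of_int_eq_0_iff)
  qed
  define t u where "t = \<theta> / 2" and "u = J / 2"
  have tu: "\<theta> = 2 * t" "J = 2 * u" unfolding t_def u_def by simp_all
  define c0 where "c0 = - 4*C*t + 2*u*a*\<tau> - 4*u*a*t + 2*u*b*\<tau> + 4*u*\<sigma>*t - 8*u*t^2 - u^2*a + u^2*b
    - 4*u^2*t + 4*a*\<tau>*t - a*\<tau>^2 + 5*a*t^2 + b*\<tau>^2 - b*t^2 - 4*\<sigma>*\<tau>*t + 20*\<sigma>*t^2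
    + 8*\<tau>*t^2 - 4*\<tau>^2*t - 4*t^3"
  define c1 where "c1 = 2 * J * \<tau> + 3 * a * \<theta> + b * \<theta> + 2 * \<sigma> * \<theta>"
  have main: "c0 + c1 * (q + of_nat i * d) + (a - b) * (q + of_nat i * d)^2 = 0"
    if ne: "q + of_nat i * d \<noteq> - \<sigma>" for i :: nat
  proof -
    define x where "x = k + 2 * j * (j + 1) * int i"
    define X where "X = q + of_nat i * d"
    have x1: "x \<ge> 1" using k j unfolding x_def by (simp add: add_increasing2)
    have zx: "z + of_int x * \<theta> = X - J / 2"
      unfolding x_def X_def q_def d_def J_def by (simp add: algebra_simps)
    have zx2: "z + of_int x * \<theta> + of_int j * \<theta> = X + J / 2"
      unfolding zx J_def by (simp add: field_simps)
    have per: "r j (x + m) = r j (k + m)" if "k + m \<ge> 0" for m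
      using r_periodic [of "k + m" j "nat ((j + 1) * int i)"] that j unfolding x_def
      by (simp add: algebra_simps)
    have ri: "r j x = \<sigma>" "r j (x + 1) = a" "r j (x - 1) = b"
      using per [of 0] per [of 1] per [of "-1"] k unfolding \<sigma>_def a_def b_def by simp_all
    have sx: "r 1 x = \<tau>"
      using r_one_even [of k "2 * j * (j + 1) * int i"] k j unfolding x_def rdefs by simp
    have s1: "r 1 (x - 1) = - \<tau>" using r_flip [of "x - 1" 1] x1 sx by simp
    have s2: "r 1 (x + j) = - \<tau>" using r_one_odd [of x j] x1 sx j by simp
    have s3: "r 1 (x + j - 1) = \<tau>" using r_one_even [of x "j - 1"] x1 sx j by (simp add: algebra_simps)
    have e11: "E x (x + 1) = X - J / 2 + \<theta> / 2 + \<tau>"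
      using E_r [of x 1] sx zx by (simp add: algebra_simps)
    have e21: "E (x + j + 1) (x + 1) = X + \<theta> + a"
      using E_r [of "x + 1" j] E_sym [of "x + j + 1" "x + 1"] ri zx j
      by (simp add: algebra_simps J_def)
    have e22: "E (x + j + 1) (x + j) = X + J / 2 + \<theta> / 2 - \<tau>"
      using E_r [of "x + j" 1] E_sym [of "x + j + 1" "x + j"] s2 zx2
      by (simp add: algebra_simps)
    have f11: "E x (x - 1) = X - J / 2 - \<theta> / 2 - \<tau>"
    proof -
      have "E x (x - 1) = (z + of_int x * \<theta>) - \<theta> + \<theta> / 2 - \<tau>"
        using E_r [of "x - 1" 1] E_sym [of x "x - 1"] s1 by (simp add: left_diff_distrib)
      moreover define h where "h = \<theta> / 2"
      moreover have "\<theta> = h + h" unfolding h_def by simp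
      ultimately show ?thesis unfolding zx h_def [symmetric] by simp
    qed
    have f21: "E (x + j - 1) (x - 1) = X - \<theta> + b"
      using E_r [of "x - 1" j] E_sym [of "x + j - 1" "x - 1"] ri zx j
      by (simp add: algebra_simps J_def)
    have f22: "E (x + j - 1) (x + j) = X + J / 2 - \<theta> / 2 + \<tau>"
      using E_r [of "x + j - 1" 1] s3 zx2
      by (simp add: algebra_simps)
    have e12: "E x (x + j) = X + \<sigma>"
      using E_r [of x j] ri zx by (simp add: algebra_simps J_def)
    have kk: "K x (x + j + 1) = 4 * (X + \<theta> / 2)^2 + C"
    proof -
      have "K x (x + (j + 1)) = K k (k + (j + 1)) + 4 * (X + \<theta> / 2)^2 - 4 * (q + \<theta> / 2)^2"
        using K_shift_iter [of k "j + 1" "nat (2 * j * int i)"] k j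
        by (simp add: x_def gamma_zero X_def q_def J_def d_def algebra_simps add_divide_distrib)
      then show ?thesis unfolding C_def by (simp add: algebra_simps)
    qed
    have D: "2 * \<theta> = (3 * of_int 1 - of_int j) * \<theta> - E x (x + 1) + E (x + j - 1) (x + j)"
      unfolding e11 f22 J_def by (simp add: field_simps)
    have "E x (x + j) \<noteq> 0" using ne e12 unfolding X_def [symmetric]
      by (metis add_eq_0_iff2 add.commute)
    from E_cubic [OF j(1) _ _ _ _ _ this D] x1 j
    have "(X - u + t + \<tau>) * (X + \<theta> + a) * (X + u + t - \<tau>)
       - (X - u - t - \<tau>) * (X - \<theta> + b) * (X + u - t + \<tau>)
       = 2 * \<theta> * (4 * (X + t)^2 + C - (X - u + t + \<tau>) * (X + \<theta> + a)
          - (X + \<sigma>) * (X + u + t - \<tau>) - (X + \<sigma>) * (2 * \<theta>))"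
      unfolding e11 e12 e21 e22 f11 f21 f22 kk t_def u_def by simp
    then show ?thesis unfolding X_def [symmetric] c0_def c1_def unfolding tu by algebra
  qed
  from quadratic_vanishing_on_progression [OF d main]
  have "a = b" "c1 = 0" by auto
  then show "r j (k + 1) = r j (k - 1)" unfolding rdefs by simp
  have "2 * \<theta> * (of_int j * \<tau> + 2 * a + \<sigma>) = 0"
    using \<open>c1 = 0\<close> \<open>a = b\<close> unfolding c1_def J_def by (simp add: algebra_simps)
  then show "of_int j * r 1 k + 2 * r j (k + 1) + r j k = 0"
    using \<theta> unfolding rdefs by simp
qed

text \<open>\<open>r j\<close> has period 2 and j - 1 is even, hence
  \<open>r j (k + 1) = r j (k + j) = - r j k\<close>, and the second relation of
  \<open>r_step\<close> yields the value. As that lemma starts at k = 1, the weight is first moved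
  up by the period 2 j.\<close>

lemma r_linear: "k \<ge> 0 \<Longrightarrow> odd j \<Longrightarrow> j > 0 \<Longrightarrow> r j k = of_int j * r 1 k"
proof -
  have *: "r j k = of_int j * r 1 k" if "k \<ge> 1" "odd j" "j \<ge> 3" for j k
  proof -
    have sh: "r j (k + 2 * int i) = r j k" if "k \<ge> 0" for i k
    proof (induction i)
      case (Suc i)
      have "r j (k + 2 * int i + 1 + 1) = r j (k + 2 * int i + 1 - 1)"
        using r_step(1) [OF \<open>odd j\<close> \<open>j \<ge> 3\<close>, of "k + 2 * int i + 1"] that by simp
      then show ?case using Suc by (simp add: algebra_simps)
    qed simp
    have "r j (k + 1) = r j (k + j)"
      using sh [of "k + 1" "nat ((j - 1) div 2)"] that by (simp add: algebra_simps)
    also have "\<dots> = - r j k" using r_flip [of k j] that by simp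
    finally show ?thesis using r_step(2) [OF that(2,3,1)] by (simp add: algebra_simps)
  qed
  assume kj: "k \<ge> 0" "odd j" "j > 0"
  show ?thesis
  proof (cases "j = 1")
    case False
    with kj have j3: "j \<ge> 3" by presburger
    have "r j (k + 2 * j) = of_int j * r 1 (k + 2 * j)" using * [of "k + 2 * j" j] kj j3 by simp
    then show ?thesis
      using r_periodic [of k j 1] r_one_even [of k "2 * j"] kj by simp
  qed simp
qed

text \<open>The edge from 0 to 1 determines \<beta>, and \<open>r_linear\<close> carries it to all
  edges with nonnegative ends. An edge with one negative end is the mirror image of such an edge at
  its nonnegative end, where the reflection relation is available.\<close>

theorem E_affine: "\<exists>\<beta>. \<forall>k l. even k \<longrightarrow> odd l \<longrightarrow> k \<ge> 0 \<or> l \<ge> 0 \<longrightarrow>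
    E k l = (1 - \<beta>) * (z + of_int k * \<theta>) + \<beta> * (z + of_int l * \<theta>)"
proof -
  define \<beta> where "\<beta> = 1/2 + r 1 0 / \<theta>"
  have b1: "\<beta> * \<theta> = \<theta> / 2 + r 1 0" using \<theta> unfolding \<beta>_def by (simp add: field_simps)
  have ev: "r 1 k = r 1 0" if "even k" "k \<ge> 0" for k using r_one_even [of 0 k] that by simp
  have od: "r 1 k = - r 1 0" if "odd k" "k \<ge> 0" for k using r_one_odd [of 0 k] that by simp
  have pos: "E k l = (1 - \<beta>) * (z + of_int k * \<theta>) + \<beta> * (z + of_int l * \<theta>)"
    if "even k" "odd l" "k \<ge> 0" "l \<ge> 0" for k l
  proof (cases "k < l")
    case True
    then have "E k l = z + of_int k * \<theta> + of_int (l - k) * \<theta> / 2 + of_int (l - k) * r 1 0"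
      using E_r [of k "l - k"] r_linear [of k "l - k"] ev [of k] that by simp
    also have "\<dots> = z + of_int k * \<theta> + of_int (l - k) * (\<beta> * \<theta>)"
      unfolding b1 by (simp add: field_simps)
    finally show ?thesis by (simp add: algebra_simps)
  next
    case False
    moreover have "k \<noteq> l" using that by auto
    ultimately have "l < k" by simp
    then have "E l k = z + of_int l * \<theta> + of_int (k - l) * \<theta> / 2 - of_int (k - l) * r 1 0"
      using E_r [of l "k - l"] r_linear [of l "k - l"] od [of l] that by simp
    also have "\<dots> = z + of_int l * \<theta> + of_int (k - l) * (\<theta> - \<beta> * \<theta>)"
      unfolding b1 by (simp add: field_simps)
    finally show ?thesis using E_sym [of k l] that by (simp add: algebra_simps)
  qed
  have "E k l = (1 - \<beta>) * (z + of_int k * \<theta>) + \<beta> * (z + of_int l * \<theta>)"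
    if "even k" "odd l" "k \<ge> 0 \<or> l \<ge> 0" for k l
  proof (cases "k \<ge> 0")
    case k: True
    show ?thesis
    proof (cases "l \<ge> 0")
      case False
      then have "E k (2 * k - l) = (1 - \<beta>) * (z + of_int k * \<theta>) + \<beta> * (z + of_int (2 * k - l) * \<theta>)"
        using pos [of k "2 * k - l"] that k by simp
      moreover have "E k l + E k (2 * k - l) = 2 * (z + of_int k * \<theta>)"
        using E_refl [OF k, of "l - k"] that gamma_zero by (simp add: algebra_simps)
      ultimately show ?thesis by (simp only: of_int_diff of_int_mult of_int_numeral) algebra
    qed (use pos that k in simp)
  next
    case k: False
    then have l: "l \<ge> 0" using that by simp
    have "E (2 * l - k) l = (1 - \<beta>) * (z + of_int (2 * l - k) * \<theta>) + \<beta> * (z + of_int l * \<theta>)"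
      using pos [of "2 * l - k" l] that k l by simp
    moreover have "E k l + E (2 * l - k) l = 2 * (z + of_int l * \<theta>)"
      using E_refl [OF l, of "k - l"] that gamma_zero E_sym [of k l] E_sym [of "2 * l - k" l]
      by (simp add: algebra_simps)
    ultimately show ?thesis by (simp only: of_int_diff of_int_mult of_int_numeral) algebra
  qed
  then show ?thesis by blast
qed

end

section \<open>The coefficients of a module\<close>

text \<open>In the application x and y are a four-cycle of \<open>G\<close> and its reverse, and x',
  y' are the same cycles for the opposite step. Substituting x' and y' in the second product leaves
  only the sum and the product of x and y.\<close>

lemma quadratic_elimination:
  fixes x y :: "'a::field"
  assumes "x - x' = \<epsilon> * d" "y - y' = \<epsilon> * d" "x * y = \<epsilon> * b" "x' * y' = \<epsilon> * b'" "x + y = a" "\<epsilon> \<noteq> 0"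
  shows "b - b' = d * (a - \<epsilon> * d)"
proof -
  have 1: "x' = x - \<epsilon> * d" "y' = y - \<epsilon> * d" using assms(1,2) by (simp_all add: algebra_simps)
  have "\<epsilon> * b - \<epsilon> * b' = \<epsilon> * (d * (x + y - \<epsilon> * d))"
    unfolding assms(3,4) [symmetric] unfolding 1 by (simp add: algebra_simps)
  then have "\<epsilon> * (b - b') = \<epsilon> * (d * (a - \<epsilon> * d))" using assms(5) by (simp add: algebra_simps)
  then show ?thesis using assms(6) by simp
qed

text \<open>
  Parities are booleans. \<open>D s\<close> is the coset of admissible weights of parity \<open>s\<close>, \<open>pr s p\<close> says
  that the weight space is nonzero, \<open>g s p q\<close> and \<open>l s p q\<close> are the coefficients of \<open>G\<close> and \<open>L\<close>
  of degree \<open>q - p\<close> from the weight \<open>p\<close> of parity \<open>s\<close> to the weight \<open>q\<close>; they are \<open>0\<close> if one of the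
  two weights is absent. \<open>GG0\<close>, \<open>LL\<close> and \<open>L0\<close> are the only relations which need the presence of \<open>p\<close>.
\<close>

locale svir_coefficients =
  fixes D :: "bool \<Rightarrow> 'f::field_char_0 set" and pr :: "bool \<Rightarrow> 'f \<Rightarrow> bool"
    and g l :: "bool \<Rightarrow> 'f \<Rightarrow> 'f \<Rightarrow> 'f" and c :: 'f
  assumes D_par: "p \<in> D s \<Longrightarrow> q \<in> D t \<Longrightarrow> r \<in> D t \<Longrightarrow> p + q - r \<in> D s"
    and D_odd: "p \<in> D s \<Longrightarrow> q \<in> D s \<Longrightarrow> r \<in> D (\<not> s) \<Longrightarrow> p + q - r \<in> D (\<not> s)"
    and D_nonempty: "D s \<noteq> {}"
    and D_two: "\<exists>p\<in>D s. \<exists>q\<in>D s. p \<noteq> q"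
    and pr_D: "pr s p \<Longrightarrow> p \<in> D s"
    and g_pr: "g s p q \<noteq> 0 \<Longrightarrow> pr s p \<and> pr (\<not> s) q"
    and l_pr: "l s p q \<noteq> 0 \<Longrightarrow> pr s p \<and> pr s q"
    and GG: "p \<in> D s \<Longrightarrow> P \<in> D s \<Longrightarrow> Q \<in> D (\<not> s) \<Longrightarrow> Q' \<in> D (\<not> s) \<Longrightarrow> p + P = Q + Q' \<Longrightarrow> p \<noteq> P \<Longrightarrow>
      g s p Q * g (\<not> s) Q P + g s p Q' * g (\<not> s) Q' P = 2 * l s p P"
    and GG0: "pr s p \<Longrightarrow> Q \<in> D (\<not> s) \<Longrightarrow> Q' \<in> D (\<not> s) \<Longrightarrow> p + p = Q + Q' \<Longrightarrow>
      g s p Q * g (\<not> s) Q p + g s p Q' * g (\<not> s) Q' p = 2 * p - ((Q - p)^2 - 1/4) * c / 3"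
    and LG: "p \<in> D s \<Longrightarrow> P \<in> D s \<Longrightarrow> q \<in> D (\<not> s) \<Longrightarrow> Q \<in> D (\<not> s) \<Longrightarrow> P + Q = p + q \<Longrightarrow>
      l (\<not> s) Q q * g s p Q - g s P q * l s p P = (Q - p - (P - p) / 2) * g s p q"
    and LL: "pr s p \<Longrightarrow> P \<in> D s \<Longrightarrow> P' \<in> D s \<Longrightarrow> p + p = P + P' \<Longrightarrow>
      l s p P * l s P p - l s p P' * l s P' p = 2 * (P - p) * p - ((P - p)^3 - (P - p)) * c / 12"
    and LL_off: "p \<in> D s \<Longrightarrow> P \<in> D s \<Longrightarrow> R \<in> D s \<Longrightarrow> R' \<in> D s \<Longrightarrow> R + R' = p + P \<Longrightarrow> p \<noteq> P \<Longrightarrow>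
      l s R P * l s p R - l s R' P * l s p R' = (R - R') * l s p P"
    and L0: "pr s p \<Longrightarrow> l s p p = p"
begin

definition e :: "bool \<Rightarrow> 'f \<Rightarrow> 'f \<Rightarrow> 'f" where
  "e s p q = g s p q * g (\<not> s) q p"

definition K :: "bool \<Rightarrow> 'f \<Rightarrow> 'f \<Rightarrow> 'f" where
  "K s p q = 4 * l s p q * l s q p"

lemma e_swap: "e (\<not> s) q p = e s p q"
  by (simp add: e_def)

lemma K_commute: "K s q p = K s p q"
  by (simp add: K_def)

lemma e_pr: "e s p q \<noteq> 0 \<Longrightarrow> pr s p \<and> pr (\<not> s) q"
  using g_pr unfolding e_def by fastforce

lemma e_refl:
  assumes "pr s p" "Q \<in> D (\<not> s)"
  shows "e s p Q + e s p (2 * p - Q) = 2 * p - ((Q - p)^2 - 1/4) * c / 3"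
proof -
  have "2 * p - Q \<in> D (\<not> s)"
    using D_odd [of p s p Q] assms pr_D by simp
  then show ?thesis using GG0 [of s p Q "2 * p - Q"] assms by (simp add: e_def)
qed

lemma e_refl':
  assumes "pr s p" "Q \<in> D (\<not> s)"
  shows "e s p Q + e s p (2 * p - Q) = 2 * (p + c / 24) - (Q - p)^2 * (c / 3)"
  unfolding e_refl [OF assms] by (simp add: field_simps)

lemma LG2:
  assumes "p \<in> D s" "P \<in> D s" "q \<in> D (\<not> s)" "Q \<in> D (\<not> s)" "P + Q = p + q"
  shows "2 * l (\<not> s) Q q * g s p Q - g s P q * (2 * l s p P) = (2 * (Q - p) - (P - p)) * g s p q"
proof -
  have "2 * (l (\<not> s) Q q * g s p Q - g s P q * l s p P) = 2 * ((Q - p - (P - p) / 2) * g s p q)"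
    using LG [OF assms] by simp
  also have "2 * ((a - b / 2) * x) = (2 * a - b) * x" for a b x :: 'f
    by (simp add: left_diff_distrib right_diff_distrib)
  finally show ?thesis by (simp add: algebra_simps)
qed

text \<open>Each \<open>l\<close> is half a sum of two paths of \<open>G\<close>. Multiplied out,
  both \<open>K\<close> contain the same two four-cycles through p, Q, P, Q', which cancel; the
  remaining products of \<open>e\<close> factor.\<close>

lemma K_diff:
  assumes "p \<in> D s" "P \<in> D s" "Q \<in> D (\<not> s)" "Q' \<in> D (\<not> s)" "p + P = Q + Q'" "p \<noteq> P" "Q \<noteq> Q'"
  shows "K s p P - K (\<not> s) Q Q' = (e s p Q - e s P Q') * (e s P Q - e s p Q')"
proof -
  have 1: "2 * l s p P = g s p Q * g (\<not> s) Q P + g s p Q' * g (\<not> s) Q' P"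
    using GG [of p s P Q Q'] assms by simp
  have 2: "2 * l s P p = g s P Q * g (\<not> s) Q p + g s P Q' * g (\<not> s) Q' p"
    using GG [of P s p Q Q'] assms by (simp add: add.commute)
  have 3: "2 * l (\<not> s) Q Q' = g (\<not> s) Q p * g s p Q' + g (\<not> s) Q P * g s P Q'"
    using GG [of Q "\<not> s" Q' p P] assms by simp
  have 4: "2 * l (\<not> s) Q' Q = g (\<not> s) Q' p * g s p Q + g (\<not> s) Q' P * g s P Q"
    using GG [of Q' "\<not> s" Q p P] assms by (simp add: add.commute)
  have "K s p P - K (\<not> s) Q Q' = (2 * l s p P) * (2 * l s P p) - (2 * l (\<not> s) Q Q') * (2 * l (\<not> s) Q' Q)"
    by (simp add: K_def)
  then show ?thesis unfolding 1 2 3 4 e_def by (simp add: algebra_simps)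
qed

lemma K_rec:
  assumes "pr s p" "P \<in> D s" "P' \<in> D s" "p + p = P + P'"
  shows "K s p P - K s p P' = 8 * (P - p) * (p + c / 24) - (P - p)^3 * (c / 3)"
proof -
  have "K s p P - K s p P' = 4 * (2 * (P - p) * p - ((P - p)^3 - (P - p)) * c / 12)"
    unfolding LL [OF assms, symmetric] K_def by (simp add: algebra_simps)
  also have "4 * (2 * x * p - (x^3 - x) * c / 12) = 8 * x * (p + c / 24) - x^3 * (c / 3)" for x
    by (simp add: field_simps)
  finally show ?thesis .
qed

text \<open>The product along the closed path p, p + n, q + n, q, p, hence unchanged by rescaling.
  Exchanging p and q together with the parity reverses the path.\<close>

definition C :: "bool \<Rightarrow> 'f \<Rightarrow> 'f \<Rightarrow> 'f \<Rightarrow> 'f" where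
  "C s p q n = g s p (p + n) * g (\<not> s) (p + n) (q + n) * g s (q + n) q * g (\<not> s) q p"

lemma D_add_odd: "p \<in> D s \<Longrightarrow> p + n \<in> D (\<not> s) \<Longrightarrow> q \<in> D t \<Longrightarrow> q + n \<in> D (\<not> t)"
  using D_par [of "p + n" "\<not> s" q s p] D_odd [of q "\<not> s" "p + n" p]
  by (cases "t = s") (simp_all add: algebra_simps)

lemma D_diff_odd: "p \<in> D s \<Longrightarrow> p + n \<in> D (\<not> s) \<Longrightarrow> q \<in> D t \<Longrightarrow> q - n \<in> D (\<not> t)"
  using D_par [of p s q "\<not> s" "p + n"] D_odd [of q s p "p + n"]
  by (cases "t = s") (simp_all add: algebra_simps)

text \<open>The bracket [L, G] from p to q, with both \<open>l\<close> expanded by \<open>GG\<close>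
  and the path closed by the coefficient from q back to p. The paths through q + n and through p - n
  become the two cycles.\<close>

lemma C_diff:
  assumes p: "p \<in> D s" and q: "q \<in> D (\<not> s)" and n: "p + n \<in> D (\<not> s)"
    and ne: "p + n \<noteq> q" "p \<noteq> q - n" "p \<noteq> q + n"
  shows "C s p q n - C s p q (- n)
    = e s p q * (3 * n - (q - p) - e s p (p + n) + e s (q - n) q)"
proof -
  have qn: "q + n \<in> D s" "q - n \<in> D s" "p - n \<in> D (\<not> s)"
    using D_add_odd [OF p n q] D_diff_odd [OF p n q] D_diff_odd [OF p n p] by simp_all
  have 1: "2 * l (\<not> s) (p + n) q = g (\<not> s) (p + n) (q + n) * g s (q + n) q + g (\<not> s) (p + n) p * g s p q"
    using GG [of "p + n" "\<not> s" q "q + n" p] p q n qn ne by (simp add: algebra_simps)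
  have 2: "2 * l s p (q - n) = g s p (p - n) * g (\<not> s) (p - n) (q - n) + g s p q * g (\<not> s) q (q - n)"
    using GG [of p s "q - n" "p - n" q] p q n qn ne by (simp add: algebra_simps)
  have "2 * l (\<not> s) (p + n) q * g s p (p + n) - g s (q - n) q * (2 * l s p (q - n))
     = (3 * n - (q - p)) * g s p q"
    using LG2 [of p s "q - n" q "p + n"] p q n qn by (simp add: algebra_simps)
  then have 3: "(2 * l (\<not> s) (p + n) q * g s p (p + n) - g s (q - n) q * (2 * l s p (q - n))) * g (\<not> s) q p
     = (3 * n - (q - p)) * e s p q"
    by (simp add: e_def)
  have "C s p q n - C s p q (- n)
    = (2 * l (\<not> s) (p + n) q * g s p (p + n) - g s (q - n) q * (2 * l s p (q - n))) * g (\<not> s) q p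
      - e s p q * e s p (p + n) + e s p q * e s (q - n) q"
    unfolding 1 2 C_def e_def by (simp add: algebra_simps)
  then show ?thesis unfolding 3 by (simp add: algebra_simps)
qed

lemma C_sum:
  assumes p: "p \<in> D s" and q: "q \<in> D (\<not> s)" and n: "p + n \<in> D (\<not> s)" and ne: "p \<noteq> q + n"
  shows "C s p q n + C (\<not> s) q p n = K s p (q + n) - e s p (p + n) * e s (q + n) (p + n) - e s p q * e s (q + n) q"
proof -
  have qn: "q + n \<in> D s" using D_add_odd [OF p n q] by simp
  have 1: "2 * l s p (q + n) = g s p (p + n) * g (\<not> s) (p + n) (q + n) + g s p q * g (\<not> s) q (q + n)"
    using GG [of p s "q + n" "p + n" q] p q n qn ne by (simp add: algebra_simps)
  have 2: "2 * l s (q + n) p = g s (q + n) (p + n) * g (\<not> s) (p + n) p + g s (q + n) q * g (\<not> s) q p"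
    using GG [of "q + n" s p "p + n" q] p q n qn ne by (simp add: algebra_simps)
  have "K s p (q + n) = (2 * l s p (q + n)) * (2 * l s (q + n) p)" by (simp add: K_def)
  then show ?thesis unfolding 1 2 C_def e_def by (simp add: algebra_simps)
qed

lemma C_prod:
  "C s p q n * C (\<not> s) q p n = e s p q * (e s p (p + n) * e s (q + n) (p + n) * e s (q + n) q)"
  by (simp add: C_def e_def)

text \<open>A cycle and its reverse are eliminated by \<open>quadratic_elimination\<close>. Both
  change by the same amount under n -> - n: this is the sum of the reflection relations at p and at
  q, whose central terms agree because both steps have length n.\<close>

lemma e_cubic:
  assumes p: "p \<in> D s" and q: "q \<in> D (\<not> s)" and n: "p + n \<in> D (\<not> s)"
    and ne: "p + n \<noteq> q" "p \<noteq> q + n" and nz: "e s p q \<noteq> 0"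
    and d: "d = 3 * n - (q - p) - e s p (p + n) + e s (q - n) q"
  shows "e s p (p + n) * e s (q + n) (p + n) * e s (q + n) q
       - e s p (p - n) * e s (q - n) (p - n) * e s (q - n) q
     = d * (K s p (q + n) - e s p (p + n) * e s (q + n) (p + n) - e s p q * e s (q + n) q - e s p q * d)"
proof -
  have pr: "pr s p" "pr (\<not> s) q" using e_pr [OF nz] by simp_all
  have qn: "q + n \<in> D s" using D_add_odd [OF p n q] by simp
  have ne': "p \<noteq> q - n" "q + n \<noteq> p" "q \<noteq> p - n" "q \<noteq> p + n"
    using ne by (auto simp: algebra_simps)
  define d' where "d' = 3 * n - (p - q) - e (\<not> s) q (q + n) + e (\<not> s) (p - n) p"
  define w where "w = (n^2 - 1/4) * c / 3"
  have R1: "e s p (p + n) + e s p (p - n) = 2 * p - w"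
    using e_refl [OF pr(1) n] by (simp add: w_def)
  have R2: "e (\<not> s) q (q + n) + e (\<not> s) q (q - n) = 2 * q - w"
    using e_refl [OF pr(2), of "q + n"] qn by (simp add: w_def)
  have sw: "e (\<not> s) q (q + n) = e s (q + n) q" "e (\<not> s) q (q - n) = e s (q - n) q"
    "e (\<not> s) (p - n) p = e s p (p - n)"
    by (rule e_swap)+
  have dd: "d' = d"
    using R1 R2 unfolding d d'_def sw by algebra
  have "C s p q n - C s p q (- n) = e s p q * d"
    using C_diff [OF p q n] ne ne' d by simp
  moreover have "C (\<not> s) q p n - C (\<not> s) q p (- n) = e s p q * d"
    using C_diff [of q "\<not> s" p n] p q qn ne ne' dd unfolding d'_def by (simp add: e_swap)
  moreover note C_prod [of s p q n]
  moreover have "C s p q (- n) * C (\<not> s) q p (- n)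
      = e s p q * (e s p (p - n) * e s (q - n) (p - n) * e s (q - n) q)"
    using C_prod [of s p q "- n"] by simp
  moreover have "C s p q n + C (\<not> s) q p n
      = K s p (q + n) - e s p (p + n) * e s (q + n) (p + n) - e s p q * e s (q + n) q"
    using C_sum [OF p q n] ne by simp
  ultimately show ?thesis using nz by (rule quadratic_elimination)
qed

section \<open>Chains of weights\<close>

lemma D_chain:
  assumes "p \<in> D s" "p + \<theta> \<in> D (\<not> s)"
  shows "p + of_int k * \<theta> \<in> D (if even k then s else \<not> s)"
proof (induction k rule: int_induct [where k = 0])
  case base
  show ?case using assms by simp
next
  case (step1 i)
  then show ?case using D_add_odd [OF assms step1(2)] by (auto simp: algebra_simps)
next
  case (step2 i)
  then show ?case using D_diff_odd [OF assms step2(2)] by (auto simp: algebra_simps)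
qed

lemma chain_affine:
  assumes p: "p \<in> D s" "p + \<theta> \<in> D (\<not> s)" and nz: "\<theta> \<noteq> 0"
    and pres: "\<And>k::int. k \<ge> 0 \<Longrightarrow> pr (if even k then s else \<not> s) (p + of_int k * \<theta>)"
  shows "c = 0" "\<exists>\<beta>. \<forall>k j. even k \<longrightarrow> odd j \<longrightarrow> k \<ge> 0 \<or> j \<ge> (0::int) \<longrightarrow>
    e s (p + of_int k * \<theta>) (p + of_int j * \<theta>) = (1 - \<beta>) * (p + of_int k * \<theta>) + \<beta> * (p + of_int j * \<theta>)"
proof -
  define sg where "sg = (\<lambda>k::int. if even k then s else \<not> s)"
  define v where "v = (\<lambda>k::int. p + of_int k * \<theta>)"
  have vD: "v k \<in> D (sg k)" for k unfolding v_def sg_def using D_chain [OF p] .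
  have sg_odd: "sg l = (\<not> sg k)" if "odd (k - l)" for k l using that by (auto simp: sg_def)
  have sg_even: "sg l = sg k" if "even (k - l)" for k l using that by (auto simp: sg_def)
  have v_eq: "v k = v l \<longleftrightarrow> k = l" for k l using nz by (auto simp: v_def)
  have v_add: "v a + v b = v x + v y" if "a + b = x + y" for a b x y
  proof -
    have "(of_int (a + b) :: 'f) = of_int (x + y)" using that by simp
    then show ?thesis unfolding v_def by (simp only: of_int_add) algebra
  qed
  interpret ch: coefficient_chain "\<lambda>k l. e (sg k) (v k) (v l)" "\<lambda>k l. K (sg k) (v k) (v l)"
    "p + c / 24" \<theta> "\<theta>^2 * c / 3"
  proof
    show "\<theta> \<noteq> 0" by fact
  next
    fix k l :: int assume "odd (k - l)"
    then show "e (sg k) (v k) (v l) = e (sg l) (v l) (v k)"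
      using sg_odd [of k l] e_swap [of "sg k" "v l" "v k"] by simp
  next
    fix k j :: int assume k: "0 \<le> k" and j: "odd j"
    have "2 * v k - v (k + j) = v (k - j)" unfolding v_def by (simp add: algebra_simps)
    moreover have "v (k + j) \<in> D (\<not> sg k)" using vD [of "k + j"] sg_odd [of k "k + j"] j by simp
    moreover have "pr (sg k) (v k)" using pres [OF k] unfolding sg_def v_def .
    moreover have "v (k + j) - v k = of_int j * \<theta>" unfolding v_def by (simp add: algebra_simps)
    ultimately have "e (sg k) (v k) (v (k + j)) + e (sg k) (v k) (v (k - j))
       = 2 * (v k + c / 24) - (of_int j * \<theta>)^2 * (c / 3)"
      using e_refl' [of "sg k" "v k" "v (k + j)"] by simp
    also have "\<dots> = 2 * (p + c / 24 + of_int k * \<theta>) - \<theta>\<^sup>2 * c / 3 * (of_int j)\<^sup>2"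
      unfolding v_def by (simp add: algebra_simps power2_eq_square)
    finally show "e (sg k) (v k) (v (k + j)) + e (sg k) (v k) (v (k - j)) =
      2 * (p + c / 24 + of_int k * \<theta>) - \<theta>\<^sup>2 * c / 3 * (of_int j)\<^sup>2" .
  next
    fix k m :: int assume k: "0 \<le> k" and m: "even m" "m \<noteq> 0"
    have "v (k + m) \<in> D (sg k)" "v (k - m) \<in> D (sg k)"
      using vD [of "k + m"] sg_even [of k "k + m"] vD [of "k - m"] sg_even [of k "k - m"] m by simp_all
    moreover have "pr (sg k) (v k)" using pres [OF k] unfolding sg_def v_def .
    moreover have "v k + v k = v (k + m) + v (k - m)" by (rule v_add) simp
    moreover have "v (k + m) - v k = of_int m * \<theta>" unfolding v_def by (simp add: algebra_simps)
    ultimately have "K (sg k) (v k) (v (k + m)) - K (sg k) (v k) (v (k - m))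
       = 8 * (of_int m * \<theta>) * (v k + c / 24) - (of_int m * \<theta>)^3 * (c / 3)"
      using K_rec [of "sg k" "v k" "v (k + m)" "v (k - m)"] by simp
    also have "\<dots> = 8 * of_int m * \<theta> * (p + c / 24 + of_int k * \<theta>) - of_int m ^ 3 * \<theta> * (\<theta>\<^sup>2 * c / 3)"
      unfolding v_def by (simp add: algebra_simps power2_eq_square power3_eq_cube)
    moreover have "K (sg (k - m)) (v (k - m)) (v k) = K (sg k) (v k) (v (k - m))"
      using sg_even [of k "k - m"] m K_commute by simp
    ultimately show "K (sg k) (v k) (v (k + m)) - K (sg (k - m)) (v (k - m)) (v k) =
      8 * of_int m * \<theta> * (p + c / 24 + of_int k * \<theta>) - of_int m ^ 3 * \<theta> * (\<theta>\<^sup>2 * c / 3)"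
      by simp
  next
    fix a b x d :: int
    assume ass: "even (a - b)" "a \<noteq> b" "odd (a - x)" "x \<noteq> d" "a + b = x + d"
    have pa: "sg b = sg a" "sg x = (\<not> sg a)" "sg d = (\<not> sg a)"
    proof -
      have "odd (a - d)" using ass(1,3,5) by presburger
      then show "sg b = sg a" "sg x = (\<not> sg a)" "sg d = (\<not> sg a)"
        using sg_even [of a b] sg_odd [of a x] sg_odd [of a d] ass by simp_all
    qed
    show "K (sg a) (v a) (v b) - K (sg x) (v x) (v d) =
       (e (sg a) (v a) (v x) - e (sg b) (v b) (v d)) * (e (sg b) (v b) (v x) - e (sg a) (v a) (v d))"
      using K_diff [of "v a" "sg a" "v b" "v x" "v d"] vD [of a] vD [of b] vD [of x] vD [of d]
        v_add [OF ass(5)] ass v_eq unfolding pa by simp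
  next
    fix k n x :: int and d
    assume ass: "odd k" "odd n" "k \<noteq> n" "k \<noteq> - n" "0 \<le> x" "0 \<le> x + k"
      and nz: "e (sg x) (v x) (v (x + k)) \<noteq> 0"
      and d: "d = (3 * of_int n - of_int k) * \<theta> - e (sg x) (v x) (v (x + n))
         + e (sg (x + k - n)) (v (x + k - n)) (v (x + k))"
    have pa: "sg (x + k + n) = sg x" "sg (x + k - n) = sg x"
      using sg_even [of x "x + k + n"] sg_even [of x "x + k - n"] ass by (simp_all add: algebra_simps)
    have po: "sg (x + k) = (\<not> sg x)" "sg (x + n) = (\<not> sg x)"
      using sg_odd [of x "x + k"] sg_odd [of x "x + n"] ass by simp_all
    define n' where "n' = of_int n * \<theta>"
    have vs: "v (x + n) = v x + n'" "v (x - n) = v x - n'" "v (x + k + n) = v (x + k) + n'"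
      "v (x + k - n) = v (x + k) - n'"
      unfolding v_def n'_def by (simp_all add: algebra_simps)
    have "v x \<in> D (sg x)" "v (x + k) \<in> D (\<not> sg x)" "v x + n' \<in> D (\<not> sg x)"
      using vD [of x] vD [of "x + k"] vD [of "x + n"] unfolding po vs by auto
    moreover have "v x + n' \<noteq> v (x + k)" "v x \<noteq> v (x + k) + n'"
      unfolding vs [symmetric] v_eq using ass by auto
    moreover have "d = 3 * n' - (v (x + k) - v x) - e (sg x) (v x) (v x + n') + e (sg x) (v (x + k) - n') (v (x + k))"
      unfolding d pa vs unfolding v_def n'_def by (simp add: algebra_simps)
    ultimately show "e (sg x) (v x) (v (x + n)) *
       e (sg (x + k + n)) (v (x + k + n)) (v (x + n)) *
       e (sg (x + k + n)) (v (x + k + n)) (v (x + k)) -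
       e (sg x) (v x) (v (x - n)) *
       e (sg (x + k - n)) (v (x + k - n)) (v (x - n)) *
       e (sg (x + k - n)) (v (x + k - n)) (v (x + k)) =
       d *
       (K (sg x) (v x) (v (x + k + n)) -
        e (sg x) (v x) (v (x + n)) * e (sg (x + k + n)) (v (x + k + n)) (v (x + n)) -
        e (sg x) (v x) (v (x + k)) * e (sg (x + k + n)) (v (x + k + n)) (v (x + k)) -
        e (sg x) (v x) (v (x + k)) * d)"
      using e_cubic [of "v x" "sg x" "v (x + k)" n' d] nz unfolding pa vs by simp
  qed
  show "c = 0" using ch.gamma_zero nz by simp
  then show "\<exists>\<beta>. \<forall>k j. even k \<longrightarrow> odd j \<longrightarrow> k \<ge> 0 \<or> j \<ge> (0::int) \<longrightarrow>
    e s (p + of_int k * \<theta>) (p + of_int j * \<theta>) = (1 - \<beta>) * (p + of_int k * \<theta>) + \<beta> * (p + of_int j * \<theta>)"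
    using ch.E_affine unfolding sg_def v_def by simp
qed

section \<open>Infinite half-chains and the presence of the nonzero weights\<close>

definition tail :: "bool \<Rightarrow> 'f \<Rightarrow> 'f \<Rightarrow> bool" where
  "tail s p \<theta> \<longleftrightarrow> (\<forall>k::nat. pr (if even k then s else \<not> s) (p + of_nat k * \<theta>))"

lemma tailD: "tail s p \<theta> \<Longrightarrow> k \<ge> 0 \<Longrightarrow> pr (if even k then s else \<not> s) (p + of_int k * \<theta>)"
  proof -
  assume "tail s p \<theta>" "k \<ge> 0"
  moreover from \<open>k \<ge> 0\<close> obtain n where "k = int n" using nonneg_int_cases by blast
  ultimately show ?thesis unfolding tail_def by simp
qed

text \<open>The unbroken string of present weights around p reaches from p - b \<theta> to p + a
  \<theta>. Reflection gives the sum of \<open>e\<close> over any two consecutive edges, and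
  \<open>e\<close> vanishes on the two edges that leave the string; the alternating sum yields the
  parity of a + b and the value.\<close>

lemma no_tail:
  assumes pr: "pr s p" and th: "p + \<theta> \<in> D (\<not> s)" "\<theta> \<noteq> 0"
    and up: "\<not> tail s p \<theta>" and down: "\<not> tail s p (- \<theta>)"
  shows "\<exists>a b::nat. even (a + b) \<and> 2 * (p + c / 24) - \<theta>^2 * (c / 3) = (of_nat b - of_nat a) * \<theta>
     \<and> (\<not> pr (\<not> s) (p + \<theta>) \<longrightarrow> a = 0)"
proof -
  define sg where "sg = (\<lambda>k::int. if even k then s else \<not> s)"
  define v where "v = (\<lambda>k::int. p + of_int k * \<theta>)"
  have pD: "p \<in> D s" by (rule pr_D [OF pr])
  have vD: "v k \<in> D (sg k)" for k unfolding v_def sg_def using D_chain [OF pD th(1)] .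
  let ?up = "\<lambda>k::nat. \<not> pr (sg (int k)) (v (int k))"
  let ?dn = "\<lambda>k::nat. \<not> pr (sg (- int k)) (v (- int k))"
  have "\<exists>k. ?up k" using up unfolding tail_def sg_def v_def by simp
  moreover have "\<exists>k. ?dn k" using down unfolding tail_def sg_def v_def by simp
  moreover have "\<not> ?up 0" "\<not> ?dn 0" using pr unfolding sg_def v_def by simp_all
  ultimately obtain a b where a: "?up (Suc a)" "\<And>k. k \<le> a \<Longrightarrow> \<not> ?up k"
    and b: "?dn (Suc b)" "\<And>k. k \<le> b \<Longrightarrow> \<not> ?dn k"
    using ex_least_nat_less [of ?up] ex_least_nat_less [of ?dn] by blast
  have pres: "pr (sg k) (v k)" if "- int b \<le> k" "k \<le> int a" for k
    using a(2) [of "nat k"] b(2) [of "nat (- k)"] that by (cases "k \<ge> 0") auto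
  \<comment> \<open>Edges are counted downwards: \<open>f 0\<close> and \<open>f (a + b + 1)\<close>
    belong to the edges that leave the string at its top and at its bottom.\<close>
  define f where "f = (\<lambda>j::nat. e (sg (int a - int j)) (v (int a - int j)) (v (int a - int j + 1)))"
  define r where "r = 2 * (p + c / 24) + 2 * of_nat a * \<theta> - \<theta>^2 * (c / 3)"
  have f0: "f 0 = 0"
  proof -
    have "sg (int a + 1) = (\<not> sg (int a))" unfolding sg_def by simp
    then have "\<not> pr (\<not> sg (int a)) (v (int a + 1))" using a(1) by (simp add: add.commute)
    then show ?thesis unfolding f_def using e_pr by auto
  qed
  have fn: "f (a + b + 1) = 0"
  proof -
    have "int a - int (a + b + 1) = - int (Suc b)" by simp
    then show ?thesis unfolding f_def using b(1) e_pr by metis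
  qed
  have step: "f (Suc j) + f j = r - 2 * of_nat j * \<theta>" if "j \<le> a + b" for j
  proof -
    define k where "k = int a - int j"
    have sgs: "sg (k + 1) = (\<not> sg k)" "sg (k - 1) = (\<not> sg k)" unfolding sg_def by simp_all
    have "pr (sg k) (v k)" by (rule pres) (use that in \<open>auto simp: k_def\<close>)
    moreover have "v (k + 1) \<in> D (\<not> sg k)" using vD [of "k + 1"] sgs by simp
    moreover have "2 * v k - v (k + 1) = v (k - 1)" "v (k + 1) - v k = \<theta>"
      unfolding v_def by (simp_all add: algebra_simps)
    ultimately have "e (sg k) (v k) (v (k + 1)) + e (sg k) (v k) (v (k - 1))
      = 2 * (v k + c / 24) - \<theta>^2 * (c / 3)"
      using e_refl' [of "sg k" "v k" "v (k + 1)"] by simp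
    moreover have "e (sg k) (v k) (v (k - 1)) = f (Suc j)"
      using e_swap [of "sg k" "v (k - 1)" "v k"] sgs unfolding f_def k_def by (simp add: algebra_simps)
    moreover have "e (sg k) (v k) (v (k + 1)) = f j" unfolding f_def k_def by simp
    moreover have "2 * (v k + c / 24) - \<theta>^2 * (c / 3) = r - 2 * of_nat j * \<theta>"
      unfolding v_def k_def r_def by (simp add: algebra_simps)
    ultimately show ?thesis by (simp add: add.commute)
  qed
  have val: "(2 * i \<le> a + b + 1 \<longrightarrow> f (2 * i) = - (2 * of_nat i * \<theta>))
     \<and> (2 * i + 1 \<le> a + b + 1 \<longrightarrow> f (2 * i + 1) = r - 2 * of_nat i * \<theta>)" for i
  proof (induction i)
    case 0
    then show ?case using f0 step [of 0] by simp
  next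
    case (Suc i)
    have 1: "f (2 * Suc i) = - (2 * of_nat (Suc i) * \<theta>)" if "2 * Suc i \<le> a + b + 1"
    proof -
      have 1: "f (2 * i + 1) = r - 2 * of_nat i * \<theta>" using Suc that by auto
      have "f (Suc (2 * i + 1)) + f (2 * i + 1) = r - 2 * of_nat (2 * i + 1) * \<theta>"
        by (rule step) (use that in simp)
      then have "f (2 * Suc i) = r - 2 * of_nat (2 * i + 1) * \<theta> - f (2 * i + 1)"
        by (simp add: eq_diff_eq)
      then show ?thesis unfolding 1 by (simp add: algebra_simps)
    qed
    have 2: "f (2 * Suc i + 1) = r - 2 * of_nat (Suc i) * \<theta>" if "2 * Suc i + 1 \<le> a + b + 1"
    proof -
      have v: "f (2 * Suc i) = - (2 * of_nat (Suc i) * \<theta>)" using 1 that by simp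
      have "f (2 * Suc i + 1) = r - 2 * of_nat (2 * Suc i) * \<theta> - f (2 * Suc i)"
        using step [of "2 * Suc i"] that by (simp add: algebra_simps)
      then show ?thesis unfolding v by (simp add: algebra_simps)
    qed
    show ?case using 1 2 by blast
  qed
  have ev: "even (a + b)"
  proof (rule ccontr)
    assume "odd (a + b)"
    then have "even (a + b + 1)" by simp
    then obtain i where i: "a + b + 1 = 2 * i" by (rule evenE)
    then have "2 * of_nat i * \<theta> = 0" using val [of i] fn by simp
    then show False using th(2) i by simp
  qed
  then obtain i where i: "a + b = 2 * i" by blast
  have "of_nat a + of_nat b = (2 * of_nat i :: 'f)" using arg_cong [OF i, of "of_nat :: nat \<Rightarrow> 'f"] by simp
  then have i2: "2 * of_nat i = (of_nat a + of_nat b :: 'f)" by simp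
  have "r = 2 * of_nat i * \<theta>" using val [of i] fn i by simp
  then have "2 * (p + c / 24) - \<theta>^2 * (c / 3) = 2 * of_nat i * \<theta> - 2 * of_nat a * \<theta>"
    unfolding r_def by (simp add: algebra_simps)
  then have "2 * (p + c / 24) - \<theta>^2 * (c / 3) = (of_nat b - of_nat a) * \<theta>"
    unfolding i2 by (simp add: algebra_simps)
  moreover have "a = 0" if "\<not> pr (\<not> s) (p + \<theta>)"
  proof (rule ccontr)
    assume "a \<noteq> 0"
    then have "\<not> ?up 1" using a(2) [of 1] by simp
    then show False using that unfolding sg_def v_def by simp
  qed
  ultimately show ?thesis using ev by blast
qed

text \<open>The cases N = 1 and N = 3 make 8 u an integer A and 8 w an integer. Eight times the
  equation for N then shows that N divides A, and N = 2 |A| + 1 is larger than |A|.\<close>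

lemma odd_multiples_vanish:
  fixes u w :: 'f
  assumes "\<And>N::int. odd N \<Longrightarrow> N > 0 \<Longrightarrow> \<exists>j::int. u - of_int N^2 * w = of_int j * of_int N"
  shows "u = 0"
proof -
  obtain j1 where j1: "u - w = of_int j1" using assms [of 1] by auto
  obtain j3 where j3: "u - 9 * w = of_int j3 * 3" using assms [of 3] by auto
  define m where "m = j1 - 3 * j3"
  have w8: "8 * w = of_int m" 
  proof -
    have "8 * w = (u - w) - (u - 9 * w)" by simp
    then show ?thesis unfolding j1 j3 m_def by simp
  qed
  define A where "A = 8 * j1 + m"
  have u8: "8 * u = of_int A" 
  proof -
    have "8 * u = 8 * (u - w) + 8 * w" by simp
    then show ?thesis unfolding j1 w8 A_def by simp
  qed
  define N where "N = 2 * \<bar>A\<bar> + 1"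
  have N: "odd N" "N > 0" unfolding N_def by auto
  obtain j where j: "u - of_int N^2 * w = of_int j * of_int N" using assms [OF N] by auto
  have "of_int (8 * j * N) = (of_int (A - N^2 * m) :: 'f)"
  proof -
    have "8 * (of_int j * of_int N) = 8 * u - of_int N^2 * (8 * w)"
      unfolding j [symmetric] by (simp add: algebra_simps)
    then show ?thesis unfolding u8 w8 by (simp add: mult.assoc)
  qed
  then have "8 * j * N = A - N^2 * m" by (simp only: of_int_eq_iff)
  then have "A = N * (8 * j + N * m)" by (simp add: algebra_simps power2_eq_square)
  then have "N dvd A" by simp
  have "A = 0"
  proof (rule ccontr)
    assume "A \<noteq> 0"
    then have "\<bar>N\<bar> \<le> \<bar>A\<bar>" using \<open>N dvd A\<close> by (rule dvd_imp_le_int)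
    then show False unfolding N_def by linarith
  qed
  then show ?thesis using u8 by simp
qed

text \<open>Otherwise \<open>no_tail\<close> applies to every odd multiple N \<theta>. There b - a
  is even, so division by 2 \<theta> brings u = (p + c / 24) / \<theta> into the shape of
  \<open>odd_multiples_vanish\<close>.\<close>

lemma tail_exists:
  assumes pr: "pr s p" and nz: "p + c / 24 \<noteq> 0" and th: "p + \<theta> \<in> D (\<not> s)" "\<theta> \<noteq> 0"
  shows "\<exists>N::int. odd N \<and> tail s p (of_int N * \<theta>)"
proof (rule ccontr)
  assume no: "\<not> ?thesis"
  define u w where "u = (p + c / 24) / \<theta>" and "w = \<theta> * (c / 6)"
  have uw: "2 * (p + c / 24) = 2 * \<theta> * u" "\<theta>^2 * (c / 3) = 2 * \<theta> * w"
    using th(2) unfolding u_def w_def by (simp_all add: power2_eq_square)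
  have "u = 0"
  proof (rule odd_multiples_vanish)
    fix N :: int assume N: "odd N" "N > 0"
    have "p + of_int N * \<theta> \<in> D (\<not> s)" using D_chain [OF pr_D [OF pr] th(1), of N] N by simp
    moreover have "of_int N * \<theta> \<noteq> 0" using N th(2) by simp
    moreover have "\<not> tail s p (of_int N * \<theta>)" "\<not> tail s p (- (of_int N * \<theta>))"
      using no N(1) by (blast, metis even_minus mult_minus_left no of_int_minus)
    ultimately obtain a b :: nat where ab: "even (a + b)"
       "2 * (p + c / 24) - (of_int N * \<theta>)^2 * (c / 3) = (of_nat b - of_nat a) * (of_int N * \<theta>)"
      using no_tail [OF pr] by blast
    from ab(1) obtain j where "int b - int a = 2 * j" by (metis dvd_def even_add even_diff even_of_nat)
    then have "(of_nat b - of_nat a :: 'f) = 2 * of_int j"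
      by (metis of_int_diff of_int_mult of_int_numeral of_int_of_nat_eq)
    with ab(2) have "2 * (p + c / 24) - of_int N^2 * (\<theta>^2 * (c / 3)) = 2 * of_int j * (of_int N * \<theta>)"
      by (simp add: power_mult_distrib mult.assoc)
    then have "2 * \<theta> * (u - of_int N^2 * w) = 2 * \<theta> * (of_int j * of_int N)"
      unfolding uw by (simp add: algebra_simps)
    then show "\<exists>j::int. u - of_int N^2 * w = of_int j * of_int N" using th(2) by auto
  qed
  then show False using nz th(2) unfolding u_def by simp
qed

lemma absent_e: "\<not> pr s p \<Longrightarrow> e s p q = 0" "\<not> pr (\<not> s) q \<Longrightarrow> e s p q = 0"
  using e_pr by blast+

text \<open>An absent weight has \<open>e = 0\<close> on its edges to two weights of the half-chain.
  Subtracting the affine formulas shows that the coefficient of the far end is 0, and then the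
  formula reduces to the absent weight itself.\<close>

lemma tail_full:
  assumes t: "tail s p \<theta>" and th: "p + \<theta> \<in> D (\<not> s)" "\<theta> \<noteq> 0" and nz: "p + of_int j * \<theta> \<noteq> 0"
  shows "pr (if even j then s else \<not> s) (p + of_int j * \<theta>)"
proof (rule ccontr)
  assume abs: "\<not> ?thesis"
  have pD: "p \<in> D s" using tailD [OF t, of 0] pr_D by simp
  define v where "v = (\<lambda>k::int. p + of_int k * \<theta>)"
  obtain \<beta> where \<beta>: "\<And>k j. even k \<Longrightarrow> odd j \<Longrightarrow> k \<ge> 0 \<or> j \<ge> 0 \<Longrightarrow>
      e s (v k) (v j) = (1 - \<beta>) * v k + \<beta> * v j"
    using chain_affine(2) [OF pD th tailD [OF t]] unfolding v_def by blast
  show False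
  proof (cases "even j")
    case True
    then have "\<not> pr s (v j)" using abs unfolding v_def by simp
    then have "(1 - \<beta>) * v j + \<beta> * v 1 = 0" "(1 - \<beta>) * v j + \<beta> * v 3 = 0"
      using \<beta> [of j 1] \<beta> [of j 3] True absent_e by simp_all
    moreover then have "\<beta> * (v 3 - v 1) = 0" by algebra
    ultimately show False using nz th(2) unfolding v_def by (auto simp: algebra_simps)
  next
    case False
    then have "\<not> pr (\<not> s) (v j)" using abs unfolding v_def by simp
    then have "(1 - \<beta>) * v 0 + \<beta> * v j = 0" "(1 - \<beta>) * v 2 + \<beta> * v j = 0"
      using \<beta> [of 0 j] \<beta> [of 2 j] False absent_e by simp_all
    moreover then have "(1 - \<beta>) * (v 2 - v 0) = 0" by algebra
    ultimately show False using nz th(2) unfolding v_def by (auto simp: algebra_simps)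
  qed
qed

lemma odd_vector_exists: "p \<in> D s \<Longrightarrow> \<exists>\<theta>. \<theta> \<noteq> 0 \<and> p + \<theta> \<in> D (\<not> s)"
proof -
  assume p: "p \<in> D s"
  obtain a b where "a \<in> D (\<not> s)" "b \<in> D (\<not> s)" "a \<noteq> b" using D_two [of "\<not> s"] by blast
  then obtain q where "q \<in> D (\<not> s)" "q \<noteq> p" by (cases "a = p") auto
  then show ?thesis by (intro exI [of _ "q - p"]) simp
qed

text \<open>With A = 1 / n0 and A - d = 1 / n1 the i-th term is (n1 - i (n1 - n0)) / (n0 n1). For n1
  > n0 it is not positive at i = n1; for n1 < n0 it exceeds 1 at i = n0 n1. The comparison takes
  place in the integers, after multiplying out.\<close>

lemma progression_of_unit_fractions:
  fixes A d :: 'f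
  assumes "\<And>i::nat. \<exists>n::int. n > 0 \<and> (A - of_nat i * d) * of_int n = 1"
  shows "d = 0"
proof (rule ccontr)
  assume d: "d \<noteq> 0"
  obtain n0 where n0: "n0 > 0" "A * of_int n0 = 1" using assms [of 0] by auto
  obtain n1 where n1: "n1 > 0" "(A - d) * of_int n1 = 1" using assms [of 1] by auto
  have key: "\<exists>n>0. n * (n1 - int i * (n1 - n0)) = n0 * n1" for i :: nat
  proof -
    obtain n where n: "n > 0" "(A - of_nat i * d) * of_int n = 1" using assms [of i] by auto
    have "of_int n * (of_int n1 - of_nat i * (of_int n1 - of_int n0)) = of_int n0 * (of_int n1 :: 'f)"
      using n0(2) n1(2) n(2) by algebra
    then have "of_int (n * (n1 - int i * (n1 - n0))) = (of_int (n0 * n1) :: 'f)" by simp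
    then show ?thesis using n(1) by (metis of_int_eq_iff)
  qed
  have ne: "n0 \<noteq> n1"
  proof
    assume "n0 = n1"
    then have "(A - d) * of_int n1 = A * of_int n1" using n0 n1 by simp
    then show False using d n1(1) by simp
  qed
  have pos: "n0 * n1 > 0" using n0(1) n1(1) by simp
  show False
  proof (cases "n1 > n0")
    case True
    obtain n where n: "n > 0" "n * (n1 - int (nat n1) * (n1 - n0)) = n0 * n1" using key [of "nat n1"] by auto
    have "n1 * (n1 - n0) \<ge> n1 * 1" using True n1(1) by (intro mult_left_mono) auto
    then have "n1 - int (nat n1) * (n1 - n0) \<le> 0" using n1(1) by simp
    then have "n * (n1 - int (nat n1) * (n1 - n0)) \<le> 0" using n(1) by (simp add: mult_le_0_iff)
    then show False using n pos by simp
  next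
    case False
    define i where "i = nat (n0 * n1)"
    obtain n where n: "n > 0" "n * (n1 - int i * (n1 - n0)) = n0 * n1" using key [of i] by auto
    have "int i * (n0 - n1) \<ge> int i * 1" using False ne by (intro mult_left_mono) auto
    then have "n1 - int i * (n1 - n0) > n0 * n1" using n1(1) pos unfolding i_def by (simp add: algebra_simps)
    moreover have "n * (n1 - int i * (n1 - n0)) \<ge> 1 * (n1 - int i * (n1 - n0))"
      using n(1) calculation pos by (intro mult_right_mono) auto
    ultimately show False using n(2) by simp
  qed
qed

end

context svir_coefficients begin

lemma tail_shift_one: "tail s p \<theta> \<Longrightarrow> tail (\<not> s) (p + \<theta>) \<theta>"
  unfolding tail_def
proof
  fix k :: nat
  assume "\<forall>k. pr (if even k then s else \<not> s) (p + of_nat k * \<theta>)"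
  from this [rule_format, of "Suc k"]
  show "pr (if even k then \<not> s else \<not> \<not> s) (p + \<theta> + of_nat k * \<theta>)"
    by (simp add: algebra_simps split: if_splits)
qed

text \<open>Suppose that q is absent. From a weight z i \<noteq> q of the half-chain no half-chain
  starts towards q or away from it, since \<open>tail_full\<close> would make q present. So
  \<open>no_tail\<close> applies with a = 0 and c = 0, and it says that 1 - z i / q is the
  reciprocal of a positive integer. These numbers form an arithmetic progression with difference - 2
  \<theta> / q.\<close>

lemma tail_present:
  assumes t: "tail s p \<theta>" and th: "p + \<theta> \<in> D (\<not> s)" "\<theta> \<noteq> 0" and q: "q \<in> D (\<not> s)" "q \<noteq> 0"
  shows "pr (\<not> s) q"
proof (rule ccontr)
  assume abs: "\<not> ?thesis"
  have pD: "p \<in> D s" using tailD [OF t, of 0] pr_D by simp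
  have c: "c = 0" by (rule chain_affine(1) [OF pD th tailD [OF t]])
  define z where "z = (\<lambda>i::nat. p + 2 * of_nat i * \<theta>)"
  have zpr: "pr s (z i)" for i using tailD [OF t, of "2 * int i"] unfolding z_def by simp
  have frac: "\<exists>m::nat. (1 + of_nat m) * z i = of_nat m * q" if ne: "z i \<noteq> q" for i
  proof -
    define \<eta> where "\<eta> = q - z i"
    have \<eta>: "z i + \<eta> = q" "\<eta> \<noteq> 0" using ne unfolding \<eta>_def by simp_all
    have zD: "z i \<in> D s" by (rule pr_D [OF zpr])
    have d: "z i + \<eta> \<in> D (\<not> s)" unfolding \<eta> by (rule q(1))
    have d': "z i + - \<eta> \<in> D (\<not> s)" using D_diff_odd [OF zD d zD] by simp
    have "\<not> tail s (z i) \<eta>"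
      using tail_full [of s "z i" \<eta> 1] d d' \<eta> abs q by auto
    moreover have "\<not> tail s (z i) (- \<eta>)"
      using tail_full [of s "z i" "- \<eta>" "-1"] d d' \<eta> abs q by auto
    ultimately obtain a b :: nat where ab: "even (a + b)"
      "2 * (z i + c / 24) - \<eta>^2 * (c / 3) = (of_nat b - of_nat a) * \<eta>" "\<not> pr (\<not> s) (z i + \<eta>) \<longrightarrow> a = 0"
      using no_tail [OF zpr d \<eta>(2)] by blast
    have "a = 0" using ab(3) abs \<eta> by simp
    with ab(1) obtain m where "b = 2 * m" by auto
    with ab(2) \<open>a = 0\<close> c have "2 * z i = 2 * (of_nat m * \<eta>)" by simp
    then have "z i = of_nat m * \<eta>" by simp
    then have "(1 + of_nat m) * z i = of_nat m * q" unfolding \<eta>_def by (simp add: algebra_simps)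
    then show ?thesis by blast
  qed
  have "\<exists>i0. \<forall>i\<ge>i0. z i \<noteq> q"
  proof (cases "\<exists>i. z i = q")
    case True
    then obtain i where i: "z i = q" by blast
    have "z j \<noteq> q" if "j > i" for j using th(2) that unfolding i [symmetric] z_def by simp
    then show ?thesis by (meson Suc_le_eq)
  qed blast
  then obtain i0 where i0: "\<And>i. i \<ge> i0 \<Longrightarrow> z i \<noteq> q" by blast
  have "2 * \<theta> / q = 0"
  proof (rule progression_of_unit_fractions)
    fix i :: nat
    obtain m where m: "(1 + of_nat m) * z (i0 + i) = of_nat m * q" using frac [OF i0, of "i0 + i"] by auto
    have "1 - z i0 / q - of_nat i * (2 * \<theta> / q) = (q - z (i0 + i)) / q"
      using q(2) unfolding z_def by (simp add: field_simps)
    moreover have "(q - z (i0 + i)) * of_int (int m + 1) = q"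
      using m by (simp add: algebra_simps)
    ultimately have "(1 - z i0 / q - of_nat i * (2 * \<theta> / q)) * of_int (int m + 1) = 1"
      using q(2) by (metis divide_self times_divide_eq_left)
    then show "\<exists>n>0. (1 - z i0 / q - of_nat i * (2 * \<theta> / q)) * of_int n = 1"
      by (intro exI [of _ "int m + 1"]) simp
  qed
  then show False using th(2) q(2) by simp
qed

text \<open>If p = - c / 24 with c \<noteq> 0, the reflection relation at p has a nonzero right
  side. So p + \<theta> or p - \<theta> is present, and adding c / 24 to it gives \<theta> or -
  \<theta>, which is not 0.\<close>

lemma nontrivial_tail:
  assumes "pr s p" "p \<noteq> 0 \<or> c \<noteq> 0"
  shows "\<exists>s p \<theta>. tail s p \<theta> \<and> \<theta> \<noteq> 0 \<and> p + \<theta> \<in> D (\<not> s)"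
proof -
  have main: "\<exists>s p \<theta>. tail s p \<theta> \<and> \<theta> \<noteq> 0 \<and> p + \<theta> \<in> D (\<not> s)" if ps: "pr s p" "p + c / 24 \<noteq> 0" for s p
  proof -
    obtain \<theta> where th: "\<theta> \<noteq> 0" "p + \<theta> \<in> D (\<not> s)" using odd_vector_exists [OF pr_D [OF ps(1)]] by blast
    obtain N :: int where N: "odd N" "tail s p (of_int N * \<theta>)" using tail_exists [OF ps th(2,1)] by blast
    have "of_int N * \<theta> \<noteq> 0" using N(1) th(1) by auto
    moreover have "p + of_int N * \<theta> \<in> D (\<not> s)" using D_chain [OF pr_D [OF ps(1)] th(2), of N] N by simp
    ultimately show ?thesis using N(2) by blast
  qed
  show ?thesis
  proof (cases "p + c / 24 = 0")
    case True
    then have c: "c \<noteq> 0" using assms(2) by auto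
    obtain \<theta> where th: "\<theta> \<noteq> 0" "p + \<theta> \<in> D (\<not> s)" using odd_vector_exists [OF pr_D [OF assms(1)]] by blast
    have "e s p (p + \<theta>) + e s p (2 * p - (p + \<theta>)) = 2 * (p + c / 24) - (p + \<theta> - p)^2 * (c / 3)"
      by (rule e_refl' [OF assms(1) th(2)])
    then have "e s p (p + \<theta>) + e s p (p - \<theta>) = - (\<theta>^2 * (c / 3))" using True by (simp add: algebra_simps)
    moreover have "\<theta>^2 * (c / 3) \<noteq> 0" using c th by simp
    ultimately have "e s p (p + \<theta>) \<noteq> 0 \<or> e s p (p - \<theta>) \<noteq> 0" by auto
    then have "pr (\<not> s) (p + \<theta>) \<or> pr (\<not> s) (p - \<theta>)" using e_pr by blast
    moreover have shift: "p + \<theta> + c / 24 = \<theta>" "p - \<theta> + c / 24 = - \<theta>"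
      using True by (simp_all add: algebra_simps)
    have "p + \<theta> + c / 24 \<noteq> 0" "p - \<theta> + c / 24 \<noteq> 0"
      using th(1) by (subst shift, simp)+
    ultimately show ?thesis using main [of "\<not> s" "p + \<theta>"] main [of "\<not> s" "p - \<theta>"] by blast
  qed (use main assms(1) in blast)
qed

end

section \<open>Vanishing central charge and affine two-sided chains\<close>

locale nontrivial_coefficients = svir_coefficients D pr g l c
  for D :: "bool \<Rightarrow> 'f::field_char_0 set" and pr g l c +
  assumes nontrivial: "\<exists>s p. pr s p \<and> (p \<noteq> 0 \<or> c \<noteq> 0)"
begin

lemma c_zero: "c = 0"
proof -
  obtain s p \<theta> where t: "tail s p \<theta>" "\<theta> \<noteq> 0" "p + \<theta> \<in> D (\<not> s)"
    using nontrivial nontrivial_tail by blast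
  have "p \<in> D s" using tailD [OF t(1), of 0] pr_D by simp
  from chain_affine(1) [OF this t(3,2) tailD [OF t(1)]] show ?thesis .
qed

text \<open>\<open>tail_present\<close> reaches the parity opposite to the start of a half-chain;
  dropping the first weight makes the half-chain start at the other parity.\<close>

lemma present: "q \<in> D t \<Longrightarrow> q \<noteq> 0 \<Longrightarrow> pr t q"
proof -
  assume q: "q \<in> D t" "q \<noteq> 0"
  obtain s p \<theta> where t: "tail s p \<theta>" "\<theta> \<noteq> 0" "p + \<theta> \<in> D (\<not> s)"
    using nontrivial nontrivial_tail by blast
  have pD: "p \<in> D s" using tailD [OF t(1), of 0] pr_D by simp
  have "p + \<theta> + \<theta> \<in> D s" using D_add_odd [OF pD t(3,3)] by simp
  then show ?thesis
    using tail_present [OF t(1,3,2), of q] tail_present [OF tail_shift_one [OF t(1)] _ t(2), of q] q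
    by (cases "t = s") auto
qed

text \<open>For odd B the half-chain starts at the opposite parity, where the two ends of an edge
  exchange their roles; hence the second case returns 1 - \<beta>.\<close>

lemma half_chain_affine:
  assumes p: "p \<in> D s" "p + \<theta> \<in> D (\<not> s)" "\<theta> \<noteq> 0" and nz: "\<And>k. k \<ge> B \<Longrightarrow> p + of_int k * \<theta> \<noteq> 0"
  shows "\<exists>\<beta>. \<forall>k j. even k \<longrightarrow> odd j \<longrightarrow> k \<ge> B \<or> j \<ge> (B::int) \<longrightarrow>
    e s (p + of_int k * \<theta>) (p + of_int j * \<theta>) = (1 - \<beta>) * (p + of_int k * \<theta>) + \<beta> * (p + of_int j * \<theta>)"
proof -
  define t where "t = (if even B then s else \<not> s)"
  define P where "P = p + of_int B * \<theta>"
  have shift: "P + of_int k * \<theta> = p + of_int (B + k) * \<theta>" for k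
    unfolding P_def by (simp add: algebra_simps)
  have PD: "P \<in> D t" unfolding P_def t_def by (rule D_chain [OF p(1,2)])
  have P1: "P + \<theta> \<in> D (\<not> t)" by (rule D_add_odd [OF p(1,2) PD])
  have "pr (if even k then t else \<not> t) (P + of_int k * \<theta>)" if "k \<ge> 0" for k
    by (rule present [OF D_chain [OF PD P1]]) (use that nz [of "B + k"] shift in simp)
  from chain_affine(2) [OF PD P1 p(3) this]
  obtain \<beta> where \<beta>: "\<And>k j. even k \<Longrightarrow> odd j \<Longrightarrow> k \<ge> 0 \<or> j \<ge> (0::int) \<Longrightarrow>
    e t (P + of_int k * \<theta>) (P + of_int j * \<theta>) = (1 - \<beta>) * (P + of_int k * \<theta>) + \<beta> * (P + of_int j * \<theta>)"
    by blast
  show ?thesis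
  proof (cases "even B")
    case True
    have "e s (p + of_int k * \<theta>) (p + of_int j * \<theta>) = (1 - \<beta>) * (p + of_int k * \<theta>) + \<beta> * (p + of_int j * \<theta>)"
      if "even k" "odd j" "k \<ge> B \<or> j \<ge> B" for k j
      using \<beta> [of "k - B" "j - B"] True that unfolding shift t_def by auto
    then show ?thesis by blast
  next
    case False
    have "e s (p + of_int k * \<theta>) (p + of_int j * \<theta>)
        = (1 - (1 - \<beta>)) * (p + of_int k * \<theta>) + (1 - \<beta>) * (p + of_int j * \<theta>)"
      if "even k" "odd j" "k \<ge> B \<or> j \<ge> B" for k j
      using \<beta> [of "j - B" "k - B"] False that e_swap [of s "p + of_int j * \<theta>" "p + of_int k * \<theta>"]
      unfolding shift t_def by auto
    then show ?thesis by blast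
  qed
qed

text \<open>At most one position k0 carries the weight 0, which may be absent. The half-chains on
  the two sides of k0 both give a slope; the slopes agree because both formulas apply to an edge
  from far above k0 to far below. Every edge has an end other than k0.\<close>

lemma full_chain_affine:
  assumes p: "p \<in> D s" "p + \<theta> \<in> D (\<not> s)" "\<theta> \<noteq> 0"
  shows "\<exists>\<beta>. \<forall>k j::int. even k \<longrightarrow> odd j \<longrightarrow>
    e s (p + of_int k * \<theta>) (p + of_int j * \<theta>) = (1 - \<beta>) * (p + of_int k * \<theta>) + \<beta> * (p + of_int j * \<theta>)"
proof -
  define v where "v = (\<lambda>k::int. p + of_int k * \<theta>)"
  have "\<exists>k0. \<forall>k. k \<noteq> k0 \<longrightarrow> v k \<noteq> 0"
  proof (cases "\<exists>k. v k = 0")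
    case True
    then obtain k where k: "v k = 0" by blast
    have "v j \<noteq> 0" if "j \<noteq> k" for j
    proof -
      have "v j - v k = of_int (j - k) * \<theta>" unfolding v_def by (simp add: algebra_simps)
      then show ?thesis using k that p(3) by auto
    qed
    then show ?thesis by blast
  qed blast
  then obtain k0 where k0: "\<And>k. k \<noteq> k0 \<Longrightarrow> v k \<noteq> 0" by blast
  obtain \<beta> where up: "\<And>k j. even k \<Longrightarrow> odd j \<Longrightarrow> k \<ge> k0 + 1 \<or> j \<ge> k0 + 1 \<Longrightarrow>
    e s (v k) (v j) = (1 - \<beta>) * v k + \<beta> * v j"
    using half_chain_affine [OF p, of "k0 + 1"] k0 unfolding v_def by fastforce
  have m: "p + of_int k * - \<theta> = v (- k)" for k unfolding v_def by simp
  have pm: "p + - \<theta> \<in> D (\<not> s)" using D_diff_odd [OF p(1,2,1)] by simp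
  have "\<exists>\<beta>. \<forall>k j. even k \<longrightarrow> odd j \<longrightarrow> k \<ge> 1 - k0 \<or> j \<ge> 1 - k0 \<longrightarrow>
    e s (v (- k)) (v (- j)) = (1 - \<beta>) * v (- k) + \<beta> * v (- j)"
    using half_chain_affine [OF p(1) pm, of "1 - k0"] p(3) k0 unfolding m by fastforce
  then obtain \<gamma> where dn0: "\<And>k j. even k \<Longrightarrow> odd j \<Longrightarrow> k \<ge> 1 - k0 \<or> j \<ge> 1 - k0 \<Longrightarrow>
    e s (v (- k)) (v (- j)) = (1 - \<gamma>) * v (- k) + \<gamma> * v (- j)" by blast
  have dn: "e s (v k) (v j) = (1 - \<gamma>) * v k + \<gamma> * v j"
    if "even k" "odd j" "k \<le> k0 - 1 \<or> j \<le> k0 - 1" for k j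
    using dn0 [of "- k" "- j"] that by auto
  have "\<gamma> = \<beta>"
  proof -
    define k j where "k = 2 * (\<bar>k0\<bar> + 1)" and "j = - 2 * (\<bar>k0\<bar> + 1) + 1"
    have "even k" "odd j" "k \<ge> k0 + 1" "j \<le> k0 - 1" unfolding k_def j_def by simp_all
    then have "(1 - \<beta>) * v k + \<beta> * v j = (1 - \<gamma>) * v k + \<gamma> * v j" using up [of k j] dn [of k j] by simp
    then have "(\<gamma> - \<beta>) * (v k - v j) = 0" by algebra
    moreover have "v k - v j = of_int (k - j) * \<theta>" unfolding v_def by (simp add: algebra_simps)
    moreover have "k \<noteq> j" using \<open>even k\<close> \<open>odd j\<close> by auto
    ultimately show ?thesis using p(3) by auto
  qed
  then have "e s (v k) (v j) = (1 - \<beta>) * v k + \<beta> * v j" if "even k" "odd j" for k j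
  proof -
    have "k \<noteq> j" using that by auto
    then consider "k \<ge> k0 + 1 \<or> j \<ge> k0 + 1" | "k \<le> k0 - 1 \<or> j \<le> k0 - 1" by linarith
    then show ?thesis using up dn that \<open>\<gamma> = \<beta>\<close> by cases simp_all
  qed
  then show ?thesis unfolding v_def by blast
qed

end

section \<open>Products of two successive coefficients of G\<close>

context svir_coefficients begin

text \<open>A rescaling of the basis multiplies all \<open>h s p Q P\<close> with the same p and P
  by one common factor, so their dependence on Q is meaningful.\<close>

definition h :: "bool \<Rightarrow> 'f \<Rightarrow> 'f \<Rightarrow> 'f \<Rightarrow> 'f" where
  "h s p Q P = g s p Q * g (\<not> s) Q P"

lemma h_diag: "h s p Q p = e s p Q"
  by (simp add: h_def e_def)

lemma h_prod: "h s p Q P * h s P Q p = e s p Q * e s P Q"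
  by (simp add: h_def e_def)

lemma D_even_shift: "p \<in> D s \<Longrightarrow> p + m \<in> D s \<Longrightarrow> q \<in> D t \<Longrightarrow> q + m \<in> D t"
  using D_par [of q t "p + m" s p] by simp

text \<open>The Leibniz rule for the bracket of an \<open>L\<close> of degree m with a product of
  two \<open>G\<close>: the term with \<open>l\<close> from Q to Q + m occurs in both brackets
  [L, G] and cancels.\<close>

lemma LG_double:
  assumes "p \<in> D s" "Q \<in> D (\<not> s)" "P \<in> D s" "p + m \<in> D s"
  shows "2 * l s P (P + m) * h s p Q P - 2 * l s p (p + m) * h s (p + m) (Q + m) (P + m)
    = (2 * (P - Q) - m) * h s p Q (P + m) + (2 * (Q - p) - m) * h s p (Q + m) (P + m)"
proof -
  have D: "Q + m \<in> D (\<not> s)" "P + m \<in> D s"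
    using D_even_shift [OF assms(1,4)] assms by blast+
  have 1: "2 * l (\<not> s) Q (Q + m) * g s p Q - g s (p + m) (Q + m) * (2 * l s p (p + m))
     = (2 * (Q - p) - m) * g s p (Q + m)"
    using LG2 [of p s "p + m" "Q + m" Q] assms D by (simp add: algebra_simps)
  have 2: "2 * l s P (P + m) * g (\<not> s) Q P - g (\<not> s) (Q + m) (P + m) * (2 * l (\<not> s) Q (Q + m))
     = (2 * (P - Q) - m) * g (\<not> s) Q (P + m)"
    using LG2 [of Q "\<not> s" "Q + m" "P + m" P] assms D by (simp add: algebra_simps)
  have "2 * l s P (P + m) * h s p Q P - 2 * l s p (p + m) * h s (p + m) (Q + m) (P + m)
    = (2 * l s P (P + m) * g (\<not> s) Q P - g (\<not> s) (Q + m) (P + m) * (2 * l (\<not> s) Q (Q + m))) * g s p Q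
    + (2 * l (\<not> s) Q (Q + m) * g s p Q - g s (p + m) (Q + m) * (2 * l s p (p + m))) * g (\<not> s) (Q + m) (P + m)"
    unfolding h_def by (simp add: algebra_simps)
  then show ?thesis unfolding 1 2 h_def by (simp add: algebra_simps)
qed

end

section \<open>The double bracket identity\<close>

text \<open>
  \<open>R3\<close> and \<open>R5\<close> combine to a first order recurrence, which together with \<open>R3\<close> makes a nonzero
  polynomial in \<open>x i\<close> annihilate \<open>D i\<close>. So \<open>D\<close> vanishes far out, and \<open>R3\<close> carries this back.
\<close>

lemma three_term_elimination:
  fixes D :: "int \<Rightarrow> 'a::field_char_0" and \<rho> :: 'a
  assumes x: "\<And>i. x i = \<rho> + 2 * of_int i + 1"
    and R3: "\<And>i. (x i - 6)^2 * D (i + 1) - 2 * (x i^2 - 12) * D i + (x i + 6)^2 * D (i - 1) = 0"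
    and R5: "\<And>i. (x i - 10)^2 * (D (i + 2) + D (i + 1)) - 4 * (x i^2 - 20) * D i
       + (x i + 10)^2 * (D (i - 1) + D (i - 2)) = 0"
    and nz: "\<And>i. x i \<noteq> - 6"
  shows "D i = 0"
proof -
  define a where "a = (\<lambda>y::'a. 380 * y^3 - 5 * y^5)"
  define b where "b = (\<lambda>y::'a. - 11520 - 3840 * y - 1552 * y^2 - 284 * y^3 + 28 * y^4 + 5 * y^5)"
  have xs: "x (i + 1) = x i + 2" "x (i - 1) = x i - 2" for i unfolding x by simp_all
  have two: "a (x i) * D (i + 1) + b (x i) * D i = 0" for i
  proof -
    define y where "y = x i"
    have r1: "(y - 4)^2 * D (i + 2) - 2 * ((y + 2)^2 - 12) * D (i + 1) + (y + 8)^2 * D i = 0"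
      using R3 [of "i + 1"] unfolding xs y_def by (simp add: algebra_simps)
    have r2: "(y - 8)^2 * D i - 2 * ((y - 2)^2 - 12) * D (i - 1) + (y + 4)^2 * D (i - 2) = 0"
      using R3 [of "i - 1"] unfolding xs y_def by (simp add: algebra_simps)
    have r0: "(y - 6)^2 * D (i + 1) - 2 * (y^2 - 12) * D i + (y + 6)^2 * D (i - 1) = 0"
      using R3 [of i] unfolding y_def .
    have r5: "(y - 10)^2 * (D (i + 2) + D (i + 1)) - 4 * (y^2 - 20) * D i + (y + 10)^2 * (D (i - 1) + D (i - 2)) = 0"
      using R5 [of i] unfolding y_def .
    \<comment> \<open>\<open>r1\<close> and \<open>r2\<close> remove d2 and c2 from
      \<open>R5\<close>. What is left has the coefficient 3 y^2 (y + 10)^2 (y - 4)^2 at c1;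
      expanded, this is the multiplier of \<open>r0\<close>.\<close>
    have id: "576 * ((380 * y^3 - 5 * y^5) * d1 + (- 11520 - 3840 * y - 1552 * y^2 - 284 * y^3 + 28 * y^4 + 5 * y^5) * d0)
       = (y + 6)^2 * ((y - 4)^2 * (y + 4)^2 * ((y - 10)^2 * (d2 + d1) - 4 * (y^2 - 20) * d0 + (y + 10)^2 * (c1 + c2))
            - (y - 10)^2 * (y + 4)^2 * ((y - 4)^2 * d2 - 2 * ((y + 2)^2 - 12) * d1 + (y + 8)^2 * d0)
            - (y + 10)^2 * (y - 4)^2 * ((y - 8)^2 * d0 - 2 * ((y - 2)^2 - 12) * c1 + (y + 4)^2 * c2))
         - (4800 * y^2 - 1440 * y^3 - 132 * y^4 + 36 * y^5 + 3 * y^6)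
            * ((y - 6)^2 * d1 - 2 * (y^2 - 12) * d0 + (y + 6)^2 * c1)" for d0 d1 d2 c1 c2 :: 'a
      by algebra
    have "576 * (a y * D (i + 1) + b y * D i) = 0"
      unfolding a_def b_def unfolding id [of "D (i + 1)" "D i" "D (i + 2)" "D (i - 1)" "D (i - 2)"] r0 r1 r2 r5
      by simp
    then have "a y * D (i + 1) + b y * D i = 0" by (metis mult_eq_0_iff zero_neq_numeral)
    then show ?thesis unfolding y_def .
  qed
  \<comment> \<open>The factor that remains when \<open>D (i + 2)\<close> and
    \<open>D (i + 1)\<close> are removed from \<open>R3\<close> at i + 1 by means of the first order
    recurrence at i + 1 and at i.\<close>
  define P where "P = (\<lambda>y. (y - 4)^2 * b y * b (y + 2) + 2 * ((y + 2)^2 - 12) * a (y + 2) * b y + (y + 8)^2 * a y * a (y + 2))"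
  have one: "P (x i) * D i = 0" for i
  proof -
    have "(x i - 4)^2 * D (i + 2) - 2 * ((x i + 2)^2 - 12) * D (i + 1) + (x i + 8)^2 * D i = 0"
      using R3 [of "i + 1"] unfolding xs by (simp add: algebra_simps)
    moreover have "a (x i) * D (i + 1) + b (x i) * D i = 0" by (rule two)
    moreover have "a (x i + 2) * D (i + 2) + b (x i + 2) * D (i + 1) = 0"
      using two [of "i + 1"] unfolding xs by (simp add: add.commute)
    ultimately show ?thesis unfolding P_def by algebra
  qed
  define pa pb where "pa = [:0, 0, 0, 380, 0, - 5 :: 'a:]" and "pb = [:- 11520, - 3840, - 1552, - 284, 28, 5 :: 'a:]"
  define pP where "pP = [:-4, 1:]^2 * pb * pcompose pb [:2, 1:] + smult 2 ([:2, 1:]^2 - [:12:]) * pcompose pa [:2, 1:] * pb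
     + [:8, 1:]^2 * pa * pcompose pa [:2, 1:]"
  have pa: "poly pa y = a y" and pb: "poly pb y = b y" for y
    unfolding pa_def pb_def a_def b_def by (simp_all, algebra+)
  have pP: "poly pP y = P y" for y
    unfolding pP_def P_def by (simp add: poly_pcompose pa pb algebra_simps)
  have "P 0 \<noteq> 0" unfolding P_def a_def b_def by simp
  then have "pP \<noteq> 0" using pP [of 0] by auto
  then have fin: "finite {y. P y = 0}" using poly_roots_finite [of pP] pP by simp
  have "finite {i. P (x i) = 0}"
  proof (rule finite_imageD)
    show "finite (x ` {i. P (x i) = 0})" by (rule finite_subset [OF _ fin]) auto
    show "inj_on x {i. P (x i) = 0}" by (rule inj_onI) (simp add: x)
  qed
  then obtain N where N: "\<And>i. P (x i) = 0 \<Longrightarrow> i \<le> N"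
    by (metis (mono_tags, lifting) Max_ge mem_Collect_eq)
  have large: "D i = 0" if "i > N" for i using one [of i] N [of i] that by auto
  have "D i = 0 \<and> D (i + 1) = 0" for i
  proof (cases "i > N")
    case False
    then have "i \<le> N + 1" by simp
    then show ?thesis
    proof (induction i rule: int_le_induct)
      case base
      then show ?case using large by simp
    next
      case (step i)
      have "(x i + 6)^2 * D (i - 1) = 0" using R3 [of i] step by simp
      moreover have "x i + 6 \<noteq> 0" using nz [of i] by (metis add_eq_0_iff2)
      ultimately show ?case using step by simp
    qed
  qed (use large in simp)
  then show ?thesis by blast
qed

context nontrivial_coefficients begin

text \<open>An absent p in \<open>D s\<close> is 0, and then both sides are 0. The same remark gives
  \<open>K_rec0\<close>.\<close>

lemma e_refl0: "p \<in> D s \<Longrightarrow> Q \<in> D (\<not> s) \<Longrightarrow> e s p Q + e s p (2 * p - Q) = 2 * p"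
  using e_refl' [of s p Q] present [of p s] absent_e [of s p] c_zero by (cases "pr s p") auto

lemma K_rec0: "p \<in> D s \<Longrightarrow> p + m \<in> D s \<Longrightarrow> K s p (p + m) - K s p (p - m) = 8 * m * p"
proof -
  assume p: "p \<in> D s" "p + m \<in> D s"
  have pm: "p - m \<in> D s" using D_par [of p s p s "p + m"] p by simp
  show ?thesis
  proof (cases "pr s p")
    case True
    then show ?thesis using K_rec [of s p "p + m" "p - m"] p pm c_zero by simp
  next
    case False
    then have "K s p q = 0" for q unfolding K_def using l_pr [of s p q] by auto
    then show ?thesis using False present [of p s] p by auto
  qed
qed

text \<open>The part of \<open>e\<close> at p that depends on the step v. The aim is
  \<open>d s p v = B * v\<close> with one B for all steps; so far this holds for the odd multiples
  of a single step.\<close>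

definition d :: "bool \<Rightarrow> 'f \<Rightarrow> 'f \<Rightarrow> 'f" where
  "d s p v = e s p (p + v) - p"

lemma e_d: "e s p (p + v) = p + d s p v"
  by (simp add: d_def)

lemma d_multiple:
  assumes "p \<in> D s" "p + v \<in> D (\<not> s)" "odd k"
  shows "d s p (of_int k * v) = of_int k * d s p v"
proof (cases "v = 0")
  case True
  then show ?thesis using e_refl0 [of p s p] assms unfolding d_def by simp
next
  case False
  obtain \<beta> where "\<And>k j::int. even k \<Longrightarrow> odd j \<Longrightarrow>
    e s (p + of_int k * v) (p + of_int j * v) = (1 - \<beta>) * (p + of_int k * v) + \<beta> * (p + of_int j * v)"
    using full_chain_affine [OF assms(1,2) False] by blast
  from this [of 0 k] this [of 0 1] assms(3) show ?thesis
    unfolding d_def by (simp add: algebra_simps)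
qed

lemma d_minus: "p \<in> D s \<Longrightarrow> p + v \<in> D (\<not> s) \<Longrightarrow> d s p (- v) = - d s p v"
  using d_multiple [of p s v "- 1"] by simp

text \<open>\<open>LG_double\<close> for the degree \<mu> followed by the degree - \<mu>. With the
  multipliers 2 y + \<mu> and 2 y - \<mu> the mixed products \<open>h\<close> recombine into
  \<open>K\<close> times differences of \<open>e\<close> at p, p + \<mu> and p - \<mu>. For y = k
  \<theta> these differences are linear in k up to the constant \<mu>, which by
  \<open>K_rec0\<close> contributes 8 \<mu>^2 p.\<close>

lemma d_bracket:
  assumes p: "p \<in> D s" and th: "p + \<theta> \<in> D (\<not> s)" and la: "p + \<mu> \<in> D s"
  shows "\<exists>A. \<forall>k. odd k \<longrightarrow> (\<forall>y. y = of_int k * \<theta> \<longrightarrow>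
    (2 * y + \<mu>)^2 * d s p (y - \<mu>) + (2 * y - \<mu>)^2 * d s p (y + \<mu>) - (8 * y^2 - 6 * \<mu>^2) * d s p y = of_int k * A)"
proof -
  define P R where "P = p + \<mu>" and "R = p - \<mu>"
  have D: "P \<in> D s" "R \<in> D s" using la D_par [of p s p s "p + \<mu>"] p unfolding P_def R_def by simp_all
  define A where "A = K s p P * (d s P \<theta> - d s p \<theta>) - K s R p * (d s p \<theta> - d s R \<theta>)"
  have "(2 * y + \<mu>)^2 * d s p (y - \<mu>) + (2 * y - \<mu>)^2 * d s p (y + \<mu>) - (8 * y^2 - 6 * \<mu>^2) * d s p y = of_int k * A"
    if k: "odd k" and y: "y = of_int k * \<theta>" for k y
  proof -
    have py: "p + y \<in> D (\<not> s)" unfolding y using D_chain [OF p th, of k] k by simp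
    have Dy: "P + y \<in> D (\<not> s)" "R + y \<in> D (\<not> s)"
      using D_add_odd [OF p py] D by blast+
    have d1: "d s p y = of_int k * d s p \<theta>" unfolding y by (rule d_multiple [OF p th k])
    have d2: "d s P y = of_int k * d s P \<theta>" unfolding y by (rule d_multiple [OF D(1) D_add_odd [OF p th D(1)] k])
    have d3: "d s R y = of_int k * d s R \<theta>" unfolding y by (rule d_multiple [OF D(2) D_add_odd [OF p th D(2)] k])
    have b1: "2 * l s p P * e s p (p + y) - 2 * l s p P * e s P (P + y)
       = (- 2 * y - \<mu>) * h s p (p + y) P + (2 * y - \<mu>) * h s p (P + y) P"
      using LG_double [of p s "p + y" p \<mu>] p py la unfolding P_def h_diag by (simp add: algebra_simps)
    have b2: "2 * l s R p * e s R (R + y) - 2 * l s R p * e s p (p + y)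
       = (- 2 * y - \<mu>) * h s R (R + y) p + (2 * y - \<mu>) * h s R (p + y) p"
      using LG_double [of R s "R + y" R \<mu>] D p Dy unfolding R_def h_diag by (simp add: algebra_simps)
    have b3: "2 * l s P p * h s p (p + y) P - 2 * l s p R * h s R (R + y) p
       = (3 * \<mu> - 2 * y) * e s p (p + y) + (2 * y + \<mu>) * e s p (R + y)"
      using LG_double [of p s "p + y" P "- \<mu>"] D p py unfolding P_def R_def by (simp add: h_diag algebra_simps)
    have b4: "2 * l s P p * h s p (P + y) P - 2 * l s p R * h s R (p + y) p
       = (\<mu> - 2 * y) * e s p (P + y) + (2 * y + 3 * \<mu>) * e s p (p + y)"
      using LG_double [of p s "P + y" P "- \<mu>"] D p Dy unfolding P_def R_def by (simp add: h_diag algebra_simps)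
    have kr: "K s p P - K s R p = 8 * \<mu> * p"
      using K_rec0 [OF p la] K_commute [of s R p] unfolding P_def R_def by simp
    have "(2 * y + \<mu>) * ((3 * \<mu> - 2 * y) * e s p (p + y) + (2 * y + \<mu>) * e s p (R + y))
        - (2 * y - \<mu>) * ((\<mu> - 2 * y) * e s p (P + y) + (2 * y + 3 * \<mu>) * e s p (p + y))
      = - 2 * l s P p * ((- 2 * y - \<mu>) * h s p (p + y) P + (2 * y - \<mu>) * h s p (P + y) P)
        + 2 * l s p R * ((- 2 * y - \<mu>) * h s R (R + y) p + (2 * y - \<mu>) * h s R (p + y) p)"
      unfolding b3 [symmetric] b4 [symmetric] by (simp add: algebra_simps)
    also have "\<dots> = K s p P * (e s P (P + y) - e s p (p + y)) - K s R p * (e s p (p + y) - e s R (R + y))"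
      unfolding b1 [symmetric] b2 [symmetric] K_def by (simp add: algebra_simps)
    also have "\<dots> = (K s p P - K s R p) * \<mu> + of_int k * A"
      unfolding e_d d1 d2 d3 A_def by (simp add: P_def R_def algebra_simps)
    also have "\<dots> = 8 * \<mu>^2 * p + of_int k * A" unfolding kr by (simp add: power2_eq_square)
    finally have fin: "(2 * y + \<mu>) * ((3 * \<mu> - 2 * y) * e s p (p + y) + (2 * y + \<mu>) * e s p (R + y))
        - (2 * y - \<mu>) * ((\<mu> - 2 * y) * e s p (P + y) + (2 * y + 3 * \<mu>) * e s p (p + y))
        = 8 * \<mu>^2 * p + of_int k * A" .
    have "e s p (R + y) = p + d s p (y - \<mu>)" "e s p (P + y) = p + d s p (y + \<mu>)"
      unfolding e_d [symmetric] P_def R_def by (simp_all add: algebra_simps)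
    with fin show ?thesis unfolding e_d by algebra
  qed
  then show ?thesis by blast
qed

text \<open>In \<open>d_bracket\<close> take \<mu> = \<nu> + (2 i + 1) \<theta> = x i \<theta> and y
  = k \<theta>. Then y + \<mu> and \<mu> - y both have the form \<nu> + 2 j \<theta>, so that only
  the sequence W and S = d(\<theta>) occur. Eliminating A between k = 1 and k = 3 gives the relation
  \<open>R3\<close> for the defect \<open>Dl\<close> of additivity, and k = 1 with k = 5 gives
  \<open>R5\<close>. If \<rho> = \<nu> / \<theta> is an odd integer, everything lies on one chain;
  otherwise x i is never - 6.\<close>

lemma d_add_even_multiple:
  assumes p: "p \<in> D s" and th: "p + \<theta> \<in> D (\<not> s)" and nu: "p + \<nu> \<in> D (\<not> s)"
  shows "d s p (\<nu> + 2 * \<theta>) = d s p \<nu> + 2 * d s p \<theta>"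
proof (cases "\<theta> = 0")
  case True
  then show ?thesis using d_multiple [OF p th, of 3] by simp
next
  case nz: False
  define \<rho> where "\<rho> = \<nu> / \<theta>"
  have nu_rho: "\<nu> = \<rho> * \<theta>" unfolding \<rho>_def using nz by simp
  show ?thesis
  proof (cases "\<exists>k. odd k \<and> \<rho> = of_int k")
    case True
    then obtain k where k: "odd k" "\<rho> = of_int k" by blast
    have "\<nu> + 2 * \<theta> = of_int (k + 2) * \<theta>" unfolding nu_rho k by (simp add: algebra_simps)
    then show ?thesis unfolding nu_rho k using d_multiple [OF p th, of k] d_multiple [OF p th, of "k + 2"] k
      by (simp add: algebra_simps)
  next
    case no: False
    define W where "W = (\<lambda>i::int. d s p (\<nu> + 2 * of_int i * \<theta>))"
    define S where "S = d s p \<theta>"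
    define x where "x = (\<lambda>i::int. \<rho> + 2 * of_int i + 1)"
    define Dl where "Dl = (\<lambda>i. W (i + 1) - W i - 2 * S)"
    have WD: "p + (\<nu> + 2 * of_int i * \<theta>) \<in> D (\<not> s)" for i
      using D_chain [OF nu, of \<theta> "2 * i"] D_add_odd [OF p th nu] by (simp add: algebra_simps)
    have eqs: "\<exists>A. (x i - 2)^2 * W (i + 1) - (x i + 2)^2 * W i - (8 - 6 * x i^2) * S = A \<and>
       (x i - 6)^2 * W (i + 2) - (x i + 6)^2 * W (i - 1) - (72 - 6 * x i^2) * (3 * S) = 3 * A \<and>
       (x i - 10)^2 * W (i + 3) - (x i + 10)^2 * W (i - 2) - (200 - 6 * x i^2) * (5 * S) = 5 * A" for i
    proof -
      define \<mu> where "\<mu> = x i * \<theta>"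
      have lam: "\<mu> = \<nu> + 2 * of_int i * \<theta> + \<theta>" unfolding \<mu>_def x_def nu_rho by (simp add: algebra_simps)
      have "p + (\<nu> + 2 * of_int i * \<theta>) + \<theta> \<in> D s" using D_add_odd [OF p th WD] by simp
      then have la: "p + \<mu> \<in> D s" unfolding lam by (simp add: add.assoc)
      obtain A where A: "\<And>k y. odd k \<Longrightarrow> y = of_int k * \<theta> \<Longrightarrow>
        (2 * y + \<mu>)^2 * d s p (y - \<mu>) + (2 * y - \<mu>)^2 * d s p (y + \<mu>) - (8 * y^2 - 6 * \<mu>^2) * d s p y = of_int k * A"
        using d_bracket [OF p th la] by blast
      have E: "(x i - 2 * of_int k)^2 * W (i + (k + 1) div 2) - (x i + 2 * of_int k)^2 * W (i - (k - 1) div 2)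
          - (8 * of_int k^2 - 6 * x i^2) * (of_int k * S) = of_int k * (A / \<theta>^2)" if k: "odd k" for k
      proof -
        define y where "y = of_int k * \<theta>"
        obtain m where m: "k = 2 * m + 1" using k by (rule oddE)
        have 1: "d s p (y + \<mu>) = W (i + (k + 1) div 2)"
          unfolding W_def y_def lam m by (rule arg_cong [where f = "d s p"]) (simp add: algebra_simps)
        have 2: "y - \<mu> = - (\<nu> + 2 * of_int (i - (k - 1) div 2) * \<theta>)"
          unfolding y_def lam m by (simp add: algebra_simps)
        have 2: "d s p (y - \<mu>) = - W (i - (k - 1) div 2)"
          unfolding 2 W_def by (rule d_minus [OF p WD])
        have 3: "d s p y = of_int k * S" unfolding y_def S_def by (rule d_multiple [OF p th k])
        have "\<theta>^2 * ((x i - 2 * of_int k)^2 * W (i + (k + 1) div 2) - (x i + 2 * of_int k)^2 * W (i - (k - 1) div 2)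
          - (8 * of_int k^2 - 6 * x i^2) * (of_int k * S)) = of_int k * A"
          using A [OF k y_def] unfolding 1 2 3 unfolding y_def \<mu>_def by (simp add: algebra_simps power2_eq_square)
        then show ?thesis using nz by (simp add: field_simps)
      qed
      show ?thesis
        using E [of 1] E [of 3] E [of 5] by (intro exI [of _ "A / \<theta>^2"]) simp
    qed
    have "Dl 0 = 0"
    proof (rule three_term_elimination [where x = x])
      show "x i = \<rho> + 2 * of_int i + 1" for i by (simp add: x_def)
      show "x i \<noteq> - 6" for i
      proof
        assume "x i = - 6"
        then have "\<rho> = of_int (- 7 - 2 * i)" unfolding x_def by (simp add: algebra_simps eq_neg_iff_add_eq_0)
        moreover have "odd (- 7 - 2 * i)" by simp
        ultimately show False using no by blast
      qed
      fix i
      obtain A where A: "(x i - 2)^2 * W (i + 1) - (x i + 2)^2 * W i - (8 - 6 * x i^2) * S = A"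
       "(x i - 6)^2 * W (i + 2) - (x i + 6)^2 * W (i - 1) - (72 - 6 * x i^2) * (3 * S) = 3 * A"
       "(x i - 10)^2 * W (i + 3) - (x i + 10)^2 * W (i - 2) - (200 - 6 * x i^2) * (5 * S) = 5 * A"
        using eqs [of i] by blast
      have Dls: "Dl (i + 1) = W (i + 2) - W (i + 1) - 2 * S" "Dl i = W (i + 1) - W i - 2 * S"
        "Dl (i - 1) = W i - W (i - 1) - 2 * S" "Dl (i + 2) = W (i + 3) - W (i + 2) - 2 * S"
        "Dl (i - 2) = W (i - 1) - W (i - 2) - 2 * S"
        unfolding Dl_def by (simp_all add: algebra_simps)
      have "(x i - 6)^2 * Dl (i + 1) - 2 * (x i^2 - 12) * Dl i + (x i + 6)^2 * Dl (i - 1)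
        = ((x i - 6)^2 * W (i + 2) - (x i + 6)^2 * W (i - 1) - (72 - 6 * x i^2) * (3 * S))
          - 3 * ((x i - 2)^2 * W (i + 1) - (x i + 2)^2 * W i - (8 - 6 * x i^2) * S)"
        unfolding Dls by (simp add: algebra_simps power2_eq_square)
      then show "(x i - 6)^2 * Dl (i + 1) - 2 * (x i^2 - 12) * Dl i + (x i + 6)^2 * Dl (i - 1) = 0"
        unfolding A by simp
      have "(x i - 10)^2 * (Dl (i + 2) + Dl (i + 1)) - 4 * (x i^2 - 20) * Dl i
          + (x i + 10)^2 * (Dl (i - 1) + Dl (i - 2))
        = ((x i - 10)^2 * W (i + 3) - (x i + 10)^2 * W (i - 2) - (200 - 6 * x i^2) * (5 * S))
          - 5 * ((x i - 2)^2 * W (i + 1) - (x i + 2)^2 * W i - (8 - 6 * x i^2) * S)"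
        unfolding Dls by (simp add: algebra_simps power2_eq_square)
      then show "(x i - 10)^2 * (Dl (i + 2) + Dl (i + 1)) - 4 * (x i^2 - 20) * Dl i
       + (x i + 10)^2 * (Dl (i - 1) + Dl (i - 2)) = 0"
        unfolding A by simp
    qed
    then show ?thesis unfolding Dl_def W_def S_def by (simp add: algebra_simps)
  qed
qed

end

lemma two_times_cancel: "2 * a = 2 * (b :: 'a::field_char_0) \<Longrightarrow> a = b"
  by simp

context svir_coefficients begin

lemma D_infinite: "infinite (D s)"
proof -
  obtain a b where ab: "a \<in> D s" "b \<in> D s" "a \<noteq> b" using D_two [of s] by blast
  have "a + of_nat i * (b - a) \<in> D s" for i
  proof (induction i)
    case (Suc i)
    from D_par [OF this ab(2,1)] show ?case by (simp add: algebra_simps)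
  qed (use ab in simp)
  then have "(\<lambda>i::nat. a + of_nat i * (b - a)) ` UNIV \<subseteq> D s" by auto
  then show ?thesis using infinite_progression [of "b - a" a] ab(3) finite_subset by auto
qed

lemma D_avoid: "finite X \<Longrightarrow> \<exists>q\<in>D s. q \<notin> X"
  using D_infinite by (meson finite_subset subsetI)

end

section \<open>Comparing the slopes of different directions\<close>

context nontrivial_coefficients begin

lemma d_periodic:
  assumes "p \<in> D s" "p + v \<in> D (\<not> s)"
  shows "d s (p + 2 * v) v = d s p v"
proof (cases "v = 0")
  case False
  obtain \<beta> where "\<And>k j::int. even k \<Longrightarrow> odd j \<Longrightarrow>
    e s (p + of_int k * v) (p + of_int j * v) = (1 - \<beta>) * (p + of_int k * v) + \<beta> * (p + of_int j * v)"
    using full_chain_affine [OF assms False] by blast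
  from this [of 0 1] this [of 2 3] show ?thesis
    unfolding d_def by (simp add: algebra_simps)
qed simp

text \<open>The edge between p + v and p + 2 \<theta> seen from both ends, each time expanded by
  \<open>d_add_even_multiple\<close>. It expresses \<open>d\<close> at a vertex of the other parity
  by values at p and p + 2 \<theta>.\<close>

lemma d_odd_vertex:
  assumes p: "p \<in> D s" and v: "p + v \<in> D (\<not> s)" and th: "p + \<theta> \<in> D (\<not> s)"
  shows "2 * d (\<not> s) (p + v) \<theta> = 2 * \<theta> - 2 * d s p \<theta> + d s (p + 2 * \<theta>) v - d s p v"
proof -
  have P: "p + 2 * \<theta> \<in> D s" using D_add_odd [OF p th th] by (simp add: algebra_simps)
  have PD: "p + 2 * \<theta> + - \<theta> \<in> D (\<not> s)" "p + 2 * \<theta> + v \<in> D (\<not> s)"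
    using th D_add_odd [OF p v P] by (simp_all add: algebra_simps)
  have "p + v - v \<in> D s" "p + v + \<theta> \<in> D s" using p D_add_odd [OF p th v] by simp_all
  then have "d (\<not> s) (p + v) (- v + 2 * \<theta>) = d (\<not> s) (p + v) (- v) + 2 * d (\<not> s) (p + v) \<theta>"
    using d_add_even_multiple [of "p + v" "\<not> s" \<theta> "- v"] v by simp
  moreover have "d (\<not> s) (p + v) (- v) = d s p v - v"
    using e_swap [of s "p + v" p] e_d [of s p v] unfolding d_def by (simp add: algebra_simps)
  moreover have "d (\<not> s) (p + v) (- v + 2 * \<theta>) = e s (p + 2 * \<theta>) (p + 2 * \<theta> + (v + 2 * - \<theta>)) - (p + v)"
    using e_swap [of s "p + v" "p + 2 * \<theta>"] unfolding d_def by (simp add: algebra_simps)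
  moreover have "e s (p + 2 * \<theta>) (p + 2 * \<theta> + (v + 2 * - \<theta>))
     = p + 2 * \<theta> + (d s (p + 2 * \<theta>) v + 2 * d s (p + 2 * \<theta>) (- \<theta>))"
    unfolding e_d using d_add_even_multiple [OF P PD] by simp
  moreover have "d s (p + 2 * \<theta>) (- \<theta>) = - d s p \<theta>"
    using d_minus [OF P, of \<theta>] d_periodic [OF p th] D_add_odd [OF p th P] by simp
  ultimately show ?thesis by (simp add: algebra_simps)
qed

text \<open>On the grid spanned by \<kappa> and \<nu> at p, all needed values of \<open>d\<close>
  are expressed by \<sigma>, \<tau> and one unknown b, half the change of d(\<kappa>) under a move
  by 2 \<nu>. Two instances of \<open>e_cubic\<close>, with k \<kappa> and l \<nu> exchanged,
  contain the same \<open>K\<close>. Eliminating it leaves a polynomial in k and l that vanishes for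
  infinitely many odd k and l; one of its coefficients gives b = 0 and another one the
  claim.\<close>

lemma d_proportional:
  assumes p: "p \<in> D s" "p \<noteq> 0" and ka: "p + \<kappa> \<in> D (\<not> s)" "\<kappa> \<noteq> 0" and nu: "p + \<nu> \<in> D (\<not> s)" "\<nu> \<noteq> 0"
  shows "\<kappa> * d s p \<nu> = \<nu> * d s p \<kappa>"
proof -
  define \<sigma> \<tau> b where "\<sigma> = d s p \<kappa>" and "\<tau> = d s p \<nu>" and "b = (d s (p + 2 * \<nu>) \<kappa> - \<sigma>) / 2"
  have b: "d s (p + 2 * \<nu>) \<kappa> = \<sigma> + 2 * b" unfolding b_def by (simp add: field_simps)
  note p1 = p(1)
  have odd_k: "p + of_int k * \<kappa> \<in> D (\<not> s)" if "odd k" for k using D_chain [OF p1 ka(1), of k] that by simp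
  have odd_l: "p + of_int l * \<nu> \<in> D (\<not> s)" if "odd l" for l using D_chain [OF p1 nu(1), of l] that by simp
  have dk: "d s p (of_int k * \<kappa>) = of_int k * \<sigma>" if "odd k" for k
    unfolding \<sigma>_def by (rule d_multiple [OF p1 ka(1) that])
  have dl: "d s p (of_int l * \<nu>) = of_int l * \<tau>" if "odd l" for l
    unfolding \<tau>_def by (rule d_multiple [OF p1 nu(1) that])
  have q_nu: "p + \<kappa> + \<nu> \<in> D s" using D_add_odd [OF p1 nu(1) ka(1)] by simp
  have dq: "d (\<not> s) (p + \<kappa>) \<nu> = \<nu> - \<tau> + b"
  proof -
    have "2 * d (\<not> s) (p + \<kappa>) \<nu> = 2 * (\<nu> - \<tau> + b)"
      using d_odd_vertex [OF p1 ka(1) nu(1)] unfolding \<tau>_def [symmetric] \<sigma>_def [symmetric] b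
      by (simp add: algebra_simps)
    then show ?thesis by (rule two_times_cancel)
  qed
  have shift_l: "d s (p + 2 * (of_int l * \<nu>)) \<kappa> = \<sigma> + 2 * of_int l * b" if l: "odd l" for l
  proof -
    have 1: "d (\<not> s) (p + \<kappa>) (of_int l * \<nu>) = of_int l * (\<nu> - \<tau> + b)"
      using d_multiple [of "p + \<kappa>" "\<not> s" \<nu> l] ka(1) q_nu l dq by simp
    show ?thesis
      using d_odd_vertex [OF p1 ka(1) odd_l [OF l]] unfolding \<sigma>_def [symmetric] 1 dl [OF l]
      by (simp add: algebra_simps)
  qed
  have P4: "p + 4 * \<nu> \<in> D s" "p + 2 * \<nu> \<in> D s" "p + 2 * \<kappa> \<in> D s"
    using D_chain [OF p1 nu(1), of 4] D_chain [OF p1 nu(1), of 2] D_chain [OF p1 ka(1), of 2] by simp_all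
  have b4: "d s (p + 4 * \<nu>) \<kappa> = \<sigma> + 4 * b"
  proof -
    have 1: "p + 2 * \<nu> + \<kappa> \<in> D (\<not> s)" "p + 2 * \<nu> + \<nu> \<in> D (\<not> s)"
      using D_add_odd [OF p1 ka(1) P4(2)] D_add_odd [OF p1 nu(1) P4(2)] by simp_all
    have s2: "p + 2 * \<nu> + 2 * \<nu> = p + 4 * \<nu>" by simp
    have "p + \<kappa> + 2 * \<nu> \<in> D (\<not> s)" using 1(1) by (simp add: algebra_simps)
    have x1: "e (\<not> s) (p + \<kappa>) (p + \<kappa> + (- \<kappa> + 2 * \<nu> + 2 * \<nu>)) = p + \<kappa> + (d (\<not> s) (p + \<kappa>) (- \<kappa>) + 4 * d (\<not> s) (p + \<kappa>) \<nu>)"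
    proof -
      have "d (\<not> s) (p + \<kappa>) (- \<kappa> + 2 * \<nu> + 2 * \<nu>) = d (\<not> s) (p + \<kappa>) (- \<kappa> + 2 * \<nu>) + 2 * d (\<not> s) (p + \<kappa>) \<nu>"
        using d_add_even_multiple [of "p + \<kappa>" "\<not> s" \<nu> "- \<kappa> + 2 * \<nu>"] ka(1) q_nu P4(2) by simp
      moreover have "d (\<not> s) (p + \<kappa>) (- \<kappa> + 2 * \<nu>) = d (\<not> s) (p + \<kappa>) (- \<kappa>) + 2 * d (\<not> s) (p + \<kappa>) \<nu>"
        using d_add_even_multiple [of "p + \<kappa>" "\<not> s" \<nu> "- \<kappa>"] ka(1) q_nu p1 by simp
      ultimately show ?thesis unfolding e_d by simp
    qed
    have x2: "d (\<not> s) (p + \<kappa>) (- \<kappa>) = \<sigma> - \<kappa>"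
      using e_swap [of s "p + \<kappa>" p] e_d [of s p \<kappa>] unfolding \<sigma>_def d_def by (simp add: algebra_simps)
    have Pv: "p + 4 * \<nu> + \<kappa> \<in> D (\<not> s)" "p + 4 * \<nu> + - \<nu> \<in> D (\<not> s)" "p + 4 * \<nu> + \<nu> \<in> D (\<not> s)"
      using D_add_odd [OF p1 ka(1) P4(1)] D_add_odd [OF p1 nu(1) P4(1)] D_diff_odd [OF p1 nu(1) P4(1)] by simp_all
    have Pv2: "p + 4 * \<nu> + (\<kappa> + 2 * - \<nu>) \<in> D (\<not> s)"
      using 1(1) by (simp add: algebra_simps)
    have x3: "e s (p + 4 * \<nu>) (p + 4 * \<nu> + (\<kappa> + 2 * - \<nu> + 2 * - \<nu>)) = p + 4 * \<nu> + (d s (p + 4 * \<nu>) \<kappa> - 4 * d s (p + 4 * \<nu>) \<nu>)"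
      unfolding e_d using d_add_even_multiple [OF P4(1) Pv(2) Pv2] d_add_even_multiple [OF P4(1) Pv(2) Pv(1)]
        d_minus [OF P4(1) Pv(3)] by simp
    have x4: "d s (p + 4 * \<nu>) \<nu> = \<tau>"
      using d_periodic [OF P4(2) 1(2)] d_periodic [OF p1 nu(1)] unfolding s2 \<tau>_def by simp
    have "p + \<kappa> + (- \<kappa> + 2 * \<nu> + 2 * \<nu>) = p + 4 * \<nu>" "p + 4 * \<nu> + (\<kappa> + 2 * - \<nu> + 2 * - \<nu>) = p + \<kappa>" by simp_all
    then have "p + \<kappa> + (\<sigma> - \<kappa> + 4 * (\<nu> - \<tau> + b)) = p + 4 * \<nu> + (d s (p + 4 * \<nu>) \<kappa> - 4 * \<tau>)"
      using x1 x3 e_swap [of s "p + \<kappa>" "p + 4 * \<nu>"] unfolding x2 x4 dq by simp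
    then show ?thesis by (simp add: algebra_simps)
  qed
  \<comment> \<open>The value of \<open>d\<close> in the direction \<kappa> + 2 \<nu> is unchanged
    by a move of 2 (\<kappa> + 2 \<nu>). So the change of d(\<kappa>), which is 4 b by
    \<open>b4\<close>, is balanced by twice the change of d(\<nu>).\<close>
  have b': "d s (p + 2 * \<kappa>) \<nu> = \<tau> - 2 * b"
  proof -
    define \<theta> where "\<theta> = \<kappa> + 2 * \<nu>"
    have th: "p + \<theta> \<in> D (\<not> s)" using D_add_odd [OF p1 ka(1) P4(2)] unfolding \<theta>_def by (simp add: algebra_simps)
    define R where "R = p + 2 * \<theta>"
    have RD: "R \<in> D s" unfolding R_def using D_chain [OF p1 th, of 2] by simp
    have Rv: "R + \<kappa> \<in> D (\<not> s)" "R + \<nu> \<in> D (\<not> s)"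
      using D_add_odd [OF p1 ka(1) RD] D_add_odd [OF p1 nu(1) RD] by simp_all
    have 1: "d s R \<theta> = d s R \<kappa> + 2 * d s R \<nu>"
      unfolding \<theta>_def by (rule d_add_even_multiple [OF RD Rv(2,1)])
    have 2: "d s p \<theta> = \<sigma> + 2 * \<tau>"
      unfolding \<theta>_def \<sigma>_def \<tau>_def by (rule d_add_even_multiple [OF p1 nu(1) ka(1)])
    have 3: "d s R \<theta> = d s p \<theta>" unfolding R_def by (rule d_periodic [OF p1 th])
    have "R = p + 4 * \<nu> + 2 * \<kappa>" unfolding R_def \<theta>_def by (simp add: algebra_simps)
    then have 4: "d s R \<kappa> = \<sigma> + 4 * b"
      using d_periodic [of "p + 4 * \<nu>" s \<kappa>] P4(1) D_add_odd [OF p1 ka(1) P4(1)] b4 by simp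
    have "p + 2 * \<kappa> + \<nu> \<in> D (\<not> s)" using D_add_odd [OF p1 nu(1) P4(3)] .
    moreover have "p + 2 * \<kappa> + 2 * \<nu> \<in> D s" using D_add_odd [OF p1 nu(1) calculation] by (simp add: algebra_simps)
    moreover have "p + 2 * \<kappa> + 2 * \<nu> + \<nu> \<in> D (\<not> s)" using D_add_odd [OF p1 nu(1) calculation(2)] .
    moreover have "R = p + 2 * \<kappa> + 2 * \<nu> + 2 * \<nu>" unfolding R_def \<theta>_def by (simp add: algebra_simps)
    ultimately have 5: "d s R \<nu> = d s (p + 2 * \<kappa>) \<nu>"
      using d_periodic [of "p + 2 * \<kappa>" s \<nu>] d_periodic [of "p + 2 * \<kappa> + 2 * \<nu>" s \<nu>] P4(3) by simp
    have "2 * d s (p + 2 * \<kappa>) \<nu> = 2 * (\<tau> - 2 * b)"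
      using 1 2 3 4 5 by (simp add: algebra_simps)
    then show ?thesis by (rule two_times_cancel)
  qed
  have shift_k: "d s (p + 2 * (of_int k * \<kappa>)) \<nu> = \<tau> - 2 * of_int k * b" if k: "odd k" for k
  proof -
    have "2 * d (\<not> s) (p + \<nu>) \<kappa> = 2 * (\<kappa> - \<sigma> - b)"
      using d_odd_vertex [OF p1 nu(1) ka(1)] unfolding \<tau>_def [symmetric] \<sigma>_def [symmetric] b'
      by (simp add: algebra_simps)
    then have "d (\<not> s) (p + \<nu>) \<kappa> = \<kappa> - \<sigma> - b" by (rule two_times_cancel)
    moreover have "d (\<not> s) (p + \<nu>) (of_int k * \<kappa>) = of_int k * d (\<not> s) (p + \<nu>) \<kappa>"
      by (rule d_multiple) (use nu(1) q_nu k in \<open>simp_all add: algebra_simps\<close>)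
    ultimately have 1: "d (\<not> s) (p + \<nu>) (of_int k * \<kappa>) = of_int k * (\<kappa> - \<sigma> - b)" by simp
    show ?thesis
      using d_odd_vertex [OF p1 nu(1) odd_k [OF k]] unfolding \<tau>_def [symmetric] 1 dk [OF k]
      by (simp add: algebra_simps)
  qed
  \<comment> \<open>The functions \<open>c1\<close> to \<open>c4\<close> are the coefficients of k,
    k^2, k^3 and k^4 in the eliminated relation; their argument y stands for l.\<close>
  define c1 where "c1 = (\<lambda>y::'f. (4 * b * \<nu> * p^2 + 4 * \<kappa> * \<nu> * p * \<tau> - 4 * \<nu>^2 * p * \<sigma>) * y^2
    + (- 4 * b * \<nu> * p * \<tau> + 4 * b * \<nu>^2 * p - 4 * \<kappa> * \<nu> * \<tau>^2 + 4 * \<kappa> * \<nu>^2 * \<tau> + 4 * \<nu>^2 * \<sigma> * \<tau> - 4 * \<nu>^3 * \<sigma>) * y^3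
    + (- 2 * b * \<nu> * \<tau>^2 + 2 * b * \<nu>^2 * \<tau>) * y^4)"
  define c2 where "c2 = (\<lambda>y::'f. (4 * b * \<kappa> * p^2 - 4 * \<kappa> * \<nu> * p * \<sigma> + 4 * \<kappa>^2 * p * \<tau>) * y
    + (- 8 * b * \<kappa> * \<nu> * p + 8 * \<kappa> * \<nu>^2 * \<sigma> - 8 * \<kappa>^2 * \<nu> * \<tau>) * y^2
    + (- 8 * b * \<kappa> * \<nu> * \<tau> + 4 * b * \<kappa> * \<tau>^2 - 2 * b * \<nu> * \<sigma> * \<tau> + 6 * b * \<nu>^2 * \<sigma> - 6 * b^2 * \<nu> * p + 2 * b^2 * p * \<tau>) * y^3
    + (- 2 * b^2 * \<nu> * \<tau> + 2 * b^2 * \<tau>^2) * y^4)"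
  define c3 where "c3 = (\<lambda>y::'f. (- 4 * b * \<kappa> * p * \<sigma> + 4 * b * \<kappa>^2 * p + 4 * \<kappa> * \<nu> * \<sigma>^2 - 4 * \<kappa>^2 * \<nu> * \<sigma> - 4 * \<kappa>^2 * \<sigma> * \<tau> + 4 * \<kappa>^3 * \<tau>) * y
    + (- 8 * b * \<kappa> * \<nu> * \<sigma> - 2 * b * \<kappa> * \<sigma> * \<tau> + 6 * b * \<kappa>^2 * \<tau> + 4 * b * \<nu> * \<sigma>^2 + 6 * b^2 * \<kappa> * p - 2 * b^2 * p * \<sigma>) * y^2
    + 2 * b^3 * p * y^3 - b^3 * \<tau> * y^4)"
  define c4 where "c4 = (\<lambda>y::'f. (- 2 * b * \<kappa> * \<sigma>^2 + 2 * b * \<kappa>^2 * \<sigma>) * y + (2 * b^2 * \<kappa> * \<sigma> - 2 * b^2 * \<sigma>^2) * y^2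
    - b^3 * \<sigma> * y^3)"
  have key: "0 + c1 (of_int l) * of_int k + c2 (of_int l) * of_int k^2 + c3 (of_int l) * of_int k^3 + c4 (of_int l) * of_int k^4 = 0"
    if k: "odd k" and l: "odd l" and nek: "p + of_int k * \<sigma> \<noteq> 0" and nel: "p + of_int l * \<tau> \<noteq> 0"
      and ne: "of_int k * \<kappa> \<noteq> of_int l * \<nu>" "of_int k * \<kappa> \<noteq> - (of_int l * \<nu>)" for k l
  proof -
    define kk ll where "kk = (of_int k :: 'f)" and "ll = (of_int l :: 'f)"
    define x y where "x = kk * \<kappa>" and "y = ll * \<nu>"
    have X: "p + x \<in> D (\<not> s)" "p - x \<in> D (\<not> s)" unfolding x_def kk_def
      using odd_k [OF k] odd_k [of "- k"] k by simp_all
    have Y: "p + y \<in> D (\<not> s)" "p - y \<in> D (\<not> s)" unfolding y_def ll_def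
      using odd_l [OF l] odd_l [of "- l"] l by simp_all
    have dx: "d s p x = kk * \<sigma>" unfolding x_def kk_def by (rule dk [OF k])
    have dy: "d s p y = ll * \<tau>" unfolding y_def ll_def by (rule dl [OF l])
    have mx: "d s p (- x) = - (kk * \<sigma>)" using d_minus [OF p1 X(1)] dx by simp
    have my: "d s p (- y) = - (ll * \<tau>)" using d_minus [OF p1 Y(1)] dy by simp
    have P2: "p + 2 * x \<in> D s" "p + 2 * y \<in> D s"
      using D_chain [OF p1 X(1), of 2] D_chain [OF p1 Y(1), of 2] by simp_all
    have Pyx: "p + 2 * y + \<kappa> \<in> D (\<not> s)" "p + 2 * x + \<nu> \<in> D (\<not> s)"
      using D_add_odd [OF p1 ka(1) P2(2)] D_add_odd [OF p1 nu(1) P2(1)] by simp_all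
    have yx: "d s (p + 2 * y) x = kk * (\<sigma> + 2 * ll * b)"
      using d_multiple [OF P2(2) Pyx(1) k] shift_l [OF l] unfolding y_def x_def kk_def ll_def by simp
    have xy: "d s (p + 2 * x) y = ll * (\<tau> - 2 * kk * b)"
      using d_multiple [OF P2(1) Pyx(2) l] shift_k [OF k] unfolding y_def x_def kk_def ll_def by simp
    have Pyx': "p + 2 * y + x \<in> D (\<not> s)" "p + 2 * x + y \<in> D (\<not> s)"
      using D_add_odd [OF p1 X(1) P2(2)] D_add_odd [OF p1 Y(1) P2(1)] by simp_all
    have myx: "d s (p + 2 * y) (- x) = - (kk * (\<sigma> + 2 * ll * b))" using d_minus [OF P2(2) Pyx'(1)] yx by simp
    have mxy: "d s (p + 2 * x) (- y) = - (ll * (\<tau> - 2 * kk * b))" using d_minus [OF P2(1) Pyx'(2)] xy by simp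
    have qx: "d (\<not> s) (p + x) y = y - ll * \<tau> + kk * ll * b"
    proof -
      have "2 * d (\<not> s) (p + x) y = 2 * (y - ll * \<tau> + kk * ll * b)"
        using d_odd_vertex [OF p1 X(1) Y(1)] unfolding dx dy yx by (simp add: algebra_simps)
      then show ?thesis by (rule two_times_cancel)
    qed
    have qmx: "d (\<not> s) (p - x) y = y - ll * \<tau> - kk * ll * b"
    proof -
      have "2 * d (\<not> s) (p - x) y = 2 * (y - ll * \<tau> - kk * ll * b)"
        using d_odd_vertex [OF p1, of "- x" y] X(2) Y(1) unfolding mx dy myx by (simp add: algebra_simps)
      then show ?thesis by (rule two_times_cancel)
    qed
    have qy: "d (\<not> s) (p + y) x = x - kk * \<sigma> - kk * ll * b"
    proof -
      have "2 * d (\<not> s) (p + y) x = 2 * (x - kk * \<sigma> - kk * ll * b)"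
        using d_odd_vertex [OF p1 Y(1) X(1)] unfolding dx dy xy by (simp add: algebra_simps)
      then show ?thesis by (rule two_times_cancel)
    qed
    have qmy: "d (\<not> s) (p - y) x = x - kk * \<sigma> + kk * ll * b"
    proof -
      have "2 * d (\<not> s) (p - y) x = 2 * (x - kk * \<sigma> + kk * ll * b)"
        using d_odd_vertex [OF p1, of "- y" x] Y(2) X(1) unfolding my dx mxy by (simp add: algebra_simps)
      then show ?thesis by (rule two_times_cancel)
    qed
    have XY: "p + x + y \<in> D s" "p - x + y \<in> D s" "p + y + x \<in> D s" "p - y + x \<in> D s"
      using D_add_odd [OF p1 Y(1) X(1)] D_add_odd [OF p1 Y(1) X(2)] D_add_odd [OF p1 X(1) Y(1)] D_add_odd [OF p1 X(1) Y(2)]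
      by simp_all
    have E: "e s p (p + x) = p + kk * \<sigma>" "e s p (p - x) = p - kk * \<sigma>" "e s p (p + y) = p + ll * \<tau>" "e s p (p - y) = p - ll * \<tau>"
      using e_d [of s p x] e_d [of s p "- x"] e_d [of s p y] e_d [of s p "- y"] unfolding dx mx dy my by simp_all
    have E1: "e s (p + x + y) (p + x) = p + x + (y - ll * \<tau> + kk * ll * b)"
      using e_swap [of s "p + x" "p + x + y"] e_d [of "\<not> s" "p + x" y] unfolding qx by simp
    have E2: "e s (p + x - y) (p + x) = p + x - (y - ll * \<tau> + kk * ll * b)"
      using e_swap [of s "p + x" "p + x - y"] e_d [of "\<not> s" "p + x" "- y"] d_minus [OF X(1), of y] XY(1) unfolding qx by simp
    have E3: "e s (p + x + y) (p + y) = p + y + (x - kk * \<sigma> - kk * ll * b)"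
      using e_swap [of s "p + y" "p + y + x"] e_d [of "\<not> s" "p + y" x] unfolding qy by (simp add: algebra_simps)
    have E4: "e s (p + y - x) (p + y) = p + y - (x - kk * \<sigma> - kk * ll * b)"
      using e_swap [of s "p + y" "p + y - x"] e_d [of "\<not> s" "p + y" "- x"] d_minus [OF Y(1), of x] XY(3) unfolding qy by simp
    have E5: "e s (p + x - y) (p - y) = p - y + (x - kk * \<sigma> + kk * ll * b)"
      using e_swap [of s "p - y" "p - y + x"] e_d [of "\<not> s" "p - y" x] unfolding qmy by (simp add: algebra_simps)
    have E6: "e s (p + y - x) (p - x) = p - x + (y - ll * \<tau> - kk * ll * b)"
      using e_swap [of s "p - x" "p - x + y"] e_d [of "\<not> s" "p - x" y] unfolding qmx by (simp add: algebra_simps)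
    have n1: "e s p (p + x) \<noteq> 0" "e s p (p + y) \<noteq> 0" unfolding E kk_def ll_def using nek nel by simp_all
    have ne': "p + y \<noteq> p + x" "p \<noteq> p + x + y" "p + x \<noteq> p + y" "p \<noteq> p + y + x"
      using ne unfolding x_def y_def kk_def ll_def by (auto simp: eq_neg_iff_add_eq_0 add.assoc add.commute)
    define K0 where "K0 = K s p (p + x + y)"
    define D1 D2 where "D1 = 2 * y - kk * ll * b" and "D2 = 2 * x + kk * ll * b"
    have c1: "(p + ll * \<tau>) * (p + y + (x - kk * \<sigma> - kk * ll * b)) * (p + x + (y - ll * \<tau> + kk * ll * b))
        - (p - ll * \<tau>) * (p - y + (x - kk * \<sigma> + kk * ll * b)) * (p + x - (y - ll * \<tau> + kk * ll * b))
       = D1 * (K0 - (p + ll * \<tau>) * (p + y + (x - kk * \<sigma> - kk * ll * b))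
           - (p + kk * \<sigma>) * (p + x + (y - ll * \<tau> + kk * ll * b)) - (p + kk * \<sigma>) * D1)"
    proof -
      have "D1 = 3 * y - (p + x - p) - e s p (p + y) + e s (p + x - y) (p + x)"
        unfolding E E2 D1_def by (simp add: algebra_simps)
      from e_cubic [OF p1 X(1) Y(1) ne'(1,2) n1(1) this]
      show ?thesis unfolding E E1 E2 E3 E5 K0_def by simp
    qed
    have c2: "(p + kk * \<sigma>) * (p + x + (y - ll * \<tau> + kk * ll * b)) * (p + y + (x - kk * \<sigma> - kk * ll * b))
        - (p - kk * \<sigma>) * (p - x + (y - ll * \<tau> - kk * ll * b)) * (p + y - (x - kk * \<sigma> - kk * ll * b))
       = D2 * (K0 - (p + kk * \<sigma>) * (p + x + (y - ll * \<tau> + kk * ll * b))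
           - (p + ll * \<tau>) * (p + y + (x - kk * \<sigma> - kk * ll * b)) - (p + ll * \<tau>) * D2)"
    proof -
      have com: "p + y + x = p + x + y" by simp
      have "D2 = 3 * x - (p + y - p) - e s p (p + x) + e s (p + y - x) (p + y)"
        unfolding E E4 D2_def by (simp add: algebra_simps)
      from e_cubic [OF p1 Y(1) X(1) ne'(3,4) n1(2) this]
      show ?thesis unfolding com E E1 E3 E4 E6 K0_def by simp
    qed
    \<comment> \<open>The right side of the first relation times \<open>D2\<close> minus that of the
      second times \<open>D1\<close> is free of \<open>K0\<close>.\<close>
    have "0 = (D1 * (K0 - (p + ll * \<tau>) * (p + y + (x - kk * \<sigma> - kk * ll * b))
           - (p + kk * \<sigma>) * (p + x + (y - ll * \<tau> + kk * ll * b)) - (p + kk * \<sigma>) * D1)) * D2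
        - (D2 * (K0 - (p + kk * \<sigma>) * (p + x + (y - ll * \<tau> + kk * ll * b))
           - (p + ll * \<tau>) * (p + y + (x - kk * \<sigma> - kk * ll * b)) - (p + ll * \<tau>) * D2)) * D1
        + ((p + kk * \<sigma>) * D1 - (p + ll * \<tau>) * D2) * D1 * D2"
      by algebra
    also have "\<dots> = 0 + c1 ll * kk + c2 ll * kk^2 + c3 ll * kk^3 + c4 ll * kk^4"
      unfolding c1 [symmetric] c2 [symmetric] unfolding D1_def D2_def c1_def c2_def c3_def c4_def x_def y_def
      by algebra
    finally show ?thesis unfolding kk_def ll_def by simp
  qed
  have odds: "infinite ((\<lambda>i::nat. of_int (1 + 2 * int i) :: 'f) ` UNIV)"
    using infinite_progression [of 2 "1 :: 'f"] by (simp add: mult.commute)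
  have lin_fin: "finite {x. p + x * a = 0}" for a
  proof (rule finite_subset)
    show "{x. p + x * a = 0} \<subseteq> {- p / a}"
    proof
      fix x assume "x \<in> {x. p + x * a = 0}"
      then have "p + x * a = 0" by simp
      moreover from this have "a \<noteq> 0" using p(2) by auto
      ultimately show "x \<in> {- p / a}" by (simp add: field_simps eq_neg_iff_add_eq_0)
    qed
  qed simp
  define L where "L = (\<lambda>i::nat. of_int (1 + 2 * int i) :: 'f) ` UNIV - {x. p + x * \<tau> = 0}"
  have L: "infinite L" unfolding L_def using odds lin_fin by (metis Diff_infinite_finite)
  have cs: "c1 y = 0 \<and> c3 y = 0" if y: "y \<in> L" for y
  proof -
    obtain i where i: "y = of_int (1 + 2 * int i)" "p + y * \<tau> \<noteq> 0" using y unfolding L_def by blast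
    define l where "l = 1 + 2 * int i"
    have l: "odd l" "y = of_int l" "p + of_int l * \<tau> \<noteq> 0" using i unfolding l_def by simp_all
    let ?A = "(\<lambda>i::nat. of_int (1 + 2 * int i) :: 'f) ` UNIV - ({x. p + x * \<sigma> = 0} \<union> {y * \<nu> / \<kappa>, - (y * \<nu>) / \<kappa>})"
    have A: "infinite ?A" using odds lin_fin by (intro Diff_infinite_finite) auto
    have "0 + c1 y * x + c2 y * x^2 + c3 y * x^3 + c4 y * x^4 = 0" if x: "x \<in> ?A" for x
    proof -
      obtain j where j: "x = of_int (1 + 2 * int j)" "p + x * \<sigma> \<noteq> 0" "x \<noteq> y * \<nu> / \<kappa>" "x \<noteq> - (y * \<nu>) / \<kappa>"
        using x by blast
      define k where "k = 1 + 2 * int j"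
      have k: "odd k" "x = of_int k" "p + of_int k * \<sigma> \<noteq> 0" "of_int k \<noteq> y * \<nu> / \<kappa>" "of_int k \<noteq> - (y * \<nu>) / \<kappa>"
        using j unfolding k_def by simp_all
      have "of_int k * \<kappa> \<noteq> of_int l * \<nu>" "of_int k * \<kappa> \<noteq> - (of_int l * \<nu>)"
        using k(4,5) unfolding l(2) nonzero_eq_divide_eq [OF ka(2)] by simp_all
      from key [OF k(1) l(1) k(3) l(3) this] show ?thesis unfolding k l .
    qed
    from poly4_vanishing [OF A this] show ?thesis by blast
  qed
  \<comment> \<open>The coefficient of y^3 in \<open>c3\<close> is 2 b^3 p, and p is not 0.\<close>
  have "b = 0"
  proof -
    have "0 + (- 4 * b * \<kappa> * p * \<sigma> + 4 * b * \<kappa>^2 * p + 4 * \<kappa> * \<nu> * \<sigma>^2 - 4 * \<kappa>^2 * \<nu> * \<sigma> - 4 * \<kappa>^2 * \<sigma> * \<tau> + 4 * \<kappa>^3 * \<tau>) * y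
    + (- 8 * b * \<kappa> * \<nu> * \<sigma> - 2 * b * \<kappa> * \<sigma> * \<tau> + 6 * b * \<kappa>^2 * \<tau> + 4 * b * \<nu> * \<sigma>^2 + 6 * b^2 * \<kappa> * p - 2 * b^2 * p * \<sigma>) * y^2
    + (2 * b^3 * p) * y^3 + (- (b^3) * \<tau>) * y^4 = 0" if "y \<in> L" for y
      using cs [OF that] unfolding c3_def by simp
    from poly4_vanishing(4) [OF L this] show ?thesis using p(2) by simp
  qed
  have "4 * \<nu> * p * (\<kappa> * \<tau> - \<nu> * \<sigma>) = 0"
  proof -
    have "0 + 0 * y + (4 * \<nu> * p * (\<kappa> * \<tau> - \<nu> * \<sigma>)) * y^2
    + (- 4 * \<kappa> * \<nu> * \<tau>^2 + 4 * \<kappa> * \<nu>^2 * \<tau> + 4 * \<nu>^2 * \<sigma> * \<tau> - 4 * \<nu>^3 * \<sigma>) * y^3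
    + 0 * y^4 = 0" if "y \<in> L" for y
      using cs [OF that] unfolding c1_def \<open>b = 0\<close> by (simp add: algebra_simps power2_eq_square)
    from poly4_vanishing(3) [OF L this] show ?thesis .
  qed
  then show ?thesis using p(2) nu(2) unfolding \<sigma>_def \<tau>_def by simp
qed

text \<open>Each nonzero weight has a slope B by \<open>d_proportional\<close>. Seen from its two
  ends, an edge between different nonzero weights forces the slopes to add up to 1. Two nonzero
  weights of one parity have a common nonzero neighbour different from both, so their slopes agree.
  For an edge with both ends 0, reflection gives 2 e = 0.\<close>

lemma e_affine: "\<exists>\<beta>. \<forall>p\<in>D s. \<forall>q\<in>D (\<not> s). e s p q = (1 - \<beta>) * p + \<beta> * q"
proof -
  have proportional: "\<exists>B. \<forall>v. p + v \<in> D (\<not> t) \<longrightarrow> d t p v = B * v" if p: "p \<in> D t" "p \<noteq> 0" for t p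
  proof -
    obtain \<theta> where th: "\<theta> \<noteq> 0" "p + \<theta> \<in> D (\<not> t)" using odd_vector_exists [OF p(1)] by blast
    have "d t p v = d t p \<theta> / \<theta> * v" if v: "p + v \<in> D (\<not> t)" for v
    proof (cases "v = 0")
      case True
      then show ?thesis using d_multiple [OF p(1) v, of 3] by simp
    next
      case False
      then show ?thesis using d_proportional [OF p v False th(2,1)] th(1) by (simp add: field_simps)
    qed
    then show ?thesis by blast
  qed
  define B where "B = (\<lambda>t p. SOME B. \<forall>v. p + v \<in> D (\<not> t) \<longrightarrow> d t p v = B * v)"
  have B: "d t p v = B t p * v" if "p \<in> D t" "p \<noteq> 0" "p + v \<in> D (\<not> t)" for t p v
    using someI_ex [OF proportional [OF that(1,2)]] that(3) unfolding B_def by blast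
  have eB: "e t p q = p + B t p * (q - p)" if "p \<in> D t" "p \<noteq> 0" "q \<in> D (\<not> t)" for t p q
    using B [of p t "q - p"] e_d [of t p "q - p"] that by simp
  have comp: "B (\<not> s) q = 1 - B s p" if "p \<in> D s" "p \<noteq> 0" "q \<in> D (\<not> s)" "q \<noteq> 0" "p \<noteq> q" for p q
  proof -
    have "p + B s p * (q - p) = q + B (\<not> s) q * (p - q)"
      using eB [of p s q] eB [of q "\<not> s" p] e_swap [of s q p] that by simp
    then have "(B (\<not> s) q - (1 - B s p)) * (q - p) = 0" by algebra
    then show ?thesis using that by simp
  qed
  obtain p0 where p0: "p0 \<in> D s" "p0 \<noteq> 0" using D_avoid [of "{0}" s] by auto
  have Bp: "B s p = B s p0" if p: "p \<in> D s" "p \<noteq> 0" for p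
  proof -
    obtain q where "q \<in> D (\<not> s)" "q \<notin> {0, p, p0}" using D_avoid [of "{0, p, p0}" "\<not> s"] by auto
    then have "1 - B s p = 1 - B s p0" using comp [of p q] comp [of p0 q] p p0 by auto
    then show ?thesis by simp
  qed
  have Bq: "B (\<not> s) q = 1 - B s p0" if q: "q \<in> D (\<not> s)" "q \<noteq> 0" for q
  proof -
    obtain p where "p \<in> D s" "p \<notin> {0, q}" using D_avoid [of "{0, q}" s] by auto
    then show ?thesis using comp [of p q] Bp [of p] q by auto
  qed
  have "e s p q = (1 - B s p0) * p + B s p0 * q" if pq: "p \<in> D s" "q \<in> D (\<not> s)" for p q
  proof (cases "p = 0")
    case False
    then show ?thesis using eB [OF pq(1) False pq(2)] Bp [OF pq(1) False] by (simp add: algebra_simps)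
  next
    case p: True
    show ?thesis
    proof (cases "q = 0")
      case True
      then show ?thesis using e_refl0 [of 0 s 0] pq p by simp
    next
      case False
      then show ?thesis using eB [of q "\<not> s" p] Bq [OF pq(2) False] e_swap [of s q p] pq p
        by (simp add: algebra_simps)
    qed
  qed
  then show ?thesis by blast
qed

end

section \<open>Rank one factorization\<close>

text \<open>The analogue of the fact that a group is not the union of two proper subgroups. A pair
  outside R lies in S and a pair outside S lies in R; the pairs that connect these two lead to a
  contradiction by transitivity.\<close>

lemma two_equivalences_cover:
  assumes "\<And>x y. R x y \<Longrightarrow> R y x" "\<And>x y z. R x y \<Longrightarrow> R y z \<Longrightarrow> R x z"
    and "\<And>x y. S x y \<Longrightarrow> S y x" "\<And>x y z. S x y \<Longrightarrow> S y z \<Longrightarrow> S x z"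
    and cover: "\<And>x y. x \<in> A \<Longrightarrow> y \<in> A \<Longrightarrow> x \<noteq> y \<Longrightarrow> R x y \<or> S x y"
  shows "(\<forall>x\<in>A. \<forall>y\<in>A. x \<noteq> y \<longrightarrow> R x y) \<or> (\<forall>x\<in>A. \<forall>y\<in>A. x \<noteq> y \<longrightarrow> S x y)"
proof (rule ccontr)
  assume "\<not> ?thesis"
  then obtain a b x y where ab: "a \<in> A" "b \<in> A" "a \<noteq> b" "\<not> R a b" and xy: "x \<in> A" "y \<in> A" "x \<noteq> y" "\<not> S x y"
    by blast
  have S: "S a b" and R: "R x y" using cover ab xy by blast+
  consider "x = a" | "x = b" | "x \<noteq> a" "x \<noteq> b" by blast
  then show False
  proof cases
    case 1
    then have "y \<noteq> b" "y \<noteq> a" using R ab xy by auto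
    then have "R y b \<or> S y b" using cover ab xy by blast
    then show False using 1 R S ab xy assms(1-4) by metis
  next
    case 2
    then have "y \<noteq> b" "y \<noteq> a" using R ab xy assms(1) by auto
    then have "R y a \<or> S y a" using cover ab xy by blast
    then show False using 2 R S ab xy assms(1-4) by metis
  next
    case 3
    then have "R x a \<or> S x a" "R x b \<or> S x b" using cover ab xy by blast+
    moreover have "y = a \<or> R y a \<or> S y a" "y = b \<or> R y b \<or> S y b" using cover ab xy by blast+
    ultimately show False using R S ab xy assms(1-4) by metis
  qed
qed

text \<open>Comparison with a fixed column p0 defines \<rho>, but only through rows with
  \<open>v p0 q \<noteq> 0\<close>. For any other row a column p1 with
  \<open>v p1 q \<noteq> 0\<close> takes over; a row q' that is generic for p0 and p1 shows that the
  ratio of the columns p and p1 is again \<rho> p / \<rho> p1.\<close>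

lemma rank_one_factorization:
  fixes u v :: "'a \<Rightarrow> 'b \<Rightarrow> 'f::field"
  assumes A: "infinite A" and B: "infinite B"
    and finB: "\<And>p. p \<in> A \<Longrightarrow> finite {q \<in> B. v p q = 0}"
    and finA: "\<And>q. q \<in> B \<Longrightarrow> finite {p \<in> A. v p q = 0}"
    and nz: "\<And>p q. v p q \<noteq> 0 \<Longrightarrow> u p q \<noteq> 0"
    and cols: "\<And>p P. p \<in> A \<Longrightarrow> P \<in> A \<Longrightarrow> p \<noteq> P \<Longrightarrow> \<exists>r. \<forall>q\<in>B. v P q \<noteq> 0 \<longrightarrow> u p q = r * u P q"
  shows "\<exists>\<rho> \<phi>. (\<forall>p\<in>A. \<rho> p \<noteq> 0) \<and> (\<forall>q\<in>B. \<phi> q \<noteq> 0) \<and> (\<forall>p\<in>A. \<forall>q\<in>B. u p q = \<rho> p * \<phi> q)"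
proof -
  have cols': "\<exists>r. \<forall>q\<in>B. v P q \<noteq> 0 \<longrightarrow> u p q = r * u P q" if "p \<in> A" "P \<in> A" for p P
    using cols [OF that] by (cases "p = P") (auto intro: exI [of _ 1])
  obtain p0 where p0: "p0 \<in> A" using infinite_imp_nonempty [OF A] by blast
  have "\<forall>p\<in>A. \<exists>r. \<forall>q\<in>B. v p0 q \<noteq> 0 \<longrightarrow> u p q = r * u p0 q"
    using cols' [OF _ p0] by blast
  from bchoice [OF this] obtain \<rho> where
    \<rho>0: "\<forall>p\<in>A. \<forall>q\<in>B. v p0 q \<noteq> 0 \<longrightarrow> u p q = \<rho> p * u p0 q" ..
  have \<rho>: "u p q = \<rho> p * u p0 q" if "p \<in> A" "q \<in> B" "v p0 q \<noteq> 0" for p q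
    using \<rho>0 [rule_format, OF that] .
  have generic: "\<exists>q\<in>B. v p q \<noteq> 0 \<and> v P q \<noteq> 0" if "p \<in> A" "P \<in> A" for p P
  proof -
    have "infinite (B - ({q \<in> B. v p q = 0} \<union> {q \<in> B. v P q = 0}))"
      using B finB that by (intro Diff_infinite_finite) auto
    then have "B - ({q \<in> B. v p q = 0} \<union> {q \<in> B. v P q = 0}) \<noteq> {}" by (rule infinite_imp_nonempty)
    then show ?thesis by blast
  qed
  have \<rho>_nz: "\<rho> p \<noteq> 0" if pA: "p \<in> A" for p
  proof -
    obtain q where q: "q \<in> B" "v p q \<noteq> 0" "v p0 q \<noteq> 0" using generic [OF pA p0] by blast
    show ?thesis using \<rho> [OF pA q(1,3)] nz [OF q(2)] by (metis mult_zero_left)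
  qed
  have "\<exists>t. t \<noteq> 0 \<and> (\<forall>p\<in>A. u p q = \<rho> p * t)" if q: "q \<in> B" for q
  proof -
    have "infinite (A - {p \<in> A. v p q = 0})" using A finA [OF q] by (intro Diff_infinite_finite) auto
    then have "A - {p \<in> A. v p q = 0} \<noteq> {}" by (rule infinite_imp_nonempty)
    then obtain p1 where p1: "p1 \<in> A" "v p1 q \<noteq> 0" by blast
    have "u p q = \<rho> p * (u p1 q / \<rho> p1)" if p: "p \<in> A" for p
    proof -
      obtain r where r: "\<And>q. q \<in> B \<Longrightarrow> v p1 q \<noteq> 0 \<Longrightarrow> u p q = r * u p1 q" using cols' [OF p p1(1)] by blast
      obtain q' where q': "q' \<in> B" "v p1 q' \<noteq> 0" "v p0 q' \<noteq> 0" using generic [OF p1(1) p0] by blast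
      have "\<rho> p * u p0 q' = r * (\<rho> p1 * u p0 q')"
        unfolding \<rho> [OF p q'(1,3), symmetric] \<rho> [OF p1(1) q'(1,3), symmetric] by (rule r [OF q'(1,2)])
      then have "\<rho> p = r * \<rho> p1" using nz [OF q'(3)] by simp
      then show ?thesis using r [OF q p1(2)] \<rho>_nz [OF p1(1)] by simp
    qed
    moreover have "u p1 q / \<rho> p1 \<noteq> 0" using nz [OF p1(2)] \<rho>_nz [OF p1(1)] by simp
    ultimately show ?thesis by blast
  qed
  then have "\<forall>q\<in>B. \<exists>t. t \<noteq> 0 \<and> (\<forall>p\<in>A. u p q = \<rho> p * t)" by blast
  from bchoice [OF this] obtain \<phi> where "\<forall>q\<in>B. \<phi> q \<noteq> 0 \<and> (\<forall>p\<in>A. u p q = \<rho> p * \<phi> q)" ..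
  then show ?thesis using \<rho>_nz by (intro exI [of _ \<rho>] exI [of _ \<phi>]) simp
qed

section \<open>One of the two factors of an affine e has rank one\<close>

locale affine_coefficients = nontrivial_coefficients D pr g l c
  for D :: "bool \<Rightarrow> 'f::field_char_0 set" and pr g l c +
  fixes s :: bool and \<beta> :: 'f
  assumes e_aff: "p \<in> D s \<Longrightarrow> q \<in> D (\<not> s) \<Longrightarrow> e s p q = (1 - \<beta>) * p + \<beta> * q"
begin

text \<open>For n = P - q the weight q + n is P, and the factor \<open>d\<close> of
  \<open>e_cubic\<close> is 2 n, so the relation can be solved for \<open>K s p P\<close>.\<close>

lemma K_affine_aux:
  assumes p: "p \<in> D s" and P: "P \<in> D s" "p \<noteq> P" and q: "q \<in> D (\<not> s)" "e s p q \<noteq> 0" "P \<noteq> q" "p + P \<noteq> 2 * q"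
  shows "K s p P = ((2 - \<beta>) * p + \<beta> * P) * ((2 - \<beta>) * P + \<beta> * p)"
proof -
  define n where "n = P - q"
  have pn: "p + n \<in> D (\<not> s)" "p - n \<in> D (\<not> s)"
    using D_odd [OF p P(1) q(1)] D_par [OF q(1), of p s P] p P(1) unfolding n_def by (simp_all add: algebra_simps)
  have qn: "q - n \<in> D s" "q + n = P"
    using D_diff_odd [OF p pn(1) q(1)] unfolding n_def by simp_all
  have e1: "e s p (p + n) = p + \<beta> * n" "e s p (p - n) = p - \<beta> * n" "e s P (p + n) = (1 - \<beta>) * P + \<beta> * (p + n)"
    "e s P q = (1 - \<beta>) * P + \<beta> * q" "e s (q - n) (p - n) = (1 - \<beta>) * (q - n) + \<beta> * (p - n)"
    "e s (q - n) q = (1 - \<beta>) * (q - n) + \<beta> * q" "e s p q = (1 - \<beta>) * p + \<beta> * q"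
    using e_aff [OF p pn(1)] e_aff [OF p pn(2)] e_aff [OF P(1) pn(1)] e_aff [OF P(1) q(1)]
      e_aff [OF qn(1) pn(2)] e_aff [OF qn(1) q(1)] e_aff [OF p q(1)] by (simp_all add: algebra_simps)
  have "2 * n = 3 * n - (q - p) - e s p (p + n) + e s (q - n) q"
    unfolding e1 by (simp add: algebra_simps)
  moreover have "p + n \<noteq> q" "p \<noteq> q + n" using q(4) P(2) unfolding n_def by (auto simp: algebra_simps)
  ultimately have "(p + \<beta> * n) * ((1 - \<beta>) * P + \<beta> * (p + n)) * ((1 - \<beta>) * P + \<beta> * q)
      - (p - \<beta> * n) * ((1 - \<beta>) * (q - n) + \<beta> * (p - n)) * ((1 - \<beta>) * (q - n) + \<beta> * q)
    = 2 * n * (K s p P - (p + \<beta> * n) * ((1 - \<beta>) * P + \<beta> * (p + n))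
       - ((1 - \<beta>) * p + \<beta> * q) * ((1 - \<beta>) * P + \<beta> * q) - ((1 - \<beta>) * p + \<beta> * q) * (2 * n))"
    using e_cubic [OF p q(1) pn(1) _ _ q(2), of "2 * n"] unfolding qn(2) e1 by simp
  then have "2 * n * (K s p P - ((2 - \<beta>) * p + \<beta> * P) * ((2 - \<beta>) * P + \<beta> * p)) = 0"
    unfolding n_def by algebra
  then show ?thesis using q(3) unfolding n_def by simp
qed

lemma finite_affine_roots: "a \<noteq> 0 \<Longrightarrow> finite {x :: 'f. b + a * x = 0}"
proof -
  assume a: "a \<noteq> 0"
  have "x = - b / a" if "b + a * x = 0" for x
    unfolding nonzero_eq_divide_eq [OF a] eq_neg_iff_add_eq_0 using that by (simp add: algebra_simps)
  then have "{x. b + a * x = 0} \<subseteq> {- b / a}" by blast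
  then show ?thesis using finite_subset by blast
qed

lemma finite_affine_roots': "a \<noteq> 0 \<Longrightarrow> finite {x :: 'f. b = a * x}"
proof -
  assume "a \<noteq> 0"
  then have "{x. b = a * x} \<subseteq> {b / a}" by auto
  then show ?thesis using finite_subset by blast
qed

text \<open>A suitable q exists unless \<beta> = 0 and p = 0, where \<open>e s p\<close> vanishes
  identically. Then P is nonzero, and the symmetry of \<open>K\<close> is used.\<close>

lemma K_affine:
  assumes p: "p \<in> D s" and P: "P \<in> D s" "p \<noteq> P"
  shows "K s p P = ((2 - \<beta>) * p + \<beta> * P) * ((2 - \<beta>) * P + \<beta> * p)"
proof -
  have fin2: "finite {q. p + P = 2 * q}" for p P :: 'f using finite_affine_roots' [of 2] by simp
  have main: "K s p P = ((2 - \<beta>) * p + \<beta> * P) * ((2 - \<beta>) * P + \<beta> * p)"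
    if p: "p \<in> D s" and P: "P \<in> D s" "p \<noteq> P" and ne: "\<beta> \<noteq> 0 \<or> p \<noteq> 0" for p P
  proof -
    have f1: "finite {q. (1 - \<beta>) * p + \<beta> * q = 0}"
    proof (cases "\<beta> = 0")
      case True
      then show ?thesis using ne by simp
    next
      case False
      then show ?thesis by (rule finite_affine_roots)
    qed
    have "finite ({P} \<union> {q. p + P = 2 * q} \<union> {q. (1 - \<beta>) * p + \<beta> * q = 0})"
      using fin2 f1 by simp
    from D_avoid [OF this, of "\<not> s"] obtain q where
      q: "q \<in> D (\<not> s)" "q \<notin> {P} \<union> {q. p + P = 2 * q} \<union> {q. (1 - \<beta>) * p + \<beta> * q = 0}" ..
    have "e s p q \<noteq> 0" "P \<noteq> q" "p + P \<noteq> 2 * q"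
      unfolding e_aff [OF p q(1)] using q(2) by blast+
    with q(1) show ?thesis by (rule K_affine_aux [OF p P])
  qed
  show ?thesis
  proof (cases "\<beta> \<noteq> 0 \<or> p \<noteq> 0")
    case False
    then have "P \<noteq> 0" using P(2) by auto
    then show ?thesis using main [OF P(1) p] P(2) K_commute [of s P p] by (simp add: mult.commute)
  qed (use main assms in blast)
qed

lemma h_conj:
  assumes "p \<in> D s" "P \<in> D s" "p \<noteq> P" "Q \<in> D (\<not> s)"
  shows "h s p Q P + h s p (p + P - Q) P = 2 * l s p P"
  using GG [of p s P Q "p + P - Q"] D_odd [of p s P Q] assms unfolding h_def by simp

text \<open>At the conjugate point p + P - Q the value of \<open>h\<close> is
  \<open>2 * l - h\<close>. Inserted into \<open>h_prod\<close> there, it leaves an equation that is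
  linear in the two unknown \<open>h\<close>, since their product is known as well.\<close>

lemma h_linear:
  assumes "p \<in> D s" "P \<in> D s" "p \<noteq> P" "Q \<in> D (\<not> s)"
  shows "2 * l s p P * h s P Q p + 2 * l s P p * h s p Q P
    = ((2 - \<beta>) * p + \<beta> * P) * e s P Q + ((2 - \<beta>) * P + \<beta> * p) * e s p Q"
proof -
  have Q': "p + P - Q \<in> D (\<not> s)" by (rule D_odd [OF assms(1,2,4)])
  have a: "h s p (p + P - Q) P = 2 * l s p P - h s p Q P"
    using h_conj [OF assms] by (simp add: algebra_simps)
  have b: "h s P (p + P - Q) p = 2 * l s P p - h s P Q p"
    using h_conj [of P p Q] assms by (simp add: algebra_simps)
  have "(2 * l s p P - h s p Q P) * (2 * l s P p - h s P Q p) = e s p (p + P - Q) * e s P (p + P - Q)"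
    unfolding a [symmetric] b [symmetric] by (rule h_prod)
  then have "2 * l s p P * h s P Q p + 2 * l s P p * h s p Q P
     = K s p P + h s p Q P * h s P Q p - e s p (p + P - Q) * e s P (p + P - Q)"
    unfolding K_def by (simp add: algebra_simps)
  then show ?thesis unfolding h_prod K_affine [OF assms(1-3)]
    e_aff [OF assms(1,4)] e_aff [OF assms(2,4)] e_aff [OF assms(1) Q'] e_aff [OF assms(2) Q']
    by (simp add: algebra_simps)
qed

text \<open>\<open>h_linear\<close> and \<open>h_prod\<close> give a quadratic equation for
  \<open>h s p Q P\<close>, and the value of \<open>K\<close> makes it split. If the multipliers of
  \<open>h\<close> are nonzero, then at each single Q the value is a fixed multiple of
  \<open>e s P Q\<close> or a fixed multiple of \<open>e s p Q\<close>.\<close>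

lemma h_quadratic:
  assumes "p \<in> D s" "P \<in> D s" "p \<noteq> P" "Q \<in> D (\<not> s)"
  shows "(((2 - \<beta>) * P + \<beta> * p) * h s p Q P - 2 * l s p P * e s P Q)
    * (((2 - \<beta>) * p + \<beta> * P) * h s p Q P - 2 * l s p P * e s p Q) = 0"
proof -
  have K: "4 * l s p P * l s P p = ((2 - \<beta>) * p + \<beta> * P) * ((2 - \<beta>) * P + \<beta> * p)"
    using K_affine [OF assms(1-3)] unfolding K_def .
  have "(((2 - \<beta>) * P + \<beta> * p) * h s p Q P - 2 * l s p P * e s P Q)
    * (((2 - \<beta>) * p + \<beta> * P) * h s p Q P - 2 * l s p P * e s p Q)
   = ((2 - \<beta>) * p + \<beta> * P) * ((2 - \<beta>) * P + \<beta> * p) * h s p Q P ^ 2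
     - 2 * l s p P * h s p Q P * (((2 - \<beta>) * p + \<beta> * P) * e s P Q + ((2 - \<beta>) * P + \<beta> * p) * e s p Q)
     + 4 * l s p P ^ 2 * (e s p Q * e s P Q)"
    by (simp add: algebra_simps power2_eq_square)
  also have "\<dots> = 0"
    unfolding K [symmetric] h_linear [OF assms, symmetric] h_prod [of s p Q P, symmetric]
    by (simp add: algebra_simps power2_eq_square)
  finally show ?thesis .
qed

lemma LG_double_affine:
  assumes "p \<in> D s" "p + y \<in> D (\<not> s)" "p + m \<in> D s"
  shows "(2 * y + m) * h s p (p + y) (p + m) - (2 * y - m) * h s p (p + m + y) (p + m) = 2 * m * l s p (p + m)"
proof -
  have D: "p + m + y \<in> D (\<not> s)" using D_add_odd [OF assms(1,2,3)] .
  have "2 * l s p (p + m) * (e s p (p + y) - e s (p + m) (p + m + y))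
    = - (2 * y + m) * h s p (p + y) (p + m) + (2 * y - m) * h s p (p + m + y) (p + m)"
    using LG_double [of p s "p + y" p m] assms by (simp add: h_diag algebra_simps)
  moreover have "e s p (p + y) - e s (p + m) (p + m + y) = - m"
    unfolding e_aff [OF assms(1,2)] e_aff [OF assms(3) D] by (simp add: algebra_simps)
  ultimately have "2 * l s p (p + m) * - m
    = - (2 * y + m) * h s p (p + y) (p + m) + (2 * y - m) * h s p (p + m + y) (p + m)"
    by (simp only:)
  then have "2 * m * l s p (p + m) = - (- (2 * y + m) * h s p (p + y) (p + m) + (2 * y - m) * h s p (p + m + y) (p + m))"
    by (metis minus_minus mult.assoc mult.commute mult_minus_right)
  then show ?thesis by (simp add: algebra_simps)
qed

text \<open>\<open>LG_double\<close> for the degree \<mu> is combined with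
  \<open>LG_double_affine\<close> for the degree \<kappa>; the remaining products of two
  \<open>l\<close> form a bracket [L, L], which \<open>LL_off\<close> evaluates. The result connects
  \<open>h s p Q P\<close> with fixed p and P at four points Q.\<close>

lemma three_point_link:
  assumes p: "p \<in> D s" and y: "p + y \<in> D (\<not> s)" and lm: "p + \<kappa> \<in> D s" "p + \<mu> \<in> D s" and ne: "\<kappa> + \<mu> \<noteq> 0"
  defines "P \<equiv> p + \<kappa> + \<mu>"
  shows "(2 * y + \<kappa>) * ((2 * \<kappa> - 2 * y - \<mu>) * h s p (p + y) P + (2 * y - \<mu>) * h s p (p + y + \<mu>) P)
     + (2 * y - \<kappa>) * ((2 * y + \<mu>) * h s p (p + y + \<kappa>) P - (2 * y + 2 * \<kappa> - \<mu>) * h s p (p + y + \<kappa> + \<mu>) P)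
     = 4 * \<kappa> * (\<kappa> - \<mu>) * l s p P"
proof -
  define R p' where "R = p + \<kappa>" and "p' = p + \<mu>"
  have RD: "R \<in> D s" "p' \<in> D s" using lm unfolding R_def p'_def by simp_all
  have PD: "P \<in> D s" using D_even_shift [OF p lm(2) lm(1)] unfolding P_def .
  have PR: "R + \<mu> = P" "p' + \<kappa> = P" unfolding R_def p'_def P_def by simp_all
  have yD: "R + y \<in> D (\<not> s)" "p' + y \<in> D (\<not> s)" using D_add_odd [OF p y] RD by blast+
  have L1: "2 * l s R P * h s p (p + y) R - 2 * l s p p' * h s p' (p' + y) P
     = (2 * \<kappa> - 2 * y - \<mu>) * h s p (p + y) P + (2 * y - \<mu>) * h s p (p + y + \<mu>) P"
    using LG_double [of p s "p + y" R \<mu>] p y RD lm unfolding PR unfolding R_def p'_def P_def by (simp add: algebra_simps)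
  have L2: "2 * l s R P * h s p (R + y) R - 2 * l s p p' * h s p' (P + y) P
     = - (2 * y + \<mu>) * h s p (p + y + \<kappa>) P + (2 * y + 2 * \<kappa> - \<mu>) * h s p (p + y + \<kappa> + \<mu>) P"
    using LG_double [of p s "R + y" R \<mu>] p yD RD lm unfolding PR unfolding R_def p'_def P_def by (simp add: algebra_simps)
  have B1: "(2 * y + \<kappa>) * h s p (p + y) R - (2 * y - \<kappa>) * h s p (R + y) R = 2 * \<kappa> * l s p R"
    using LG_double_affine [OF p y lm(1)] unfolding R_def .
  have B2: "(2 * y + \<kappa>) * h s p' (p' + y) P - (2 * y - \<kappa>) * h s p' (P + y) P = 2 * \<kappa> * l s p' P"
    using LG_double_affine [OF RD(2) yD(2), of \<kappa>] PD unfolding PR by simp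
  have "R + p' = p + P" "p \<noteq> P" using ne unfolding R_def p'_def P_def by (simp_all add: add.assoc)
  then have LLo: "l s R P * l s p R - l s p' P * l s p p' = (\<kappa> - \<mu>) * l s p P"
    using LL_off [OF p PD RD] unfolding R_def p'_def by simp
  have "(2 * y + \<kappa>) * (2 * l s R P * h s p (p + y) R - 2 * l s p p' * h s p' (p' + y) P)
      - (2 * y - \<kappa>) * (2 * l s R P * h s p (R + y) R - 2 * l s p p' * h s p' (P + y) P)
    = 2 * l s R P * ((2 * y + \<kappa>) * h s p (p + y) R - (2 * y - \<kappa>) * h s p (R + y) R)
      - 2 * l s p p' * ((2 * y + \<kappa>) * h s p' (p' + y) P - (2 * y - \<kappa>) * h s p' (P + y) P)"
    by (simp add: algebra_simps)
  also have "\<dots> = 4 * \<kappa> * (l s R P * l s p R - l s p' P * l s p p')"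
    unfolding B1 B2 by (simp add: algebra_simps)
  finally show ?thesis unfolding LLo L1 L2 by (simp add: algebra_simps)
qed

text \<open>Suppose the slope is z at y but z' at y0. For \<kappa> = y0 - y and \<kappa> + \<mu> = S
  the four points of \<open>three_point_link\<close> are y with slope z, y0 with slope z', y + S
  with slope z by \<open>LG_double_affine\<close>, and y + \<mu> with an unknown slope w. The
  choices w = z and w = z' contradict the first and the second inequality.\<close>

lemma slope_transfer:
  assumes p: "p \<in> D s" and P: "p + S \<in> D s" "S \<noteq> 0" and y: "p + y \<in> D (\<not> s)" "2 * y \<noteq> S" and y0: "p + y0 \<in> D (\<not> s)"
    and two: "\<And>x. p + x \<in> D (\<not> s) \<Longrightarrow> h s p (p + x) (p + S) = l s p (p + S) + (2 * x - S) * z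
       \<or> h s p (p + x) (p + S) = l s p (p + S) + (2 * x - S) * z'"
    and z: "h s p (p + y) (p + S) = l s p (p + S) + (2 * y - S) * z" and zz: "z \<noteq> z'"
    and ne1: "(3 * y - y0) * (3 * y + S - y0) * (2 * y0 - S) \<noteq> 0"
    and ne2: "(y + y0) * (y - S + y0) * (4 * y + S - 2 * y0) + (3 * y - y0) * (3 * y + S - y0) * (2 * y0 - S) \<noteq> 0"
  shows "h s p (p + y0) (p + S) = l s p (p + S) + (2 * y0 - S) * z"
proof (rule ccontr)
  assume neg: "\<not> ?thesis"
  define \<kappa> \<mu> where "\<kappa> = y0 - y" and "\<mu> = S - \<kappa>"
  have lm: "p + \<kappa> \<in> D s" unfolding \<kappa>_def using D_par [OF p y0 y(1)] by (simp add: algebra_simps)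
  have lm': "p + \<mu> \<in> D s" unfolding \<mu>_def using D_par [OF p P(1) lm] by (simp add: algebra_simps)
  have PP: "p + \<kappa> + \<mu> = p + S" unfolding \<mu>_def by simp
  have x0: "h s p (p + y + \<kappa>) (p + S) = l s p (p + S) + (2 * y0 - S) * z'"
    using two [OF y0] neg unfolding \<kappa>_def by simp
  have "p + y + \<mu> \<in> D (\<not> s)" using D_even_shift [OF p lm' y(1)] .
  then obtain w where w: "w = z \<or> w = z'" "h s p (p + y + \<mu>) (p + S) = l s p (p + S) + (2 * (y + \<mu>) - S) * w"
    using two [of "y + \<mu>"] by (auto simp: add.assoc)
  have "(2 * y + S) * h s p (p + y) (p + S) - (2 * y - S) * h s p (p + S + y) (p + S) = 2 * S * l s p (p + S)"
    by (rule LG_double_affine [OF p y(1) P(1)])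
  then have "(2 * y - S) * h s p (p + S + y) (p + S) = (2 * y - S) * (l s p (p + S) + (2 * y + S) * z)"
    unfolding z by (simp add: algebra_simps)
  moreover have "2 * y - S \<noteq> 0" using y(2) by simp
  ultimately have "h s p (p + S + y) (p + S) = l s p (p + S) + (2 * y + S) * z"
    by (simp only: mult_cancel_left) simp
  moreover have "p + y + \<kappa> + \<mu> = p + S + y" unfolding \<mu>_def by simp
  ultimately have xS: "h s p (p + y + \<kappa> + \<mu>) (p + S) = l s p (p + S) + (2 * y + S) * z"
    by (simp only:)
  have "\<kappa> + \<mu> \<noteq> 0" using P(2) unfolding \<mu>_def by simp
  from three_point_link [OF p y(1) lm lm' this, unfolded PP] 
  have "(2 * y + \<kappa>) * ((2 * \<kappa> - 2 * y - \<mu>) * (l s p (p + S) + (2 * y - S) * z) + (2 * y - \<mu>) * (l s p (p + S) + (2 * (y + \<mu>) - S) * w))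
     + (2 * y - \<kappa>) * ((2 * y + \<mu>) * (l s p (p + S) + (2 * y0 - S) * z') - (2 * y + 2 * \<kappa> - \<mu>) * (l s p (p + S) + (2 * y + S) * z))
     = 4 * \<kappa> * (\<kappa> - \<mu>) * l s p (p + S)"
    unfolding z x0 xS w(2) .
  then have "(y + y0) * (y - S + y0) * (4 * y + S - 2 * y0) * (w - z) + (3 * y - y0) * (3 * y + S - y0) * (2 * y0 - S) * (z' - z) = 0"
    unfolding \<mu>_def \<kappa>_def by algebra
  then have "(3 * y - y0) * (3 * y + S - y0) * (2 * y0 - S) * (z' - z) = 0
      \<or> ((y + y0) * (y - S + y0) * (4 * y + S - 2 * y0) + (3 * y - y0) * (3 * y + S - y0) * (2 * y0 - S)) * (z' - z) = 0"
    using w(1) by (auto simp only: distrib_right diff_self mult_zero_right add_0_left)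
  then show False using ne1 ne2 zz by (simp only: mult_eq_0_iff) auto
qed

text \<open>The exceptions are zeros of nonzero polynomials in y; the last of these has leading
  coefficient 4.\<close>

lemma cubic_exceptions:
  assumes "2 * y0 \<noteq> S"
  shows "finite {y :: 'f. 2 * y = S \<or> (3 * y - y0) * (3 * y + S - y0) * (2 * y0 - S) = 0
    \<or> (y + y0) * (y - S + y0) * (4 * y + S - 2 * y0) + (3 * y - y0) * (3 * y + S - y0) * (2 * y0 - S) = 0}"
proof -
  have 1: "finite {y :: 'f. 2 * y = S}" using finite_affine_roots' [of 2 S] by (simp add: eq_commute)
  have 2: "finite {y :: 'f. 3 * y - y0 = 0}" using finite_affine_roots [of 3 "- y0"] by simp
  have 3: "finite {y :: 'f. 3 * y + S - y0 = 0}"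
    using finite_affine_roots [of 3 "S - y0"] by (simp add: algebra_simps)
  have 4: "finite {y :: 'f. (y + y0) * (y - S + y0) * (4 * y + S - 2 * y0) + (3 * y - y0) * (3 * y + S - y0) * (2 * y0 - S) = 0}"
  proof (rule ccontr)
    assume inf: "infinite {y :: 'f. (y + y0) * (y - S + y0) * (4 * y + S - 2 * y0) + (3 * y - y0) * (3 * y + S - y0) * (2 * y0 - S) = 0}"
    have "(y0 * (y0 - S) * (S - 2 * y0) - y0 * (S - y0) * (2 * y0 - S))
       + (4 * y0 * (y0 - S) + (2 * y0 - S) * (S - 2 * y0) + (3 * S - 6 * y0) * (2 * y0 - S)) * y
       + (4 * (2 * y0 - S) + (S - 2 * y0) + 9 * (2 * y0 - S)) * y^2 + 4 * y^3 + 0 * y^4 = 0"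
      if "y \<in> {y :: 'f. (y + y0) * (y - S + y0) * (4 * y + S - 2 * y0) + (3 * y - y0) * (3 * y + S - y0) * (2 * y0 - S) = 0}" for y
    proof -
      from that have "(y + y0) * (y - S + y0) * (4 * y + S - 2 * y0) + (3 * y - y0) * (3 * y + S - y0) * (2 * y0 - S) = 0"
        by simp
      then show ?thesis by algebra
    qed
    from poly4_vanishing(4) [OF inf this] show False by simp
  qed
  have "{y :: 'f. 2 * y = S \<or> (3 * y - y0) * (3 * y + S - y0) * (2 * y0 - S) = 0
    \<or> (y + y0) * (y - S + y0) * (4 * y + S - 2 * y0) + (3 * y - y0) * (3 * y + S - y0) * (2 * y0 - S) = 0}
    \<subseteq> {y. 2 * y = S} \<union> {y. 3 * y - y0 = 0} \<union> {y. 3 * y + S - y0 = 0}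
      \<union> {y. (y + y0) * (y - S + y0) * (4 * y + S - 2 * y0) + (3 * y - y0) * (3 * y + S - y0) * (2 * y0 - S) = 0}"
    using assms by auto
  then show ?thesis by (rule finite_subset) (use 1 2 3 4 in simp)
qed

lemma slope_constant:
  assumes p: "p \<in> D s" and P: "p + S \<in> D s" "S \<noteq> 0"
    and two: "\<And>x. p + x \<in> D (\<not> s) \<Longrightarrow> h s p (p + x) (p + S) = l s p (p + S) + (2 * x - S) * z
       \<or> h s p (p + x) (p + S) = l s p (p + S) + (2 * x - S) * z'" and zz: "z \<noteq> z'"
  shows "(\<forall>x. p + x \<in> D (\<not> s) \<longrightarrow> h s p (p + x) (p + S) = l s p (p + S) + (2 * x - S) * z)
    \<or> (\<forall>x. p + x \<in> D (\<not> s) \<longrightarrow> h s p (p + x) (p + S) = l s p (p + S) + (2 * x - S) * z')"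
proof (rule ccontr)
  assume "\<not> ?thesis"
  then obtain y0 y1 where y0: "p + y0 \<in> D (\<not> s)" "h s p (p + y0) (p + S) \<noteq> l s p (p + S) + (2 * y0 - S) * z"
    and y1: "p + y1 \<in> D (\<not> s)" "h s p (p + y1) (p + S) \<noteq> l s p (p + S) + (2 * y1 - S) * z'" by blast
  have ne: "2 * y0 \<noteq> S" "2 * y1 \<noteq> S" using two [OF y0(1)] two [OF y1(1)] y0(2) y1(2) by auto
  let ?X = "\<lambda>y0. {y. 2 * y = S \<or> (3 * y - y0) * (3 * y + S - y0) * (2 * y0 - S) = 0
    \<or> (y + y0) * (y - S + y0) * (4 * y + S - 2 * y0) + (3 * y - y0) * (3 * y + S - y0) * (2 * y0 - S) = 0}"
  have "finite ((\<lambda>y. p + y) ` (?X y0 \<union> ?X y1))"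
    using cubic_exceptions [OF ne(1)] cubic_exceptions [OF ne(2)] by simp
  from D_avoid [OF this, of "\<not> s"] obtain q where q: "q \<in> D (\<not> s)" "q \<notin> (\<lambda>y. p + y) ` (?X y0 \<union> ?X y1)" ..
  define y where "y = q - p"
  have y: "p + y \<in> D (\<not> s)" using q(1) unfolding y_def by simp
  have "y \<notin> ?X y0 \<union> ?X y1" using q(2) unfolding y_def by (metis (no_types, lifting) add_diff_cancel_left' diff_add_cancel image_eqI add.commute)
  then have c: "2 * y \<noteq> S" "(3 * y - y0) * (3 * y + S - y0) * (2 * y0 - S) \<noteq> 0"
    "(y + y0) * (y - S + y0) * (4 * y + S - 2 * y0) + (3 * y - y0) * (3 * y + S - y0) * (2 * y0 - S) \<noteq> 0"
    "(3 * y - y1) * (3 * y + S - y1) * (2 * y1 - S) \<noteq> 0"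
    "(y + y1) * (y - S + y1) * (4 * y + S - 2 * y1) + (3 * y - y1) * (3 * y + S - y1) * (2 * y1 - S) \<noteq> 0"
    by simp_all
  from two [OF y] show False
  proof
    assume "h s p (p + y) (p + S) = l s p (p + S) + (2 * y - S) * z"
    from slope_transfer [OF p P y c(1) y0(1) two this zz c(2,3)] y0(2) show False by simp
  next
    assume "h s p (p + y) (p + S) = l s p (p + S) + (2 * y - S) * z'"
    from slope_transfer [OF p P y c(1) y1(1) _ this zz [symmetric] c(4,5)] two y1(2) show False by blast
  qed
qed

lemma e_value:
  assumes "p \<in> D s" "P \<in> D s" "p + x \<in> D (\<not> s)"
  shows "2 * e s P (p + x) = ((2 - \<beta>) * P + \<beta> * p) + (2 * x - (P - p)) * \<beta>"
    "2 * e s p (p + x) = ((2 - \<beta>) * p + \<beta> * P) + (2 * x - (P - p)) * \<beta>"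
  unfolding e_aff [OF assms(2,3)] e_aff [OF assms(1,3)] by (simp_all add: algebra_simps)

text \<open>\<open>h_quadratic\<close> leaves the choice open for each Q, and
  \<open>slope_constant\<close> makes it uniform if \<open>EP\<close> and \<open>Ep\<close> are both
  nonzero. As \<beta> \<noteq> 1, at most one of them vanishes. If one does, the product of the two
  opposite \<open>l\<close> is 0: for \<open>l s p P = 0\<close> the linear relation gives
  \<open>h\<close>, otherwise the quadratic one does, except at the midpoint of p and P, where
  \<open>h = l\<close>.\<close>

lemma h_dichotomy:
  assumes \<beta>: "\<beta> \<noteq> 0" "\<beta> \<noteq> 1" and p: "p \<in> D s" and P: "P \<in> D s" "p \<noteq> P"
  shows "(\<exists>r. \<forall>Q\<in>D (\<not> s). h s p Q P = r * e s P Q) \<or> (\<exists>r. \<forall>Q\<in>D (\<not> s). h s p Q P = r * e s p Q)"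
proof -
  define EP Ep where "EP = (2 - \<beta>) * P + \<beta> * p" and "Ep = (2 - \<beta>) * p + \<beta> * P"
  define S where "S = P - p"
  have PS: "p + S = P" "S \<noteq> 0" using P unfolding S_def by simp_all
  have E_ne: "EP \<noteq> Ep"
  proof
    assume "EP = Ep"
    then have "2 * ((1 - \<beta>) * (P - p)) = 0" unfolding EP_def Ep_def by (simp add: algebra_simps)
    then show False using \<beta>(2) P(2) by simp
  qed
  have K: "4 * l s p P * l s P p = Ep * EP" using K_affine [OF p P] unfolding K_def EP_def Ep_def .
  have quad: "EP * h s p Q P = 2 * l s p P * e s P Q \<or> Ep * h s p Q P = 2 * l s p P * e s p Q"
    if "Q \<in> D (\<not> s)" for Q
    using h_quadratic [OF p P that] unfolding EP_def Ep_def by simp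
  have lin: "2 * l s p P * h s P Q p + 2 * l s P p * h s p Q P = Ep * e s P Q + EP * e s p Q"
    if "Q \<in> D (\<not> s)" for Q
    using h_linear [OF p P that] unfolding EP_def Ep_def .
  have middle: "h s p Q P = l s p P" if Q: "Q \<in> D (\<not> s)" "2 * Q = p + P" for Q
  proof -
    have "p + P - Q = Q" unfolding Q(2) [symmetric] by simp
    then have "2 * h s p Q P = 2 * l s p P" using h_conj [OF p P Q(1)] by simp
    then show ?thesis by simp
  qed
  consider "EP \<noteq> 0" "Ep \<noteq> 0" | "EP = 0" "Ep \<noteq> 0" | "EP \<noteq> 0" "Ep = 0" using E_ne by auto
  then show ?thesis
  proof cases
    case 1
    have l0: "l s p P \<noteq> 0" using K 1 by auto
    define z z' where "z = l s p P * \<beta> / EP" and "z' = l s p P * \<beta> / Ep"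
    have v1: "l s p P + (2 * x - S) * z = 2 * l s p P * e s P (p + x) / EP" if "p + x \<in> D (\<not> s)" for x
    proof -
      have "2 * l s p P * e s P (p + x) = l s p P * (EP + (2 * x - S) * \<beta>)"
        using e_value(1) [OF p P(1) that] unfolding EP_def S_def by (simp add: mult.commute mult.left_commute)
      then show ?thesis using 1(1) unfolding z_def by (simp add: field_simps)
    qed
    have v2: "l s p P + (2 * x - S) * z' = 2 * l s p P * e s p (p + x) / Ep" if "p + x \<in> D (\<not> s)" for x
    proof -
      have "2 * l s p P * e s p (p + x) = l s p P * (Ep + (2 * x - S) * \<beta>)"
        using e_value(2) [OF p P(1) that] unfolding Ep_def S_def by (simp add: mult.commute mult.left_commute)
      then show ?thesis using 1(2) unfolding z'_def by (simp add: field_simps)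
    qed
    have two: "h s p (p + x) (p + S) = l s p (p + S) + (2 * x - S) * z
       \<or> h s p (p + x) (p + S) = l s p (p + S) + (2 * x - S) * z'" if x: "p + x \<in> D (\<not> s)" for x
      unfolding PS v1 [OF x] v2 [OF x] using quad [OF x] 1 by (simp add: nonzero_eq_divide_eq mult.commute)
    have zz: "z \<noteq> z'" using E_ne l0 \<beta>(1) 1 unfolding z_def z'_def by (simp add: frac_eq_eq)
    have pP: "p + S \<in> D s" using P PS by simp
    from slope_constant [OF p pP PS(2) two zz, unfolded PS]
    show ?thesis
    proof
      assume a: "\<forall>x. p + x \<in> D (\<not> s) \<longrightarrow> h s p (p + x) P = l s p P + (2 * x - S) * z"
      have "h s p Q P = (2 * l s p P / EP) * e s P Q" if "Q \<in> D (\<not> s)" for Q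
        using a [rule_format, of "Q - p"] v1 [of "Q - p"] that by simp
      then show ?thesis by blast
    next
      assume a: "\<forall>x. p + x \<in> D (\<not> s) \<longrightarrow> h s p (p + x) P = l s p P + (2 * x - S) * z'"
      have "h s p Q P = (2 * l s p P / Ep) * e s p Q" if "Q \<in> D (\<not> s)" for Q
        using a [rule_format, of "Q - p"] v2 [of "Q - p"] that by simp
      then show ?thesis by blast
    qed
  next
    case 2
    show ?thesis
    proof (cases "l s p P = 0")
      case True
      have l: "2 * l s P p * h s p Q P = Ep * e s P Q" if "Q \<in> D (\<not> s)" for Q using lin [OF that] True 2 by simp
      have "l s P p \<noteq> 0"
      proof
        assume 0: "l s P p = 0"
        have "finite {q. (1 - \<beta>) * P + \<beta> * q = 0}" by (rule finite_affine_roots [OF \<beta>(1)])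
        from D_avoid [OF this, of "\<not> s"] obtain Q where "Q \<in> D (\<not> s)" "Q \<notin> {q. (1 - \<beta>) * P + \<beta> * q = 0}" ..
        then show False using l [of Q] 0 2 e_aff [OF P(1), of Q] by simp
      qed
      then have "h s p Q P = (Ep / (2 * l s P p)) * e s P Q" if "Q \<in> D (\<not> s)" for Q
        using l [OF that] by (simp add: nonzero_eq_divide_eq mult.commute)
      then show ?thesis by blast
    next
      case False
      have "h s p Q P = (2 * l s p P / Ep) * e s p Q" if Q: "Q \<in> D (\<not> s)" for Q
      proof (cases "e s P Q = 0")
        case True
        have "EP + (2 * (Q - p) - (P - p)) * \<beta> = 0"
          using e_value(1) [OF p P(1), of "Q - p"] Q True unfolding EP_def by simp
        then have "(2 * Q - (p + P)) * \<beta> = 0" using 2(1) by (simp add: algebra_simps)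
        then have m: "2 * Q = p + P" using \<beta>(1) by simp
        then have "2 * e s p Q = Ep" using e_value(2) [OF p P(1), of "Q - p"] Q unfolding Ep_def by simp
        then show ?thesis using middle [OF Q m] 2(2) by (simp add: field_simps)
      next
        case nz: False
        then have "Ep * h s p Q P = 2 * l s p P * e s p Q" using quad [OF Q] 2(1) False by auto
        then show ?thesis using 2(2) by (simp add: nonzero_eq_divide_eq mult.commute)
      qed
      then show ?thesis by blast
    qed
  next
    case 3
    show ?thesis
    proof (cases "l s p P = 0")
      case True
      have l: "2 * l s P p * h s p Q P = EP * e s p Q" if "Q \<in> D (\<not> s)" for Q using lin [OF that] True 3 by simp
      have "l s P p \<noteq> 0"
      proof
        assume 0: "l s P p = 0"
        have "finite {q. (1 - \<beta>) * p + \<beta> * q = 0}" by (rule finite_affine_roots [OF \<beta>(1)])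
        from D_avoid [OF this, of "\<not> s"] obtain Q where "Q \<in> D (\<not> s)" "Q \<notin> {q. (1 - \<beta>) * p + \<beta> * q = 0}" ..
        then show False using l [of Q] 0 3 e_aff [OF p, of Q] by simp
      qed
      then have "h s p Q P = (EP / (2 * l s P p)) * e s p Q" if "Q \<in> D (\<not> s)" for Q
        using l [OF that] by (simp add: nonzero_eq_divide_eq mult.commute)
      then show ?thesis by blast
    next
      case False
      have "h s p Q P = (2 * l s p P / EP) * e s P Q" if Q: "Q \<in> D (\<not> s)" for Q
      proof (cases "e s p Q = 0")
        case True
        have "Ep + (2 * (Q - p) - (P - p)) * \<beta> = 0"
          using e_value(2) [OF p P(1), of "Q - p"] Q True unfolding Ep_def by simp
        then have "(2 * Q - (p + P)) * \<beta> = 0" using 3(2) by (simp add: algebra_simps)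
        then have m: "2 * Q = p + P" using \<beta>(1) by simp
        then have "2 * e s P Q = EP" using e_value(1) [OF p P(1), of "Q - p"] Q unfolding EP_def by simp
        then show ?thesis using middle [OF Q m] 3(1) by (simp add: field_simps)
      next
        case nz: False
        then have "EP * h s p Q P = 2 * l s p P * e s P Q" using quad [OF Q] 3(2) False by auto
        then show ?thesis using 3(1) by (simp add: nonzero_eq_divide_eq mult.commute)
      qed
      then show ?thesis by blast
    qed
  qed
qed

text \<open>\<open>FC\<close> compares the coefficients out of p and out of P, \<open>GC\<close>
  those into p and into P. Finitely many exceptions are allowed because the comparison is known only
  where \<open>e\<close> does not vanish; in this form both relations are symmetric and
  transitive.\<close>

definition FC :: "'f \<Rightarrow> 'f \<Rightarrow> bool" where
  "FC p P \<longleftrightarrow> (\<exists>k. k \<noteq> 0 \<and> finite {Q \<in> D (\<not> s). g s p Q \<noteq> k * g s P Q})"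

definition GC :: "'f \<Rightarrow> 'f \<Rightarrow> bool" where
  "GC p P \<longleftrightarrow> (\<exists>k. k \<noteq> 0 \<and> finite {Q \<in> D (\<not> s). g (\<not> s) Q p \<noteq> k * g (\<not> s) Q P})"

lemma cofinitely_proportional_sym:
  fixes u w :: "'f \<Rightarrow> 'f"
  assumes "\<exists>k. k \<noteq> 0 \<and> finite {Q \<in> B. u Q \<noteq> k * w Q}"
  shows "\<exists>k. k \<noteq> 0 \<and> finite {Q \<in> B. w Q \<noteq> k * u Q}"
proof -
  obtain k where k: "k \<noteq> 0" "finite {Q \<in> B. u Q \<noteq> k * w Q}" using assms by blast
  have "{Q \<in> B. w Q \<noteq> (1 / k) * u Q} \<subseteq> {Q \<in> B. u Q \<noteq> k * w Q}" using k(1) by auto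
  then have "finite {Q \<in> B. w Q \<noteq> (1 / k) * u Q}" using k(2) finite_subset by blast
  moreover have "1 / k \<noteq> 0" using k(1) by simp
  ultimately show ?thesis by blast
qed

lemma cofinitely_proportional_trans:
  fixes u v w :: "'f \<Rightarrow> 'f"
  assumes "\<exists>k. k \<noteq> 0 \<and> finite {Q \<in> B. u Q \<noteq> k * v Q}" "\<exists>k. k \<noteq> 0 \<and> finite {Q \<in> B. v Q \<noteq> k * w Q}"
  shows "\<exists>k. k \<noteq> 0 \<and> finite {Q \<in> B. u Q \<noteq> k * w Q}"
proof -
  obtain k where k: "k \<noteq> 0" "finite {Q \<in> B. u Q \<noteq> k * v Q}" using assms by blast
  obtain j where j: "j \<noteq> 0" "finite {Q \<in> B. v Q \<noteq> j * w Q}" using assms by blast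
  have "{Q \<in> B. u Q \<noteq> (k * j) * w Q} \<subseteq> {Q \<in> B. u Q \<noteq> k * v Q} \<union> {Q \<in> B. v Q \<noteq> j * w Q}" by auto
  then have "finite {Q \<in> B. u Q \<noteq> (k * j) * w Q}" using k(2) j(2) finite_subset by blast
  moreover have "k * j \<noteq> 0" using k(1) j(1) by simp
  ultimately show ?thesis by blast
qed

lemma finite_e_roots:
  assumes "\<beta> \<noteq> 0" "p \<in> D s"
  shows "finite {Q \<in> D (\<not> s). e s p Q = 0}"
proof (rule finite_subset [OF _ finite_affine_roots [OF assms(1)]])
  show "{Q \<in> D (\<not> s). e s p Q = 0} \<subseteq> {Q. (1 - \<beta>) * p + \<beta> * Q = 0}" using e_aff [OF assms(2)] by auto
qed

lemma finite_e_roots':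
  assumes "\<beta> \<noteq> 1" "Q \<in> D (\<not> s)"
  shows "finite {p \<in> D s. e s p Q = 0}"
proof (rule finite_subset)
  have "1 - \<beta> \<noteq> 0" using assms by simp
  then show "finite {p. \<beta> * Q + (1 - \<beta>) * p = 0}" by (rule finite_affine_roots)
  show "{p \<in> D s. e s p Q = 0} \<subseteq> {p. \<beta> * Q + (1 - \<beta>) * p = 0}" using e_aff [OF _ assms(2)] by (auto simp: add.commute)
qed

text \<open>Both together make \<open>e s p Q\<close> a constant multiple of \<open>e s P Q\<close>
  for almost all Q. For \<beta> \<noteq> 0 the multiple is 1, and for \<beta> \<noteq> 1 this forces
  p = P.\<close>

lemma FC_GC_exclusive:
  assumes \<beta>: "\<beta> \<noteq> 0" "\<beta> \<noteq> 1" and p: "p \<in> D s" "P \<in> D s" "p \<noteq> P" and FG: "FC p P" "GC p P"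
  shows False
proof -
  obtain k where k: "finite {Q \<in> D (\<not> s). g s p Q \<noteq> k * g s P Q}" using FG(1) unfolding FC_def by blast
  obtain j where j: "finite {Q \<in> D (\<not> s). g (\<not> s) Q p \<noteq> j * g (\<not> s) Q P}" using FG(2) unfolding GC_def by blast
  define X where "X = D (\<not> s) - ({Q \<in> D (\<not> s). g s p Q \<noteq> k * g s P Q} \<union> {Q \<in> D (\<not> s). g (\<not> s) Q p \<noteq> j * g (\<not> s) Q P})"
  have inf: "infinite X" unfolding X_def using k j D_infinite by (intro Diff_infinite_finite) auto
  have "(1 - \<beta>) * (p - k * j * P) + \<beta> * (1 - k * j) * Q + 0 * Q^2 + 0 * Q^3 + 0 * Q^4 = 0" if "Q \<in> X" for Q
  proof -
    have Q: "Q \<in> D (\<not> s)" "g s p Q = k * g s P Q" "g (\<not> s) Q p = j * g (\<not> s) Q P" using that unfolding X_def by auto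
    have "e s p Q = k * j * e s P Q" unfolding e_def Q by simp
    then show ?thesis unfolding e_aff [OF p(1) Q(1)] e_aff [OF p(2) Q(1)] by (simp add: algebra_simps)
  qed
  from poly4_vanishing(1,2) [OF inf this] \<beta> p(3) show False by auto
qed

text \<open>\<open>two_equivalences_cover\<close> gives one kind of cofinite proportionality for all
  pairs. By exclusivity no pair can be of the other kind only, and this returns the exact statement
  at every Q.\<close>

lemma columns_proportional:
  assumes \<beta>: "\<beta> \<noteq> 0" "\<beta> \<noteq> 1"
  shows "(\<forall>p\<in>D s. \<forall>P\<in>D s. p \<noteq> P \<longrightarrow> (\<exists>r. \<forall>Q\<in>D (\<not> s). h s p Q P = r * e s P Q))
    \<or> (\<forall>p\<in>D s. \<forall>P\<in>D s. p \<noteq> P \<longrightarrow> (\<exists>r. \<forall>Q\<in>D (\<not> s). h s p Q P = r * e s p Q))"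
proof -
  have generic: "\<exists>Q\<in>D (\<not> s). e s p Q \<noteq> 0 \<and> e s P Q \<noteq> 0" if "p \<in> D s" "P \<in> D s" for p P
  proof -
    have "finite ({Q \<in> D (\<not> s). e s p Q = 0} \<union> {Q \<in> D (\<not> s). e s P Q = 0})"
      using finite_e_roots [OF \<beta>(1)] that by simp
    from D_avoid [OF this, of "\<not> s"] show ?thesis by blast
  qed
  have F: "FC p P" if p: "p \<in> D s" "P \<in> D s" and r: "\<And>Q. Q \<in> D (\<not> s) \<Longrightarrow> h s p Q P = r * e s P Q" for p P r
  proof -
    obtain Q where Q: "Q \<in> D (\<not> s)" "e s p Q \<noteq> 0" "e s P Q \<noteq> 0" using generic [OF p] by blast
    have "r \<noteq> 0" using h_prod [of s p Q P] r [OF Q(1)] Q(2,3) by auto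
    moreover have "finite {Q \<in> D (\<not> s). g s p Q \<noteq> r * g s P Q}"
    proof (rule finite_subset [OF _ finite_e_roots [OF \<beta>(1) p(2)]])
      show "{Q \<in> D (\<not> s). g s p Q \<noteq> r * g s P Q} \<subseteq> {Q \<in> D (\<not> s). e s P Q = 0}"
        using r unfolding h_def e_def by auto
    qed
    ultimately show ?thesis unfolding FC_def by blast
  qed
  have G: "GC P p" if p: "p \<in> D s" "P \<in> D s" and r: "\<And>Q. Q \<in> D (\<not> s) \<Longrightarrow> h s p Q P = r * e s p Q" for p P r
  proof -
    obtain Q where Q: "Q \<in> D (\<not> s)" "e s p Q \<noteq> 0" "e s P Q \<noteq> 0" using generic [OF p] by blast
    have "r \<noteq> 0" using h_prod [of s p Q P] r [OF Q(1)] Q(2,3) by auto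
    moreover have "finite {Q \<in> D (\<not> s). g (\<not> s) Q P \<noteq> r * g (\<not> s) Q p}"
    proof (rule finite_subset [OF _ finite_e_roots [OF \<beta>(1) p(1)]])
      show "{Q \<in> D (\<not> s). g (\<not> s) Q P \<noteq> r * g (\<not> s) Q p} \<subseteq> {Q \<in> D (\<not> s). e s p Q = 0}"
        using r unfolding h_def e_def by auto
    qed
    ultimately show ?thesis unfolding GC_def by blast
  qed
  have symF: "FC y x" if "FC x y" for x y
    using cofinitely_proportional_sym [of "D (\<not> s)" "g s x" "g s y"] that unfolding FC_def by blast
  have symG: "GC y x" if "GC x y" for x y
    using cofinitely_proportional_sym [of "D (\<not> s)" "\<lambda>Q. g (\<not> s) Q x" "\<lambda>Q. g (\<not> s) Q y"] that unfolding GC_def by blast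
  have transF: "FC x z" if "FC x y" "FC y z" for x y z
    using cofinitely_proportional_trans [of "D (\<not> s)" "g s x" "g s y" "g s z"] that unfolding FC_def by blast
  have transG: "GC x z" if "GC x y" "GC y z" for x y z
    using cofinitely_proportional_trans [of "D (\<not> s)" "\<lambda>Q. g (\<not> s) Q x" "\<lambda>Q. g (\<not> s) Q y" "\<lambda>Q. g (\<not> s) Q z"]
      that unfolding GC_def by blast
  have cover: "FC x y \<or> GC x y" if xy: "x \<in> D s" "y \<in> D s" "x \<noteq> y" for x y
  proof -
    from h_dichotomy [OF \<beta> xy] show ?thesis
    proof
      assume "\<exists>r. \<forall>Q\<in>D (\<not> s). h s x Q y = r * e s y Q"
      then obtain r where "\<And>Q. Q \<in> D (\<not> s) \<Longrightarrow> h s x Q y = r * e s y Q" by blast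
      from F [OF xy(1,2) this] show ?thesis ..
    next
      assume "\<exists>r. \<forall>Q\<in>D (\<not> s). h s x Q y = r * e s x Q"
      then obtain r where "\<And>Q. Q \<in> D (\<not> s) \<Longrightarrow> h s x Q y = r * e s x Q" by blast
      from G [OF xy(1,2) this] symG show ?thesis by blast
    qed
  qed
  have "(\<forall>x\<in>D s. \<forall>y\<in>D s. x \<noteq> y \<longrightarrow> FC x y) \<or> (\<forall>x\<in>D s. \<forall>y\<in>D s. x \<noteq> y \<longrightarrow> GC x y)"
    by (rule two_equivalences_cover) (fact symF transF symG transG cover)+
  then show ?thesis
  proof
    assume all: "\<forall>x\<in>D s. \<forall>y\<in>D s. x \<noteq> y \<longrightarrow> FC x y"
    have "\<exists>r. \<forall>Q\<in>D (\<not> s). h s p Q P = r * e s P Q" if pP: "p \<in> D s" "P \<in> D s" "p \<noteq> P" for p P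
    proof (rule ccontr)
      assume "\<not> ?thesis"
      then obtain r where "\<And>Q. Q \<in> D (\<not> s) \<Longrightarrow> h s p Q P = r * e s p Q" using h_dichotomy [OF \<beta> pP] by blast
      then have "GC p P" using G [OF pP(1,2)] symG by blast
      then show False using FC_GC_exclusive [OF \<beta> pP] all pP by blast
    qed
    then show ?thesis by blast
  next
    assume all: "\<forall>x\<in>D s. \<forall>y\<in>D s. x \<noteq> y \<longrightarrow> GC x y"
    have "\<exists>r. \<forall>Q\<in>D (\<not> s). h s p Q P = r * e s p Q" if pP: "p \<in> D s" "P \<in> D s" "p \<noteq> P" for p P
    proof (rule ccontr)
      assume "\<not> ?thesis"
      then obtain r where "\<And>Q. Q \<in> D (\<not> s) \<Longrightarrow> h s p Q P = r * e s P Q" using h_dichotomy [OF \<beta> pP] by blast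
      then have "FC p P" using F [OF pP(1,2)] by blast
      then show False using FC_GC_exclusive [OF \<beta> pP] all pP by blast
    qed
    then show ?thesis by blast
  qed
qed

lemma rank_one_generic:
  assumes \<beta>: "\<beta> \<noteq> 0" "\<beta> \<noteq> 1"
  shows "\<exists>\<rho> \<phi>. (\<forall>p\<in>D s. \<rho> p \<noteq> 0) \<and> (\<forall>q\<in>D (\<not> s). \<phi> q \<noteq> 0) \<and>
    ((\<forall>p\<in>D s. \<forall>q\<in>D (\<not> s). g s p q = \<rho> p * \<phi> q) \<or> (\<forall>p\<in>D s. \<forall>q\<in>D (\<not> s). g (\<not> s) q p = \<rho> p * \<phi> q))"
  using columns_proportional [OF \<beta>]
proof
  assume F: "\<forall>p\<in>D s. \<forall>P\<in>D s. p \<noteq> P \<longrightarrow> (\<exists>r. \<forall>Q\<in>D (\<not> s). h s p Q P = r * e s P Q)"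
  have "\<exists>\<rho> \<phi>. (\<forall>p\<in>D s. \<rho> p \<noteq> 0) \<and> (\<forall>q\<in>D (\<not> s). \<phi> q \<noteq> 0) \<and> (\<forall>p\<in>D s. \<forall>q\<in>D (\<not> s). g s p q = \<rho> p * \<phi> q)"
  proof (rule rank_one_factorization [where v = "e s"])
    fix p P assume pP: "p \<in> D s" "P \<in> D s" "p \<noteq> P"
    then obtain r where r: "\<And>Q. Q \<in> D (\<not> s) \<Longrightarrow> h s p Q P = r * e s P Q" using F by blast
    have "g s p q = r * g s P q" if "q \<in> D (\<not> s)" "e s P q \<noteq> 0" for q
      using r [OF that(1)] that(2) unfolding h_def e_def by simp
    then show "\<exists>r. \<forall>q\<in>D (\<not> s). e s P q \<noteq> 0 \<longrightarrow> g s p q = r * g s P q" by blast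
  qed (use D_infinite finite_e_roots [OF \<beta>(1)] finite_e_roots' [OF \<beta>(2)] in \<open>auto simp: e_def\<close>)
  then show ?thesis by blast
next
  assume G: "\<forall>p\<in>D s. \<forall>P\<in>D s. p \<noteq> P \<longrightarrow> (\<exists>r. \<forall>Q\<in>D (\<not> s). h s p Q P = r * e s p Q)"
  have "\<exists>\<rho> \<phi>. (\<forall>p\<in>D s. \<rho> p \<noteq> 0) \<and> (\<forall>q\<in>D (\<not> s). \<phi> q \<noteq> 0) \<and> (\<forall>p\<in>D s. \<forall>q\<in>D (\<not> s). g (\<not> s) q p = \<rho> p * \<phi> q)"
  proof (rule rank_one_factorization [where v = "e s"])
    fix p P assume pP: "p \<in> D s" "P \<in> D s" "p \<noteq> P"
    then obtain r where r: "\<And>Q. Q \<in> D (\<not> s) \<Longrightarrow> h s P Q p = r * e s P Q" using G by metis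
    have "g (\<not> s) q p = r * g (\<not> s) q P" if "q \<in> D (\<not> s)" "e s P q \<noteq> 0" for q
      using r [OF that(1)] that(2) unfolding h_def e_def by simp
    then show "\<exists>r. \<forall>q\<in>D (\<not> s). e s P q \<noteq> 0 \<longrightarrow> g (\<not> s) q p = r * g (\<not> s) q P" by blast
  qed (use D_infinite finite_e_roots [OF \<beta>(1)] finite_e_roots' [OF \<beta>(2)] in \<open>auto simp: e_def\<close>)
  then show ?thesis by blast
qed

text \<open>For \<beta> = 0 both factors of \<open>h_quadratic\<close> are nonzero multiples of h -
  l, so \<open>h = l\<close> and there is no choice to be made. The weight 0 is left out because
  \<open>e\<close> vanishes on its edges.\<close>

lemma rank_one_degenerate:
  assumes \<beta>: "\<beta> = 0"
  shows "\<exists>\<rho> \<phi>. (\<forall>p\<in>D s - {0}. \<rho> p \<noteq> 0) \<and> (\<forall>q\<in>D (\<not> s). \<phi> q \<noteq> 0) \<and>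
    (\<forall>p\<in>D s - {0}. \<forall>q\<in>D (\<not> s). g s p q = \<rho> p * \<phi> q)"
proof (rule rank_one_factorization [where v = "e s"])
  have e: "e s p q = p" if "p \<in> D s" "q \<in> D (\<not> s)" for p q using e_aff [OF that] \<beta> by simp
  fix p P assume pP: "p \<in> D s - {0}" "P \<in> D s - {0}" "p \<noteq> P"
  have "g s p q = (l s p P / P) * g s P q" if q: "q \<in> D (\<not> s)" "e s P q \<noteq> 0" for q
  proof -
    have "(2 * P * (h s p q P - l s p P)) * (2 * p * (h s p q P - l s p P)) = 0"
      using h_quadratic [of p P q] pP q(1) e \<beta> by (simp add: algebra_simps)
    then have "h s p q P = l s p P" using pP by simp
    moreover have "g s P q * g (\<not> s) q P = P" using e [of P q] pP q(1) unfolding e_def by simp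
    ultimately have "g s p q * P = l s p P * g s P q" unfolding h_def
      by (metis mult.assoc mult.commute)
    then show ?thesis using pP by (simp add: field_simps)
  qed
  then show "\<exists>r. \<forall>q\<in>D (\<not> s). e s P q \<noteq> 0 \<longrightarrow> g s p q = r * g s P q" by blast
next
  have e: "e s p q = p" if "p \<in> D s" "q \<in> D (\<not> s)" for p q using e_aff [OF that] \<beta> by simp
  show "finite {q \<in> D (\<not> s). e s p q = 0}" if "p \<in> D s - {0}" for p
  proof -
    have "{q \<in> D (\<not> s). e s p q = 0} = {}" using e that by auto
    then show ?thesis by (simp only: finite.emptyI)
  qed
  show "finite {p \<in> D s - {0}. e s p q = 0}" if "q \<in> D (\<not> s)" for q
  proof -
    have "{p \<in> D s - {0}. e s p q = 0} = {}" using e that by auto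
    then show ?thesis by (simp only: finite.emptyI)
  qed
qed (use D_infinite in \<open>auto simp: e_def\<close>)

end

section \<open>Coefficients at the weight 0 in the degenerate case\<close>

locale degenerate_coefficients = nontrivial_coefficients D pr g l c
  for D :: "bool \<Rightarrow> 'f::field_char_0 set" and pr g l c +
  fixes s :: bool and \<rho> \<phi> :: "'f \<Rightarrow> 'f"
  assumes e_deg: "p \<in> D s \<Longrightarrow> q \<in> D (\<not> s) \<Longrightarrow> e s p q = p"
    and \<rho>: "p \<in> D s \<Longrightarrow> p \<noteq> 0 \<Longrightarrow> \<rho> p \<noteq> 0" and \<phi>: "q \<in> D (\<not> s) \<Longrightarrow> \<phi> q \<noteq> 0"
    and g_deg: "p \<in> D s \<Longrightarrow> p \<noteq> 0 \<Longrightarrow> q \<in> D (\<not> s) \<Longrightarrow> g s p q = \<rho> p * \<phi> q"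
    and zero: "0 \<in> D s"
begin

lemma g_back: "p \<in> D s \<Longrightarrow> p \<noteq> 0 \<Longrightarrow> q \<in> D (\<not> s) \<Longrightarrow> g (\<not> s) q p = p / (\<rho> p * \<phi> q)"
  using e_deg [of p q] g_deg [of p q] \<rho> [of p] \<phi> [of q] unfolding e_def
  by (simp add: field_simps)

lemma D_neg: "q \<in> D (\<not> s) \<Longrightarrow> - q \<in> D (\<not> s)"
  using D_odd [OF zero zero] by simp

lemma l_odd:
  assumes q: "q \<in> D (\<not> s)" "Q \<in> D (\<not> s)" "q \<noteq> Q"
  shows "2 * l (\<not> s) q Q * \<phi> q = (q + Q) * \<phi> Q"
proof -
  have "finite {0, q + Q}" by simp
  from D_avoid [OF this, of s] obtain p where p: "p \<in> D s" "p \<notin> {0, q + Q}" ..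
  define P where "P = q + Q - p"
  have P: "P \<in> D s" "P \<noteq> 0" using D_odd [OF q(1,2), of p] p unfolding P_def by auto
  have "2 * l (\<not> s) q Q = g (\<not> s) q p * g s p Q + g (\<not> s) q P * g s P Q"
    using GG [of q "\<not> s" Q p P] q p P unfolding P_def by simp
  also have "\<dots> = p / (\<rho> p * \<phi> q) * (\<rho> p * \<phi> Q) + P / (\<rho> P * \<phi> q) * (\<rho> P * \<phi> Q)"
    using g_back [of p q] g_back [of P q] g_deg [of p Q] g_deg [of P Q] p P q by simp
  also have "\<dots> = (p + P) * \<phi> Q / \<phi> q"
    using \<rho> [of p] \<rho> [of P] p P by (simp add: add_divide_distrib distrib_right)
  finally show ?thesis using \<phi> [OF q(1)] unfolding P_def by (simp add: nonzero_eq_divide_eq)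
qed

text \<open>The quotient f of \<open>g s 0\<close> by \<phi> no longer depends on the scaling of the
  targets. The bracket [L, G] from 0 to q by way of a fixed n expresses f q by f n and f (- n),
  linearly in q.\<close>

lemma zero_source: "\<exists>a b. \<forall>q\<in>D (\<not> s). g s 0 q = (a * q + b) * \<phi> q"
proof -
  define f where "f = (\<lambda>q. g s 0 q / \<phi> q)"
  have gf: "g s 0 q = f q * \<phi> q" if "q \<in> D (\<not> s)" for q using \<phi> [OF that] unfolding f_def by simp
  have "finite {0 :: 'f}" by simp
  from D_avoid [OF this, of "\<not> s"] obtain n where n: "n \<in> D (\<not> s)" "n \<noteq> 0" by blast
  have key: "2 * n * f q = (n + q) * f n - (q - n) * f (- n)" if q: "q \<in> D (\<not> s)" for q
  proof (cases "q = n")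
    case False
    define m where "m = q - n"
    have m: "m \<in> D s" "m \<noteq> 0" using D_par [OF zero q n(1)] False unfolding m_def by simp_all
    have L: "2 * l s 0 m = m / \<rho> m * (f (- n) + f q)"
    proof -
      have "2 * l s 0 m = g s 0 (- n) * g (\<not> s) (- n) m + g s 0 q * g (\<not> s) q m"
        using GG [of 0 s m "- n" q] zero m D_neg [OF n(1)] q unfolding m_def by simp
      also have "\<dots> = f (- n) * \<phi> (- n) * (m / (\<rho> m * \<phi> (- n))) + f q * \<phi> q * (m / (\<rho> m * \<phi> q))"
        using gf [OF D_neg [OF n(1)]] gf [OF q] g_back [OF m D_neg [OF n(1)]] g_back [OF m q] by simp
      also have "\<dots> = m / \<rho> m * (f (- n) + f q)"
        using \<phi> [OF D_neg [OF n(1)]] \<phi> [OF q] \<rho> [OF m] by (simp add: field_simps)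
      finally show ?thesis .
    qed
    have "2 * l (\<not> s) n q * g s 0 n - g s m q * (2 * l s 0 m) = (2 * n - m) * g s 0 q"
      using LG2 [of 0 s m q n] zero m q n unfolding m_def by simp
    then have "(2 * l (\<not> s) n q * \<phi> n) * f n - \<rho> m * \<phi> q * (m / \<rho> m * (f (- n) + f q)) = (2 * n - m) * f q * \<phi> q"
      unfolding L gf [OF n(1)] gf [OF q] g_deg [OF m q] by (simp add: algebra_simps)
    then have "(n + q) * \<phi> q * f n - \<phi> q * (m * (f (- n) + f q)) = (2 * n - m) * f q * \<phi> q"
      unfolding l_odd [OF n(1) q False [symmetric]] using \<rho> [OF m] by (simp add: mult.assoc)
    then have "\<phi> q * ((n + q) * f n - (q - n) * f (- n)) = \<phi> q * (2 * n * f q)"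
      unfolding m_def by (simp add: algebra_simps)
    then show ?thesis using \<phi> [OF q] by simp
  qed simp
  have "g s 0 q = ((f n - f (- n)) / (2 * n) * q + (f n + f (- n)) / 2) * \<phi> q" if q: "q \<in> D (\<not> s)" for q
  proof -
    have "f q = ((n + q) * f n - (q - n) * f (- n)) / (2 * n)"
      using key [OF q] n(2) by (simp add: nonzero_eq_divide_eq mult.commute)
    also have "\<dots> = (f n - f (- n)) / (2 * n) * q + (f n + f (- n)) / 2"
      using n(2) by (simp add: field_simps)
    finally show ?thesis using gf [OF q] by simp
  qed
  then show ?thesis by blast
qed

text \<open>The mirror image of \<open>zero_source\<close>, with [L, G] taken from n to 0 by way of
  a fixed b.\<close>

lemma zero_target: "\<exists>a b. \<forall>q\<in>D (\<not> s). g (\<not> s) q 0 * \<phi> q = a * q + b"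
proof -
  define f where "f = (\<lambda>q. g (\<not> s) q 0 * \<phi> q)"
  have gf: "g (\<not> s) q 0 = f q / \<phi> q" if "q \<in> D (\<not> s)" for q using \<phi> [OF that] unfolding f_def by simp
  have "finite {0 :: 'f}" by simp
  from D_avoid [OF this, of "\<not> s"] obtain b where b: "b \<in> D (\<not> s)" "b \<noteq> 0" by blast
  have key: "2 * b * f n = (b + n) * f b + (b - n) * f (- b)" if n: "n \<in> D (\<not> s)" for n
  proof (cases "n = b")
    case False
    define m where "m = b - n"
    have "n - b \<in> D s" using D_par [OF zero n b(1)] by simp
    then have m: "- m \<in> D s" "- m \<noteq> 0" using False unfolding m_def by simp_all
    have L: "2 * l s (- m) 0 = \<rho> (- m) * (f n + f (- b))"
    proof -
      have "2 * l s (- m) 0 = g s (- m) n * g (\<not> s) n 0 + g s (- m) (- b) * g (\<not> s) (- b) 0"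
        using GG [of "- m" s 0 n "- b"] zero m D_neg [OF b(1)] n unfolding m_def by simp
      also have "\<dots> = \<rho> (- m) * \<phi> n * (f n / \<phi> n) + \<rho> (- m) * \<phi> (- b) * (f (- b) / \<phi> (- b))"
        unfolding gf [OF n] gf [OF D_neg [OF b(1)]] g_deg [OF m n] g_deg [OF m D_neg [OF b(1)]] ..
      also have "\<dots> = \<rho> (- m) * (f n + f (- b))"
        using \<phi> [OF D_neg [OF b(1)]] \<phi> [OF n] by (simp add: distrib_left)
      finally show ?thesis .
    qed
    have "2 * l s (- m) 0 * g (\<not> s) n (- m) - g (\<not> s) b 0 * (2 * l (\<not> s) n b) = (- 2 * b - m) * g (\<not> s) n 0"
      using LG2 [of n "\<not> s" b 0 "- m"] zero m n b unfolding m_def by (simp add: algebra_simps)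
    then have "\<phi> n * (\<rho> (- m) * (f n + f (- b)) * (- m / (\<rho> (- m) * \<phi> n)) - f b / \<phi> b * (2 * l (\<not> s) n b))
        = \<phi> n * ((- 2 * b - m) * (f n / \<phi> n))"
      unfolding L gf [OF n] gf [OF b(1)] g_back [OF m n] by simp
    moreover have "u * (r * x * (- m / (r * u)) - y) = - m * x - y * u" if "u \<noteq> 0" "r \<noteq> 0" for u r x y
      using that by (simp add: field_simps)
    moreover have "\<phi> n * ((- 2 * b - m) * (f n / \<phi> n)) = (- 2 * b - m) * f n" using \<phi> [OF n] by simp
    ultimately have "- m * (f n + f (- b)) - f b / \<phi> b * (2 * l (\<not> s) n b) * \<phi> n = (- 2 * b - m) * f n"
      using \<phi> [OF n] \<rho> [OF m] by metis
    then have "- m * (f n + f (- b)) - f b / \<phi> b * (2 * l (\<not> s) n b * \<phi> n) = (- 2 * b - m) * f n"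
      by (simp add: mult.assoc)
    then have "- m * (f n + f (- b)) - f b * (n + b) = (- 2 * b - m) * f n"
      unfolding l_odd [OF n b(1) False] using \<phi> [OF b(1)] by simp
    then show ?thesis unfolding m_def by (simp add: algebra_simps)
  qed simp
  have "f q = (f b - f (- b)) / (2 * b) * q + (f b + f (- b)) / 2" if q: "q \<in> D (\<not> s)" for q
  proof -
    have "f q = ((b + q) * f b + (b - q) * f (- b)) / (2 * b)"
      using key [OF q] b(2) by (simp add: nonzero_eq_divide_eq mult.commute)
    also have "\<dots> = (f b - f (- b)) / (2 * b) * q + (f b + f (- b)) / 2"
      using b(2) by (simp add: field_simps)
    finally show ?thesis .
  qed
  then show ?thesis unfolding f_def by blast
qed

text \<open>\<open>e\<close> vanishes on the edges at 0, so the product of the two affine functions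
  has infinitely many zeros and one of them is identically 0.\<close>

lemma zero_one_sided:
  "(\<exists>a b. \<forall>q\<in>D (\<not> s). g s 0 q = (a * q + b) * \<phi> q \<and> g (\<not> s) q 0 = 0)
   \<or> (\<exists>a b. \<forall>q\<in>D (\<not> s). g s 0 q = 0 \<and> g (\<not> s) q 0 = (a * q + b) / \<phi> q)"
proof -
  obtain a b where ab: "\<And>q. q \<in> D (\<not> s) \<Longrightarrow> g s 0 q = (a * q + b) * \<phi> q" using zero_source by blast
  obtain a' b' where ab': "\<And>q. q \<in> D (\<not> s) \<Longrightarrow> g (\<not> s) q 0 * \<phi> q = a' * q + b'" using zero_target by blast
  have ab'': "g (\<not> s) q 0 = (a' * q + b') / \<phi> q" if "q \<in> D (\<not> s)" for q
    unfolding ab' [OF that, symmetric] using \<phi> [OF that] by simp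
  have "b * b' + (a * b' + b * a') * q + a * a' * q^2 + 0 * q^3 + 0 * q^4 = 0" if q: "q \<in> D (\<not> s)" for q
  proof -
    have "g s 0 q * g (\<not> s) q 0 = 0" using e_deg [OF zero q] unfolding e_def .
    then have "(a * q + b) * (a' * q + b') = 0" unfolding ab [OF q] ab'' [OF q] using \<phi> [OF q] by simp
    then show ?thesis by (simp add: algebra_simps power2_eq_square)
  qed
  from poly4_vanishing(1-3) [OF D_infinite this]
  have z: "b * b' = 0" "a * b' + b * a' = 0" "a * a' = 0" by blast+
  show ?thesis
  proof (cases "a = 0 \<and> b = 0")
    case True
    then show ?thesis using ab ab'' by auto
  next
    case False
    then have "a' = 0 \<and> b' = 0" using z by auto
    then show ?thesis using ab ab'' by auto
  qed
qed

end

section \<open>Rescaled coefficients and normal forms\<close>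

context svir_coefficients begin

text \<open>The coefficients with respect to the rescaled basis vectors \<open>t u p \<cdot> b u p\<close>.\<close>

definition g_scaled :: "(bool \<Rightarrow> 'f \<Rightarrow> 'f) \<Rightarrow> bool \<Rightarrow> 'f \<Rightarrow> 'f \<Rightarrow> 'f" where
  "g_scaled t u p q = t u p * g u p q / t (\<not> u) q"

definition l_scaled :: "(bool \<Rightarrow> 'f \<Rightarrow> 'f) \<Rightarrow> bool \<Rightarrow> 'f \<Rightarrow> 'f \<Rightarrow> 'f" where
  "l_scaled t u p q = t u p * l u p q / t u q"

lemma GG_scaled:
  assumes "\<And>u p. t u p \<noteq> 0" and "p \<in> D s" "P \<in> D s" "Q \<in> D (\<not> s)" "p \<noteq> P"
  shows "2 * l_scaled t s p P = g_scaled t s p Q * g_scaled t (\<not> s) Q P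
    + g_scaled t s p (p + P - Q) * g_scaled t (\<not> s) (p + P - Q) P"
proof -
  have "2 * l_scaled t s p P = t s p * (2 * l s p P) / t s P" by (simp add: l_scaled_def)
  also have "2 * l s p P = g s p Q * g (\<not> s) Q P + g s p (p + P - Q) * g (\<not> s) (p + P - Q) P"
    using GG [of p s P Q "p + P - Q"] D_odd [of p s P Q] assms by simp
  finally show ?thesis unfolding g_scaled_def using assms(1) by (simp add: field_simps)
qed

lemma l_scaled_diag: "(\<And>u p. t u p \<noteq> 0) \<Longrightarrow> pr s p \<Longrightarrow> l_scaled t s p p = p"
  by (simp add: l_scaled_def L0)

text \<open>Here p and q are weights, that is a + \<mu> and a + \<nu>, and therefore the parameter a
  does not show. For b = 1 no generator leads to the weight 0 of parity s, so this weight may be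
  absent.\<close>

definition normal_SAab :: "bool \<Rightarrow> (bool \<Rightarrow> 'f \<Rightarrow> 'f) \<Rightarrow> 'f \<Rightarrow> bool" where
  "normal_SAab s t b \<longleftrightarrow> (\<forall>p\<in>D s. pr s p \<or> p = 0 \<and> b = 1) \<and>
    (\<forall>p\<in>D s. \<forall>q\<in>D (\<not> s). pr s p \<longrightarrow>
       g_scaled t s p q = 1 \<and> g_scaled t (\<not> s) q p = q + 2 * (p - q) * (b - 1/2))"

definition normal_SAa :: "bool \<Rightarrow> (bool \<Rightarrow> 'f \<Rightarrow> 'f) \<Rightarrow> 'f \<Rightarrow> bool" where
  "normal_SAa s t a \<longleftrightarrow> 0 \<in> D s \<and> (\<forall>p\<in>D s. pr s p) \<and>
    (\<forall>p\<in>D s. \<forall>q\<in>D (\<not> s).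
       g_scaled t s p q = (if p = 0 then 2 * q + a else 1) \<and> g_scaled t (\<not> s) q p = p)"

text \<open>The degree of \<open>G\<close> from q to 0 is - q, so - 2 q + a is the factor 2 \<eta> +
  a of the module; in \<open>normal_SAa\<close> the degree from 0 to q is q.\<close>

definition normal_SBa :: "bool \<Rightarrow> (bool \<Rightarrow> 'f \<Rightarrow> 'f) \<Rightarrow> 'f \<Rightarrow> bool" where
  "normal_SBa s t a \<longleftrightarrow> 0 \<in> D s \<and> (\<forall>p\<in>D s. pr s p) \<and>
    (\<forall>p\<in>D s. \<forall>q\<in>D (\<not> s).
       g_scaled t (\<not> s) q p = (if p = 0 then - 2 * q + a else 1) \<and> g_scaled t s p q = p)"

text \<open>Supplies intermediate weights other than 0, where the normal forms are not
  exceptional.\<close>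

lemma avoid_two:
  assumes "q \<in> D (\<not> s)" "Q \<in> D (\<not> s)"
  shows "\<exists>p. p \<in> D s \<and> q + Q - p \<in> D s \<and> p \<noteq> 0 \<and> q + Q - p \<noteq> 0"
proof -
  have "finite {0, q + Q}" by simp
  from D_avoid [OF this, of s] obtain p where p: "p \<in> D s" "p \<notin> {0, q + Q}" ..
  then have "q + Q - p \<in> D s" "q + Q - p \<noteq> 0" using D_odd [OF assms, of p] by auto
  then show ?thesis using p by blast
qed

text \<open>The normal forms prescribe \<open>G\<close> only. The coefficients of \<open>L\<close>
  follow from [G, G] between different weights, and on the diagonal they are the weights.\<close>

lemma normal_SAab_l:
  assumes t: "\<And>u p. t u p \<noteq> 0" and n: "normal_SAab s t b"
  shows "p \<in> D s \<Longrightarrow> P \<in> D s \<Longrightarrow> pr s p \<Longrightarrow> pr s P \<Longrightarrow> l_scaled t s p P = p + (P - p) * b"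
    and "q \<in> D (\<not> s) \<Longrightarrow> Q \<in> D (\<not> s) \<Longrightarrow> pr (\<not> s) q \<Longrightarrow> l_scaled t (\<not> s) q Q = q + (Q - q) * (b - 1/2)"
proof -
  assume p: "p \<in> D s" "P \<in> D s" "pr s p" "pr s P"
  show "l_scaled t s p P = p + (P - p) * b"
  proof (cases "p = P")
    case False
    obtain Q where Q: "Q \<in> D (\<not> s)" using D_nonempty [of "\<not> s"] by blast
    define B where "B = b - 1/2"
    have Q': "p + P - Q \<in> D (\<not> s)" by (rule D_odd [OF p(1,2) Q])
    have g: "g_scaled t s p Q = 1" "g_scaled t s p (p + P - Q) = 1" 
      "g_scaled t (\<not> s) Q P = Q + 2 * (P - Q) * B"
      "g_scaled t (\<not> s) (p + P - Q) P = p + P - Q + 2 * (P - (p + P - Q)) * B"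
      using n p Q Q' unfolding normal_SAab_def B_def by blast+
    have b: "2 * b = 2 * B + 1" unfolding B_def by (simp add: algebra_simps)
    have "2 * (p + (P - p) * b) = 2 * p + (P - p) * (2 * b)" by (simp add: algebra_simps)
    then have b': "2 * (p + (P - p) * b) = 2 * p + (P - p) * (2 * B + 1)" unfolding b .
    have "2 * l_scaled t s p P = Q + 2 * (P - Q) * B + (p + P - Q + 2 * (P - (p + P - Q)) * B)"
      using GG_scaled [of t p s P Q] t p Q False unfolding g by simp
    also have "\<dots> = 2 * (p + (P - p) * b)" unfolding b' by (simp add: algebra_simps)
    finally have "2 * l_scaled t s p P = 2 * (p + (P - p) * b)" .
    then show ?thesis by (rule two_times_cancel)
  qed (use l_scaled_diag [OF t p(3)] in simp)
next
  assume q: "q \<in> D (\<not> s)" "Q \<in> D (\<not> s)" "pr (\<not> s) q"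
  show "l_scaled t (\<not> s) q Q = q + (Q - q) * (b - 1/2)"
  proof (cases "q = Q")
    case False
    obtain p where p: "p \<in> D s" "q + Q - p \<in> D s" "p \<noteq> 0" "q + Q - p \<noteq> 0" using avoid_two [OF q(1,2)] by blast
    then have pp: "pr s p" "pr s (q + Q - p)" using n unfolding normal_SAab_def by blast+
    define B where "B = b - 1/2"
    have g: "g_scaled t s p Q = 1" "g_scaled t s (q + Q - p) Q = 1"
      "g_scaled t (\<not> s) q p = q + 2 * (p - q) * B"
      "g_scaled t (\<not> s) q (q + Q - p) = q + 2 * (q + Q - p - q) * B"
      using n p pp q unfolding normal_SAab_def B_def by blast+
    have "2 * l_scaled t (\<not> s) q Q = q + 2 * (p - q) * B + (q + 2 * (q + Q - p - q) * B)"
      using GG_scaled [of t q "\<not> s" Q p] t p q False by (simp add: g)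
    also have "\<dots> = 2 * (q + (Q - q) * B)" by (simp add: algebra_simps)
    finally show ?thesis unfolding B_def by (rule two_times_cancel)
  qed (use l_scaled_diag [OF t q(3)] in simp)
qed

lemma normal_SAa_l:
  assumes t: "\<And>u p. t u p \<noteq> 0" and n: "normal_SAa s t a"
  shows "p \<in> D s \<Longrightarrow> P \<in> D s \<Longrightarrow> l_scaled t s p P = (if p = 0 then P * (P + a) else P)"
    and "q \<in> D (\<not> s) \<Longrightarrow> Q \<in> D (\<not> s) \<Longrightarrow> pr (\<not> s) q \<Longrightarrow> l_scaled t (\<not> s) q Q = (q + Q) / 2"
proof -
  assume p: "p \<in> D s" "P \<in> D s"
  then have pp: "pr s p" using n unfolding normal_SAa_def by blast
  show "l_scaled t s p P = (if p = 0 then P * (P + a) else P)"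
  proof (cases "p = P")
    case False
    obtain Q where Q: "Q \<in> D (\<not> s)" using D_nonempty [of "\<not> s"] by blast
    have Q': "p + P - Q \<in> D (\<not> s)" by (rule D_odd [OF p(1,2) Q])
    have g: "g_scaled t s p Q = (if p = 0 then 2 * Q + a else 1)" "g_scaled t s p (p + P - Q) = (if p = 0 then 2 * (p + P - Q) + a else 1)"
      "g_scaled t (\<not> s) Q P = P" "g_scaled t (\<not> s) (p + P - Q) P = P"
      using n p Q Q' unfolding normal_SAa_def by blast+
    have "2 * l_scaled t s p P = (if p = 0 then 2 * Q + a else 1) * P + (if p = 0 then 2 * (p + P - Q) + a else 1) * P"
      using GG_scaled [of t p s P Q] t p Q False unfolding g by simp
    also have "\<dots> = 2 * (if p = 0 then P * (P + a) else P)" by (simp add: algebra_simps)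
    finally have "2 * l_scaled t s p P = 2 * (if p = 0 then P * (P + a) else P)" .
    then show ?thesis by (rule two_times_cancel)
  qed (use l_scaled_diag [OF t pp] in simp)
next
  assume q: "q \<in> D (\<not> s)" "Q \<in> D (\<not> s)" "pr (\<not> s) q"
  show "l_scaled t (\<not> s) q Q = (q + Q) / 2"
  proof (cases "q = Q")
    case False
    obtain p where p: "p \<in> D s" "q + Q - p \<in> D s" "p \<noteq> 0" "q + Q - p \<noteq> 0" using avoid_two [OF q(1,2)] by blast
    have "2 * l_scaled t (\<not> s) q Q = q + Q"
      using GG_scaled [of t q "\<not> s" Q p] t n p q False unfolding normal_SAa_def by simp
    then show ?thesis by (simp add: nonzero_eq_divide_eq mult.commute)
  qed (use l_scaled_diag [OF t q(3)] in simp)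
qed

lemma normal_SBa_l:
  assumes t: "\<And>u p. t u p \<noteq> 0" and n: "normal_SBa s t a"
  shows "p \<in> D s \<Longrightarrow> P \<in> D s \<Longrightarrow> l_scaled t s p P = (if P = 0 then p * (- p + a) else p)"
    and "q \<in> D (\<not> s) \<Longrightarrow> Q \<in> D (\<not> s) \<Longrightarrow> pr (\<not> s) q \<Longrightarrow> l_scaled t (\<not> s) q Q = (q + Q) / 2"
proof -
  assume p: "p \<in> D s" "P \<in> D s"
  then have pp: "pr s p" using n unfolding normal_SBa_def by blast
  show "l_scaled t s p P = (if P = 0 then p * (- p + a) else p)"
  proof (cases "p = P")
    case False
    obtain Q where Q: "Q \<in> D (\<not> s)" using D_nonempty [of "\<not> s"] by blast
    have Q': "p + P - Q \<in> D (\<not> s)" by (rule D_odd [OF p(1,2) Q])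
    have g: "g_scaled t s p Q = p" "g_scaled t s p (p + P - Q) = p"
      "g_scaled t (\<not> s) Q P = (if P = 0 then - 2 * Q + a else 1)" "g_scaled t (\<not> s) (p + P - Q) P = (if P = 0 then - 2 * (p + P - Q) + a else 1)"
      using n p Q Q' unfolding normal_SBa_def by blast+
    have "2 * l_scaled t s p P = p * (if P = 0 then - 2 * Q + a else 1) + p * (if P = 0 then - 2 * (p + P - Q) + a else 1)"
      using GG_scaled [of t p s P Q] t p Q False unfolding g by simp
    also have "\<dots> = 2 * (if P = 0 then p * (- p + a) else p)" by (simp add: algebra_simps)
    finally have "2 * l_scaled t s p P = 2 * (if P = 0 then p * (- p + a) else p)" .
    then show ?thesis by (rule two_times_cancel)
  qed (use l_scaled_diag [OF t pp] in simp)
next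
  assume q: "q \<in> D (\<not> s)" "Q \<in> D (\<not> s)" "pr (\<not> s) q"
  show "l_scaled t (\<not> s) q Q = (q + Q) / 2"
  proof (cases "q = Q")
    case False
    obtain p where p: "p \<in> D s" "q + Q - p \<in> D s" "p \<noteq> 0" "q + Q - p \<noteq> 0" using avoid_two [OF q(1,2)] by blast
    have "2 * l_scaled t (\<not> s) q Q = q + Q"
      using GG_scaled [of t q "\<not> s" Q p] t n p q False unfolding normal_SBa_def by simp
    then show ?thesis by (simp add: nonzero_eq_divide_eq mult.commute)
  qed (use l_scaled_diag [OF t q(3)] in simp)
qed

end

context nontrivial_coefficients begin

lemma normal_form_from_rank_one:
  assumes aff: "\<And>p q. p \<in> D s \<Longrightarrow> q \<in> D (\<not> s) \<Longrightarrow> e s p q = (1 - \<beta>) * p + \<beta> * q"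
    and \<rho>: "\<And>p. p \<in> D s \<Longrightarrow> pr s p \<Longrightarrow> \<rho> p \<noteq> 0" and \<phi>: "\<And>q. q \<in> D (\<not> s) \<Longrightarrow> \<phi> q \<noteq> 0"
    and g: "\<And>p q. p \<in> D s \<Longrightarrow> pr s p \<Longrightarrow> q \<in> D (\<not> s) \<Longrightarrow> g s p q = \<rho> p * \<phi> q"
    and abs: "\<And>p. p \<in> D s \<Longrightarrow> pr s p \<or> p = 0 \<and> \<beta> = 0"
  shows "\<exists>t. (\<forall>u p. t u p \<noteq> 0) \<and> normal_SAab s t (1 - \<beta> / 2)"
proof -
  define t where "t = (\<lambda>u p. if u = s then (if \<rho> p = 0 then 1 else 1 / \<rho> p) else if \<phi> p = 0 then 1 else \<phi> p)"
  have t: "t u p \<noteq> 0" for u p unfolding t_def by simp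
  have "g_scaled t s p q = 1 \<and> g_scaled t (\<not> s) q p = q + 2 * (p - q) * (1 - \<beta> / 2 - 1/2)"
    if pq: "p \<in> D s" "q \<in> D (\<not> s)" "pr s p" for p q
  proof -
    have r: "\<rho> p \<noteq> 0" "\<phi> q \<noteq> 0" using \<rho> \<phi> pq by blast+
    have gg: "g s p q = \<rho> p * \<phi> q" by (rule g [OF pq(1,3,2)])
    have b: "g (\<not> s) q p = ((1 - \<beta>) * p + \<beta> * q) / (\<rho> p * \<phi> q)"
      using aff [OF pq(1,2)] r unfolding e_def gg by (simp add: nonzero_eq_divide_eq mult.commute)
    have "g_scaled t (\<not> s) q p = (1 - \<beta>) * p + \<beta> * q"
      unfolding g_scaled_def t_def b using r by simp
    moreover have "(1 - \<beta>) * p + \<beta> * q = q + 2 * (p - q) * (1 - \<beta> / 2 - 1/2)" by (simp add: algebra_simps)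
    ultimately show ?thesis unfolding g_scaled_def t_def gg using r by simp
  qed
  moreover have "pr s p \<or> p = 0 \<and> 1 - \<beta> / 2 = 1" if "p \<in> D s" for p using abs [OF that] by auto
  ultimately show ?thesis unfolding normal_SAab_def using t by blast
qed

lemma normal_form:
  assumes indec: "\<And>Y. (\<And>u p q. g u p q \<noteq> 0 \<Longrightarrow> Y u p = Y (\<not> u) q) \<Longrightarrow>
     (\<forall>u p. pr u p \<longrightarrow> Y u p) \<or> (\<forall>u p. pr u p \<longrightarrow> \<not> Y u p)"
  shows "\<exists>s t. (\<forall>u p. t u p \<noteq> 0) \<and> (\<forall>q\<in>D (\<not> s). pr (\<not> s) q) \<and>
    ((\<exists>b. normal_SAab s t b) \<or> (\<exists>a. normal_SAa s t a) \<or> (\<exists>a. normal_SBa s t a))"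
proof -
  obtain \<beta> where \<beta>: "\<forall>p\<in>D False. \<forall>q\<in>D (\<not> False). e False p q = (1 - \<beta>) * p + \<beta> * q"
    using e_affine [of False] by blast
  have \<beta>': "e True p q = (1 - (1 - \<beta>)) * p + (1 - \<beta>) * q" if "p \<in> D True" "q \<in> D (\<not> True)" for p q
  proof -
    have "e False q p = (1 - \<beta>) * q + \<beta> * p" using \<beta> that by simp
    then show ?thesis using e_swap [of False p q] by (simp add: algebra_simps)
  qed
  have pres: "pr s p" if aff: "\<And>p q. p \<in> D s \<Longrightarrow> q \<in> D (\<not> s) \<Longrightarrow> e s p q = (1 - \<gamma>) * p + \<gamma> * q" and "\<gamma> \<noteq> 0" "p \<in> D s" for s \<gamma> p
  proof (cases "p = 0")
    case True
    have "finite {0 :: 'f}" by simp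
    from D_avoid [OF this, of "\<not> s"] obtain q where q: "q \<in> D (\<not> s)" "q \<noteq> 0" by blast
    then have "e s p q \<noteq> 0" using aff [OF that(3) q(1)] that(2) True by simp
    then show ?thesis using e_pr by blast
  qed (use present that in blast)
  show ?thesis
  proof (cases "\<beta> = 0 \<or> \<beta> = 1")
    case False
    then have b: "\<beta> \<noteq> 0" "\<beta> \<noteq> 1" by auto
    interpret A: affine_coefficients D pr g l c False \<beta>
      by unfold_locales (use \<beta> in blast)
    have affF: "e False p q = (1 - \<beta>) * p + \<beta> * q" if "p \<in> D False" "q \<in> D (\<not> False)" for p q using \<beta> that by blast
    have prF: "pr False p" if "p \<in> D False" for p by (rule pres [OF affF b(1) that])
    have prT: "pr True p" if "p \<in> D True" for p by (rule pres [OF \<beta>' _ that]) (use b in auto)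
    obtain \<rho> \<phi> where r: "\<And>p. p \<in> D False \<Longrightarrow> \<rho> p \<noteq> 0" "\<And>q. q \<in> D (\<not> False) \<Longrightarrow> \<phi> q \<noteq> 0"
      and cs: "(\<forall>p\<in>D False. \<forall>q\<in>D (\<not> False). g False p q = \<rho> p * \<phi> q) \<or> (\<forall>p\<in>D False. \<forall>q\<in>D (\<not> False). g (\<not> False) q p = \<rho> p * \<phi> q)"
      using A.rank_one_generic [OF b] by blast
    from cs show ?thesis
    proof
      assume F: "\<forall>p\<in>D False. \<forall>q\<in>D (\<not> False). g False p q = \<rho> p * \<phi> q"
      have "\<exists>t. (\<forall>u p. t u p \<noteq> 0) \<and> normal_SAab False t (1 - \<beta> / 2)"
        by (rule normal_form_from_rank_one [where \<rho> = \<rho> and \<phi> = \<phi>]) (use \<beta> r F prF in auto)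
      then show ?thesis using prT by (intro exI [of _ False]) auto
    next
      \<comment> \<open>If the backward coefficients have rank one, the parities exchange their
        roles and 1 - \<beta> takes the place of \<beta>.\<close>
      assume G: "\<forall>p\<in>D False. \<forall>q\<in>D (\<not> False). g (\<not> False) q p = \<rho> p * \<phi> q"
      have "\<exists>t. (\<forall>u p. t u p \<noteq> 0) \<and> normal_SAab True t (1 - (1 - \<beta>) / 2)"
        by (rule normal_form_from_rank_one [where \<rho> = \<phi> and \<phi> = \<rho>]) (use \<beta>' r G prT in \<open>auto simp: mult.commute\<close>)
      then show ?thesis using prF by (intro exI [of _ True]) auto
    qed
  next
    case True
    have "\<exists>s. \<forall>p\<in>D s. \<forall>q\<in>D (\<not> s). e s p q = p"
      using True
    proof
      assume "\<beta> = 0"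
      then show ?thesis using \<beta> by (intro exI [of _ False]) auto
    next
      assume "\<beta> = 1"
      then show ?thesis using \<beta>' by (intro exI [of _ True]) auto
    qed
    then obtain s where es: "\<And>p q. p \<in> D s \<Longrightarrow> q \<in> D (\<not> s) \<Longrightarrow> e s p q = p" by blast
    interpret A: affine_coefficients D pr g l c s 0
      by unfold_locales (use es in simp)
    have aff': "e (\<not> s) q p = (1 - 1) * q + 1 * p" if "q \<in> D (\<not> s)" "p \<in> D (\<not> \<not> s)" for p q
      using es [of p q] e_swap [of s q p] that by simp
    have prq: "pr (\<not> s) q" if "q \<in> D (\<not> s)" for q by (rule pres [OF aff' _ that]) simp_all
    obtain \<rho> \<phi> where \<rho>: "\<And>p. p \<in> D s \<Longrightarrow> p \<noteq> 0 \<Longrightarrow> \<rho> p \<noteq> 0" and \<phi>: "\<And>q. q \<in> D (\<not> s) \<Longrightarrow> \<phi> q \<noteq> 0"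
      and g: "\<And>p q. p \<in> D s \<Longrightarrow> p \<noteq> 0 \<Longrightarrow> q \<in> D (\<not> s) \<Longrightarrow> g s p q = \<rho> p * \<phi> q"
      using A.rank_one_degenerate by blast
    show ?thesis
    proof (cases "0 \<in> D s \<and> pr s 0")
      case False
      have ne: "p \<noteq> 0" if "p \<in> D s" "pr s p" for p using False that by auto
      have "\<exists>t. (\<forall>u p. t u p \<noteq> 0) \<and> normal_SAab s t (1 - 0 / 2)"
      proof (rule normal_form_from_rank_one [where \<rho> = \<rho> and \<phi> = \<phi>])
        show "pr s p \<or> p = 0 \<and> (0 :: 'f) = 0" if "p \<in> D s" for p using present [OF that] by auto
      qed (use es \<rho> \<phi> g ne in auto)
      then show ?thesis using prq by blast
    next
      case zero: True
      then have prp: "pr s p" if "p \<in> D s" for p using present [OF that] by auto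
      interpret B: degenerate_coefficients D pr g l c s \<rho> \<phi>
        by unfold_locales (use es \<rho> \<phi> g zero in auto)
      note gb = B.g_back
      from B.zero_one_sided show ?thesis
      proof
        assume "\<exists>a b. \<forall>q\<in>D (\<not> s). g s 0 q = (a * q + b) * \<phi> q \<and> g (\<not> s) q 0 = 0"
        then obtain a b where ab: "\<And>q. q \<in> D (\<not> s) \<Longrightarrow> g s 0 q = (a * q + b) * \<phi> q"
          and z: "\<And>q. q \<in> D (\<not> s) \<Longrightarrow> g (\<not> s) q 0 = 0" by blast
        \<comment> \<open>The scale t0 of the vector of weight 0 stays free; it later normalizes the
          affine factor a q + b to leading coefficient 2, or to the constant 1 if a = 0.\<close>
        define t where "t = (\<lambda>t0 u p. if u = s then (if p = 0 then t0 else if \<rho> p = 0 then 1 else 1 / \<rho> p)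
          else if \<phi> p = 0 then 1 else \<phi> p)"
        have t: "t t0 u p \<noteq> 0" if "t0 \<noteq> 0" for t0 u p using that unfolding t_def by simp
        have n1: "g_scaled (t t0) s p q = 1" "g_scaled (t t0) (\<not> s) q p = p"
          if "p \<in> D s" "p \<noteq> 0" "q \<in> D (\<not> s)" for t0 p q
          using \<rho> [OF that(1,2)] \<phi> [OF that(3)] that(2)
          unfolding g_scaled_def t_def g [OF that] gb [OF that] by simp_all
        have n0: "g_scaled (t t0) s 0 q = t0 * (a * q + b)" "g_scaled (t t0) (\<not> s) q 0 = 0"
          if "q \<in> D (\<not> s)" for t0 q
          using \<phi> [OF that] unfolding g_scaled_def t_def ab [OF that] z [OF that] by simp_all
        consider "a \<noteq> 0" | "a = 0" "b \<noteq> 0" | "a = 0" "b = 0" by blast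
        then show ?thesis
        proof cases
          case 1
          have "normal_SAa s (t (2 / a)) (2 * b / a)"
            unfolding normal_SAa_def
          proof (intro conjI ballI)
            fix p q assume pq: "p \<in> D s" "q \<in> D (\<not> s)"
            show "g_scaled (t (2 / a)) s p q = (if p = 0 then 2 * q + 2 * b / a else 1)"
              using n1(1) [of p q] n0(1) [of q] pq 1 by (auto simp: field_simps)
            show "g_scaled (t (2 / a)) (\<not> s) q p = p"
              using n1(2) [of p q] n0(2) [of q] pq by auto
          qed (use zero prp in auto)
          moreover have "\<forall>u p. t (2 / a) u p \<noteq> 0" using t [of "2 / a"] 1 by simp
          ultimately show ?thesis using prq by blast
        next
          case 2
          have "normal_SAab s (t (1 / b)) 1"
            unfolding normal_SAab_def
          proof (intro conjI ballI impI)
            fix p q assume pq: "p \<in> D s" "q \<in> D (\<not> s)"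
            show "g_scaled (t (1 / b)) s p q = 1"
              using n1(1) [of p q] n0(1) [of q] pq 2 by (cases "p = 0") auto
            show "g_scaled (t (1 / b)) (\<not> s) q p = q + 2 * (p - q) * (1 - 1/2)"
            proof -
              have "q + 2 * (p - q) * (1 - 1/2) = p" by (simp add: field_simps)
              then show ?thesis using n1(2) [of p q] n0(2) [of q] pq by (cases "p = 0") auto
            qed
          qed (use prp in auto)
          moreover have "\<forall>u p. t (1 / b) u p \<noteq> 0" using t [of "1 / b"] 2 by simp
          ultimately show ?thesis using prq by blast
        next
          case 3
          \<comment> \<open>For a = b = 0 the vector of weight 0 is not connected with any other and
            would split off.\<close>
          have "(\<forall>u p. pr u p \<longrightarrow> (u = s \<and> p = 0)) \<or> (\<forall>u p. pr u p \<longrightarrow> \<not> (u = s \<and> p = 0))"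
          proof (rule indec)
            fix u p q assume nz: "g u p q \<noteq> 0"
            have D: "p \<in> D u" "q \<in> D (\<not> u)" using g_pr [OF nz] pr_D by blast+
            show "(u = s \<and> p = 0) = ((\<not> u) = s \<and> q = 0)"
              using nz ab z D 3 by auto
          qed
          then have False
          proof
            assume Y: "\<forall>u p. pr u p \<longrightarrow> u = s \<and> p = 0"
            obtain q where "q \<in> D (\<not> s)" using D_nonempty [of "\<not> s"] by blast
            then show False using Y [rule_format, OF prq] by simp
          next
            assume Y: "\<forall>u p. pr u p \<longrightarrow> \<not> (u = s \<and> p = 0)"
            show False using Y [rule_format, of s 0] zero by simp
          qed
          then show ?thesis ..
        qed
      next
        assume "\<exists>a b. \<forall>q\<in>D (\<not> s). g s 0 q = 0 \<and> g (\<not> s) q 0 = (a * q + b) / \<phi> q"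
        then obtain a b where ab: "\<And>q. q \<in> D (\<not> s) \<Longrightarrow> g (\<not> s) q 0 = (a * q + b) / \<phi> q"
          and z: "\<And>q. q \<in> D (\<not> s) \<Longrightarrow> g s 0 q = 0" by blast
        \<comment> \<open>The additional factor p moves the product e = p into the forward
          coefficients, so that the backward coefficients become 1 as in \<open>SBa\<close>.\<close>
        define t where "t = (\<lambda>t0 u p. if u = s then (if p = 0 then t0 else if \<rho> p = 0 then 1 else p / \<rho> p)
          else if \<phi> p = 0 then 1 else \<phi> p)"
        have t: "t t0 u p \<noteq> 0" if "t0 \<noteq> 0" for t0 u p using that unfolding t_def by simp
        have n1: "g_scaled (t t0) s p q = p" "g_scaled (t t0) (\<not> s) q p = 1"
          if "p \<in> D s" "p \<noteq> 0" "q \<in> D (\<not> s)" for t0 p q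
          using \<rho> [OF that(1,2)] \<phi> [OF that(3)] that(2)
          unfolding g_scaled_def t_def g [OF that] gb [OF that] by simp_all
        have n0: "g_scaled (t t0) (\<not> s) q 0 = (a * q + b) / t0" "g_scaled (t t0) s 0 q = 0"
          if "q \<in> D (\<not> s)" for t0 q
          using \<phi> [OF that] unfolding g_scaled_def t_def ab [OF that] z [OF that] by simp_all
        consider "a \<noteq> 0" | "a = 0" "b \<noteq> 0" | "a = 0" "b = 0" by blast
        then show ?thesis
        proof cases
          case 1
          have "normal_SBa s (t (- a / 2)) (- 2 * b / a)"
            unfolding normal_SBa_def
          proof (intro conjI ballI)
            fix p q assume pq: "p \<in> D s" "q \<in> D (\<not> s)"
            show "g_scaled (t (- a / 2)) (\<not> s) q p = (if p = 0 then - 2 * q + - 2 * b / a else 1)"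
              using n1(2) [of p q] n0(1) [of q] pq 1 by (auto simp: field_simps)
            show "g_scaled (t (- a / 2)) s p q = p"
              using n1(1) [of p q] n0(2) [of q] pq by auto
          qed (use zero prp in auto)
          moreover have "\<forall>u p. t (- a / 2) u p \<noteq> 0" using t [of "- a / 2"] 1 by simp
          ultimately show ?thesis using prq by blast
        next
          case 2
          \<comment> \<open>With forward coefficients p and backward coefficients 1, also at 0, the
            module is of type \<open>SAab\<close> seen from the other parity, and b = 1/2 removes
            the term in p - q.\<close>
          have "normal_SAab (\<not> s) (t b) (1 / 2)"
            unfolding normal_SAab_def
          proof (intro conjI ballI impI)
            fix p q assume pq: "q \<in> D (\<not> s)" "p \<in> D (\<not> \<not> s)"
            show "g_scaled (t b) (\<not> s) q p = 1"
              using n1(2) [of p q] n0(1) [of q] pq 2 by (cases "p = 0") auto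
            show "g_scaled (t b) (\<not> \<not> s) p q = p + 2 * (q - p) * (1 / 2 - 1/2)"
              using n1(1) [of p q] n0(2) [of q] pq by (cases "p = 0") auto
          qed (use prq in auto)
          moreover have "\<forall>u p. t b u p \<noteq> 0" using t 2 by blast
          ultimately show ?thesis using prp by (intro exI [of _ "\<not> s"]) auto
        next
          case 3
          have "(\<forall>u p. pr u p \<longrightarrow> (u = s \<and> p = 0)) \<or> (\<forall>u p. pr u p \<longrightarrow> \<not> (u = s \<and> p = 0))"
          proof (rule indec)
            fix u p q assume nz: "g u p q \<noteq> 0"
            have D: "p \<in> D u" "q \<in> D (\<not> u)" using g_pr [OF nz] pr_D by blast+
            show "(u = s \<and> p = 0) = ((\<not> u) = s \<and> q = 0)"
              using nz ab z D 3 by auto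
          qed
          then have False
          proof
            assume Y: "\<forall>u p. pr u p \<longrightarrow> u = s \<and> p = 0"
            obtain q where "q \<in> D (\<not> s)" using D_nonempty [of "\<not> s"] by blast
            then show False using Y [rule_format, OF prq] by simp
          next
            assume Y: "\<forall>u p. pr u p \<longrightarrow> \<not> (u = s \<and> p = 0)"
            show False using Y [rule_format, of s 0] zero by simp
          qed
          then show ?thesis ..
        qed
      qed
    qed
  qed
qed

end

section \<open>From modules to coefficients\<close>

lemma lookup_pm_scale [simp]: "Poly_Mapping.lookup (pm_scale k x) i = k * Poly_Mapping.lookup x i"
  by (simp add: pm_scale_def Poly_Mapping.map.rep_eq when_def)

lemma keys_pm_scale: "Poly_Mapping.keys (pm_scale k x) \<subseteq> Poly_Mapping.keys x"
  by (auto simp: in_keys_iff)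

lemma vector_space_pm_scale: "vector_space pm_scale"
  by unfold_locales (auto intro!: poly_mapping_eqI simp: lookup_add algebra_simps)

text \<open>Evaluates a formal combination of symbols at vectors x: the linear map from the free
  space to V, with V inside an arbitrary type.\<close>

definition linear_combination ::
  "('f::field \<Rightarrow> 'v \<Rightarrow> 'v::ab_group_add) \<Rightarrow> ('i \<Rightarrow> 'v) \<Rightarrow> ('i \<Rightarrow>\<^sub>0 'f) \<Rightarrow> 'v" where
  "linear_combination sc x m = (\<Sum>i\<in>Poly_Mapping.keys m. sc (Poly_Mapping.lookup m i) (x i))"

context vector_space begin

lemma linear_combination_superset:
  assumes "finite F" "Poly_Mapping.keys m \<subseteq> F"
  shows "linear_combination scale x m = (\<Sum>i\<in>F. scale (Poly_Mapping.lookup m i) (x i))"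
  unfolding linear_combination_def
  by (rule sum.mono_neutral_left) (use assms in \<open>auto simp: in_keys_iff\<close>)

lemma linear_combination_add:
  "linear_combination scale x (m + n) = linear_combination scale x m + linear_combination scale x n"
proof -
  let ?F = "Poly_Mapping.keys m \<union> Poly_Mapping.keys n"
  have F: "finite ?F" by simp
  show ?thesis
    using linear_combination_superset [OF F, of m x] linear_combination_superset [OF F, of n x]
      linear_combination_superset [OF F keys_add, of x]
    by (simp add: lookup_add scale_left_distrib sum.distrib)
qed

lemma linear_combination_scale:
  "linear_combination scale x (pm_scale k m) = scale k (linear_combination scale x m)"
  using linear_combination_superset [OF finite_keys keys_pm_scale, of x k m]
  by (simp add: linear_combination_def scale_sum_right)

lemma linear_combination_zero [simp]: "linear_combination scale x 0 = 0"
  by (simp add: linear_combination_def)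

lemma linear_combination_single [simp]:
  "linear_combination scale x (Poly_Mapping.single i k) = scale k (x i)"
  by (simp add: linear_combination_def)

lemma linear_combination_sum:
  "linear_combination scale x (\<Sum>i\<in>F. m i) = (\<Sum>i\<in>F. linear_combination scale x (m i))"
  by (induction F rule: infinite_finite_induct) (simp_all add: linear_combination_add)

lemma linear_combination_minus:
  "linear_combination scale x (m - n) = linear_combination scale x m - linear_combination scale x n"
  using linear_combination_add [of x "m - n" n] by simp

lemma linear_combination_bilinear_ext:
  "linear_combination scale x (bilinear_ext f y z) =
    (\<Sum>i\<in>Poly_Mapping.keys y. \<Sum>j\<in>Poly_Mapping.keys z.
      scale (Poly_Mapping.lookup y i * Poly_Mapping.lookup z j) (linear_combination scale x (f i j)))"
  by (simp add: bilinear_ext_def linear_combination_sum linear_combination_scale)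

lemma subspace_linear_combinations:
  "subspace (linear_combination scale x ` {m. Poly_Mapping.keys m \<subseteq> S})"
proof (rule subspaceI)
  show "0 \<in> linear_combination scale x ` {m. Poly_Mapping.keys m \<subseteq> S}"
    by (rule image_eqI [of _ _ 0]) simp_all
next
  fix v w
  assume "v \<in> linear_combination scale x ` {m. Poly_Mapping.keys m \<subseteq> S}"
    and "w \<in> linear_combination scale x ` {m. Poly_Mapping.keys m \<subseteq> S}"
  then obtain m n where mn: "v = linear_combination scale x m" "w = linear_combination scale x n"
    "Poly_Mapping.keys m \<subseteq> S" "Poly_Mapping.keys n \<subseteq> S" by auto
  have "Poly_Mapping.keys (m + n) \<subseteq> S" using keys_add [of m n] mn(3,4) by blast
  then show "v + w \<in> linear_combination scale x ` {m. Poly_Mapping.keys m \<subseteq> S}"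
    unfolding mn(1,2) linear_combination_add [symmetric] by simp
next
  fix k v assume "v \<in> linear_combination scale x ` {m. Poly_Mapping.keys m \<subseteq> S}"
  then obtain m where m: "v = linear_combination scale x m" "Poly_Mapping.keys m \<subseteq> S" by auto
  have "Poly_Mapping.keys (pm_scale k m) \<subseteq> S" using keys_pm_scale [of k m] m(2) by blast
  then show "scale k v \<in> linear_combination scale x ` {m. Poly_Mapping.keys m \<subseteq> S}"
    unfolding m(1) linear_combination_scale [symmetric] by simp
qed

lemma linear_combinations_eq_span:
  "linear_combination scale x ` {m. Poly_Mapping.keys m \<subseteq> S} = span (x ` S)"
proof (rule span_unique [symmetric])
  show "x ` S \<subseteq> linear_combination scale x ` {m. Poly_Mapping.keys m \<subseteq> S}"
  proof
    fix v assume "v \<in> x ` S"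
    then obtain i where i: "i \<in> S" "v = x i" by blast
    show "v \<in> linear_combination scale x ` {m. Poly_Mapping.keys m \<subseteq> S}"
      by (rule image_eqI [of _ _ "Poly_Mapping.single i 1"]) (use i in simp_all)
  qed
  show "subspace (linear_combination scale x ` {m. Poly_Mapping.keys m \<subseteq> S})"
    by (rule subspace_linear_combinations)
  fix T assume T: "x ` S \<subseteq> T" "subspace T"
  show "linear_combination scale x ` {m. Poly_Mapping.keys m \<subseteq> S} \<subseteq> T"
    unfolding linear_combination_def
    by (rule image_subsetI, rule subspace_sum [OF T(2)], rule subspace_scale [OF T(2)]) (use T(1) in auto)
qed

end

lemma bilinear_ext_single [simp]:
  fixes f :: "'i \<Rightarrow> 'j \<Rightarrow> ('k \<Rightarrow>\<^sub>0 'f::field)"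
  shows "bilinear_ext f (Poly_Mapping.single i 1) (Poly_Mapping.single j 1) = f i j"
  by (rule poly_mapping_eqI) (simp add: bilinear_ext_def)

section \<open>The action of the generators of the algebra\<close>

locale svir_mod =
  fixes M :: "'f::field_char_0 set" and \<alpha> :: 'f and V :: "('f, 'v::ab_group_add) gr_module"
  assumes zero_in_M: "0 \<in> M" and M_diff: "x \<in> M \<Longrightarrow> y \<in> M \<Longrightarrow> x - y \<in> M"
    and two_alpha: "2 * \<alpha> \<in> M"
    and svir_module: "svir_module M \<alpha> V"
begin

lemma vector_space_scal: "vector_space (scal V)"
  by (rule svir_module [unfolded svir_module_def, THEN conjunct1, rule_format])

sublocale vector_space "scal V"
  by (rule vector_space_scal)

lemma M_add: "x \<in> M \<Longrightarrow> y \<in> M \<Longrightarrow> x + y \<in> M"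
  using M_diff [of x "0 - y"] M_diff [of 0 y] zero_in_M by simp

abbreviation Pt :: "bool \<Rightarrow> 'v set" where "Pt u \<equiv> part V (of_bool u)"

abbreviation L :: "'f \<Rightarrow> 'v \<Rightarrow> 'v" where "L \<mu> \<equiv> act V (Poly_Mapping.single (LG \<mu>) 1)"
abbreviation G :: "'f \<Rightarrow> 'v \<Rightarrow> 'v" where "G \<nu> \<equiv> act V (Poly_Mapping.single (GG \<nu>) 1)"
abbreviation Z :: "'v \<Rightarrow> 'v" where "Z \<equiv> act V (Poly_Mapping.single CG 1)"

lemma subspace_part: "subspace (part V \<sigma>)"
  by (rule svir_module [unfolded svir_module_def, THEN conjunct2, THEN conjunct1, rule_format])

lemma part_disjoint: "v \<in> part V 0 \<Longrightarrow> v \<in> part V 1 \<Longrightarrow> v = 0"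
  using svir_module [unfolded svir_module_def, THEN conjunct2, THEN conjunct2, THEN conjunct1] by blast

lemma part_in_vecs: "v \<in> part V \<sigma> \<Longrightarrow> v \<in> vecs V"
proof -
  assume v: "v \<in> part V \<sigma>"
  consider "\<sigma> = 0" | "\<sigma> = 1" using bit_not_one_iff by blast
  then show ?thesis
  proof cases
    case 1
    then show ?thesis unfolding vecs_def
      using v set_plus_intro [of v "part V 0" 0 "part V 1"] subspace_0 [OF subspace_part] by simp
  next
    case 2
    then show ?thesis unfolding vecs_def
      using v set_plus_intro [of 0 "part V 0" v "part V 1"] subspace_0 [OF subspace_part] by simp
  qed
qed

lemma subspace_vecs: "subspace (vecs V)"
  unfolding vecs_def set_plus_def
  using subspace_sums [OF subspace_part subspace_part, of 0 1]
  by (rule back_subst [of subspace]) auto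

lemma act_part: "x \<in> svir_part M \<alpha> \<sigma> \<Longrightarrow> v \<in> part V \<tau> \<Longrightarrow> act V x v \<in> part V (\<sigma> + \<tau>)"
  by (rule svir_module [unfolded svir_module_def, THEN conjunct2, THEN conjunct2, THEN conjunct2, THEN conjunct1, rule_format])

lemma act_add_right: "x \<in> svir_carrier M \<alpha> \<Longrightarrow> u \<in> vecs V \<Longrightarrow> v \<in> vecs V \<Longrightarrow> act V x (u + v) = act V x u + act V x v"
  by (rule svir_module [unfolded svir_module_def, THEN conjunct2, THEN conjunct2, THEN conjunct2, THEN conjunct2, THEN conjunct1, rule_format])

lemma act_scale_right: "x \<in> svir_carrier M \<alpha> \<Longrightarrow> v \<in> vecs V \<Longrightarrow> act V x (scal V k v) = scal V k (act V x v)"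
  by (rule svir_module [unfolded svir_module_def, THEN conjunct2, THEN conjunct2, THEN conjunct2, THEN conjunct2, THEN conjunct2, THEN conjunct1, rule_format])

lemma act_add_left: "x \<in> svir_carrier M \<alpha> \<Longrightarrow> y \<in> svir_carrier M \<alpha> \<Longrightarrow> v \<in> vecs V \<Longrightarrow> act V (x + y) v = act V x v + act V y v"
  by (rule svir_module [unfolded svir_module_def, THEN conjunct2, THEN conjunct2, THEN conjunct2, THEN conjunct2, THEN conjunct2, THEN conjunct2, THEN conjunct1, rule_format])

lemma act_scale_left: "x \<in> svir_carrier M \<alpha> \<Longrightarrow> v \<in> vecs V \<Longrightarrow> act V (pm_scale k x) v = scal V k (act V x v)"
  by (rule svir_module [unfolded svir_module_def, THEN conjunct2, THEN conjunct2, THEN conjunct2, THEN conjunct2, THEN conjunct2, THEN conjunct2, THEN conjunct2, THEN conjunct1, rule_format])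

lemma act_bracket: "x \<in> svir_part M \<alpha> \<sigma> \<Longrightarrow> y \<in> svir_part M \<alpha> \<tau> \<Longrightarrow> v \<in> vecs V \<Longrightarrow> act V (svir_bracket x y) v =
    (if \<sigma> = 1 \<and> \<tau> = 1 then act V x (act V y v) + act V y (act V x v)
     else act V x (act V y v) - act V y (act V x v))"
  by (rule svir_module [unfolded svir_module_def, THEN conjunct2, THEN conjunct2, THEN conjunct2, THEN conjunct2, THEN conjunct2, THEN conjunct2, THEN conjunct2, THEN conjunct2, rule_format])

lemma gen_part:
  "\<mu> \<in> M \<Longrightarrow> Poly_Mapping.single (LG \<mu>) 1 \<in> svir_part M \<alpha> 0"
  "Poly_Mapping.single CG 1 \<in> svir_part M \<alpha> 0"
  "\<nu> \<in> \<alpha> +o M \<Longrightarrow> Poly_Mapping.single (GG \<nu>) 1 \<in> svir_part M \<alpha> 1"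
  by (auto simp: svir_part_def)

abbreviation gens :: "'f svir_gen set" where "gens \<equiv> insert CG (LG ` M \<union> GG ` (\<alpha> +o M))"

lemma single_carrier: "g \<in> gens \<Longrightarrow> Poly_Mapping.single g k \<in> svir_carrier M \<alpha>"
  by (cases "k = 0") (auto simp: svir_carrier_def)

lemma act_zero_left: "v \<in> vecs V \<Longrightarrow> act V 0 v = 0"
  using act_add_left [of 0 0 v] by (simp add: svir_carrier_def)

lemma act_single: "g \<in> gens \<Longrightarrow> v \<in> vecs V \<Longrightarrow> act V (Poly_Mapping.single g k) v = scal V k (act V (Poly_Mapping.single g 1) v)"
proof -
  assume a: "g \<in> gens" "v \<in> vecs V"
  have "Poly_Mapping.single g k = pm_scale k (Poly_Mapping.single g 1)"
    by (rule poly_mapping_eqI) (simp add: lookup_single when_def)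
  then show ?thesis using act_scale_left [OF single_carrier [OF a(1)] a(2), of k 1] by simp
qed

lemma act_minus_left: "x \<in> svir_carrier M \<alpha> \<Longrightarrow> y \<in> svir_carrier M \<alpha> \<Longrightarrow> v \<in> vecs V \<Longrightarrow> act V (x - y) v = act V x v - act V y v"
proof -
  assume a: "x \<in> svir_carrier M \<alpha>" "y \<in> svir_carrier M \<alpha>" "v \<in> vecs V"
  have "Poly_Mapping.keys (x - y) \<subseteq> Poly_Mapping.keys x \<union> Poly_Mapping.keys y" by (rule keys_diff)
  then have "x - y \<in> svir_carrier M \<alpha>" using a unfolding svir_carrier_def by blast
  from act_add_left [OF this a(2,3)] show ?thesis by simp
qed

lemma act_zero_right: "x \<in> svir_carrier M \<alpha> \<Longrightarrow> act V x 0 = 0"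
  using act_add_right [of x 0 0] subspace_0 [OF subspace_vecs] by simp

lemma act_sum_right:
  assumes "x \<in> svir_carrier M \<alpha>" "\<And>i. i \<in> F \<Longrightarrow> y i \<in> vecs V"
  shows "act V x (\<Sum>i\<in>F. y i) = (\<Sum>i\<in>F. act V x (y i))"
  using assms(2)
proof (induction F rule: infinite_finite_induct)
  case (insert i F)
  then show ?case using act_add_right [OF assms(1), of "y i" "sum y F"] subspace_sum [OF subspace_vecs, of F y] by simp
qed (use act_zero_right [OF assms(1)] in simp_all)

lemma act_expand:
  assumes x: "x \<in> svir_carrier M \<alpha>" and v: "v \<in> vecs V"
  shows "act V x v = (\<Sum>g\<in>Poly_Mapping.keys x. scal V (Poly_Mapping.lookup x g) (act V (Poly_Mapping.single g 1) v))"
proof -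
  have *: "(\<Sum>g\<in>F. Poly_Mapping.single g (Poly_Mapping.lookup x g)) \<in> svir_carrier M \<alpha> \<and>
     act V (\<Sum>g\<in>F. Poly_Mapping.single g (Poly_Mapping.lookup x g)) v =
     (\<Sum>g\<in>F. scal V (Poly_Mapping.lookup x g) (act V (Poly_Mapping.single g 1) v))"
    if "finite F" "F \<subseteq> gens" for F
    using that
  proof (induction F)
    case empty
    show ?case using act_zero_left [OF v] by (simp add: svir_carrier_def)
  next
    case (insert g F)
    let ?s = "\<lambda>g. Poly_Mapping.single g (Poly_Mapping.lookup x g)"
    have g: "g \<in> gens" and IH: "sum ?s F \<in> svir_carrier M \<alpha>" 
      "act V (sum ?s F) v = (\<Sum>g\<in>F. scal V (Poly_Mapping.lookup x g) (act V (Poly_Mapping.single g 1) v))"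
      using insert by auto
    have "?s g + sum ?s F \<in> svir_carrier M \<alpha>"
      using keys_add [of "?s g" "sum ?s F"] single_carrier [OF g, of "Poly_Mapping.lookup x g"] IH(1)
      unfolding svir_carrier_def by blast
    then show ?case
      using insert(1,2) act_add_left [OF single_carrier [OF g] IH(1) v] act_single [OF g v, of "Poly_Mapping.lookup x g"] IH(2) by simp
  qed
  have "(\<Sum>g\<in>Poly_Mapping.keys x. Poly_Mapping.single g (Poly_Mapping.lookup x g)) = x"
    by (rule poly_mapping_eqI) (auto simp: lookup_sum lookup_single when_def in_keys_iff)
  then show ?thesis using * [of "Poly_Mapping.keys x"] x unfolding svir_carrier_def by auto
qed

lemma L_part: "\<mu> \<in> M \<Longrightarrow> v \<in> Pt u \<Longrightarrow> L \<mu> v \<in> Pt u"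
  and Z_part: "v \<in> Pt u \<Longrightarrow> Z v \<in> Pt u"
  and G_part: "\<nu> \<in> \<alpha> +o M \<Longrightarrow> v \<in> Pt u \<Longrightarrow> G \<nu> v \<in> Pt (\<not> u)"
proof -
  show "\<mu> \<in> M \<Longrightarrow> v \<in> Pt u \<Longrightarrow> L \<mu> v \<in> Pt u" using act_part [OF gen_part(1)] by fastforce
  show "v \<in> Pt u \<Longrightarrow> Z v \<in> Pt u" using act_part [OF gen_part(2)] by fastforce
  have "(1 :: bit) + of_bool u = of_bool (\<not> u)" by (cases u) simp_all
  then show "\<nu> \<in> \<alpha> +o M \<Longrightarrow> v \<in> Pt u \<Longrightarrow> G \<nu> v \<in> Pt (\<not> u)" using act_part [OF gen_part(3)] by fastforce
qed

lemma G_add_M: "\<eta> \<in> \<alpha> +o M \<Longrightarrow> \<kappa> \<in> \<alpha> +o M \<Longrightarrow> \<eta> + \<kappa> \<in> M"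
proof -
  assume "\<eta> \<in> \<alpha> +o M" "\<kappa> \<in> \<alpha> +o M"
  then obtain m n where "m \<in> M" "n \<in> M" "\<eta> + \<kappa> = 2 * \<alpha> + (m + n)" by (auto simp: elt_set_plus_def algebra_simps)
  then show ?thesis using M_add two_alpha by auto
qed

lemma L_add_G: "\<mu> \<in> M \<Longrightarrow> \<nu> \<in> \<alpha> +o M \<Longrightarrow> \<mu> + \<nu> \<in> \<alpha> +o M"
proof -
  assume \<mu>: "\<mu> \<in> M" and "\<nu> \<in> \<alpha> +o M"
  then obtain m where m: "m \<in> M" "\<nu> = \<alpha> + m" by (auto simp: elt_set_plus_def)
  have "\<mu> + \<nu> = \<alpha> + (\<mu> + m)" unfolding m(2) by (simp add: algebra_simps)
  then show ?thesis using M_add [OF \<mu> m(1)] by (metis set_plus_intro2)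
qed

lemma L_L:
  assumes "\<mu> \<in> M" "\<nu> \<in> M" "v \<in> vecs V"
  shows "L \<mu> (L \<nu> v) - L \<nu> (L \<mu> v) = scal V (\<nu> - \<mu>) (L (\<mu> + \<nu>) v)
    + scal V (if \<mu> + \<nu> = 0 then 1/12 * (\<mu>^3 - \<mu>) else 0) (Z v)"
proof -
  have g: "LG (\<mu> + \<nu>) \<in> gens" "CG \<in> gens" using M_add [OF assms(1,2)] by simp_all
  show ?thesis
    using act_bracket [OF gen_part(1) [OF assms(1)] gen_part(1) [OF assms(2)] assms(3)]
      act_add_left [OF single_carrier [OF g(1)] single_carrier [OF g(2)] assms(3)]
      act_single [OF g(1) assms(3), of "\<nu> - \<mu>"] act_single [OF g(2) assms(3), of "if \<mu> + \<nu> = 0 then 1/12 * (\<mu>^3 - \<mu>) else 0"]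
    by (simp add: svir_bracket_def)
qed

lemma L_G:
  assumes "\<mu> \<in> M" "\<nu> \<in> \<alpha> +o M" "v \<in> vecs V"
  shows "L \<mu> (G \<nu> v) - G \<nu> (L \<mu> v) = scal V (\<nu> - 1/2 * \<mu>) (G (\<mu> + \<nu>) v)"
proof -
  have g: "GG (\<mu> + \<nu>) \<in> gens" using L_add_G [OF assms(1,2)] by simp
  show ?thesis
    using act_bracket [OF gen_part(1) [OF assms(1)] gen_part(3) [OF assms(2)] assms(3)]
      act_single [OF g assms(3), of "\<nu> - 1/2 * \<mu>"]
    by (simp add: svir_bracket_def)
qed

lemma G_G:
  assumes "\<nu> \<in> \<alpha> +o M" "\<kappa> \<in> \<alpha> +o M" "v \<in> vecs V"
  shows "G \<nu> (G \<kappa> v) + G \<kappa> (G \<nu> v) = scal V 2 (L (\<nu> + \<kappa>) v)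
    - scal V (if \<nu> + \<kappa> = 0 then 1/3 * (\<nu>^2 - 1/4) else 0) (Z v)"
proof -
  have g: "LG (\<nu> + \<kappa>) \<in> gens" "CG \<in> gens" using G_add_M [OF assms(1,2)] by simp_all
  show ?thesis
    using act_bracket [OF gen_part(3) [OF assms(1)] gen_part(3) [OF assms(2)] assms(3)]
      act_minus_left [OF single_carrier [OF g(1)] single_carrier [OF g(2)] assms(3)]
      act_single [OF g(1) assms(3), of 2] act_single [OF g(2) assms(3), of "if \<nu> + \<kappa> = 0 then 1/3 * (\<nu>^2 - 1/4) else 0"]
    by (simp add: svir_bracket_def)
qed

lemma Z_L: "\<mu> \<in> M \<Longrightarrow> v \<in> vecs V \<Longrightarrow> Z (L \<mu> v) = L \<mu> (Z v)"
  and Z_G: "\<nu> \<in> \<alpha> +o M \<Longrightarrow> v \<in> vecs V \<Longrightarrow> Z (G \<nu> v) = G \<nu> (Z v)"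
  using act_bracket [OF gen_part(2) gen_part(1)] act_bracket [OF gen_part(2) gen_part(3)] act_zero_left
  by (simp_all add: svir_bracket_def)

end

section \<open>Weight spaces and indecomposability\<close>

locale svir_series = svir_mod M \<alpha> V
  for M :: "'f::field_char_0 set" and \<alpha> and V :: "('f, 'v::ab_group_add) gr_module" +
  assumes intermediate_series: "intermediate_series M \<alpha> V"
begin

definition wt :: "bool \<Rightarrow> 'f \<Rightarrow> 'v set" where
  "wt u \<kappa> = weight_space V (of_bool u) \<kappa>"

lemma wt_iff: "v \<in> wt u \<kappa> \<longleftrightarrow> v \<in> Pt u \<and> L 0 v = scal V \<kappa> v"
  by (simp add: wt_def weight_space_def)

lemma L0_carrier: "Poly_Mapping.single (LG 0) 1 \<in> svir_carrier M \<alpha>"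
  by (rule single_carrier) (use zero_in_M in simp)

lemma subspace_wt: "subspace (wt u \<kappa>)"
proof (rule subspaceI)
  show "0 \<in> wt u \<kappa>" using subspace_0 [OF subspace_part] act_zero_right [OF L0_carrier] by (simp add: wt_iff)
next
  fix x y assume "x \<in> wt u \<kappa>" "y \<in> wt u \<kappa>"
  then show "x + y \<in> wt u \<kappa>" unfolding wt_iff
    using subspace_add [OF subspace_part] act_add_right [OF L0_carrier part_in_vecs part_in_vecs] scale_right_distrib
    by metis
next
  fix k x assume "x \<in> wt u \<kappa>"
  then show "scal V k x \<in> wt u \<kappa>" unfolding wt_iff
    using subspace_scale [OF subspace_part] act_scale_right [OF L0_carrier part_in_vecs] scale_left_commute
    by metis
qed

lemma wt_in_vecs: "v \<in> wt u \<kappa> \<Longrightarrow> v \<in> vecs V"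
  using part_in_vecs unfolding wt_iff by blast

lemma L_wt:
  assumes "\<mu> \<in> M" "v \<in> wt u \<kappa>"
  shows "L \<mu> v \<in> wt u (\<kappa> + \<mu>)"
proof -
  have v: "v \<in> Pt u" "L 0 v = scal V \<kappa> v" using assms(2) by (simp_all add: wt_iff)
  have vv: "v \<in> vecs V" by (rule part_in_vecs [OF v(1)])
  have c: "Poly_Mapping.single (LG \<mu>) 1 \<in> svir_carrier M \<alpha>" by (rule single_carrier) (use assms in simp)
  have "L 0 (L \<mu> v) - L \<mu> (L 0 v) = scal V \<mu> (L \<mu> v)"
    using L_L [OF zero_in_M assms(1) vv] by simp
  moreover have "L \<mu> (L 0 v) = scal V \<kappa> (L \<mu> v)"
    unfolding v(2) by (rule act_scale_right [OF c vv])
  ultimately have "L 0 (L \<mu> v) = scal V \<mu> (L \<mu> v) + scal V \<kappa> (L \<mu> v)" by (simp add: algebra_simps)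
  then show ?thesis using L_part [OF assms(1) v(1)] by (simp add: wt_iff scale_left_distrib add.commute)
qed

lemma G_wt:
  assumes "\<nu> \<in> \<alpha> +o M" "v \<in> wt u \<kappa>"
  shows "G \<nu> v \<in> wt (\<not> u) (\<kappa> + \<nu>)"
proof -
  have v: "v \<in> Pt u" "L 0 v = scal V \<kappa> v" using assms(2) by (simp_all add: wt_iff)
  have vv: "v \<in> vecs V" by (rule part_in_vecs [OF v(1)])
  have c: "Poly_Mapping.single (GG \<nu>) 1 \<in> svir_carrier M \<alpha>" by (rule single_carrier) (use assms in simp)
  have "L 0 (G \<nu> v) - G \<nu> (L 0 v) = scal V \<nu> (G \<nu> v)"
    using L_G [OF zero_in_M assms(1) vv] by simp
  moreover have "G \<nu> (L 0 v) = scal V \<kappa> (G \<nu> v)"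
    unfolding v(2) by (rule act_scale_right [OF c vv])
  ultimately have "L 0 (G \<nu> v) = scal V \<nu> (G \<nu> v) + scal V \<kappa> (G \<nu> v)" by (simp add: algebra_simps)
  then show ?thesis using G_part [OF assms(1) v(1)] by (simp add: wt_iff scale_left_distrib add.commute)
qed

lemma Z_wt:
  assumes "v \<in> wt u \<kappa>"
  shows "Z v \<in> wt u \<kappa>"
proof -
  have v: "v \<in> Pt u" "L 0 v = scal V \<kappa> v" using assms by (simp_all add: wt_iff)
  have vv: "v \<in> vecs V" by (rule part_in_vecs [OF v(1)])
  have c: "Poly_Mapping.single CG 1 \<in> svir_carrier M \<alpha>" by (rule single_carrier) simp
  have "L 0 (Z v) = scal V \<kappa> (Z v)"
    using Z_L [OF zero_in_M vv] act_scale_right [OF c vv] v(2) by simp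
  then show ?thesis using Z_part [OF v(1)] by (simp add: wt_iff)
qed

lemma wt_line: "\<exists>w. wt u \<kappa> = range (\<lambda>k. scal V k w)"
proof -
  obtain B0 where B0: "finite B0" "wt u \<kappa> \<subseteq> span B0" and dim: "dim (wt u \<kappa>) \<le> 1"
    using intermediate_series unfolding intermediate_series_def wt_def by metis
  obtain B where B: "B \<subseteq> wt u \<kappa>" "independent B" "wt u \<kappa> \<subseteq> span B" "card B = dim (wt u \<kappa>)"
    using basis_exists by blast
  have "finite B" using independent_span_bound [OF B0(1) B(2)] B(1) B0(2) by blast
  then have "B = {} \<or> (\<exists>w. B = {w})" using dim B(4) by (metis card_1_singletonE card_eq_0_iff le_less less_one)
  then obtain w where "span B = span {w}" by (metis span_empty span_insert_0)
  moreover have "span B = wt u \<kappa>" using span_minimal [OF B(1) subspace_wt] B(3) by blast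
  ultimately show ?thesis using span_singleton by metis
qed

text \<open>A weight space is \<open>{0}\<close> exactly if its spanning vector \<open>b u \<kappa>\<close> is \<open>0\<close>.\<close>

definition b :: "bool \<Rightarrow> 'f \<Rightarrow> 'v" where
  "b u \<kappa> = (SOME w. wt u \<kappa> = range (\<lambda>k. scal V k w))"

lemma wt_eq: "wt u \<kappa> = range (\<lambda>k. scal V k (b u \<kappa>))"
  unfolding b_def by (rule someI_ex [OF wt_line])

lemma b_wt: "b u \<kappa> \<in> wt u \<kappa>"
  unfolding wt_eq by (rule range_eqI [of _ _ 1]) simp

lemma b_vecs: "b u \<kappa> \<in> vecs V"
  by (rule wt_in_vecs [OF b_wt])

lemma b_part: "b u \<kappa> \<in> Pt u"
  using b_wt by (simp add: wt_iff)

lemma part_span: "Pt u = span (range (b u))"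
proof -
  have "Pt u = span (\<Union>\<kappa>. wt u \<kappa>)"
    using intermediate_series unfolding intermediate_series_def wt_def by blast
  also have "\<dots> \<subseteq> span (range (b u))"
  proof (rule span_minimal [OF _ subspace_span], rule UN_least)
    fix \<kappa> show "wt u \<kappa> \<subseteq> span (range (b u))"
      unfolding wt_eq using span_scale [OF span_base] by blast
  qed
  finally show ?thesis using span_minimal [OF _ subspace_part, of "range (b u)" "of_bool u"] b_part by blast
qed

lemma set_plus_Collect: "A + B = {x + y | x y. x \<in> A \<and> y \<in> (B :: 'v set)}"
  unfolding set_plus_def by auto

lemma vecs_eq_sum: "vecs V = {x + y | x y. x \<in> Pt False \<and> y \<in> Pt True}"
  unfolding vecs_def set_plus_Collect by simp

lemma eigenvector_sum_zero:
  assumes "finite S" "\<And>i. i \<in> S \<Longrightarrow> y i \<in> wt u (w i)" "inj_on w S" "sum y S = 0"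
  shows "\<forall>i\<in>S. y i = 0"
  using assms
proof (induction S arbitrary: y)
  case (insert j S)
  have yv: "y i \<in> vecs V" if "i \<in> insert j S" for i using wt_in_vecs insert.prems(1) that by blast
  have ev: "L 0 (y i) = scal V (w i) (y i)" if "i \<in> insert j S" for i
    using insert.prems(1) [OF that] by (simp add: wt_iff)
  have s0: "y j + sum y S = 0" using insert by simp
  have "(\<Sum>i\<in>insert j S. L 0 (y i)) = 0"
    using act_sum_right [of _ "insert j S" y, OF L0_carrier yv] act_zero_right [OF L0_carrier] insert.prems(3) by simp
  then have "(\<Sum>i\<in>insert j S. scal V (w i) (y i)) = 0" using ev by simp
  then have "scal V (w j) (y j) + (\<Sum>i\<in>S. scal V (w i) (y i)) = 0" using insert(1,2) by simp
  moreover have "scal V (w j) (y j) + (\<Sum>i\<in>S. scal V (w j) (y i)) = 0"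
    using s0 by (simp add: scale_right_distrib [symmetric] scale_sum_right [symmetric])
  ultimately have "(\<Sum>i\<in>S. scal V (w i) (y i)) - (\<Sum>i\<in>S. scal V (w j) (y i)) = 0" by (metis add_left_cancel right_minus_eq)
  then have "(\<Sum>i\<in>S. scal V (w i - w j) (y i)) = 0"
    by (simp add: sum_subtractf scale_left_diff_distrib)
  moreover have "scal V (w i - w j) (y i) \<in> wt u (w i)" if "i \<in> S" for i
    by (rule subspace_scale [OF subspace_wt], rule insert.prems(1)) (use that in simp)
  moreover have "inj_on w S" using insert.prems(2) by simp
  ultimately have "\<forall>i\<in>S. scal V (w i - w j) (y i) = 0" by (intro insert.IH)
  moreover have "w i \<noteq> w j" if "i \<in> S" for i using insert.prems(2) insert(2) that by (auto simp: inj_on_def)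
  ultimately have "\<forall>i\<in>S. y i = 0" by simp
  then show ?case using s0 by simp
qed simp

text \<open>The two parities may share an eigenvalue, so the sums over each parity are separated
  first; within one parity the eigenvalues are distinct.\<close>

lemma weight_vectors_independent:
  assumes inj: "inj_on w S" and x: "\<And>i. i \<in> S \<Longrightarrow> x i \<in> wt (fst (w i)) (snd (w i)) \<and> x i \<noteq> 0"
    and m: "Poly_Mapping.keys m \<subseteq> S" "linear_combination (scal V) x m = 0"
  shows "m = 0"
proof -
  define y where "y i = scal V (Poly_Mapping.lookup m i) (x i)" for i
  define K where "K u = {i \<in> Poly_Mapping.keys m. fst (w i) = u}" for u
  have fin: "finite (K u)" for u unfolding K_def by simp
  have y: "y i \<in> wt (fst (w i)) (snd (w i))" if "i \<in> Poly_Mapping.keys m" for i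
    unfolding y_def using subspace_scale [OF subspace_wt] x m(1) that by blast
  have part: "sum y (K u) \<in> Pt u" for u
    by (rule subspace_sum [OF subspace_part]) (use y wt_iff in \<open>fastforce simp: K_def\<close>)
  have "Poly_Mapping.keys m = K False \<union> K True" "K False \<inter> K True = {}" unfolding K_def by auto
  then have "sum y (K False) + sum y (K True) = 0"
    using m(2) sum.union_disjoint [OF fin [of False] fin [of True], of y]
    unfolding linear_combination_def y_def by simp
  then have e: "sum y (K True) = - sum y (K False)" by (metis add.commute eq_neg_iff_add_eq_0)
  have "sum y (K True) \<in> Pt False" unfolding e by (rule subspace_neg [OF subspace_part part])
  then have "sum y (K True) = 0" using part [of True] part_disjoint by simp
  then have z: "sum y (K u) = 0" for u using e by (cases u) auto
  have "Poly_Mapping.keys m = {}"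
  proof (rule ccontr)
    assume "Poly_Mapping.keys m \<noteq> {}"
    then obtain i where i: "i \<in> Poly_Mapping.keys m" by blast
    let ?u = "fst (w i)"
    have "\<forall>j\<in>K ?u. y j = 0"
    proof (rule eigenvector_sum_zero [OF fin _ _ z])
      show "y j \<in> wt ?u ((snd \<circ> w) j)" if "j \<in> K ?u" for j using y [of j] that by (simp add: K_def)
      show "inj_on (snd \<circ> w) (K ?u)"
        using inj m(1) by (auto simp: inj_on_def K_def prod_eq_iff)
    qed
    then have "y i = 0" using i by (simp add: K_def)
    then show False using i x m(1) by (auto simp: y_def in_keys_iff)
  qed
  then show ?thesis by simp
qed

lemma gens_cases:
  assumes "g \<in> gens"
  obtains "g = CG" | \<mu> where "g = LG \<mu>" "\<mu> \<in> M" | \<nu> where "g = GG \<nu>" "\<nu> \<in> \<alpha> +o M"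
  using assms by blast

text \<open>The weight vectors with a true label and those with a false label span two graded
  submodules, because no generator leads from one label to the other. Their direct sum is V, so one
  of them is 0.\<close>

lemma indecomposable_weights:
  assumes YL: "\<And>u p \<mu>. \<mu> \<in> M \<Longrightarrow> L \<mu> (b u p) \<noteq> 0 \<Longrightarrow> Y u p = Y u (p + \<mu>)"
    and YG: "\<And>u p \<nu>. \<nu> \<in> \<alpha> +o M \<Longrightarrow> G \<nu> (b u p) \<noteq> 0 \<Longrightarrow> Y u p = Y (\<not> u) (p + \<nu>)"
  shows "(\<forall>u p. b u p \<noteq> 0 \<longrightarrow> Y u p) \<or> (\<forall>u p. b u p \<noteq> 0 \<longrightarrow> \<not> Y u p)"
proof -
  define B where "B i = b (fst i) (snd i)" for i
  define S where "S y = {i. B i \<noteq> 0 \<and> Y (fst i) (snd i) = y}" for y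
  have BS: "B i \<in> span (B ` S y)" if "Y (fst i) (snd i) = y" for i y
    by (cases "B i = 0") (use that in \<open>auto simp: S_def span_zero intro: span_base\<close>)
  have Bv: "B ` S y \<subseteq> vecs V" for y unfolding B_def using b_vecs by blast
  have sv: "span (B ` S y) \<subseteq> vecs V" for y by (rule span_minimal [OF Bv subspace_vecs])
  have gen: "act V (Poly_Mapping.single g 1) (B i) \<in> span (B ` S y)" if i: "i \<in> S y" and g: "g \<in> gens" for g i y
    using g
  proof (cases rule: gens_cases)
    case 1
    have "Z (B i) \<in> range (\<lambda>k. scal V k (B i))" using Z_wt [OF b_wt] unfolding wt_eq B_def .
    then obtain k where k: "Z (B i) = scal V k (B i)" by blast
    show ?thesis unfolding 1 k by (rule span_scale, rule BS) (use i in \<open>simp add: S_def\<close>)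
  next
    case (2 \<mu>)
    have "L \<mu> (B i) \<in> range (\<lambda>k. scal V k (b (fst i) (snd i + \<mu>)))" using L_wt [OF 2(2) b_wt] unfolding wt_eq B_def .
    then obtain k where k: "L \<mu> (B i) = scal V k (B (fst i, snd i + \<mu>))" unfolding B_def by auto
    show ?thesis unfolding 2(1)
    proof (cases "L \<mu> (B i) = 0")
      case False
      then have "Y (fst i) (snd i + \<mu>) = y" using YL [OF 2(2), of "fst i" "snd i"] i unfolding B_def S_def by simp
      then show "L \<mu> (B i) \<in> span (B ` S y)" unfolding k
        using span_scale [OF BS [of "(fst i, snd i + \<mu>)" y], of k] by simp
    qed (simp add: span_zero)
  next
    case (3 \<nu>)
    have "G \<nu> (B i) \<in> range (\<lambda>k. scal V k (b (\<not> fst i) (snd i + \<nu>)))" using G_wt [OF 3(2) b_wt] unfolding wt_eq B_def .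
    then obtain k where k: "G \<nu> (B i) = scal V k (B (\<not> fst i, snd i + \<nu>))" unfolding B_def by auto
    show ?thesis unfolding 3(1)
    proof (cases "G \<nu> (B i) = 0")
      case False
      then have "Y (\<not> fst i) (snd i + \<nu>) = y" using YG [OF 3(2), of "fst i" "snd i"] i unfolding B_def S_def by simp
      then show "G \<nu> (B i) \<in> span (B ` S y)" unfolding k
        using span_scale [OF BS [of "(\<not> fst i, snd i + \<nu>)" y], of k] by simp
    qed (simp add: span_zero)
  qed
  have sub: "svir_submodule M \<alpha> V (span (B ` S y))" for y
    unfolding svir_submodule_def
  proof (intro conjI ballI)
    let ?N = "span (B ` S y)"
    show "subspace ?N" by (rule subspace_span)
    have sp: "subspace (?N \<inter> part V \<sigma>)" for \<sigma> by (rule subspace_inter [OF subspace_span subspace_part])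
    have "?N \<subseteq> {x + z | x z. x \<in> ?N \<inter> Pt False \<and> z \<in> ?N \<inter> Pt True}"
    proof (rule span_minimal [OF _ subspace_sums [OF sp sp]], rule image_subsetI)
      fix i assume i: "i \<in> S y"
      have n: "B i \<in> ?N" using i by (blast intro: span_base)
      have p: "B i \<in> Pt (fst i)" unfolding B_def by (rule b_part)
      show "B i \<in> {x + z | x z. x \<in> ?N \<inter> Pt False \<and> z \<in> ?N \<inter> Pt True}"
      proof (cases "fst i")
        case True
        then have "B i \<in> ?N \<inter> Pt True" using n p by simp
        then show ?thesis using subspace_0 [OF sp [of "of_bool False"]]
          by (intro CollectI exI [of _ 0] exI [of _ "B i"] conjI) simp_all
      next
        case False
        then have "B i \<in> ?N \<inter> Pt False" using n p by simp
        then show ?thesis using subspace_0 [OF sp [of "of_bool True"]]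
          by (intro CollectI exI [of _ 0] exI [of _ "B i"] conjI) simp_all
      qed
    qed
    then have "?N \<subseteq> (?N \<inter> part V 0) + (?N \<inter> part V 1)"
      unfolding set_plus_Collect of_bool_eq .
    moreover have "(?N \<inter> part V 0) + (?N \<inter> part V 1) \<subseteq> ?N"
    proof (rule subsetI, erule set_plus_elim)
      fix v x z assume "v = x + z" "x \<in> ?N \<inter> part V 0" "z \<in> ?N \<inter> part V 1"
      then show "v \<in> ?N" using span_add [of x "B ` S y" z] by simp
    qed
    ultimately show "?N = (?N \<inter> part V 0) + (?N \<inter> part V 1)" by (rule antisym)
    fix x v assume x: "x \<in> svir_carrier M \<alpha>" and v: "v \<in> ?N"
    have "act V (Poly_Mapping.single g 1) v \<in> ?N" if g: "g \<in> gens" for g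
    proof -
      have "?N \<subseteq> {v \<in> vecs V. act V (Poly_Mapping.single g 1) v \<in> ?N}"
      proof (rule span_minimal)
        show "B ` S y \<subseteq> {v \<in> vecs V. act V (Poly_Mapping.single g 1) v \<in> ?N}"
        proof (rule image_subsetI)
          fix i assume i: "i \<in> S y"
          show "B i \<in> {v \<in> vecs V. act V (Poly_Mapping.single g 1) v \<in> ?N}"
            using gen [OF i g] Bv [of y] i by blast
        qed
        show "subspace {v \<in> vecs V. act V (Poly_Mapping.single g 1) v \<in> ?N}"
        proof (rule subspaceI)
          show "0 \<in> {v \<in> vecs V. act V (Poly_Mapping.single g 1) v \<in> ?N}"
            using subspace_0 [OF subspace_vecs] act_zero_right [OF single_carrier [OF g], of 1] by (simp add: span_zero)
        next
          fix x z assume "x \<in> {v \<in> vecs V. act V (Poly_Mapping.single g 1) v \<in> ?N}"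
            "z \<in> {v \<in> vecs V. act V (Poly_Mapping.single g 1) v \<in> ?N}"
          then show "x + z \<in> {v \<in> vecs V. act V (Poly_Mapping.single g 1) v \<in> ?N}"
            using subspace_add [OF subspace_vecs, of x z] act_add_right [OF single_carrier [OF g], of x z 1] span_add
            by simp
        next
          fix k x assume "x \<in> {v \<in> vecs V. act V (Poly_Mapping.single g 1) v \<in> ?N}"
          then show "scal V k x \<in> {v \<in> vecs V. act V (Poly_Mapping.single g 1) v \<in> ?N}"
            using subspace_scale [OF subspace_vecs, of x k] act_scale_right [OF single_carrier [OF g], of x 1 k] span_scale
            by simp
        qed
      qed
      then show ?thesis using v by blast
    qed
    moreover have "Poly_Mapping.keys x \<subseteq> gens" using x by (simp add: svir_carrier_def)
    moreover have "v \<in> vecs V" using sv v by blast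
    ultimately show "act V x v \<in> ?N"
      unfolding act_expand [OF x \<open>v \<in> vecs V\<close>] by (intro span_sum span_scale) blast
  qed
  have vecs: "span (B ` S True) + span (B ` S False) = vecs V"
  proof
    show "span (B ` S True) + span (B ` S False) \<subseteq> vecs V"
    proof (rule subsetI, erule set_plus_elim)
      fix v x y assume "v = x + y" "x \<in> span (B ` S True)" "y \<in> span (B ` S False)"
      then show "v \<in> vecs V" using subspace_add [OF subspace_vecs, of x y] sv by blast
    qed
    have sum: "span (B ` S True) + span (B ` S False) = {x + y | x y. x \<in> span (B ` S True) \<and> y \<in> span (B ` S False)}"
      by (rule set_plus_Collect)
    have ss: "subspace (span (B ` S True) + span (B ` S False))"
      unfolding sum by (rule subspace_sums [OF subspace_span subspace_span])
    have "b u \<kappa> \<in> span (B ` S True) + span (B ` S False)" for u \<kappa>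
    proof (cases "Y u \<kappa>")
      case True
      then have "b u \<kappa> \<in> span (B ` S True)" using BS [of "(u, \<kappa>)" True] by (simp add: B_def)
      then show ?thesis using set_plus_intro [OF _ span_zero, of "b u \<kappa>" "span (B ` S True)" "B ` S False"] by simp
    next
      case False
      then have "b u \<kappa> \<in> span (B ` S False)" using BS [of "(u, \<kappa>)" False] by (simp add: B_def)
      then show ?thesis using set_plus_intro [OF span_zero, of "b u \<kappa>" "span (B ` S False)" "B ` S True"] by simp
    qed
    then have "Pt u \<subseteq> span (B ` S True) + span (B ` S False)" for u
      unfolding part_span by (intro span_minimal ss) blast
    then show "vecs V \<subseteq> span (B ` S True) + span (B ` S False)"
      unfolding vecs_eq_sum using subspace_add [OF ss] by blast
  qed
  have "span (B ` S True) \<inter> span (B ` S False) \<subseteq> {0}"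
  proof
    fix v assume "v \<in> span (B ` S True) \<inter> span (B ` S False)"
    then obtain m n where mn: "Poly_Mapping.keys m \<subseteq> S True" "Poly_Mapping.keys n \<subseteq> S False"
      "v = linear_combination (scal V) B m" "v = linear_combination (scal V) B n"
      unfolding linear_combinations_eq_span [symmetric] by blast
    have "m - n = 0"
    proof (rule weight_vectors_independent [where w = "\<lambda>i. i" and x = B and S = "S True \<union> S False"])
      show "linear_combination (scal V) B (m - n) = 0" using mn by (simp add: linear_combination_minus)
      show "Poly_Mapping.keys (m - n) \<subseteq> S True \<union> S False" using keys_diff [of m n] mn by blast
      show "B i \<in> wt (fst i) (snd i) \<and> B i \<noteq> 0" if "i \<in> S True \<union> S False" for i
        using that b_wt by (auto simp: S_def B_def)
    qed simp
    then have "m = n" by simp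
    moreover have "S True \<inter> S False = {}" by (auto simp: S_def)
    ultimately have "Poly_Mapping.keys m = {}" using mn by blast
    then show "v \<in> {0}" using mn(3) by simp
  qed
  then have "span (B ` S True) \<inter> span (B ` S False) = {0}" using span_zero by blast
  moreover have "\<forall>A C. svir_submodule M \<alpha> V A \<and> svir_submodule M \<alpha> V C \<and> A + C = vecs V \<and> A \<inter> C = {0}
      \<longrightarrow> A = {0} \<or> C = {0}"
    using intermediate_series unfolding intermediate_series_def svir_indecomposable_def by blast
  ultimately have "span (B ` S True) = {0} \<or> span (B ` S False) = {0}"
    using sub vecs by simp
  then obtain y where y: "span (B ` S y) = {0}" by blast
  have "Y u p \<noteq> y" if "b u p \<noteq> 0" for u p
    using BS [of "(u, p)" y] y that by (auto simp: B_def)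
  then show ?thesis by (cases y) auto
qed

lemma some_weight: "\<exists>u p. b u p \<noteq> 0"
proof (rule ccontr)
  assume "\<not> ?thesis"
  then have z: "Pt u = {0}" for u unfolding part_span by (simp add: image_constant_conv)
  have "vecs V = {0}" unfolding vecs_eq_sum z by simp
  then show False using intermediate_series unfolding intermediate_series_def svir_indecomposable_def by blast
qed

end

lemma coset_iff: "x \<in> a +o A \<longleftrightarrow> x - a \<in> (A :: 'f::field_char_0 set)"
  unfolding elt_set_plus_def by (auto simp: algebra_simps intro: bexI [of _ "x - a"])

section \<open>Matrix coefficients relative to a base weight\<close>

locale svir_based = svir_series M \<alpha> V
  for M :: "'f::field_char_0 set" and \<alpha> and V :: "('f, 'v::ab_group_add) gr_module" +
  fixes u0 :: bool and \<kappa>0 :: 'f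
  assumes base: "b u0 \<kappa>0 \<noteq> 0" and M_nonzero: "M \<noteq> {0}"
begin

definition D :: "bool \<Rightarrow> 'f set" where
  "D u = {\<kappa>. \<kappa> - \<kappa>0 \<in> (if u = u0 then M else \<alpha> +o M)}"

definition pr :: "bool \<Rightarrow> 'f \<Rightarrow> bool" where
  "pr u p \<longleftrightarrow> b u p \<noteq> 0"

text \<open>For a vanishing target vector the equation would not determine k; the value 0 at absent
  weights makes the relations hold there trivially.\<close>

definition g :: "bool \<Rightarrow> 'f \<Rightarrow> 'f \<Rightarrow> 'f" where
  "g u p q = (if pr u p \<and> pr (\<not> u) q then SOME k. G (q - p) (b u p) = scal V k (b (\<not> u) q) else 0)"

definition l :: "bool \<Rightarrow> 'f \<Rightarrow> 'f \<Rightarrow> 'f" where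
  "l u p q = (if pr u p \<and> pr u q then SOME k. L (q - p) (b u p) = scal V k (b u q) else 0)"

definition c :: 'f where
  "c = (SOME k. Z (b u0 \<kappa>0) = scal V k (b u0 \<kappa>0))"

lemma M_uminus: "x \<in> M \<Longrightarrow> - x \<in> M"
  using M_diff [of 0 x] zero_in_M by simp

lemma D_shift_M: "p \<in> D s \<Longrightarrow> \<mu> \<in> M \<Longrightarrow> p + \<mu> \<in> D s"
proof -
  assume a: "p \<in> D s" "\<mu> \<in> M"
  have e: "p + \<mu> - \<kappa>0 = \<mu> + (p - \<kappa>0)" by simp
  show ?thesis using a M_add [of \<mu> "p - \<kappa>0"] L_add_G [of \<mu> "p - \<kappa>0"] unfolding D_def mem_Collect_eq e
    by (simp split: if_splits)
qed

lemma D_shift_G: "p \<in> D s \<Longrightarrow> \<nu> \<in> \<alpha> +o M \<Longrightarrow> p + \<nu> \<in> D (\<not> s)"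
proof -
  assume a: "p \<in> D s" "\<nu> \<in> \<alpha> +o M"
  have e: "p + \<nu> - \<kappa>0 = (p - \<kappa>0) + \<nu>" by simp
  show ?thesis using a G_add_M [of "p - \<kappa>0" \<nu>] L_add_G [of "p - \<kappa>0" \<nu>] unfolding D_def mem_Collect_eq e
    by (auto split: if_splits)
qed

lemma D_diff: "p \<in> D s \<Longrightarrow> q \<in> D s \<Longrightarrow> q - p \<in> M"
proof -
  assume a: "p \<in> D s" "q \<in> D s"
  have "q - p = (q - \<kappa>0) - (p - \<kappa>0)" "q - p = (q - \<kappa>0 - \<alpha>) - (p - \<kappa>0 - \<alpha>)" by simp_all
  then show ?thesis using a M_diff unfolding D_def coset_iff mem_Collect_eq by (metis coset_iff)
qed

lemma uminus_coset: "x \<in> \<alpha> +o M \<Longrightarrow> - x \<in> \<alpha> +o M"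
proof -
  assume "x \<in> \<alpha> +o M"
  then have "- (2 * \<alpha> + (x - \<alpha>)) \<in> M" unfolding coset_iff by (intro M_uminus M_add two_alpha)
  moreover have "- (2 * \<alpha> + (x - \<alpha>)) = - x - \<alpha>" by (simp add: algebra_simps)
  ultimately show ?thesis unfolding coset_iff by metis
qed

lemma D_diff_odd: "p \<in> D s \<Longrightarrow> q \<in> D (\<not> s) \<Longrightarrow> q - p \<in> \<alpha> +o M"
proof -
  assume a: "p \<in> D s" "q \<in> D (\<not> s)"
  show ?thesis
  proof (cases "s = u0")
    case True
    then have "p - \<kappa>0 \<in> M" "q - \<kappa>0 \<in> \<alpha> +o M" using a by (auto simp: D_def)
    from L_add_G [OF M_uminus [OF this(1)] this(2)] show ?thesis by simp
  next
    case False
    then have "q - \<kappa>0 \<in> M" "p - \<kappa>0 \<in> \<alpha> +o M" using a by (auto simp: D_def)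
    from L_add_G [OF this(1) uminus_coset [OF this(2)]] show ?thesis by simp
  qed
qed

lemma base_D: "\<kappa>0 \<in> D u0"
  using zero_in_M by (simp add: D_def)

text \<open>Membership in \<open>D\<close> is a label that no generator changes, and the base weight
  has it.\<close>

lemma pr_D': "pr u p \<Longrightarrow> p \<in> D u"
proof -
  assume pr: "pr u p"
  have "(\<forall>u p. b u p \<noteq> 0 \<longrightarrow> p \<in> D u) \<or> (\<forall>u p. b u p \<noteq> 0 \<longrightarrow> p \<notin> D u)"
  proof (rule indecomposable_weights)
    fix u p \<mu> assume m: "\<mu> \<in> M"
    show "(p \<in> D u) = (p + \<mu> \<in> D u)"
      using D_shift_M [of p u \<mu>] D_shift_M [of "p + \<mu>" u "- \<mu>"] M_uminus [OF m] m by auto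
  next
    fix u p \<nu> assume m: "\<nu> \<in> \<alpha> +o M"
    show "(p \<in> D u) = (p + \<nu> \<in> D (\<not> u))"
      using D_shift_G [of p u \<nu>] D_shift_G [of "p + \<nu>" "\<not> u" "- \<nu>"] uminus_coset [OF m] m by auto
  qed
  then show ?thesis using base base_D pr unfolding pr_def by blast
qed

lemma G_b:
  assumes "p \<in> D u" "q \<in> D (\<not> u)"
  shows "G (q - p) (b u p) = scal V (g u p q) (b (\<not> u) q)"
proof -
  have "G (q - p) (b u p) \<in> wt (\<not> u) (p + (q - p))" by (rule G_wt [OF D_diff_odd [OF assms] b_wt])
  then have ex: "\<exists>k. G (q - p) (b u p) = scal V k (b (\<not> u) q)" unfolding wt_eq by auto
  have c: "Poly_Mapping.single (GG (q - p)) 1 \<in> svir_carrier M \<alpha>"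
    by (rule single_carrier) (use D_diff_odd [OF assms] in simp)
  show ?thesis
  proof (cases "pr u p \<and> pr (\<not> u) q")
    case True
    then show ?thesis using someI_ex [OF ex] by (simp add: g_def)
  next
    case False
    then show ?thesis using ex act_zero_right [OF c] by (auto simp: g_def pr_def)
  qed
qed

lemma L_b:
  assumes "p \<in> D u" "q \<in> D u"
  shows "L (q - p) (b u p) = scal V (l u p q) (b u q)"
proof -
  have "L (q - p) (b u p) \<in> wt u (p + (q - p))" by (rule L_wt [OF D_diff [OF assms] b_wt])
  then have ex: "\<exists>k. L (q - p) (b u p) = scal V k (b u q)" unfolding wt_eq by auto
  have c: "Poly_Mapping.single (LG (q - p)) 1 \<in> svir_carrier M \<alpha>"
    by (rule single_carrier) (use D_diff [OF assms] in simp)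
  show ?thesis
  proof (cases "pr u p \<and> pr u q")
    case True
    then show ?thesis using someI_ex [OF ex] by (simp add: l_def)
  next
    case False
    then show ?thesis using ex act_zero_right [OF c] by (auto simp: l_def pr_def)
  qed
qed

lemma Z_carrier: "Poly_Mapping.single CG 1 \<in> svir_carrier M \<alpha>"
  by (rule single_carrier) simp

lemma central_eigenvalue:
  assumes x: "x \<in> wt u p" and y: "y \<in> wt u' p'" "y \<noteq> 0" and xy: "act V a x = scal V k y" "k \<noteq> 0"
    and a: "a \<in> svir_carrier M \<alpha>" and com: "Z (act V a x) = act V a (Z x)"
    and d: "Z x = scal V d x"
  shows "Z x = scal V c' x \<longleftrightarrow> Z y = scal V c' y"
proof -
  have xv: "x \<in> vecs V" "y \<in> vecs V" using wt_in_vecs x y by blast+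
  have "scal V k (Z y) = scal V (d * k) y"
    using com act_scale_right [OF a xv(1), of d] act_scale_right [OF Z_carrier xv(2), of k] unfolding d xy by simp
  then have "scal V k (Z y) = scal V k (scal V d y)" unfolding scale_scale mult.commute [of k] .
  then have Zy: "Z y = scal V d y" using xy(2) scale_left_imp_eq by blast
  have "x \<noteq> 0" using xy y(2) act_zero_right [OF a] by (metis scale_eq_0_iff)
  then show ?thesis unfolding Zy d using y(2) by simp
qed

text \<open>\<open>Z\<close> acts on each weight line by a scalar, and as it commutes with the
  generators, a nonzero action carries this scalar on. The label is whether the scalar equals
  c.\<close>

lemma Z_b: "Z (b u p) = scal V c (b u p)"
proof (cases "b u p = 0")
  case False
  have ex: "\<exists>k. Z (b u p) = scal V k (b u p)" for u p using Z_wt [OF b_wt] unfolding wt_eq by blast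
  have "(\<forall>u p. b u p \<noteq> 0 \<longrightarrow> Z (b u p) = scal V c (b u p)) \<or> (\<forall>u p. b u p \<noteq> 0 \<longrightarrow> Z (b u p) \<noteq> scal V c (b u p))"
  proof (rule indecomposable_weights)
    fix u p \<mu> assume m: "\<mu> \<in> M" and nz: "L \<mu> (b u p) \<noteq> 0"
    obtain k where k: "L \<mu> (b u p) = scal V k (b u (p + \<mu>))" using L_wt [OF m b_wt] unfolding wt_eq by blast
    obtain d where d: "Z (b u p) = scal V d (b u p)" using ex by blast
    have "k \<noteq> 0" "b u (p + \<mu>) \<noteq> 0" using nz unfolding k by auto
    then show "(Z (b u p) = scal V c (b u p)) = (Z (b u (p + \<mu>)) = scal V c (b u (p + \<mu>)))"
      by (intro central_eigenvalue [OF b_wt b_wt _ k _ single_carrier Z_L [OF m b_vecs] d]) (use m in simp_all)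
  next
    fix u p \<nu> assume m: "\<nu> \<in> \<alpha> +o M" and nz: "G \<nu> (b u p) \<noteq> 0"
    obtain k where k: "G \<nu> (b u p) = scal V k (b (\<not> u) (p + \<nu>))" using G_wt [OF m b_wt] unfolding wt_eq by blast
    obtain d where d: "Z (b u p) = scal V d (b u p)" using ex by blast
    have "k \<noteq> 0" "b (\<not> u) (p + \<nu>) \<noteq> 0" using nz unfolding k by auto
    then show "(Z (b u p) = scal V c (b u p)) = (Z (b (\<not> u) (p + \<nu>)) = scal V c (b (\<not> u) (p + \<nu>)))"
      by (intro central_eigenvalue [OF b_wt b_wt _ k _ single_carrier Z_G [OF m b_vecs] d]) (use m in simp_all)
  qed
  moreover have "Z (b u0 \<kappa>0) = scal V c (b u0 \<kappa>0)" unfolding c_def by (rule someI_ex [OF ex])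
  ultimately show ?thesis using base False by blast
qed (use act_zero_right [OF Z_carrier] in simp)

lemma gen_carrier:
  "p \<in> D s \<Longrightarrow> q \<in> D s \<Longrightarrow> Poly_Mapping.single (LG (q - p)) 1 \<in> svir_carrier M \<alpha>"
  "p \<in> D s \<Longrightarrow> q \<in> D (\<not> s) \<Longrightarrow> Poly_Mapping.single (GG (q - p)) 1 \<in> svir_carrier M \<alpha>"
  by (rule single_carrier, use D_diff D_diff_odd in simp)+

lemma G_G_b: "p \<in> D s \<Longrightarrow> Q \<in> D (\<not> s) \<Longrightarrow> P \<in> D s \<Longrightarrow>
    G (P - Q) (G (Q - p) (b s p)) = scal V (g s p Q * g (\<not> s) Q P) (b s P)"
  using act_scale_right [OF gen_carrier(2) b_vecs, of Q "\<not> s" P "g s p Q" "\<not> s" Q] G_b [of p s Q] G_b [of Q "\<not> s" P]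
  by simp

lemma L_G_b: "p \<in> D s \<Longrightarrow> Q \<in> D (\<not> s) \<Longrightarrow> q \<in> D (\<not> s) \<Longrightarrow>
    L (q - Q) (G (Q - p) (b s p)) = scal V (g s p Q * l (\<not> s) Q q) (b (\<not> s) q)"
  using act_scale_right [OF gen_carrier(1) b_vecs, of Q "\<not> s" q "g s p Q" "\<not> s" Q] G_b [of p s Q] L_b [of Q "\<not> s" q]
  by simp

lemma G_L_b: "p \<in> D s \<Longrightarrow> P \<in> D s \<Longrightarrow> q \<in> D (\<not> s) \<Longrightarrow>
    G (q - P) (L (P - p) (b s p)) = scal V (l s p P * g s P q) (b (\<not> s) q)"
  using act_scale_right [OF gen_carrier(2) b_vecs, of P s q "l s p P" s P] L_b [of p s P] G_b [of P s q]
  by simp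

lemma L_L_b: "p \<in> D s \<Longrightarrow> Q \<in> D s \<Longrightarrow> P \<in> D s \<Longrightarrow>
    L (P - Q) (L (Q - p) (b s p)) = scal V (l s p Q * l s Q P) (b s P)"
  using act_scale_right [OF gen_carrier(1) b_vecs, of Q s P "l s p Q" s Q] L_b [of p s Q] L_b [of Q s P]
  by simp

lemma coefficient_eq: "pr s p \<Longrightarrow> scal V x (b s p) = scal V y (b s p) \<Longrightarrow> x = y"
  by (simp add: pr_def)

lemma l_zero: "\<not> pr s p \<or> \<not> pr s q \<Longrightarrow> l s p q = 0"
  and g_zero: "\<not> pr s p \<or> \<not> pr (\<not> s) q \<Longrightarrow> g s p q = 0"
  by (auto simp: l_def g_def)

lemma GG_relation:
  assumes D: "p \<in> D s" "P \<in> D s" "Q \<in> D (\<not> s)" "Q' \<in> D (\<not> s)" "p + P = Q + Q'" and pr: "pr s P" and pr': "pr s p"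
  shows "g s p Q * g (\<not> s) Q P + g s p Q' * g (\<not> s) Q' P =
    2 * l s p P - (if p = P then ((Q - p)^2 - 1/4) * c / 3 else 0)"
proof (rule coefficient_eq [OF pr])
  have e: "P - Q' = Q - p" "P - Q = Q' - p" using D(5) by (simp_all add: algebra_simps)
  have s: "(Q - p) + (Q' - p) = P - p" using D(5) by (simp add: algebra_simps)
  have "G (P - Q') (G (Q' - p) (b s p)) + G (P - Q) (G (Q - p) (b s p)) = scal V 2 (L (P - p) (b s p))
    - scal V (if P - p = 0 then 1/3 * ((Q - p)^2 - 1/4) else 0) (Z (b s p))"
    unfolding e using G_G [OF D_diff_odd [OF D(1,3)] D_diff_odd [OF D(1,4)] b_vecs, of s p] unfolding s .
  then have *: "scal V (g s p Q' * g (\<not> s) Q' P) (b s P) + scal V (g s p Q * g (\<not> s) Q P) (b s P) =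
     scal V 2 (scal V (l s p P) (b s P)) - scal V (if P - p = 0 then 1/3 * ((Q - p)^2 - 1/4) else 0) (scal V c (b s p))"
    unfolding G_G_b [OF D(1,3,2)] G_G_b [OF D(1,4,2)] L_b [OF D(1,2)] Z_b .
  have z: "scal V (if P - p = 0 then 1/3 * ((Q - p)^2 - 1/4) else 0) (scal V c (b s p))
    = scal V (if p = P then ((Q - p)^2 - 1/4) * c / 3 else 0) (b s P)" by simp
  show "scal V (g s p Q * g (\<not> s) Q P + g s p Q' * g (\<not> s) Q' P) (b s P) =
    scal V (2 * l s p P - (if p = P then ((Q - p)^2 - 1/4) * c / 3 else 0)) (b s P)"
    using * unfolding z by (simp only: scale_left_distrib scale_left_diff_distrib scale_scale add.commute)
qed

lemma l_diagonal: "pr s p \<Longrightarrow> l s p p = p"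
proof (rule coefficient_eq)
  assume pr: "pr s p"
  show "scal V (l s p p) (b s p) = scal V p (b s p)"
    using L_b [OF pr_D' [OF pr] pr_D' [OF pr]] b_wt [of s p] by (simp add: wt_iff)
qed

sublocale svir_coefficients D pr g l c
proof
  fix s t p q r assume "p \<in> D s" "q \<in> D t" "r \<in> D t"
  then show "p + q - r \<in> D s" using D_shift_M [of p s "q - r"] D_diff [of r t q] by (simp add: add_diff_eq)
next
  fix p s q r assume "p \<in> D s" "q \<in> D s" "r \<in> D (\<not> s)"
  then show "p + q - r \<in> D (\<not> s)" using D_shift_G [of p s "q - r"] D_diff_odd [of r "\<not> s" q] by (simp add: add_diff_eq)
next
  fix s
  have "\<alpha> \<in> \<alpha> +o M" using zero_in_M by (simp add: coset_iff)
  then show ne: "D s \<noteq> {}" using base_D D_shift_G [OF base_D, of \<alpha>] by (cases "s = u0") auto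
  obtain m where m: "m \<in> M" "m \<noteq> 0" using M_nonzero zero_in_M by blast
  obtain p where p: "p \<in> D s" using ne by blast
  show "\<exists>p\<in>D s. \<exists>q\<in>D s. p \<noteq> q" using p D_shift_M [OF p m(1)] m(2) by (intro bexI [of _ p] bexI [of _ "p + m"]) simp_all
next
  show "pr s p \<Longrightarrow> p \<in> D s" for s p by (rule pr_D')
  show "g s p q \<noteq> 0 \<Longrightarrow> pr s p \<and> pr (\<not> s) q" for s p q using g_zero by blast
  show "l s p q \<noteq> 0 \<Longrightarrow> pr s p \<and> pr s q" for s p q using l_zero by blast
  show "pr s p \<Longrightarrow> l s p p = p" for s p by (rule l_diagonal)
next
  fix p s P Q Q' assume D: "p \<in> D s" "P \<in> D s" "Q \<in> D (\<not> s)" "Q' \<in> D (\<not> s)" "p + P = Q + Q'" "p \<noteq> P"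
  show "g s p Q * g (\<not> s) Q P + g s p Q' * g (\<not> s) Q' P = 2 * l s p P"
  proof (cases "pr s p \<and> pr s P")
    case True
    then show ?thesis using GG_relation [OF D(1-5)] D(6) by simp
  next
    case False
    then show ?thesis using g_zero [of s p] g_zero [of "\<not> s" _ P] l_zero [of s p P] by auto
  qed
next
  fix s p Q Q' assume D: "pr s p" "Q \<in> D (\<not> s)" "Q' \<in> D (\<not> s)" "p + p = Q + Q'"
  show "g s p Q * g (\<not> s) Q p + g s p Q' * g (\<not> s) Q' p = 2 * p - ((Q - p)\<^sup>2 - 1 / 4) * c / 3"
    using GG_relation [OF pr_D' [OF D(1)] pr_D' [OF D(1)] D(2-4,1,1)] l_diagonal [OF D(1)] by simp
next
  fix p s P q Q assume D: "p \<in> D s" "P \<in> D s" "q \<in> D (\<not> s)" "Q \<in> D (\<not> s)" "P + Q = p + q"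
  show "l (\<not> s) Q q * g s p Q - g s P q * l s p P = (Q - p - (P - p) / 2) * g s p q"
  proof (cases "pr (\<not> s) q")
    case True
    show ?thesis
    proof (rule coefficient_eq [OF True])
      have e: "q - Q = P - p" "q - P = Q - p" using D(5) by (simp_all add: algebra_simps)
      have s: "(P - p) + (Q - p) = q - p" using D(5) by (simp add: algebra_simps)
      have "L (q - Q) (G (Q - p) (b s p)) - G (q - P) (L (P - p) (b s p)) = scal V (Q - p - 1/2 * (P - p)) (G (q - p) (b s p))"
        unfolding e using L_G [OF D_diff [OF D(1,2)] D_diff_odd [OF D(1,4)] b_vecs, of s p] unfolding s .
      then have "scal V (g s p Q * l (\<not> s) Q q) (b (\<not> s) q) - scal V (l s p P * g s P q) (b (\<not> s) q)
          = scal V (Q - p - 1/2 * (P - p)) (scal V (g s p q) (b (\<not> s) q))"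
        unfolding L_G_b [OF D(1,4,3)] G_L_b [OF D(1,2,3)] G_b [OF D(1,3)] .
      then have "scal V (g s p Q * l (\<not> s) Q q - l s p P * g s P q) (b (\<not> s) q)
          = scal V ((Q - p - 1/2 * (P - p)) * g s p q) (b (\<not> s) q)"
        unfolding scale_left_diff_distrib scale_scale .
      then show "scal V (l (\<not> s) Q q * g s p Q - g s P q * l s p P) (b (\<not> s) q)
          = scal V ((Q - p - (P - p) / 2) * g s p q) (b (\<not> s) q)" by (simp add: mult.commute)
    qed
  next
    case False
    then show ?thesis using g_zero [of s _ q] l_zero [of "\<not> s" Q q] by simp
  qed
next
  fix s p P P' assume pr: "pr s p" and D: "P \<in> D s" "P' \<in> D s" "p + p = P + P'"
  have p: "p \<in> D s" by (rule pr_D' [OF pr])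
  show "l s p P * l s P p - l s p P' * l s P' p = 2 * (P - p) * p - ((P - p)^3 - (P - p)) * c / 12"
  proof (rule coefficient_eq [OF pr])
    have e: "p - P' = P - p" "p - P = P' - p" using D(3) by (simp_all add: algebra_simps)
    have s: "(P' - p) + (P - p) = p - p" using D(3) by (simp add: algebra_simps)
    have n: "P' - p = - (P - p)" using D(3) by (simp add: algebra_simps)
    have "L (p - P) (L (P - p) (b s p)) - L (p - P') (L (P' - p) (b s p)) =
       scal V ((P - p) - (P' - p)) (L (p - p) (b s p)) + scal V (if p - p = 0 then 1/12 * ((P' - p)^3 - (P' - p)) else 0) (Z (b s p))"
      unfolding e using L_L [OF D_diff [OF p D(2)] D_diff [OF p D(1)] b_vecs, of s p] unfolding s .
    then have "scal V (l s p P * l s P p) (b s p) - scal V (l s p P' * l s P' p) (b s p) =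
       scal V ((P - p) - (P' - p)) (scal V p (b s p)) + scal V (1/12 * ((P' - p)^3 - (P' - p))) (scal V c (b s p))"
      unfolding L_L_b [OF p D(1) p] L_L_b [OF p D(2) p] L_b [OF p p] Z_b l_diagonal [OF pr] by simp
    then have "scal V (l s p P * l s P p - l s p P' * l s P' p) (b s p) =
       scal V (((P - p) - (P' - p)) * p + 1/12 * ((P' - p)^3 - (P' - p)) * c) (b s p)"
      unfolding scale_left_diff_distrib scale_left_distrib scale_scale .
    also have "((P - p) - (P' - p)) * p + 1/12 * ((P' - p)^3 - (P' - p)) * c = 2 * (P - p) * p - ((P - p)^3 - (P - p)) * c / 12"
    proof -
      have c: "(- x)^3 = - (x^3)" for x :: 'f by (simp add: power3_eq_cube)
      define x where "x = P - p"
      show ?thesis unfolding n x_def [symmetric] c by (simp add: field_simps)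
    qed
    finally show "scal V (l s p P * l s P p - l s p P' * l s P' p) (b s p) =
      scal V (2 * (P - p) * p - ((P - p)^3 - (P - p)) * c / 12) (b s p)" .
  qed
next
  fix p s P R R' assume D: "p \<in> D s" "P \<in> D s" "R \<in> D s" "R' \<in> D s" "R + R' = p + P" "p \<noteq> P"
  show "l s R P * l s p R - l s R' P * l s p R' = (R - R') * l s p P"
  proof (cases "pr s P")
    case True
    show ?thesis
    proof (rule coefficient_eq [OF True])
      have e: "P - R' = R - p" "P - R = R' - p" using D(5) by (simp_all add: algebra_simps)
      have s: "(R' - p) + (R - p) = P - p" using D(5) by (simp add: algebra_simps)
      have "L (P - R) (L (R - p) (b s p)) - L (P - R') (L (R' - p) (b s p)) =
        scal V ((R - p) - (R' - p)) (L (P - p) (b s p)) + scal V (if P - p = 0 then 1/12 * ((R' - p)^3 - (R' - p)) else 0) (Z (b s p))"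
        unfolding e using L_L [OF D_diff [OF D(1,4)] D_diff [OF D(1,3)] b_vecs, of s p] unfolding s .
      then have "scal V (l s p R * l s R P) (b s P) - scal V (l s p R' * l s R' P) (b s P) =
        scal V (R - R') (scal V (l s p P) (b s P))"
        unfolding L_L_b [OF D(1,3,2)] L_L_b [OF D(1,4,2)] L_b [OF D(1,2)] using D(6) by simp
      then have "scal V (l s p R * l s R P - l s p R' * l s R' P) (b s P) = scal V ((R - R') * l s p P) (b s P)"
        unfolding scale_left_diff_distrib scale_scale .
      then show "scal V (l s R P * l s p R - l s R' P * l s p R') (b s P) = scal V ((R - R') * l s p P) (b s P)"
        by (simp add: mult.commute)
    qed
  next
    case False
    then show ?thesis using l_zero [of s _ P] by simp
  qed
qed

end

section \<open>From coefficients to an isomorphism\<close>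

text \<open>The action f of the model has to match V only at symbols whose weight is present, so the
  model may be larger than V. The parameter a turns the index of a symbol into its weight, and s is
  the parity in V of the vectors that belong to the symbols \<open>VB\<close>.\<close>

locale svir_model = svir_based M \<alpha> V u0 \<kappa>0
  for M :: "'f::field_char_0 set" and \<alpha> and V :: "('f, 'v::ab_group_add) gr_module"
    and u0 and \<kappa>0 :: 'f +
  fixes s :: bool and a :: 'f and t :: "bool \<Rightarrow> 'f \<Rightarrow> 'f" and I J :: "'f set"
    and f :: "'f svir_gen \<Rightarrow> 'f vw \<Rightarrow> ('f vw \<Rightarrow>\<^sub>0 'f)"
  assumes t_nonzero: "t u p \<noteq> 0" and c_zero': "c = 0"
    and I_iff: "\<mu> \<in> I \<longleftrightarrow> a + \<mu> \<in> D s" and J_iff: "\<nu> \<in> J \<longleftrightarrow> a + \<nu> \<in> D (\<not> s)"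
    and f_LV: "\<kappa> \<in> M \<Longrightarrow> pr s (a + \<mu>) \<Longrightarrow> f (LG \<kappa>) (VB \<mu>) =
      Poly_Mapping.single (VB (\<kappa> + \<mu>)) (l_scaled t s (a + \<mu>) (a + (\<kappa> + \<mu>)))"
    and f_LW: "\<kappa> \<in> M \<Longrightarrow> pr (\<not> s) (a + \<nu>) \<Longrightarrow> f (LG \<kappa>) (WB \<nu>) =
      Poly_Mapping.single (WB (\<kappa> + \<nu>)) (l_scaled t (\<not> s) (a + \<nu>) (a + (\<kappa> + \<nu>)))"
    and f_GV: "\<eta> \<in> \<alpha> +o M \<Longrightarrow> pr s (a + \<mu>) \<Longrightarrow> f (GG \<eta>) (VB \<mu>) =
      Poly_Mapping.single (WB (\<eta> + \<mu>)) (g_scaled t s (a + \<mu>) (a + (\<eta> + \<mu>)))"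
    and f_GW: "\<eta> \<in> \<alpha> +o M \<Longrightarrow> pr (\<not> s) (a + \<nu>) \<Longrightarrow> f (GG \<eta>) (WB \<nu>) =
      Poly_Mapping.single (VB (\<eta> + \<nu>)) (g_scaled t (\<not> s) (a + \<nu>) (a + (\<eta> + \<nu>)))"
    and f_C: "f CG i = 0"
begin

fun vertex :: "'f vw \<Rightarrow> bool \<times> 'f" where
  "vertex (VB \<mu>) = (s, a + \<mu>)"
| "vertex (WB \<nu>) = (\<not> s, a + \<nu>)"

definition symbols :: "bool \<Rightarrow> 'f vw set" where
  "symbols u = {i. fst (vertex i) = u \<and> pr (fst (vertex i)) (snd (vertex i))}"

definition x :: "'f vw \<Rightarrow> 'v" where
  "x i = scal V (t (fst (vertex i)) (snd (vertex i))) (b (fst (vertex i)) (snd (vertex i)))"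

abbreviation Sy :: "'f vw set" where "Sy \<equiv> symbols False \<union> symbols True"

abbreviation \<psi> :: "('f vw \<Rightarrow>\<^sub>0 'f) \<Rightarrow> 'v" where "\<psi> \<equiv> linear_combination (scal V) x"

abbreviation W :: "('f, 'f vw \<Rightarrow>\<^sub>0 'f) gr_module" where "W \<equiv> vw_module I J f"

definition A :: "('f vw \<Rightarrow>\<^sub>0 'f) set" where "A = {m. Poly_Mapping.keys m \<subseteq> Sy}"

lemma inj_vertex: "inj vertex"
proof (rule injI)
  fix i j assume "vertex i = vertex j"
  then show "i = j" by (cases i; cases j) auto
qed

lemma vertex_surj: "\<exists>i. vertex i = (u, p)"
proof (cases "u = s")
  case True
  then have "vertex (VB (p - a)) = (u, p)" by simp
  then show ?thesis ..
next
  case False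
  then have "vertex (WB (p - a)) = (u, p)" by auto
  then show ?thesis ..
qed

lemma Sy_iff: "i \<in> Sy \<longleftrightarrow> pr (fst (vertex i)) (snd (vertex i))"
  by (auto simp: symbols_def)

lemma x_wt: "x i \<in> wt (fst (vertex i)) (snd (vertex i))"
  unfolding x_def by (rule subspace_scale [OF subspace_wt b_wt])

lemma x_vecs: "x i \<in> vecs V"
  by (rule wt_in_vecs [OF x_wt])

lemma \<psi>_injective: "m \<in> A \<Longrightarrow> n \<in> A \<Longrightarrow> \<psi> m = \<psi> n \<Longrightarrow> m = n"
proof -
  assume mn: "m \<in> A" "n \<in> A" "\<psi> m = \<psi> n"
  have "m - n = 0"
  proof (rule weight_vectors_independent [where w = vertex and x = x and S = Sy])
    show "inj_on vertex Sy" using inj_vertex by (rule inj_on_subset) simp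
    show "x i \<in> wt (fst (vertex i)) (snd (vertex i)) \<and> x i \<noteq> 0" if "i \<in> Sy" for i
      using that x_wt t_nonzero unfolding Sy_iff pr_def by (simp add: x_def)
    show "Poly_Mapping.keys (m - n) \<subseteq> Sy" using keys_diff [of m n] mn(1,2) by (auto simp: A_def)
    show "\<psi> (m - n) = 0" using mn(3) by (simp add: linear_combination_minus)
  qed
  then show ?thesis by simp
qed

lemma \<psi>_part: "\<psi> ` {m. Poly_Mapping.keys m \<subseteq> symbols u} = Pt u"
proof
  show "\<psi> ` {m. Poly_Mapping.keys m \<subseteq> symbols u} \<subseteq> Pt u"
    unfolding linear_combinations_eq_span
  proof (rule span_minimal [OF _ subspace_part], rule image_subsetI)
    fix i assume "i \<in> symbols u"
    then show "x i \<in> Pt u" using x_wt [of i] by (simp add: symbols_def wt_iff)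
  qed
  show "Pt u \<subseteq> \<psi> ` {m. Poly_Mapping.keys m \<subseteq> symbols u}"
    unfolding linear_combinations_eq_span part_span
  proof (rule span_minimal [OF _ subspace_span], rule image_subsetI)
    fix p
    show "b u p \<in> span (x ` symbols u)"
    proof (cases "pr u p")
      case True
      obtain i where i: "vertex i = (u, p)" using vertex_surj by blast
      have "x i \<in> span (x ` symbols u)" by (rule span_base) (use i True in \<open>simp add: symbols_def\<close>)
      from span_scale [OF this, of "1 / t u p"] show ?thesis using t_nonzero by (simp add: x_def i)
    qed (simp add: pr_def span_zero)
  qed
qed

lemma \<psi>_vecs: "\<psi> ` A = vecs V"
proof
  show "\<psi> ` A \<subseteq> vecs V"
    unfolding A_def linear_combinations_eq_span
    by (rule span_minimal [OF _ subspace_vecs]) (use x_vecs in blast)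
  have sub: "subspace (\<psi> ` A)" unfolding A_def by (rule subspace_linear_combinations)
  have "Pt u \<subseteq> \<psi> ` A" for u
    unfolding \<psi>_part [symmetric] A_def by (rule image_mono) (cases u; auto)
  then show "vecs V \<subseteq> \<psi> ` A" unfolding vecs_eq_sum using subspace_add [OF sub] by blast
qed

text \<open>A coefficient that leads to an absent weight is 0, so the action does not leave the span
  of the present symbols.\<close>

lemma f_gens:
  assumes "gn \<in> gens" "i \<in> Sy"
  shows "f gn i \<in> A \<and> \<psi> (f gn i) = act V (Poly_Mapping.single gn 1) (x i)"
proof -
  have sA: "Poly_Mapping.single j k \<in> A" if "k \<noteq> 0 \<Longrightarrow> pr (fst (vertex j)) (snd (vertex j))" for j k
    using that Sy_iff [of j] by (cases "k = 0") (simp_all add: A_def)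
  have lt: "pr u q" if "l_scaled t u p q \<noteq> 0" for u p q
    using that l_pr [of u p q] by (auto simp: l_scaled_def)
  have gt: "pr (\<not> u) q" if "g_scaled t u p q \<noteq> 0" for u p q
    using that g_pr [of u p q] by (auto simp: g_scaled_def)
  have Lx: "L \<kappa> (x i) = scal V (l_scaled t u p (p + \<kappa>)) (scal V (t u (p + \<kappa>)) (b u (p + \<kappa>)))"
    if "vertex i = (u, p)" "pr u p" "\<kappa> \<in> M" for \<kappa> u p i
  proof -
    have p: "p \<in> D u" "p + \<kappa> \<in> D u" using pr_D [OF that(2)] D_shift_M [OF pr_D [OF that(2)] that(3)] by blast+
    have "L \<kappa> (x i) = scal V (t u p) (L \<kappa> (b u p))" unfolding x_def that(1) fst_conv snd_conv
      by (rule act_scale_right [OF single_carrier b_vecs]) (use that(3) in simp)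
    also have "L \<kappa> (b u p) = scal V (l u p (p + \<kappa>)) (b u (p + \<kappa>))" using L_b [OF p] by simp
    finally show ?thesis using t_nonzero by (simp add: l_scaled_def)
  qed
  have Gx: "G \<nu> (x i) = scal V (g_scaled t u p (p + \<nu>)) (scal V (t (\<not> u) (p + \<nu>)) (b (\<not> u) (p + \<nu>)))"
    if "vertex i = (u, p)" "pr u p" "\<nu> \<in> \<alpha> +o M" for \<nu> u p i
  proof -
    have p: "p \<in> D u" "p + \<nu> \<in> D (\<not> u)" using pr_D [OF that(2)] D_shift_G [OF pr_D [OF that(2)] that(3)] by blast+
    have "G \<nu> (x i) = scal V (t u p) (G \<nu> (b u p))" unfolding x_def that(1) fst_conv snd_conv
      by (rule act_scale_right [OF single_carrier b_vecs]) (use that(3) in simp)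
    also have "G \<nu> (b u p) = scal V (g u p (p + \<nu>)) (b (\<not> u) (p + \<nu>))" using G_b [OF p] by simp
    finally show ?thesis using t_nonzero by (simp add: g_scaled_def)
  qed
  show ?thesis
    using assms(1)
  proof (cases rule: gens_cases)
    case 1
    have "Z (x i) = 0" unfolding x_def act_scale_right [OF Z_carrier b_vecs] Z_b c_zero' by simp
    then show ?thesis unfolding 1 f_C by (simp add: A_def)
  next
    case (2 \<kappa>)
    show ?thesis
    proof (cases i)
      case (VB \<mu>)
      have pr: "pr s (a + \<mu>)" using assms(2) unfolding VB Sy_iff by simp
      have e: "a + \<mu> + \<kappa> = a + (\<kappa> + \<mu>)" by simp
      show ?thesis unfolding 2(1) VB f_LV [OF 2(2) pr] linear_combination_single
        using Lx [of "VB \<mu>" s "a + \<mu>", OF _ pr 2(2)] lt unfolding e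
        by (intro conjI sA) (simp_all add: x_def)
    next
      case (WB \<mu>)
      have pr: "pr (\<not> s) (a + \<mu>)" using assms(2) unfolding WB Sy_iff by simp
      have e: "a + \<mu> + \<kappa> = a + (\<kappa> + \<mu>)" by simp
      show ?thesis unfolding 2(1) WB f_LW [OF 2(2) pr] linear_combination_single
        using Lx [of "WB \<mu>" "\<not> s" "a + \<mu>", OF _ pr 2(2)] lt unfolding e
        by (intro conjI sA) (simp_all add: x_def)
    qed
  next
    case (3 \<nu>)
    show ?thesis
    proof (cases i)
      case (VB \<mu>)
      have pr: "pr s (a + \<mu>)" using assms(2) unfolding VB Sy_iff by simp
      have e: "a + \<mu> + \<nu> = a + (\<nu> + \<mu>)" by simp
      show ?thesis unfolding 3(1) VB f_GV [OF 3(2) pr] linear_combination_single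
        using Gx [of "VB \<mu>" s "a + \<mu>", OF _ pr 3(2)] gt [of s] unfolding e
        by (intro conjI sA) (simp_all add: x_def)
    next
      case (WB \<mu>)
      have pr: "pr (\<not> s) (a + \<mu>)" using assms(2) unfolding WB Sy_iff by simp
      have e: "a + \<mu> + \<nu> = a + (\<nu> + \<mu>)" by simp
      show ?thesis unfolding 3(1) WB f_GW [OF 3(2) pr] linear_combination_single
        using Gx [of "WB \<mu>" "\<not> s" "a + \<mu>", OF _ pr 3(2)] gt [of "\<not> s"] unfolding e
        by (intro conjI sA) (simp_all add: x_def)
    qed
  qed
qed

interpretation W: vector_space "pm_scale :: 'f \<Rightarrow> ('f vw \<Rightarrow>\<^sub>0 'f) \<Rightarrow> _"
  by (rule vector_space_pm_scale)

lemma subspace_keys: "W.subspace {m. Poly_Mapping.keys m \<subseteq> S}"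
proof (rule W.subspaceI)
  show "0 \<in> {m. Poly_Mapping.keys m \<subseteq> S}" by simp
next
  fix m n :: "'f vw \<Rightarrow>\<^sub>0 'f" assume "m \<in> {m. Poly_Mapping.keys m \<subseteq> S}" "n \<in> {m. Poly_Mapping.keys m \<subseteq> S}"
  then show "m + n \<in> {m. Poly_Mapping.keys m \<subseteq> S}" using keys_add [of m n] by blast
next
  fix k and m :: "'f vw \<Rightarrow>\<^sub>0 'f" assume "m \<in> {m. Poly_Mapping.keys m \<subseteq> S}"
  then show "pm_scale k m \<in> {m. Poly_Mapping.keys m \<subseteq> S}" using keys_pm_scale [of k m] by blast
qed

lemma subspace_A: "W.subspace A"
  unfolding A_def by (rule subspace_keys)

lemma act_A: "y \<in> svir_carrier M \<alpha> \<Longrightarrow> m \<in> A \<Longrightarrow> bilinear_ext f y m \<in> A"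
  unfolding bilinear_ext_def
proof (intro W.subspace_sum W.subspace_scale subspace_A)
  fix gn i assume "y \<in> svir_carrier M \<alpha>" "m \<in> A" "gn \<in> Poly_Mapping.keys y" "i \<in> Poly_Mapping.keys m"
  then have "gn \<in> gens" "i \<in> Sy" by (auto simp: A_def svir_carrier_def)
  then show "f gn i \<in> A" using f_gens by blast
qed

lemma \<psi>_act:
  assumes y: "y \<in> svir_carrier M \<alpha>" and m: "m \<in> A"
  shows "\<psi> (bilinear_ext f y m) = act V y (\<psi> m)"
proof -
  have "\<psi> m \<in> vecs V" using m \<psi>_vecs by blast
  note act_expand [OF y this]
  also have "(\<Sum>gn\<in>Poly_Mapping.keys y. scal V (Poly_Mapping.lookup y gn) (act V (Poly_Mapping.single gn 1) (\<psi> m))) =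
    (\<Sum>gn\<in>Poly_Mapping.keys y. \<Sum>i\<in>Poly_Mapping.keys m.
      scal V (Poly_Mapping.lookup y gn * Poly_Mapping.lookup m i) (\<psi> (f gn i)))"
  proof (rule sum.cong [OF refl])
    fix gn assume "gn \<in> Poly_Mapping.keys y"
    then have gn: "gn \<in> gens" using y by (auto simp: svir_carrier_def)
    have "act V (Poly_Mapping.single gn 1) (\<psi> m) =
      (\<Sum>i\<in>Poly_Mapping.keys m. act V (Poly_Mapping.single gn 1) (scal V (Poly_Mapping.lookup m i) (x i)))"
      unfolding linear_combination_def
      by (rule act_sum_right [OF single_carrier [OF gn]], rule subspace_scale [OF subspace_vecs x_vecs])
    also have "\<dots> = (\<Sum>i\<in>Poly_Mapping.keys m. scal V (Poly_Mapping.lookup m i) (\<psi> (f gn i)))"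
    proof (rule sum.cong [OF refl])
      fix i assume "i \<in> Poly_Mapping.keys m"
      then have "i \<in> Sy" using m by (auto simp: A_def)
      then show "act V (Poly_Mapping.single gn 1) (scal V (Poly_Mapping.lookup m i) (x i)) = scal V (Poly_Mapping.lookup m i) (\<psi> (f gn i))"
        using f_gens [OF gn, of i] act_scale_right [OF single_carrier [OF gn] x_vecs] by simp
    qed
    finally show "scal V (Poly_Mapping.lookup y gn) (act V (Poly_Mapping.single gn 1) (\<psi> m)) =
      (\<Sum>i\<in>Poly_Mapping.keys m. scal V (Poly_Mapping.lookup y gn * Poly_Mapping.lookup m i) (\<psi> (f gn i)))"
      by (simp add: scale_sum_right)
  qed
  finally show ?thesis by (simp add: linear_combination_bilinear_ext)
qed

text \<open>The symbols \<open>VB\<close> are even in the model but have parity s in V; hence the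
  parity u of V becomes \<open>u \<noteq> s\<close>.\<close>

lemma part_W: "A \<inter> part W (of_bool (u \<noteq> s)) = {m. Poly_Mapping.keys m \<subseteq> symbols u}"
proof -
  have V: "VB \<mu> \<in> symbols u \<longleftrightarrow> u = s \<and> pr s (a + \<mu>)" for \<mu> u by (auto simp: symbols_def)
  have WW: "WB \<mu> \<in> symbols u \<longleftrightarrow> u \<noteq> s \<and> pr (\<not> s) (a + \<mu>)" for \<mu> u by (auto simp: symbols_def)
  have "Sy \<inter> (if u \<noteq> s then WB ` J else VB ` I) = symbols u"
  proof (rule set_eqI)
    fix i
    show "i \<in> Sy \<inter> (if u \<noteq> s then WB ` J else VB ` I) \<longleftrightarrow> i \<in> symbols u"
      using pr_D [of s] pr_D [of "\<not> s"] I_iff J_iff by (cases i) (auto simp: V WW)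
  qed
  moreover have "part W (of_bool (u \<noteq> s)) = {m. Poly_Mapping.keys m \<subseteq> (if u \<noteq> s then WB ` J else VB ` I)}"
    by (simp add: vw_module_def)
  moreover have "{m :: 'f vw \<Rightarrow>\<^sub>0 'f. Poly_Mapping.keys m \<subseteq> X} \<inter> {m. Poly_Mapping.keys m \<subseteq> Y} =
      {m. Poly_Mapping.keys m \<subseteq> X \<inter> Y}" for X Y by blast
  ultimately show ?thesis unfolding A_def by metis
qed

lemma part_W': "part W 0 = part W (of_bool (s \<noteq> s))" "part W 1 = part W (of_bool ((\<not> s) \<noteq> s))"
  by simp_all

lemma A_split: "A = (A \<inter> part W 0) + (A \<inter> part W 1)"
  unfolding part_W' part_W
proof
  have sub: "W.subspace ({m. Poly_Mapping.keys m \<subseteq> symbols s} + {m. Poly_Mapping.keys m \<subseteq> symbols (\<not> s)})"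
    using W.subspace_sums [OF subspace_keys subspace_keys, of "symbols s" "symbols (\<not> s)"]
    unfolding set_plus_def by (rule back_subst [of W.subspace]) auto
  show "A \<subseteq> {m. Poly_Mapping.keys m \<subseteq> symbols s} + {m. Poly_Mapping.keys m \<subseteq> symbols (\<not> s)}" (is "_ \<subseteq> ?T")
  proof
    fix m assume m: "m \<in> A"
    have "Poly_Mapping.single i k \<in> ?T" if "i \<in> Poly_Mapping.keys m" for i k
    proof -
      have "i \<in> symbols s \<or> i \<in> symbols (\<not> s)" using m that unfolding A_def symbols_def by blast
      then show ?thesis
      proof
        assume "i \<in> symbols s"
        then have "Poly_Mapping.single i k + 0 \<in> ?T" by (intro set_plus_intro) auto
        then show ?thesis by simp
      next
        assume "i \<in> symbols (\<not> s)"
        then have "0 + Poly_Mapping.single i k \<in> ?T" by (intro set_plus_intro) auto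
        then show ?thesis by simp
      qed
    qed
    then have "(\<Sum>i\<in>Poly_Mapping.keys m. Poly_Mapping.single i (Poly_Mapping.lookup m i)) \<in> ?T"
      by (rule W.subspace_sum [OF sub])
    moreover have "(\<Sum>i\<in>Poly_Mapping.keys m. Poly_Mapping.single i (Poly_Mapping.lookup m i)) = m"
      by (rule poly_mapping_eqI) (auto simp: lookup_sum lookup_single when_def in_keys_iff)
    ultimately show "m \<in> ?T" by simp
  qed
  show "?T \<subseteq> A"
  proof (rule subsetI, erule set_plus_elim)
    fix m n k :: "'f vw \<Rightarrow>\<^sub>0 'f" assume m: "m = n + k" "n \<in> {m. Poly_Mapping.keys m \<subseteq> symbols s}" "k \<in> {m. Poly_Mapping.keys m \<subseteq> symbols (\<not> s)}"
    have "symbols u \<subseteq> Sy" for u by (cases u) auto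
    then have "n \<in> A" "k \<in> A" using m by (auto simp: A_def)
    then show "m \<in> A" unfolding m(1) by (rule W.subspace_add [OF subspace_A])
  qed
qed

lemma submodule_A: "svir_submodule M \<alpha> W A"
  unfolding svir_submodule_def
  using subspace_A A_split act_A by (simp add: vw_module_def)

lemma submodule_zero: "svir_submodule M \<alpha> W {0}"
  unfolding svir_submodule_def
proof (intro conjI ballI)
  show "module.subspace (scal W) {0}" using W.subspace_single_0 by (simp add: vw_module_def)
  have "{0} \<inter> part W \<sigma> = {0}" for \<sigma> by (auto simp: vw_module_def)
  then show "{0} = ({0} \<inter> part W 0) + ({0} \<inter> part W 1)" by (simp add: set_plus_def)
  show "act W y m \<in> {0}" if "m \<in> {0}" for y m using that by (simp add: vw_module_def bilinear_ext_def)
qed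

text \<open>V is the submodule \<open>A\<close> of the present symbols modulo \<open>{0}\<close>.
  The cosets are singletons, so the isomorphism sends v to \<open>{\<chi> v}\<close> with \<chi>
  inverse to \<psi>; it shifts the parity by s.\<close>

lemma isomorphic_subquotient:
  "\<exists>A B. svir_submodule M \<alpha> W A \<and> svir_submodule M \<alpha> W B \<and> B \<subset> A \<and>
     isomorphic_upto_parity M \<alpha> V (subquotient W A B)"
proof (intro exI conjI)
  show "svir_submodule M \<alpha> W A" by (rule submodule_A)
  show "svir_submodule M \<alpha> W {0}" by (rule submodule_zero)
  obtain i where i: "vertex i = (u0, \<kappa>0)" using vertex_surj by blast
  then have "Poly_Mapping.single i 1 \<in> A" using base Sy_iff [of i] by (simp add: A_def pr_def)
  moreover have "Poly_Mapping.single i (1 :: 'f) \<noteq> 0" by (metis lookup_single_eq lookup_zero zero_neq_one)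
  moreover have "0 \<in> A" by (simp add: A_def)
  ultimately show "{0} \<subset> A" by blast
  define \<chi> where "\<chi> = inv_into A \<psi>"
  have inj: "inj_on \<psi> A" by (rule inj_onI) (rule \<psi>_injective)
  have \<chi>: "\<chi> (\<psi> m) = m" if "m \<in> A" for m unfolding \<chi>_def by (rule inv_into_f_f [OF inj that])
  let ?Q = "subquotient W A {0}"
  have Qpart: "part ?Q \<sigma> = (\<lambda>m. {m}) ` (A \<inter> part W \<sigma>)" for \<sigma>
    by (simp add: subquotient_def elt_set_plus_def)
  have Qscal: "scal ?Q k {m} = {pm_scale k m}" for k m
    by (simp add: subquotient_def vw_module_def set_plus_def)
  have Qact: "act ?Q y {m} = {bilinear_ext f y m}" for y m
    by (simp add: subquotient_def vw_module_def set_plus_def)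
  have sing: "{m} + {n} = {m + n}" for m n :: "'f vw \<Rightarrow>\<^sub>0 'f" by (simp add: set_plus_def)
  have "((\<lambda>m. {m}) ` X) + ((\<lambda>m. {m}) ` Y) = (\<lambda>m. {m}) ` (X + Y)" for X Y :: "('f vw \<Rightarrow>\<^sub>0 'f) set"
    by (auto simp: set_plus_def)
  then have Qvecs: "vecs ?Q = (\<lambda>m. {m}) ` A"
    unfolding vecs_def Qpart using A_split by simp
  have VA: "\<exists>m\<in>A. v = \<psi> m" if "v \<in> vecs V" for v using that \<psi>_vecs by blast
  show "isomorphic_upto_parity M \<alpha> V ?Q"
    unfolding isomorphic_upto_parity_def
  proof (intro exI [of _ "\<lambda>v. {\<chi> v}"] conjI ballI allI)
    have "bij_betw \<chi> (vecs V) A"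
      unfolding \<chi>_def by (rule bij_betw_inv_into) (use inj \<psi>_vecs in \<open>simp add: bij_betw_def\<close>)
    moreover have "bij_betw (\<lambda>m. {m}) A (vecs ?Q)" unfolding Qvecs by (simp add: bij_betw_def inj_on_def)
    ultimately show "bij_betw (\<lambda>v. {\<chi> v}) (vecs V) (vecs ?Q)"
      using bij_betw_trans by (fastforce simp: comp_def)
  next
    fix v w assume "v \<in> vecs V" "w \<in> vecs V"
    then obtain m n where mn: "m \<in> A" "n \<in> A" "v = \<psi> m" "w = \<psi> n" using VA by blast
    have "\<chi> (\<psi> (m + n)) = m + n" by (rule \<chi>, rule W.subspace_add [OF subspace_A mn(1,2)])
    then show "{\<chi> (v + w)} = {\<chi> v} + {\<chi> w}"
      unfolding sing mn(3,4) \<chi> [OF mn(1)] \<chi> [OF mn(2)] linear_combination_add [symmetric] by simp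
  next
    fix k v assume "v \<in> vecs V"
    then obtain m where m: "m \<in> A" "v = \<psi> m" using VA by blast
    have "\<chi> (\<psi> (pm_scale k m)) = pm_scale k m" by (rule \<chi>, rule W.subspace_scale [OF subspace_A m(1)])
    then show "{\<chi> (scal V k v)} = scal ?Q k {\<chi> v}"
      unfolding Qscal m(2) \<chi> [OF m(1)] linear_combination_scale [symmetric] by simp
  next
    fix y v assume y: "y \<in> svir_carrier M \<alpha>" and "v \<in> vecs V"
    then obtain m where m: "m \<in> A" "v = \<psi> m" using VA by blast
    have "\<chi> (\<psi> (bilinear_ext f y m)) = bilinear_ext f y m" by (rule \<chi>, rule act_A [OF y m(1)])
    then show "{\<chi> (act V y v)} = act ?Q y {\<chi> v}"
      unfolding Qact m(2) \<chi> [OF m(1)] \<psi>_act [OF y m(1), symmetric] by simp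
  next
    show "\<exists>\<epsilon>. \<forall>\<sigma>. (\<lambda>v. {\<chi> v}) ` part V \<sigma> = part ?Q (\<sigma> + \<epsilon>)"
    proof (intro exI [of _ "of_bool s"] allI)
      fix \<sigma> :: bit
      define u where "u = (\<sigma> = 1)"
      have \<sigma>: "\<sigma> = of_bool u" unfolding u_def by (cases \<sigma>) simp_all
      have \<sigma>s: "\<sigma> + of_bool s = of_bool (u \<noteq> s)" unfolding \<sigma> by (cases u; cases s) simp_all
      have "symbols u \<subseteq> Sy" by (cases u) auto
      then have sub: "{m. Poly_Mapping.keys m \<subseteq> symbols u} \<subseteq> A" unfolding A_def by blast
      have "(\<lambda>v. {\<chi> v}) ` part V \<sigma> = (\<lambda>m. {\<chi> (\<psi> m)}) ` {m. Poly_Mapping.keys m \<subseteq> symbols u}"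
        unfolding \<sigma> \<psi>_part [symmetric] by (simp add: image_image)
      also have "\<dots> = (\<lambda>m. {m}) ` {m. Poly_Mapping.keys m \<subseteq> symbols u}"
        by (rule image_cong [OF refl]) (use sub \<chi> in blast)
      finally show "(\<lambda>v. {\<chi> v}) ` part V \<sigma> = part ?Q (\<sigma> + of_bool s)"
        unfolding Qpart \<sigma>s part_W .
    qed
  qed
qed

end

section \<open>Each normal form is realized by one of the three families\<close>

context svir_coefficients begin

lemma l_scaled_absent: "\<not> pr s p \<or> \<not> pr s P \<Longrightarrow> l_scaled t s p P = 0"
  using l_pr [of s p P] by (auto simp: l_scaled_def)

lemma g_scaled_absent: "\<not> pr s p \<or> \<not> pr (\<not> s) P \<Longrightarrow> g_scaled t s p P = 0"
  using g_pr [of s p P] by (auto simp: g_scaled_def)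

text \<open>If the target is absent, then P = 0 and b = 1, and the formula gives 0 as it should. The
  same holds in \<open>normal_SAab_g_odd\<close>.\<close>

lemma normal_SAab_l_even:
  assumes t: "\<And>u p. t u p \<noteq> 0" and n: "normal_SAab s t b" and p: "p \<in> D s" "P \<in> D s" "pr s p"
  shows "l_scaled t s p P = p + (P - p) * b"
proof (cases "pr s P")
  case False
  then have "P = 0" "b = 1" using n p(2) unfolding normal_SAab_def by auto
  then show ?thesis using l_scaled_absent [of s p P t] False by simp
qed (use normal_SAab_l(1) [OF _ n p(1,2,3), of] t in simp)

lemma normal_SAab_g_odd:
  assumes n: "normal_SAab s t b" and p: "p \<in> D s" "q \<in> D (\<not> s)"
  shows "g_scaled t (\<not> s) q p = q + 2 * (p - q) * (b - 1/2)"
proof (cases "pr s p")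
  case False
  then have z: "p = 0" "b = 1" using n p(1) unfolding normal_SAab_def by auto
  have "q + 2 * (p - q) * (b - 1/2) = 0" unfolding z by simp
  then show ?thesis using g_scaled_absent [of "\<not> s" q p t] False by simp
qed (use n p in \<open>auto simp: normal_SAab_def\<close>)

end

context svir_based begin

definition covered :: bool where
  "covered \<longleftrightarrow> (\<exists>W \<in> {SAab M \<alpha> a b | a b. True} \<union> {SAa M \<alpha> a | a. True} \<union> {SBa M \<alpha> a | a. True}.
    \<exists>A B. svir_submodule M \<alpha> W A \<and> svir_submodule M \<alpha> W B \<and> B \<subset> A
         \<and> isomorphic_upto_parity M \<alpha> V (subquotient W A B))"

text \<open>Any element of \<open>D s\<close> can serve as the weight of the symbol with index
  0.\<close>

lemma base_shift: "\<exists>a. \<forall>\<mu>. (\<mu> \<in> M \<longleftrightarrow> a + \<mu> \<in> D s) \<and> (\<mu> \<in> \<alpha> +o M \<longleftrightarrow> a + \<mu> \<in> D (\<not> s))"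
proof -
  obtain a where a: "a \<in> D s" using D_nonempty [of s] by blast
  have "\<mu> \<in> M \<longleftrightarrow> a + \<mu> \<in> D s" for \<mu> using D_shift_M [OF a, of \<mu>] D_diff [OF a, of "a + \<mu>"] by auto
  moreover have "\<mu> \<in> \<alpha> +o M \<longleftrightarrow> a + \<mu> \<in> D (\<not> s)" for \<mu>
    using D_shift_G [OF a, of \<mu>] D_diff_odd [OF a, of "a + \<mu>"] by auto
  ultimately show ?thesis by blast
qed

lemma zero_shift: "0 \<in> D s \<Longrightarrow> \<mu> \<in> M \<longleftrightarrow> 0 + \<mu> \<in> D s"
  "0 \<in> D s \<Longrightarrow> \<mu> \<in> \<alpha> +o M \<longleftrightarrow> 0 + \<mu> \<in> D (\<not> s)"
  using D_shift_M [of 0 s \<mu>] D_diff [of 0 s \<mu>] D_shift_G [of 0 s \<mu>] D_diff_odd [of 0 s \<mu>] by auto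

lemma covered_SAab:
  assumes t: "\<And>u p. t u p \<noteq> 0" and c: "c = 0" and n: "normal_SAab s t \<beta>"
  shows covered
proof -
  obtain a where a: "\<And>\<mu>. \<mu> \<in> M \<longleftrightarrow> a + \<mu> \<in> D s" "\<And>\<mu>. \<mu> \<in> \<alpha> +o M \<longleftrightarrow> a + \<mu> \<in> D (\<not> s)"
    using base_shift by blast
  have "svir_model M \<alpha> V u0 \<kappa>0 s a t M (\<alpha> +o M) (SAab_gen_act a \<beta>)"
  proof unfold_locales
    fix \<kappa> \<mu> assume m: "\<kappa> \<in> M" "pr s (a + \<mu>)"
    have D: "a + \<mu> \<in> D s" by (rule pr_D [OF m(2)])
    have "a + (\<kappa> + \<mu>) \<in> D s" using D_shift_M [OF D m(1)] by (simp add: ac_simps)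
    from normal_SAab_l_even [of t, OF t n D this m(2)]
    show "SAab_gen_act a \<beta> (LG \<kappa>) (VB \<mu>) = Poly_Mapping.single (VB (\<kappa> + \<mu>)) (l_scaled t s (a + \<mu>) (a + (\<kappa> + \<mu>)))"
      by simp
  next
    fix \<kappa> \<mu> assume m: "\<kappa> \<in> M" "pr (\<not> s) (a + \<mu>)"
    have D: "a + \<mu> \<in> D (\<not> s)" by (rule pr_D [OF m(2)])
    have "a + (\<kappa> + \<mu>) \<in> D (\<not> s)" using D_shift_M [OF D m(1)] by (simp add: ac_simps)
    from normal_SAab_l(2) [of t, OF t n D this m(2)]
    show "SAab_gen_act a \<beta> (LG \<kappa>) (WB \<mu>) = Poly_Mapping.single (WB (\<kappa> + \<mu>)) (l_scaled t (\<not> s) (a + \<mu>) (a + (\<kappa> + \<mu>)))"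
      by simp
  next
    fix \<eta> \<mu> assume m: "\<eta> \<in> \<alpha> +o M" "pr s (a + \<mu>)"
    have D: "a + \<mu> \<in> D s" by (rule pr_D [OF m(2)])
    have "a + (\<eta> + \<mu>) \<in> D (\<not> s)" using D_shift_G [OF D m(1)] by (simp add: ac_simps)
    then have "g_scaled t s (a + \<mu>) (a + (\<eta> + \<mu>)) = 1" using n D m(2) unfolding normal_SAab_def by blast
    then show "SAab_gen_act a \<beta> (GG \<eta>) (VB \<mu>) = Poly_Mapping.single (WB (\<eta> + \<mu>)) (g_scaled t s (a + \<mu>) (a + (\<eta> + \<mu>)))"
      by simp
  next
    fix \<eta> \<mu> assume m: "\<eta> \<in> \<alpha> +o M" "pr (\<not> s) (a + \<mu>)"
    have D: "a + \<mu> \<in> D (\<not> s)" by (rule pr_D [OF m(2)])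
    have "a + (\<eta> + \<mu>) \<in> D s" using D_shift_G [OF D m(1)] by (simp add: ac_simps)
    from normal_SAab_g_odd [OF n this D]
    show "SAab_gen_act a \<beta> (GG \<eta>) (WB \<mu>) = Poly_Mapping.single (VB (\<eta> + \<mu>)) (g_scaled t (\<not> s) (a + \<mu>) (a + (\<eta> + \<mu>)))"
      by simp
  qed (use t c a in simp_all)
  from svir_model.isomorphic_subquotient [OF this] show ?thesis unfolding covered_def SAab_def by blast
qed

lemma covered_SAa:
  assumes t: "\<And>u p. t u p \<noteq> 0" and c: "c = 0" and n: "normal_SAa s t a"
  shows covered
proof -
  have z: "0 \<in> D s" using n by (simp add: normal_SAa_def)
  have "svir_model M \<alpha> V u0 \<kappa>0 s 0 t M (\<alpha> +o M) (SAa_gen_act a)"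
  proof unfold_locales
    fix \<kappa> \<mu> assume m: "\<kappa> \<in> M" "pr s (0 + \<mu>)"
    have D: "\<mu> \<in> D s" using pr_D [OF m(2)] by simp
    have "\<kappa> + \<mu> \<in> D s" using D_shift_M [OF D m(1)] by (simp add: ac_simps)
    from normal_SAa_l(1) [of t, OF t n D this]
    show "SAa_gen_act a (LG \<kappa>) (VB \<mu>) = Poly_Mapping.single (VB (\<kappa> + \<mu>)) (l_scaled t s (0 + \<mu>) (0 + (\<kappa> + \<mu>)))"
      by (simp add: ac_simps)
  next
    fix \<kappa> \<mu> assume m: "\<kappa> \<in> M" "pr (\<not> s) (0 + \<mu>)"
    have D: "\<mu> \<in> D (\<not> s)" using pr_D [OF m(2)] by simp
    have "\<kappa> + \<mu> \<in> D (\<not> s)" using D_shift_M [OF D m(1)] by (simp add: ac_simps)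
    from normal_SAa_l(2) [of t, OF t n D this]
    have "l_scaled t (\<not> s) (0 + \<mu>) (0 + (\<kappa> + \<mu>)) = (\<mu> + (\<kappa> + \<mu>)) / 2" using m(2) by simp
    also have "\<dots> = \<mu> + \<kappa> / 2" by (simp add: field_simps)
    finally show "SAa_gen_act a (LG \<kappa>) (WB \<mu>) = Poly_Mapping.single (WB (\<kappa> + \<mu>)) (l_scaled t (\<not> s) (0 + \<mu>) (0 + (\<kappa> + \<mu>)))"
      by simp
  next
    fix \<eta> \<mu> assume m: "\<eta> \<in> \<alpha> +o M" "pr s (0 + \<mu>)"
    have D: "\<mu> \<in> D s" using pr_D [OF m(2)] by simp
    have "\<eta> + \<mu> \<in> D (\<not> s)" using D_shift_G [OF D m(1)] by (simp add: ac_simps)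
    then have "g_scaled t s \<mu> (\<eta> + \<mu>) = (if \<mu> = 0 then 2 * (\<eta> + \<mu>) + a else 1)" using n D unfolding normal_SAa_def by blast
    then show "SAa_gen_act a (GG \<eta>) (VB \<mu>) = Poly_Mapping.single (WB (\<eta> + \<mu>)) (g_scaled t s (0 + \<mu>) (0 + (\<eta> + \<mu>)))"
      by simp
  next
    fix \<eta> \<mu> assume m: "\<eta> \<in> \<alpha> +o M" "pr (\<not> s) (0 + \<mu>)"
    have D: "\<mu> \<in> D (\<not> s)" using pr_D [OF m(2)] by simp
    have "\<eta> + \<mu> \<in> D s" using D_shift_G [OF D m(1)] by (simp add: ac_simps)
    then have "g_scaled t (\<not> s) \<mu> (\<eta> + \<mu>) = \<eta> + \<mu>" using n D unfolding normal_SAa_def by blast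
    then show "SAa_gen_act a (GG \<eta>) (WB \<mu>) = Poly_Mapping.single (VB (\<eta> + \<mu>)) (g_scaled t (\<not> s) (0 + \<mu>) (0 + (\<eta> + \<mu>)))"
      by (simp add: add.commute)
  qed (use t c zero_shift [OF z] in simp_all)
  from svir_model.isomorphic_subquotient [OF this] show ?thesis unfolding covered_def SAa_def by blast
qed

text \<open>In \<open>SBa\<close> the weight 0 belongs to the w's, whereas s is the parity of the
  weight 0; so the model is taken with the parity \<open>\<not> s\<close>.\<close>

lemma covered_SBa:
  assumes t: "\<And>u p. t u p \<noteq> 0" and c: "c = 0" and n: "normal_SBa s t a"
  shows covered
proof -
  have z: "0 \<in> D s" using n by (simp add: normal_SBa_def)
  have "svir_model M \<alpha> V u0 \<kappa>0 (\<not> s) 0 t (\<alpha> +o M) M (SBa_gen_act a)"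
  proof unfold_locales
    fix \<kappa> \<mu> assume m: "\<kappa> \<in> M" "pr (\<not> s) (0 + \<mu>)"
    have D: "\<mu> \<in> D (\<not> s)" using pr_D [OF m(2)] by simp
    have "\<kappa> + \<mu> \<in> D (\<not> s)" using D_shift_M [OF D m(1)] by (simp add: ac_simps)
    from normal_SBa_l(2) [of t, OF t n D this]
    have "l_scaled t (\<not> s) (0 + \<mu>) (0 + (\<kappa> + \<mu>)) = (\<mu> + (\<kappa> + \<mu>)) / 2" using m(2) by simp
    also have "\<dots> = \<mu> + \<kappa> / 2" by (simp add: field_simps)
    finally show "SBa_gen_act a (LG \<kappa>) (VB \<mu>) = Poly_Mapping.single (VB (\<kappa> + \<mu>)) (l_scaled t (\<not> s) (0 + \<mu>) (0 + (\<kappa> + \<mu>)))"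
      by simp
  next
    fix \<kappa> \<mu> assume m: "\<kappa> \<in> M" "pr (\<not> \<not> s) (0 + \<mu>)"
    have D: "\<mu> \<in> D s" using pr_D [OF m(2)] by simp
    have "\<kappa> + \<mu> \<in> D s" using D_shift_M [OF D m(1)] by (simp add: ac_simps)
    from normal_SBa_l(1) [of t, OF t n D this]
    have l: "l_scaled t (\<not> \<not> s) (0 + \<mu>) (0 + (\<kappa> + \<mu>)) = (if \<mu> = - \<kappa> then \<mu> * (- \<mu> + a) else \<mu>)"
      by (simp add: eq_neg_iff_add_eq_0 add.commute)
    show "SBa_gen_act a (LG \<kappa>) (WB \<mu>) = Poly_Mapping.single (WB (\<kappa> + \<mu>)) (l_scaled t (\<not> \<not> s) (0 + \<mu>) (0 + (\<kappa> + \<mu>)))"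
      unfolding l by simp
  next
    fix \<eta> \<mu> assume m: "\<eta> \<in> \<alpha> +o M" "pr (\<not> s) (0 + \<mu>)"
    have D: "\<mu> \<in> D (\<not> s)" using pr_D [OF m(2)] by simp
    have "\<eta> + \<mu> \<in> D s" using D_shift_G [OF D m(1)] by (simp add: ac_simps)
    then have "g_scaled t (\<not> s) \<mu> (\<eta> + \<mu>) = (if \<eta> + \<mu> = 0 then - 2 * \<mu> + a else 1)" using n D unfolding normal_SBa_def by blast
    then have g: "g_scaled t (\<not> s) (0 + \<mu>) (0 + (\<eta> + \<mu>)) = (if \<mu> = - \<eta> then - 2 * \<mu> + a else 1)"
      by (simp add: eq_neg_iff_add_eq_0 add.commute)
    show "SBa_gen_act a (GG \<eta>) (VB \<mu>) = Poly_Mapping.single (WB (\<eta> + \<mu>)) (g_scaled t (\<not> s) (0 + \<mu>) (0 + (\<eta> + \<mu>)))"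
      unfolding g by simp
  next
    fix \<eta> \<mu> assume m: "\<eta> \<in> \<alpha> +o M" "pr (\<not> \<not> s) (0 + \<mu>)"
    have D: "\<mu> \<in> D s" using pr_D [OF m(2)] by simp
    have "\<eta> + \<mu> \<in> D (\<not> s)" using D_shift_G [OF D m(1)] by (simp add: ac_simps)
    then have "g_scaled t s \<mu> (\<eta> + \<mu>) = \<mu>" using n D unfolding normal_SBa_def by blast
    then show "SBa_gen_act a (GG \<eta>) (WB \<mu>) = Poly_Mapping.single (VB (\<eta> + \<mu>)) (g_scaled t (\<not> \<not> s) (0 + \<mu>) (0 + (\<eta> + \<mu>)))"
      by simp
  qed (use t c zero_shift [OF z] in simp_all)
  from svir_model.isomorphic_subquotient [OF this] show ?thesis unfolding covered_def SBa_def by blast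
qed

lemma indecomposable_coefficients:
  assumes "\<And>u p q. g u p q \<noteq> 0 \<Longrightarrow> Y u p = Y (\<not> u) q" and "\<And>u p q. l u p q \<noteq> 0 \<Longrightarrow> Y u p = Y u q"
  shows "(\<forall>u p. pr u p \<longrightarrow> Y u p) \<or> (\<forall>u p. pr u p \<longrightarrow> \<not> Y u p)"
  unfolding pr_def
proof (rule indecomposable_weights)
  fix u p \<mu> assume m: "\<mu> \<in> M" and nz: "L \<mu> (b u p) \<noteq> 0"
  have c: "Poly_Mapping.single (LG \<mu>) 1 \<in> svir_carrier M \<alpha>" by (rule single_carrier) (use m in simp)
  have "pr u p" using nz act_zero_right [OF c] unfolding pr_def by auto
  then have "p \<in> D u" by (rule pr_D)
  then have "L \<mu> (b u p) = scal V (l u p (p + \<mu>)) (b u (p + \<mu>))" using L_b [OF _ D_shift_M [OF _ m]] by force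
  then have "l u p (p + \<mu>) \<noteq> 0" using nz by auto
  then show "Y u p = Y u (p + \<mu>)" by (rule assms(2))
next
  fix u p \<nu> assume m: "\<nu> \<in> \<alpha> +o M" and nz: "G \<nu> (b u p) \<noteq> 0"
  have c: "Poly_Mapping.single (GG \<nu>) 1 \<in> svir_carrier M \<alpha>" by (rule single_carrier) (use m in simp)
  have "pr u p" using nz act_zero_right [OF c] unfolding pr_def by auto
  then have "p \<in> D u" by (rule pr_D)
  then have "G \<nu> (b u p) = scal V (g u p (p + \<nu>)) (b (\<not> u) (p + \<nu>))" using G_b [OF _ D_shift_G [OF _ m]] by force
  then have "g u p (p + \<nu>) \<noteq> 0" using nz by auto
  then show "Y u p = Y (\<not> u) (p + \<nu>)" by (rule assms(1))
qed

text \<open>A nonzero \<open>l\<close> between different weights is by [G, G] half a sum of two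
  paths of \<open>G\<close>, one of which is nonzero. Hence a label respected by \<open>G\<close> is
  respected by \<open>L\<close>.\<close>

lemma indecomposable_odd:
  assumes Y: "\<And>u p q. g u p q \<noteq> 0 \<Longrightarrow> Y u p = Y (\<not> u) q"
  shows "(\<forall>u p. pr u p \<longrightarrow> Y u p) \<or> (\<forall>u p. pr u p \<longrightarrow> \<not> Y u p)"
proof (rule indecomposable_coefficients)
  show "g u p q \<noteq> 0 \<Longrightarrow> Y u p = Y (\<not> u) q" for u p q by (rule Y)
  fix u p q assume nz: "l u p q \<noteq> 0"
  have D: "p \<in> D u" "q \<in> D u" using l_pr [OF nz] pr_D by blast+
  show "Y u p = Y u q"
  proof (cases "p = q")
    case False
    obtain Q where Q: "Q \<in> D (\<not> u)" using D_nonempty [of "\<not> u"] by blast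
    have "g u p Q * g (\<not> u) Q q + g u p (p + q - Q) * g (\<not> u) (p + q - Q) q \<noteq> 0"
      using GG [OF D Q D_odd [OF D Q] _ False] nz by simp
    then obtain R where "g u p R \<noteq> 0" "g (\<not> u) R q \<noteq> 0" by (metis add.right_neutral mult_eq_0_iff)
    from Y [OF this(1)] Y [OF this(2)] show ?thesis by simp
  qed simp
qed

text \<open>The trivial module is the submodule of \<open>SB\<^sub>0\<close> spanned by \<open>w\<^sub>0\<close>.\<close>

lemma covered_trivial:
  assumes "\<And>s p. pr s p \<Longrightarrow> p = 0" and c: "c = 0"
  shows covered
proof -
  have g0: "g u p q = 0" for u p q
  proof (rule ccontr)
    assume nz: "g u p q \<noteq> 0"
    have z: "p = 0" "q = 0" using g_pr [OF nz] assms(1) by blast+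
    obtain m where m: "m \<in> M" "m \<noteq> 0" using M_nonzero zero_in_M by blast
    have D: "0 \<in> D u" "0 \<in> D (\<not> u)" using g_pr [OF nz] pr_D z by blast+
    have Dm: "m \<in> D u" "- m \<in> D (\<not> u)" using D_shift_M [OF D(1) m(1)] D_shift_M [OF D(2) M_uminus [OF m(1)]] by simp_all
    have "g u 0 (- m) = 0" "g u m 0 = 0" using g_pr assms(1) m(2) by (metis neg_equal_0_iff_equal)+
    \<comment> \<open>[L, G] with degrees m and - m at the weight 0: both two-step paths pass
      through an absent weight, m or - m, while the right side is - 3 m / 2 times the coefficient
      from 0 to 0.\<close>
    then have "(- m - 0 - (m - 0) / 2) * g u 0 0 = 0"
      using LG [OF D(1) Dm(1) D(2) Dm(2)] by simp
    moreover have "- m - 0 - (m - 0) / 2 = - (3 * m / 2)" by (simp add: field_simps)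
    ultimately show False using nz m(2) unfolding z by simp
  qed
  have l0: "l u p q = 0" for u p q
    using l_pr [of u p q] assms(1) [of u p] assms(1) [of u q] L0 [of u 0] by metis
  have k0: "\<kappa>0 = 0" using base assms(1) unfolding pr_def by blast
  have z: "0 \<in> D u0" using base_D k0 by simp
  \<comment> \<open>As all coefficients of \<open>G\<close> vanish, the parity itself is a label,
    and only the line of weight 0 and parity u0 remains.\<close>
  have "(\<forall>u p. pr u p \<longrightarrow> u = u0) \<or> (\<forall>u p. pr u p \<longrightarrow> u \<noteq> u0)"
    by (rule indecomposable_odd) (use g0 in simp)
  then have only: "u = u0" if "pr u p" for u p using base that unfolding pr_def by blast
  have "svir_model M \<alpha> V u0 \<kappa>0 (\<not> u0) 0 (\<lambda>_ _. 1) (\<alpha> +o M) M (SBa_gen_act 0)"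
  proof unfold_locales
    fix \<kappa> \<mu> assume "\<kappa> \<in> M" and m: "pr (\<not> \<not> u0) (0 + \<mu>)"
    have "\<mu> = 0" using assms(1) [OF m] by simp
    then show "SBa_gen_act 0 (LG \<kappa>) (WB \<mu>) = Poly_Mapping.single (WB (\<kappa> + \<mu>)) (l_scaled (\<lambda>_ _. 1) (\<not> \<not> u0) (0 + \<mu>) (0 + (\<kappa> + \<mu>)))"
      by (simp add: l_scaled_def l0)
  next
    fix \<eta> \<mu> assume "\<eta> \<in> \<alpha> +o M" and m: "pr (\<not> \<not> u0) (0 + \<mu>)"
    have "\<mu> = 0" using assms(1) [OF m] by simp
    then show "SBa_gen_act 0 (GG \<eta>) (WB \<mu>) = Poly_Mapping.single (VB (\<eta> + \<mu>)) (g_scaled (\<lambda>_ _. 1) (\<not> \<not> u0) (0 + \<mu>) (0 + (\<eta> + \<mu>)))"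
      by (simp add: g_scaled_def g0)
  next
    fix \<kappa> \<mu> assume "\<kappa> \<in> M" and m: "pr (\<not> u0) (0 + \<mu>)"
    show "SBa_gen_act 0 (LG \<kappa>) (VB \<mu>) = Poly_Mapping.single (VB (\<kappa> + \<mu>)) (l_scaled (\<lambda>_ _. 1) (\<not> u0) (0 + \<mu>) (0 + (\<kappa> + \<mu>)))"
      using only [OF m] by simp
  next
    fix \<eta> \<mu> assume "\<eta> \<in> \<alpha> +o M" and m: "pr (\<not> u0) (0 + \<mu>)"
    show "SBa_gen_act 0 (GG \<eta>) (VB \<mu>) = Poly_Mapping.single (WB (\<eta> + \<mu>)) (g_scaled (\<lambda>_ _. 1) (\<not> u0) (0 + \<mu>) (0 + (\<eta> + \<mu>)))"
      using only [OF m] by simp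
  qed (use c zero_shift [OF z] in simp_all)
  from svir_model.isomorphic_subquotient [OF this] show ?thesis unfolding covered_def SBa_def by blast
qed

lemma covered: covered
proof (cases "\<exists>s p. pr s p \<and> (p \<noteq> 0 \<or> c \<noteq> 0)")
  case True
  interpret N: nontrivial_coefficients D pr g l c
    by unfold_locales (rule True)
  obtain s t where t: "\<And>u p. t u p \<noteq> 0"
    and n: "(\<exists>b. normal_SAab s t b) \<or> (\<exists>a. normal_SAa s t a) \<or> (\<exists>a. normal_SBa s t a)"
    using N.normal_form [OF indecomposable_odd] by blast
  from n show ?thesis
    using covered_SAab [of t, OF t N.c_zero] covered_SAa [of t, OF t N.c_zero] covered_SBa [of t, OF t N.c_zero]
    by blast
next
  case False
  have "pr u0 \<kappa>0" using base by (simp add: pr_def)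
  then have "c = 0" using False by blast
  then show ?thesis using False by (intro covered_trivial) auto
qed

end

theorem theorem5p4:
  fixes M :: "'f::field_char_0 set" and \<alpha> :: 'f
    and V :: "('f, 'v::ab_group_add) gr_module"
  assumes "0 \<in> M" and "\<And>x y. x \<in> M \<Longrightarrow> y \<in> M \<Longrightarrow> x - y \<in> M" and "M \<noteq> {0}"
    and "2 * \<alpha> \<in> M"
    and "intermediate_series M \<alpha> V"
  shows "\<exists>W \<in> {SAab M \<alpha> a b | a b. True} \<union> {SAa M \<alpha> a | a. True} \<union> {SBa M \<alpha> a | a. True}.
    isomorphic_upto_parity M \<alpha> V W
    \<or> (\<exists>A B. svir_submodule M \<alpha> W A \<and> svir_submodule M \<alpha> W B \<and> B \<subset> A
         \<and> isomorphic_upto_parity M \<alpha> V (subquotient W A B))"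
proof -
  have m: "svir_module M \<alpha> V" using assms(5) unfolding intermediate_series_def by blast
  interpret svir_series M \<alpha> V
    by unfold_locales (use assms m in auto)
  obtain u0 \<kappa>0 where "b u0 \<kappa>0 \<noteq> 0" using some_weight by blast
  then interpret svir_based M \<alpha> V u0 \<kappa>0
    by unfold_locales (use assms in auto)
  show ?thesis using covered unfolding covered_def by blast
qed

end
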